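(* Let $n=3m$ with $m\ge 1$ an integer, and let $H(n)\subset\mathbb P^2$ be the union of all Halphen cubics of order $n/3=m$. Then the singularities of $H(n)$ are: (i) $12$ points of multiplicity $n^2-3$, located at the $12$ vertices of the dual Hesse configuration, with $\frac{n^2}{3}-1$ triple points infinitely near to each of them; and (ii) $(n^2-3)\left(\frac{n^2}{3}-3\right)$ quadruple points.
   Context: Work over $\mathbb C$. Let $\varepsilon$ be a primitive cube root of unity. Dual Hesse configuration: it consists of the nine lines in $\mathbb P^2$ (coordinates $x,y,z$) with equations $z-y,\ z-\varepsilon y,\ \varepsilon z-y,\ z-x,\ \varepsilon z-x,\ z-\varepsilon x,\ y-x,\ y-\varepsilon x,\ \varepsilon y-x$. Its set $\Omega$ of vertices consists of the 12 points $v_0=(1:0:0),\ v_1=(0:1:0),\ v_\infty=(0:0:1)$; $h_0=(1:1:1),\ h_1=(1:\varepsilon:\varepsilon^2),\ h_\infty=(1:\varepsilon^2:\varepsilon)$; $\delta_0=(\varepsilon:1:1),\ \delta_1=(1:\varepsilon:1),\ \delta_\infty=(1:1:\varepsilon)$; $\gamma_0=(\varepsilon^2:1:1),\ \gamma_1=(1:\varepsilon^2:1),\ \gamma_\infty=(1:1:\varepsilon^2)$. Through each vertex pass exactly three of the nine lines, and each line contains four vertices, one of each of the types $v,h,\delta,\gamma$. Pencils: for $t\in\{v,h,\delta,\gamma\}$ let $\Lambda_t=\Omega\setminus\{t_0,t_1,t_\infty\}$ (nine points). The plane cubics through $\Lambda_t$ form a pencil $\mathcal C_t\cong\mathbb P^1$;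 it has exactly three singular members, namely, for each of the three vertices $t_u$, the union of the three lines of the dual Hesse configuration through $t_u$. Equianharmonic torsion parameters: let $M$ be a set of three distinct points of a projective line $\mathbb P^1$. There is an elliptic curve $T$ (necessarily of $j$-invariant $0$) and a degree $3$ morphism $f:T\to\mathbb P^1$ with triple ramification at three points and branch locus $M$. Choose one of the ramification points as zero of the group law on $T$, let $T[3m]$ be the $3m$-torsion subgroup, and put $\mathbb P^1_M[3m]=f(T[3m])\setminus M$. This set is independent of the choices and consists of $3m^2-1$ points. Halphen cubics of order $m$: these are the cubics belonging, for some $t\in\{v,h,\delta,\gamma\}$, to $\mathbb P^1_M[3m]$, where $\mathbb P^1=\mathcal C_t$ and $M$ is the set of the three singular members of $\mathcal C_t$. There are $4(3m^2-1)$ of them. A triple point infinitely near to a vertex means a triple point, lying on the exceptional curve over that vertex, of the strict transform of the curve under the blow-up of $\mathbb P^2$ at the 12 vertices. *)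

theory Defs
  imports "HOL-Complex_Analysis.Complex_Analysis" "HOL-Computational_Algebra.Computational_Algebra"
begin

section \<open>Projective points\<close>

text \<open>A point of projective space is the set of its homogeneous coordinate vectors.\<close>

definition proj :: "complex^'n \<Rightarrow> (complex^'n) set" where
  "proj v = {c *s v | c. c \<noteq> 0}"

definition proj_space :: "(complex^'n) set set" where
  "proj_space = {proj v | v. v \<noteq> 0}"


section \<open>Multiplicities of plane curves\<close>

text \<open>
  A plane curve is given by a form, regarded as a function on \<open>\<complex>\<^sup>3\<close>.
  Polynomials in two variables are elements of \<^typ>\<open>complex poly poly\<close>; the first variable is
  the outer one.
\<close>

definition bipoly :: "(complex \<Rightarrow> complex \<Rightarrow> complex) \<Rightarrow> complex poly poly" where
  "bipoly g = (THE P. \<forall>s t. poly (poly P [:s:]) t = g s t)"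

definition mult_origin :: "complex poly poly \<Rightarrow> nat" where
  "mult_origin P = (LEAST k. \<exists>i j. i + j = k \<and> coeff (coeff P i) j \<noteq> 0)"

text \<open>
  If \<open>v\<close>, \<open>d\<close>, \<open>e\<close> is a basis of \<open>\<complex>\<^sup>3\<close>, then \<open>(s, t) \<mapsto> proj (v + s d + t e)\<close> is an affine chart
  centred at \<open>proj v\<close>. The multiplicity does not depend on the chart.
\<close>

definition multiplicity_at :: "(complex^3 \<Rightarrow> complex) \<Rightarrow> (complex^3) set \<Rightarrow> nat" where
  "multiplicity_at F p =
     (case (SOME (v, d, e). v \<in> p \<and> vec.span {v, d, e} = UNIV) of (v, d, e) \<Rightarrow>
        mult_origin (bipoly (\<lambda>s t. F (v + s *s d + t *s e))))"

text \<open>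
  The points of the exceptional curve over \<open>p\<close> are the tangent directions at \<open>p\<close>, i.e. the lines
  through \<open>p\<close>, which are represented by two-dimensional subspaces of \<open>\<complex>\<^sup>3\<close>.
\<close>

definition exceptional_curve :: "(complex^3) set \<Rightarrow> (complex^3) set set" where
  "exceptional_curve p = {vec.span {v, d} | v d. v \<in> p \<and> d \<notin> vec.span {v}}"

text \<open>
  For the direction \<open>l\<close> spanned by \<open>v\<close> and \<open>d\<close>, the blow-up of the chart above has coordinates
  \<open>(u, w)\<close> with \<open>s = u\<close> and \<open>t = u w\<close>; the exceptional curve is \<open>u = 0\<close> and \<open>l\<close> is the origin.
  The strict transform is obtained from the total transform by cancelling the highest possible
  power of \<open>u\<close>.
\<close>

definition strict_transform ::
    "(complex^3 \<Rightarrow> complex) \<Rightarrow> complex^3 \<Rightarrow> complex^3 \<Rightarrow> complex^3 \<Rightarrow> complex poly poly" where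
  "strict_transform F v d e =
     (let T = bipoly (\<lambda>u w. F (v + u *s d + (u * w) *s e)) in poly_shift (order 0 T) T)"

definition inf_near_multiplicity ::
    "(complex^3 \<Rightarrow> complex) \<Rightarrow> (complex^3) set \<Rightarrow> (complex^3) set \<Rightarrow> nat" where
  "inf_near_multiplicity F p l =
     (case (SOME (v, d, e). v \<in> p \<and> vec.span {v, d} = l \<and> vec.span {v, d, e} = UNIV) of
        (v, d, e) \<Rightarrow> mult_origin (strict_transform F v d e))"


section \<open>Torsion parameters on a projective line\<close>

text \<open>
  Elliptic curves are complex tori \<open>\<complex>/\<Lambda>\<close>, and their nonconstant morphisms to the projective line
  are the nonconstant \<open>\<Lambda>\<close>-periodic meromorphic functions on \<open>\<complex>\<close>.
\<close>

definition is_lattice :: "complex set \<Rightarrow> bool" where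
  "is_lattice \<Lambda> \<longleftrightarrow> (\<exists>\<omega>1 \<omega>2.
     (\<forall>a b :: real. of_real a * \<omega>1 + of_real b * \<omega>2 = 0 \<longrightarrow> a = 0 \<and> b = 0) \<and>
     \<Lambda> = {of_int a * \<omega>1 + of_int b * \<omega>2 | a b :: int. True})"

definition torus :: "complex set \<Rightarrow> complex set set" where
  "torus \<Lambda> = range (\<lambda>z. (+) z ` \<Lambda>)"

definition P1_value :: "(complex \<Rightarrow> complex) \<Rightarrow> complex \<Rightarrow> (complex^2) set" where
  "P1_value f z = (if is_pole f z then proj (vector [1, 0]) else proj (vector [f z, 1]))"

definition ram_index :: "(complex \<Rightarrow> complex) \<Rightarrow> complex \<Rightarrow> int" where
  "ram_index f z = (if is_pole f z then - zorder f z else zorder (\<lambda>w. f w - f z) z)"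

text \<open>
  The index is constant on the classes of the torus if \<open>f\<close> is periodic. In
  \<open>has_degree\<close>, the sum is 0 if the fibre is infinite, so constant functions are excluded.
\<close>

definition torus_ram_index :: "(complex \<Rightarrow> complex) \<Rightarrow> complex set \<Rightarrow> int" where
  "torus_ram_index f x = the_elem (ram_index f ` x)"

definition has_degree :: "complex set \<Rightarrow> (complex \<Rightarrow> complex) \<Rightarrow> nat \<Rightarrow> bool" where
  "has_degree \<Lambda> f k \<longleftrightarrow>
     (\<forall>q \<in> proj_space. (\<Sum>x \<in> {x \<in> torus \<Lambda>. P1_value f ` x = {q}}. torus_ram_index f x) = int k)"

definition equianharmonic_cover ::
    "complex set \<Rightarrow> (complex \<Rightarrow> complex) \<Rightarrow> (complex^2) set set \<Rightarrow> bool" where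
  "equianharmonic_cover \<Lambda> f M \<longleftrightarrow>
     is_lattice \<Lambda> \<and>
     f nicely_meromorphic_on UNIV \<and> (\<forall>z. \<forall>\<omega> \<in> \<Lambda>. f (z + \<omega>) = f z) \<and>
     has_degree \<Lambda> f 3 \<and>
     card {x \<in> torus \<Lambda>. torus_ram_index f x = 3} = 3 \<and>
     {P1_value f z | z. ram_index f z \<ge> 2} = M"

text \<open>
  The zero of the group law is the class of \<open>z0\<close>, so the \<open>N\<close>-torsion points are the classes of
  the \<open>z\<close> with \<open>N (z - z0) \<in> \<Lambda>\<close>. All choices of \<open>\<Lambda>\<close>, \<open>f\<close> and \<open>z0\<close> yield the same set.
\<close>

definition torsion_params :: "(complex^2) set set \<Rightarrow> nat \<Rightarrow> (complex^2) set set" where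
  "torsion_params M N =
     {P1_value f z | \<Lambda> f z0 z.
        equianharmonic_cover \<Lambda> f M \<and> ram_index f z0 = 3 \<and> of_nat N * (z - z0) \<in> \<Lambda>} - M"


section \<open>The dual Hesse configuration and Halphen cubics\<close>

datatype vertex_type = V_type | H_type | D_type | G_type

datatype vertex_index = Idx_0 | Idx_1 | Idx_inf

fun vertex_coords :: "complex \<Rightarrow> vertex_type \<Rightarrow> vertex_index \<Rightarrow> complex^3" where
  "vertex_coords \<epsilon> V_type Idx_0 = vector [1, 0, 0]"
| "vertex_coords \<epsilon> V_type Idx_1 = vector [0, 1, 0]"
| "vertex_coords \<epsilon> V_type Idx_inf = vector [0, 0, 1]"
| "vertex_coords \<epsilon> H_type Idx_0 = vector [1, 1, 1]"
| "vertex_coords \<epsilon> H_type Idx_1 = vector [1, \<epsilon>, \<epsilon>^2]"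
| "vertex_coords \<epsilon> H_type Idx_inf = vector [1, \<epsilon>^2, \<epsilon>]"
| "vertex_coords \<epsilon> D_type Idx_0 = vector [\<epsilon>, 1, 1]"
| "vertex_coords \<epsilon> D_type Idx_1 = vector [1, \<epsilon>, 1]"
| "vertex_coords \<epsilon> D_type Idx_inf = vector [1, 1, \<epsilon>]"
| "vertex_coords \<epsilon> G_type Idx_0 = vector [\<epsilon>^2, 1, 1]"
| "vertex_coords \<epsilon> G_type Idx_1 = vector [1, \<epsilon>^2, 1]"
| "vertex_coords \<epsilon> G_type Idx_inf = vector [1, 1, \<epsilon>^2]"

definition vertices :: "complex \<Rightarrow> (complex^3) set set" where
  "vertices \<epsilon> = {proj (vertex_coords \<epsilon> t u) | t u. True}"

definition vertices_off :: "complex \<Rightarrow> vertex_type \<Rightarrow> (complex^3) set set" where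
  "vertices_off \<epsilon> t = vertices \<epsilon> - {proj (vertex_coords \<epsilon> t u) | u. True}"

definition cubic_form :: "(complex^3 \<Rightarrow> complex) \<Rightarrow> bool" where
  "cubic_form F \<longleftrightarrow> (\<exists>c :: nat \<Rightarrow> nat \<Rightarrow> complex. \<forall>x.
     F x = (\<Sum>i\<le>3. \<Sum>j\<le>3 - i. c i j * (x$1)^i * (x$2)^j * (x$3)^(3 - i - j)))"

definition pencil_forms :: "complex \<Rightarrow> vertex_type \<Rightarrow> (complex^3 \<Rightarrow> complex) set" where
  "pencil_forms \<epsilon> t = {F. cubic_form F \<and> (\<forall>p \<in> vertices_off \<epsilon> t. \<forall>v \<in> p. F v = 0)}"

definition pencil_basis ::
    "complex \<Rightarrow> vertex_type \<Rightarrow> (complex^3 \<Rightarrow> complex) \<Rightarrow> (complex^3 \<Rightarrow> complex) \<Rightarrow> bool" where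
  "pencil_basis \<epsilon> t F G \<longleftrightarrow>
     pencil_forms \<epsilon> t = {\<lambda>x. a * F x + b * G x | a b. True} \<and>
     (\<forall>a b. (\<forall>x. a * F x + b * G x = 0) \<longrightarrow> a = 0 \<and> b = 0)"

text \<open>
  A cubic is the set of all its equations, i.e. a class of nonzero forms up to nonzero scalars.
  A basis of the space of forms identifies the pencil with the projective line as follows.
\<close>

definition pencil_member ::
    "(complex^3 \<Rightarrow> complex) \<Rightarrow> (complex^3 \<Rightarrow> complex) \<Rightarrow> (complex^2) set \<Rightarrow> (complex^3 \<Rightarrow> complex) set"
  where
  "pencil_member F G q = {\<lambda>x. w$1 * F x + w$2 * G x | w. w \<in> q}"

definition singular_cubic :: "(complex^3 \<Rightarrow> complex) set \<Rightarrow> bool" where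
  "singular_cubic C \<longleftrightarrow> (\<exists>F \<in> C. \<exists>p \<in> proj_space. multiplicity_at F p \<ge> 2)"

text \<open>The parameter set \<open>torsion_params M N\<close> is compatible with projectivities, so the choice of
  the basis is immaterial.\<close>

definition halphen_cubics :: "complex \<Rightarrow> nat \<Rightarrow> (complex^3 \<Rightarrow> complex) set set" where
  "halphen_cubics \<epsilon> m =
     {pencil_member F G q | t F G q.
        pencil_basis \<epsilon> t F G \<and>
        q \<in> torsion_params {q \<in> proj_space. singular_cubic (pencil_member F G q)} (3 * m)}"

text \<open>
  The union of finitely many curves without common components is given by the product of their
  equations, and Halphen cubics are smooth because the singular members are excluded. Another choice
  of the equations changes the product by a nonzero constant factor only.
\<close>

definition halphen_union :: "complex \<Rightarrow> nat \<Rightarrow> complex^3 \<Rightarrow> complex" where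
  "halphen_union \<epsilon> m x = (\<Prod>C \<in> halphen_cubics \<epsilon> m. (SOME F. F \<in> C) x)"

end

theory Submission
  imports Defs
begin

text \<open>
  The values at torsion points of the function \<open>f\<close> on the curve \<open>g\<^sup>3 = f\<^sup>2 + f\<close>, uniformised by the
  hexagonal lattice, are the torsion parameters of a projective line with branch points \<open>0\<close>, \<open>-1\<close>,
  \<open>\<infinity>\<close>. In suitable coordinates each of the four pencils is the Fermat pencil spanned by \<open>y\<^sup>3 - z\<^sup>3\<close>
  and \<open>z\<^sup>3 - x\<^sup>3\<close>, so a plane point that is not a vertex determines a parameter, hence a point of the
  curve, for each pencil. Determinant identities show that the points belonging to three of the
  pencils are collinear on the curve, so by the chord law two Halphen cubics through a point force
  all four. At a vertex, the tangent directions of the three pencils differ only by permutations of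
  the branch points.

  For the number of quadruple points, a plane point is recovered from its data for the
  pencils of type \<open>v\<close> and \<open>h\<close> as the kernel of a \<open>3 \<times> 3\<close> matrix. For each of the \<open>n\<^sup>2 - 3\<close> data
  of type \<open>h\<close> exactly six data of type \<open>v\<close> are excluded, namely those whose kernel is spanned by a
  vertex of type \<open>\<delta>\<close> or \<open>\<gamma>\<close>; scaling by cube roots of unity makes the correspondence three to one.
\<close>

text \<open>The definition of torsion parameters ranges over every lattice and every cover of degree
  3, so the explicit function \<open>wF\<close> settles nothing without a uniqueness theorem: any
  cover with branch points 0, -1, \<infinity> satisfies f'^3 = C (f^2 + f)^2, and this forces it to
  be \<open>wF\<close> after an affine substitution.

  The obstacle in the chord law is that the two given points may coincide, where a tangent would be
  needed. No tangent law is proved. Each triple of pencils comes with two collinearity relations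
  that differ by permutations of coordinates, and the two pairs of points cannot both coincide.

  In every pencil the three singular members multiply to the same form of degree 9, the product of
  the nine lines. Hence a single rescaling of the plane vector places the data of all four pencils
  on one curve a + b + c = 0, abc = 1. A plane point has nine such rescalings, while a pair of data
  of types v and h belongs to three vectors; the quotient is the factor three in the count.\<close>

no_notation fps_nth (infixl \<open>$\<close> 75)

section \<open>The hexagonal lattice\<close>

locale cube_root =
  fixes \<epsilon> :: complex
  assumes eps3: "\<epsilon> ^ 3 = 1" and eps1: "\<epsilon> \<noteq> 1"
begin

lemma eps_nz: "\<epsilon> \<noteq> 0" using eps3 by auto

lemma eps2: "\<epsilon> ^ 2 = - 1 - \<epsilon>"
proof -
  have "(\<epsilon> - 1) * (\<epsilon>^2 + \<epsilon> + 1) = 0"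
    using eps3 by (simp add: algebra_simps power2_eq_square power3_eq_cube)
  then have "\<epsilon>^2 + \<epsilon> + 1 = 0" using eps1 by simp
  then show ?thesis by (simp add: algebra_simps add_eq_0_iff)
qed

text \<open>Only the square of the imaginary part is determined, since \<epsilon> may be either of
  the two primitive roots.\<close>

lemma Re_eps: "Re \<epsilon> = - 1 / 2" and Im_eps: "(Im \<epsilon>)^2 = 3 / 4"
proof -
  have r: "(Re \<epsilon>)^2 - (Im \<epsilon>)^2 = - 1 - Re \<epsilon>" and i: "2 * Re \<epsilon> * Im \<epsilon> = - Im \<epsilon>"
    using arg_cong[OF eps2, of Re] arg_cong[OF eps2, of Im] by (simp_all add: power2_eq_square algebra_simps)
  have "Im \<epsilon> \<noteq> 0"
  proof
    assume "Im \<epsilon> = 0"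
    with r have "(Re \<epsilon> + 1/2)^2 + 3/4 = 0" by (simp add: power2_eq_square algebra_simps)
    then show False using zero_le_power2[of "Re \<epsilon> + 1/2"] by linarith
  qed
  moreover have "Im \<epsilon> * (2 * Re \<epsilon> + 1) = 0" using i by (simp add: algebra_simps)
  ultimately show re: "Re \<epsilon> = - 1 / 2" by simp
  show "(Im \<epsilon>)^2 = 3 / 4" using r re by (simp add: power2_eq_square algebra_simps)
qed

lemma norm_lattice: "(cmod (of_real a + of_real b * \<epsilon>))^2 = a^2 - a * b + b^2"
proof -
  have "(cmod (of_real a + of_real b * \<epsilon>))^2 = (a + b * Re \<epsilon>)^2 + b^2 * (Im \<epsilon>)^2"
    by (simp add: cmod_power2 power_mult_distrib)
  also have "\<dots> = a^2 - a * b + b^2"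
    unfolding Re_eps Im_eps by (simp add: power2_eq_square algebra_simps)
  finally show ?thesis .
qed

text \<open>The factor 1 is written out so that the set has literally the shape demanded by
  \<open>is_lattice\<close>, with periods 1 and \<epsilon>.\<close>

definition L :: "complex set" where
  "L = {of_int a * 1 + of_int b * \<epsilon> | a b :: int. True}"

definition lat :: "int \<times> int \<Rightarrow> complex" where
  "lat = (\<lambda>(a, b). of_int a + of_int b * \<epsilon>)"

lemma L_lat: "L = range lat"
  unfolding L_def lat_def by auto

lemma norm_lat: "(cmod (lat (a, b)))^2 = of_int a^2 - of_int a * of_int b + of_int b^2"
  using norm_lattice[of "of_int a" "of_int b"] by (simp add: lat_def)

lemma real_indep:
  fixes a b :: real
  assumes "of_real a + of_real b * \<epsilon> = 0" shows "a = 0 \<and> b = 0"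
proof -
  have "a^2 - a * b + b^2 = 0" using norm_lattice[of a b] assms by simp
  then have *: "(a - b/2)^2 + 3/4 * b^2 = 0" by (simp add: power2_eq_square algebra_simps)
  then have "b^2 = 0" using zero_le_power2[of "a - b/2"] zero_le_power2[of b] by linarith
  then have "b = 0" by simp
  with * show ?thesis by simp
qed

lemma is_lattice_L: "is_lattice L"
  unfolding is_lattice_def L_def using real_indep
  by (intro exI[of _ 1] exI[of _ \<epsilon>]) (auto simp: mult.commute)

lemma inj_lat: "inj lat"
proof (rule injI)
  fix p q assume eq: "lat p = lat q"
  obtain a b c d where [simp]: "p = (a, b)" "q = (c, d)" by (cases p, cases q) auto
  have "complex_of_real (real_of_int (a - c)) + complex_of_real (real_of_int (b - d)) * \<epsilon> = 0"
    using eq by (simp add: lat_def algebra_simps)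
  from real_indep[OF this] show "p = q" by simp
qed

lemma L_0 [simp]: "0 \<in> L" unfolding L_def by (intro CollectI exI[of _ 0]) auto
lemma L_1 [simp]: "1 \<in> L" unfolding L_def by (intro CollectI exI[of _ 1] exI[of _ 0]) auto
lemma L_eps [simp]: "\<epsilon> \<in> L" unfolding L_def by (intro CollectI exI[of _ 0] exI[of _ 1]) auto

lemma L_add: "u \<in> L \<Longrightarrow> v \<in> L \<Longrightarrow> u + v \<in> L"
  unfolding L_def
proof (clarify, goal_cases)
  case (1 a b a' b')
  then show ?case by (intro exI[of _ "a + b"] exI[of _ "a' + b'"]) (simp add: algebra_simps)
qed

lemma L_uminus: "u \<in> L \<Longrightarrow> - u \<in> L"
  unfolding L_def
proof (clarify, goal_cases)
  case (1 a b)
  then show ?case by (intro exI[of _ "- a"] exI[of _ "- b"]) (simp add: algebra_simps)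
qed

lemma L_uminus_iff [simp]: "- u \<in> L \<longleftrightarrow> u \<in> L"
  using L_uminus[of u] L_uminus[of "-u"] by auto

lemma L_diff: "u \<in> L \<Longrightarrow> v \<in> L \<Longrightarrow> u - v \<in> L"
  using L_add[of u "-v"] by simp

lemma L_add_iff: "v \<in> L \<Longrightarrow> u + v \<in> L \<longleftrightarrow> u \<in> L"
  using L_add[of u v] L_diff[of "u + v" v] by auto

lemma L_of_int: "u \<in> L \<Longrightarrow> of_int k * u \<in> L"
  unfolding L_def
proof (clarify, goal_cases)
  case (1 a b)
  then show ?case by (intro exI[of _ "k * a"] exI[of _ "k * b"]) (simp add: algebra_simps)
qed

lemma L_of_nat: "u \<in> L \<Longrightarrow> of_nat k * u \<in> L"
  using L_of_int[of u "int k"] by simp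

lemma L_eps_mult: "u \<in> L \<Longrightarrow> \<epsilon> * u \<in> L"
  unfolding L_def
proof (clarify, goal_cases)
  case (1 a b)
  have "\<epsilon> * (of_int a * 1 + of_int b * \<epsilon>) = of_int (- b) * 1 + of_int (a - b) * \<epsilon>"
    using eps2 unfolding power2_eq_square by (simp add: distrib_left mult.left_commute[of \<epsilon>]) (simp add: algebra_simps)
  then show ?case by blast
qed

lemma L_eps_iff [simp]: "\<epsilon> * u \<in> L \<longleftrightarrow> u \<in> L"
proof
  assume "\<epsilon> * u \<in> L"
  then have "\<epsilon> * (\<epsilon> * (\<epsilon> * u)) \<in> L" by (rule L_eps_mult[OF L_eps_mult])
  moreover have "\<epsilon> * (\<epsilon> * (\<epsilon> * u)) = u" using eps3 by (simp add: power3_eq_cube mult.assoc)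
  ultimately show "u \<in> L" by simp
qed (rule L_eps_mult)

text \<open>A lower bound by a product allows the lattice sum of |w|^(-3) to be compared with a
  product of two sums over the integers with exponent 3/2. The constant 8 has slack; the
  inequalities below would give 6.\<close>

lemma norm_lat_ge: "(1 + \<bar>of_int a\<bar>) * (1 + \<bar>of_int b\<bar>) \<le> 8 * (cmod (lat (a, b)))^2"
  if "(a, b) \<noteq> (0, 0)"
proof -
  define x y :: real where "x = \<bar>of_int a\<bar>" and "y = \<bar>of_int b\<bar>"
  have nn: "x \<ge> 0" "y \<ge> 0" by (auto simp: x_def y_def)
  have "\<bar>a\<bar> \<ge> 1 \<or> \<bar>b\<bar> \<ge> 1" using that by auto
  then have one: "x \<ge> 1 \<or> y \<ge> 1" unfolding x_def y_def by linarith
  have ab: "of_int a * of_int b \<le> x * y" unfolding x_def y_def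
    by (metis abs_ge_self abs_mult)
  have "(cmod (lat (a, b)))^2 \<ge> x^2 - x * y + y^2"
    unfolding norm_lat using ab by (simp add: x_def y_def)
  moreover have "x^2 - x * y + y^2 \<ge> (x^2 + y^2)/2"
    using zero_le_power2[of "x - y"] by (simp add: power2_eq_square field_simps)
  moreover have "x^2 + y^2 \<ge> 1"
  proof -
    have "x^2 \<ge> 1 \<or> y^2 \<ge> 1" using one by (metis one_le_power)
    then show ?thesis using zero_le_power2[of x] zero_le_power2[of y] by linarith
  qed
  moreover have "(1 + x) * (1 + y) \<le> 1 + (x^2 + 1) / 2 + (y^2 + 1)/2 + (x^2 + y^2)/2"
    using zero_le_power2[of "x - y"] zero_le_power2[of "x - 1"] zero_le_power2[of "y - 1"]
    by (simp add: power2_eq_square field_simps)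
  ultimately have "(1 + x) * (1 + y) \<le> 8 * (cmod (lat (a, b)))^2" by (simp add: field_simps)
  then show ?thesis by (simp add: x_def y_def)
qed

end

lemma summable_int_powr: "(\<lambda>a::int. (1 + \<bar>real_of_int a\<bar>) powr (-3/2)) summable_on UNIV"
proof -
  have "summable (\<lambda>n. real n powr (-3/2))" by (subst summable_real_powr_iff) simp
  then have s: "summable (\<lambda>n. real (Suc n) powr (-3/2))" by (subst summable_Suc_iff) 
  then have n: "(\<lambda>n. (1 + real n) powr (-3/2)) summable_on UNIV"
    by (subst summable_on_UNIV_nonneg_real_iff) (auto simp: add.commute)
  have p: "(\<lambda>a::int. (1 + \<bar>real_of_int a\<bar>) powr (-3/2)) summable_on range int"
    by (subst summable_on_reindex) (use n in \<open>auto simp: o_def\<close>)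
  have m: "(\<lambda>a::int. (1 + \<bar>real_of_int a\<bar>) powr (-3/2)) summable_on range (\<lambda>n. - int n)"
    by (subst summable_on_reindex) (use n in \<open>auto simp: o_def inj_def\<close>)
  have "UNIV = range int \<union> (range (\<lambda>n. - int n) - range int)"
    by (auto, metis int_cases2 rangeI)
  moreover have "(\<lambda>a::int. (1 + \<bar>real_of_int a\<bar>) powr (-3/2)) summable_on
      (range int \<union> (range (\<lambda>n. - int n) - range int))"
    by (intro summable_on_Un_disjoint p summable_on_subset_banach[OF m]) auto
  ultimately show ?thesis by simp
qed

context cube_root begin

lemma summable_lat: "(\<lambda>w. inverse (cmod w) ^ 3) summable_on L"
proof -
  let ?f = "\<lambda>a::int. (1 + \<bar>real_of_int a\<bar>) powr (-3/2) :: real"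
  have "(\<lambda>(a,b). ?f a * ?f b) summable_on UNIV \<times> UNIV"
    using summable_int_powr
    by (intro summable_on_SigmaI[where g = "\<lambda>a. ?f a * infsum ?f UNIV"])
       (auto intro!: has_sum_cmult_right has_sum_infsum summable_on_cmult_left)
  then have s: "(\<lambda>(a,b). 8 powr (3/2) * (?f a * ?f b)) summable_on UNIV"
    using summable_on_cmult_right[of "\<lambda>(a,b). ?f a * ?f b" UNIV "8 powr (3/2)"]
    by (simp add: case_prod_unfold)
  have bd: "inverse (cmod (lat (a,b))) ^ 3 \<le> 8 powr (3/2) * (?f a * ?f b)" for a b
  proof (cases "(a, b) = (0, 0)")
    \<comment> \<open>The lattice point 0 contributes nothing, because
      \<open>inverse 0 = 0\<close>.\<close>
    case True then show ?thesis by (simp add: lat_def)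
  next
    case False
    define N where "N = cmod (lat (a,b))"
    define P where "P = (1 + \<bar>of_int a\<bar>) * (1 + \<bar>of_int b\<bar> :: real)"
    have P: "P \<ge> 1" unfolding P_def by (rule mult_ge1_I) auto
    have le: "P \<le> 8 * N^2" using norm_lat_ge[OF False] by (simp add: P_def N_def)
    have N: "N > 0" using le P by (cases "N = 0") (auto simp: N_def)
    have "inverse N ^ 3 = (N^2) powr (-3/2)"
      using N by (simp add: powr_powr powr_minus power_inverse flip: powr_numeral)
    also have "\<dots> = 8 powr (3/2) * (8 * N^2) powr (-3/2)"
      using N by (simp add: powr_mult powr_minus)
    also have "\<dots> \<le> 8 powr (3/2) * P powr (-3/2)"
      using le P by (intro mult_left_mono powr_mono2') auto
    also have "P powr (-3/2) = ?f a * ?f b" unfolding P_def by (simp add: powr_mult)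
    finally show ?thesis by (simp add: N_def)
  qed
  have "(\<lambda>p. inverse (cmod (lat p)) ^ 3) summable_on UNIV"
    by (rule summable_on_comparison_test[OF s]) (use bd in auto)
  then show ?thesis unfolding L_lat
    by (subst summable_on_reindex[OF inj_lat]) (simp add: o_def)
qed

lemma finite_L_ball: "finite {w \<in> L. cmod w < R}"
proof -
  have sub: "{w \<in> L. cmod w < R} \<subseteq> insert 0 (lat ` ({-k..k} \<times> {-k..k}))"
    if k: "k = \<lceil>8 * R^2\<rceil>" for k
  proof
    fix w assume "w \<in> {w \<in> L. cmod w < R}"
    then obtain a b where w: "w = lat (a,b)" and lt: "cmod w < R" by (auto simp: L_lat)
    show "w \<in> insert 0 (lat ` ({-k..k} \<times> {-k..k}))"
    proof (cases "(a,b) = (0,0)")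
      case True then show ?thesis using w by (simp add: lat_def)
    next
      case False
      define x y :: real where "x = \<bar>of_int a\<bar>" and "y = \<bar>of_int b\<bar>"
      have nn: "x \<ge> 0" "y \<ge> 0" by (auto simp: x_def y_def)
      have "(cmod w)^2 \<le> R^2" using lt by (intro power_mono) auto
      then have "(1 + x) * (1 + y) \<le> 8 * R^2" using norm_lat_ge[OF False] w by (simp add: x_def y_def)
      moreover have "x \<le> (1 + x) * (1 + y)" "y \<le> (1 + x) * (1 + y)" using nn by (simp_all add: algebra_simps)
      ultimately have "x \<le> 8 * R^2" "y \<le> 8 * R^2" by linarith+
      then have "\<bar>a\<bar> \<le> k" "\<bar>b\<bar> \<le> k" unfolding k x_def y_def by linarith+
      then show ?thesis using w by (auto simp: abs_le_iff)
    qed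
  qed
  show ?thesis by (rule finite_subset[OF sub[OF refl]]) auto
qed

end

lemma is_lattice_0: "is_lattice \<Lambda> \<Longrightarrow> 0 \<in> \<Lambda>"
  and is_lattice_add: "is_lattice \<Lambda> \<Longrightarrow> u \<in> \<Lambda> \<Longrightarrow> v \<in> \<Lambda> \<Longrightarrow> u + v \<in> \<Lambda>"
  and is_lattice_uminus: "is_lattice \<Lambda> \<Longrightarrow> u \<in> \<Lambda> \<Longrightarrow> - u \<in> \<Lambda>"
proof -
  assume "is_lattice \<Lambda>"
  then obtain w1 w2 where L: "\<Lambda> = {of_int a * w1 + of_int b * w2 | a b :: int. True}"
    unfolding is_lattice_def by blast
  show "0 \<in> \<Lambda>" unfolding L by (intro CollectI exI[of _ 0]) auto
  {
    assume "u \<in> \<Lambda>" "v \<in> \<Lambda>"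
    then obtain a b c d where "u = of_int a * w1 + of_int b * w2" "v = of_int c * w1 + of_int d * w2"
      unfolding L by blast
    then show "u + v \<in> \<Lambda>" unfolding L
      by (intro CollectI exI[of _ "a + c"] exI[of _ "b + d"]) (simp add: algebra_simps)
  }
  {
    assume "u \<in> \<Lambda>"
    then obtain a b where "u = of_int a * w1 + of_int b * w2" unfolding L by blast
    then show "- u \<in> \<Lambda>" unfolding L
      by (intro CollectI exI[of _ "- a"] exI[of _ "- b"]) (simp add: algebra_simps)
  }
qed

text \<open>Cramer's rule with determinant \<open>D\<close> gives the real coordinates of z.
  Removing their integer parts moves z into a period parallelogram, which lies in a disc.\<close>

lemma is_lattice_compact_reps:
  assumes "is_lattice \<Lambda>"
  obtains K where "compact K" and "\<And>z. \<exists>w\<in>\<Lambda>. z - w \<in> K"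
proof -
  obtain w1 w2 where ind: "\<And>a b::real. of_real a * w1 + of_real b * w2 = 0 \<Longrightarrow> a = 0 \<and> b = 0"
    and L: "\<Lambda> = {of_int a * w1 + of_int b * w2 | a b :: int. True}"
    using assms unfolding is_lattice_def by blast
  define D where "D = Re w1 * Im w2 - Im w1 * Re w2"
  have D: "D \<noteq> 0"
  proof
    assume D0: "D = 0"
    have "of_real (Re w2) * w1 + of_real (- Re w1) * w2 = 0"
      using D0 by (simp add: complex_eq_iff D_def algebra_simps)
    from ind[OF this] have r: "Re w1 = 0" "Re w2 = 0" by auto
    have "of_real (Im w2) * w1 + of_real (- Im w1) * w2 = 0"
      using r by (simp add: complex_eq_iff)
    from ind[OF this] r have "w1 = 0" by (simp add: complex_eq_iff)
    then show False using ind[of 1 0] by simp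
  qed
  define R where "R = cmod w1 + cmod w2"
  show ?thesis
  proof (rule that)
    show "compact (cball (0::complex) R)" by simp
    fix z
    define a b where "a = (Re z * Im w2 - Im z * Re w2) / D" and "b = (Re w1 * Im z - Im w1 * Re z) / D"
    have a: "a * D = Re z * Im w2 - Im z * Re w2" and b: "b * D = Re w1 * Im z - Im w1 * Re z"
      using D by (auto simp: a_def b_def)
    have "D * (a * Re w1 + b * Re w2) = D * Re z" "D * (a * Im w1 + b * Im w2) = D * Im z"
      using arg_cong[OF a, of "\<lambda>u. u * Re w1"] arg_cong[OF b, of "\<lambda>u. u * Re w2"]
        arg_cong[OF a, of "\<lambda>u. u * Im w1"] arg_cong[OF b, of "\<lambda>u. u * Im w2"]
      by (simp_all add: D_def algebra_simps)
    then have z: "z = of_real a * w1 + of_real b * w2"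
      using D by (simp add: complex_eq_iff)
    define w where "w = of_int \<lfloor>a\<rfloor> * w1 + of_int \<lfloor>b\<rfloor> * w2"
    have "z - w = of_real (frac a) * w1 + of_real (frac b) * w2"
      by (simp add: z w_def frac_def algebra_simps)
    then have "cmod (z - w) \<le> frac a * cmod w1 + frac b * cmod w2"
      using norm_triangle_ineq[of "of_real (frac a) * w1" "of_real (frac b) * w2"]
      by (simp add: norm_mult)
    also have "\<dots> \<le> 1 * cmod w1 + 1 * cmod w2"
      by (intro add_mono mult_right_mono) (auto simp: less_imp_le frac_lt_1)
    finally have "z - w \<in> cball 0 R" by (simp add: R_def)
    moreover have "w \<in> \<Lambda>" unfolding L w_def by blast
    ultimately show "\<exists>w\<in>\<Lambda>. z - w \<in> cball 0 R" by blast
  qed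
qed

text \<open>All values are already taken on a compact set of representatives, so the function is
  bounded and Liouville's theorem applies.\<close>

lemma entire_periodic_constant:
  assumes "is_lattice \<Lambda>" and hol: "h holomorphic_on UNIV"
    and per: "\<And>z w. w \<in> \<Lambda> \<Longrightarrow> h (z + w) = h z"
  shows "h z = h z'"
proof -
  obtain K where K: "compact K" "\<And>z. \<exists>w\<in>\<Lambda>. z - w \<in> K"
    by (rule is_lattice_compact_reps[OF assms(1)]) blast
  have "range h \<subseteq> h ` K"
  proof clarify
    fix z
    obtain w where "w \<in> \<Lambda>" "z - w \<in> K" using K(2) by blast
    then show "h z \<in> h ` K" using per[of w "z - w"] by (metis diff_add_cancel imageI)
  qed
  moreover have "compact (h ` K)"
    using K(1) hol by (intro compact_continuous_image holomorphic_on_imp_continuous_on)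
      (auto intro: holomorphic_on_subset)
  ultimately have "bounded (range h)" using compact_imp_bounded bounded_subset by blast
  then obtain c where "\<And>z. h z = c" using Liouville_theorem[OF hol] by (auto simp: constant_on_def)
  then show ?thesis by simp
qed

section \<open>The Weierstrass function of the lattice\<close>

context cube_root begin

text \<open>Because \<open>inverse 0 = 0\<close>, the summand at w = 0 is just 1/z^2. The
  Weierstrass function is therefore a sum over the whole lattice, with no exceptional index, which
  keeps reindexing by symmetries simple.\<close>

definition wp_term :: "complex \<Rightarrow> complex \<Rightarrow> complex" where
  "wp_term z w = inverse ((z - w)^2) - inverse (w^2)"

definition wp :: "complex \<Rightarrow> complex" where
  "wp z = (\<Sum>\<^sub>\<infinity>w\<in>L. wp_term z w)"

text \<open>Discarding the finitely many lattice points of norm below 2R removes every pole from the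
  disc of radius R; on that disc the remaining summands are dominated by a multiple of
  |w|^(-3).\<close>

definition wp_tail :: "real \<Rightarrow> complex \<Rightarrow> complex" where
  "wp_tail R z = (\<Sum>\<^sub>\<infinity>w\<in>{w \<in> L. 2 * R \<le> cmod w}. wp_term z w)"

lemma wp_term_bound:
  assumes R: "R > 0" and z: "cmod z \<le> R" and w: "2 * R \<le> cmod w"
  shows "cmod (wp_term z w) \<le> 10 * R * inverse (cmod w) ^ 3"
proof -
  have w0: "cmod w > 0" "w \<noteq> 0" using R w by auto
  have zw: "cmod (z - w) \<ge> cmod w / 2"
    using norm_triangle_ineq2[of w z] z w by (simp add: norm_minus_commute)
  then have zw0: "z - w \<noteq> 0" using w0 by auto
  have "wp_term z w = z * (2 * w - z) / ((z - w)^2 * w^2)"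
  proof -
    define d where "d = z - w"
    have "inverse (d^2) - inverse (w^2) = (w^2 - d^2) / (d^2 * w^2)"
      using w0 zw0 unfolding d_def[symmetric] by (simp add: divide_simps)
    also have "w^2 - d^2 = z * (2 * w - z)" by (simp add: d_def power2_eq_square algebra_simps)
    finally show ?thesis by (simp add: wp_term_def d_def)
  qed
  then have "cmod (wp_term z w) = cmod z * cmod (2 * w - z) / (cmod (z - w)^2 * cmod w^2)"
    by (simp add: norm_mult norm_divide norm_power)
  also have "\<dots> \<le> R * (5/2 * cmod w) / ((cmod w / 2)^2 * cmod w^2)"
  proof (rule frac_le)
    have "cmod (2 * w - z) \<le> 2 * cmod w + cmod z"
      using norm_triangle_ineq4[of "2 * w" z] by (simp add: norm_mult)
    then have "cmod (2 * w - z) \<le> 5/2 * cmod w" using z w by linarith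
    then show "cmod z * cmod (2 * w - z) \<le> R * (5/2 * cmod w)"
      using z R by (intro mult_mono) auto
    show "(cmod w / 2)^2 * cmod w^2 \<le> cmod (z - w)^2 * cmod w^2"
      using zw by (intro mult_right_mono power_mono) auto
  qed (use R w0 in auto)
  also have "\<dots> = 10 * R * inverse (cmod w) ^ 3"
  proof -
    define c where "c = cmod w"
    have "c \<noteq> 0" using w0 by (simp add: c_def)
    then show ?thesis unfolding c_def[symmetric]
      by (simp add: divide_simps) (simp add: power2_eq_square power3_eq_cube power4_eq_xxxx mult.assoc)
  qed
  finally show ?thesis .
qed

lemma summable_lat_subset: "A \<subseteq> L \<Longrightarrow> (\<lambda>w. c * inverse (cmod w) ^ 3) summable_on A"
  by (rule summable_on_cmult_right[OF summable_on_subset_banach[OF summable_lat]])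

lemma wp_tail_summable:
  assumes "R > 0" "cmod z \<le> R"
  shows "wp_term z summable_on {w \<in> L. 2 * R \<le> cmod w}"
proof -
  have "(\<lambda>w. norm (wp_term z w)) summable_on {w \<in> L. 2 * R \<le> cmod w}"
    by (rule Infinite_Sum.abs_summable_on_comparison_test'[OF summable_lat_subset[of _ "10 * R"]])
       (use wp_term_bound assms in auto)
  then show ?thesis by (rule abs_summable_summable)
qed

lemma wp_split:
  assumes "R > 0" "cmod z \<le> R"
  shows "wp_term z summable_on L"
    and "wp z = (\<Sum>w\<in>{w \<in> L. cmod w < 2 * R}. wp_term z w) + wp_tail R z"
proof -
  have L: "L = {w \<in> L. cmod w < 2 * R} \<union> {w \<in> L. 2 * R \<le> cmod w}" by auto
  have fin: "finite {w \<in> L. cmod w < 2 * R}" by (rule finite_L_ball)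
  show "wp_term z summable_on L"
    by (subst L, rule summable_on_Un_disjoint) (use fin wp_tail_summable[OF assms] in auto)
  show "wp z = (\<Sum>w\<in>{w \<in> L. cmod w < 2 * R}. wp_term z w) + wp_tail R z"
    unfolding wp_def wp_tail_def
    by (subst L, subst infsum_Un_disjoint) (use fin wp_tail_summable[OF assms] in auto)
qed

lemma wp_summable: "wp_term z summable_on L"
  using wp_split(1)[of "cmod z + 1" z] by (simp add: add_nonneg_pos)

lemma wp_term_holomorphic: "w \<notin> A \<Longrightarrow> (\<lambda>z. wp_term z w) holomorphic_on A"
  unfolding wp_term_def by (intro holomorphic_intros) auto

text \<open>By the M-test the finite partial sums converge uniformly on the closed disc, and each of
  them is holomorphic there.\<close>

lemma wp_tail_holomorphic:
  assumes R: "R > 0"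
  shows "wp_tail R holomorphic_on ball 0 R"
proof -
  let ?X = "{w \<in> L. 2 * R \<le> cmod w}"
  have notin: "w \<notin> cball 0 R" if "w \<in> ?X" for w using that R by auto
  have ul: "uniform_limit (cball 0 R) (\<lambda>X z. \<Sum>w\<in>X. wp_term z w) (wp_tail R) (finite_subsets_at_top ?X)"
    unfolding wp_tail_def
    by (rule Weierstrass_m_test_general[where M = "\<lambda>w. 10 * R * inverse (cmod w) ^ 3"])
       (use R wp_term_bound summable_lat_subset in auto)
  have hol: "(\<lambda>z. \<Sum>w\<in>X. wp_term z w) holomorphic_on cball 0 R" if "X \<subseteq> ?X" for X
    by (intro holomorphic_on_sum wp_term_holomorphic) (use that notin in auto)
  have ev: "\<forall>\<^sub>F X in finite_subsets_at_top ?X.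
      continuous_on (cball 0 R) (\<lambda>z. \<Sum>w\<in>X. wp_term z w) \<and> (\<lambda>z. \<Sum>w\<in>X. wp_term z w) holomorphic_on ball 0 R"
    by (rule eventually_finite_subsets_at_top_weakI)
       (use hol in \<open>auto intro: holomorphic_on_imp_continuous_on holomorphic_on_subset[OF _ ball_subset_cball]\<close>)
  show ?thesis
    by (rule holomorphic_uniform_limit[OF ev ul]) auto
qed

lemma closed_L: "closed L"
proof -
  have "\<not> z islimpt L" for z
  proof
    assume "z islimpt L"
    then have "infinite (L \<inter> ball z 1)" by (simp add: islimpt_eq_infinite_ball)
    moreover have "cmod w < cmod z + 1" if "dist z w < 1" for w
      using that norm_triangle_ineq2[of w z] by (simp add: dist_norm norm_minus_commute)
    then have "L \<inter> ball z 1 \<subseteq> {w \<in> L. cmod w < cmod z + 1}" by auto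
    ultimately show False using finite_L_ball finite_subset by blast
  qed
  then show ?thesis by (simp add: closed_limpt)
qed

lemma open_compl_L: "open (- L)" using closed_L by auto

text \<open>The squared norm of a nonzero lattice point is a positive integer.\<close>

lemma L_norm_ge_1: "w \<in> L \<Longrightarrow> w \<noteq> 0 \<Longrightarrow> cmod w \<ge> 1"
proof -
  assume "w \<in> L" "w \<noteq> 0"
  then obtain a b where w: "w = lat (a,b)" by (auto simp: L_lat)
  have eq: "(cmod w)^2 = of_int (a^2 - a * b + b^2)" unfolding w norm_lat by simp
  then have "of_int (a^2 - a * b + b^2) > (0::real)" using \<open>w \<noteq> 0\<close> by (metis zero_less_norm_iff zero_less_power)
  then have "a^2 - a * b + b^2 \<ge> 1" by linarith
  then have "(cmod w)^2 \<ge> 1" unfolding eq by linarith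
  then show ?thesis by (metis abs_norm_cancel abs_square_less_1 not_le)
qed

lemma wp_holomorphic: "wp holomorphic_on - L"
proof -
  have "wp field_differentiable at z" if z: "z \<in> - L" for z
  proof -
    define R where "R = cmod z + 1"
    have R: "R > 0" unfolding R_def by (simp add: add_nonneg_pos)
    have op: "open (ball 0 R - L)" using closed_L by auto
    have "(\<lambda>z. (\<Sum>w\<in>{w \<in> L. cmod w < 2 * R}. wp_term z w) + wp_tail R z) holomorphic_on (ball 0 R - L)"
      by (intro holomorphic_intros wp_term_holomorphic)
         (use holomorphic_on_subset[OF wp_tail_holomorphic[OF R]] in auto)
    then have "wp holomorphic_on (ball 0 R - L)"
      by (rule holomorphic_transform) (use wp_split(2)[OF R] in auto)
    moreover have "z \<in> ball 0 R - L" using z by (auto simp: R_def)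
    ultimately show ?thesis using op by (simp add: holomorphic_on_imp_differentiable_at)
  qed
  then show ?thesis by (simp add: holomorphic_on_def field_differentiable_at_within)
qed

lemma wp_near_0: "cmod z \<le> 1/2 \<Longrightarrow> wp z = inverse (z^2) + wp_tail (1/2) z"
proof -
  assume z: "cmod z \<le> 1/2"
  have "{w \<in> L. cmod w < 2 * (1/2)} = {0}"
  proof (intro equalityI subsetI)
    fix w assume "w \<in> {w \<in> L. cmod w < 2 * (1/2)}"
    then show "w \<in> {0}" using L_norm_ge_1[of w] by auto
  qed auto
  then show ?thesis using wp_split(2)[of "1/2" z] z by (simp add: wp_term_def)
qed

lemma L_bij_eps: "bij_betw (\<lambda>w. \<epsilon> * w) L L"
proof (rule bij_betwI')
  show "\<exists>x\<in>L. y = \<epsilon> * x" if "y \<in> L" for y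
  proof (rule bexI[of _ "\<epsilon> * (\<epsilon> * y)"])
    have "\<epsilon> * (\<epsilon> * (\<epsilon> * y)) = \<epsilon>^3 * y" by (simp add: power3_eq_cube mult.assoc)
    then show "y = \<epsilon> * (\<epsilon> * (\<epsilon> * y))" by (simp add: eps3)
  qed (use that in auto)
qed (use eps_nz in auto)

lemma norm_eps [simp]: "cmod \<epsilon> = 1"
proof -
  have "cmod \<epsilon> ^ 3 = 1" using arg_cong[OF eps3, of cmod] by (simp add: norm_power)
  then show ?thesis using power_eq_iff_eq_base[of 3 "cmod \<epsilon>" 1] by simp
qed

lemma eps_inv_sq: "inverse (\<epsilon>^2) = \<epsilon>"
  using eps3 eps_nz by (simp add: field_simps power2_eq_square power3_eq_cube)

lemma wp_term_eps: "wp_term (\<epsilon> * z) (\<epsilon> * w) = \<epsilon> * wp_term z w"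
proof -
  have "(\<epsilon> * z - \<epsilon> * w)^2 = \<epsilon>^2 * (z - w)^2" by (simp add: power2_eq_square algebra_simps)
  then show ?thesis unfolding wp_term_def
    by (simp add: power_mult_distrib eps_inv_sq) (simp add: algebra_simps)
qed

lemma wp_term_uminus: "wp_term (- z) (- w) = wp_term z w"
  unfolding wp_term_def by (simp add: power2_eq_square algebra_simps)

lemma wp_eps: "wp (\<epsilon> * z) = \<epsilon> * wp z"
proof -
  have "wp (\<epsilon> * z) = (\<Sum>\<^sub>\<infinity>w\<in>L. wp_term (\<epsilon> * z) (\<epsilon> * w))"
    unfolding wp_def using infsum_reindex_bij_betw[OF L_bij_eps] by metis
  also have "\<dots> = \<epsilon> * wp z" unfolding wp_def wp_term_eps by (rule infsum_cmult_right')
  finally show ?thesis .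
qed

lemma wp_uminus: "wp (- z) = wp z"
proof -
  have b: "bij_betw uminus L L"
    by (rule bij_betwI[of _ _ _ uminus]) auto
  have "wp (- z) = (\<Sum>\<^sub>\<infinity>w\<in>L. wp_term (- z) (- w))"
    unfolding wp_def using infsum_reindex_bij_betw[OF b] by metis
  then show ?thesis unfolding wp_def wp_term_uminus .
qed

text \<open>After reindexing w to w + u, the difference of corresponding summands no longer involves
  z. The constant is thus found termwise, without differentiating the series.\<close>

lemma wp_quasi_periodic:
  assumes u: "u \<in> L" obtains c where "\<And>z. wp (z + u) = wp z + c"
proof
  fix z
  have b: "bij_betw (\<lambda>w. w + u) L L"
    by (rule bij_betwI[of _ _ _ "\<lambda>w. w - u"]) (use u L_add L_diff in auto)
  have e: "wp_term (z + u) (w + u) = inverse ((z - w)^2) - inverse ((w + u)^2)" for w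
    unfolding wp_term_def by (simp add: algebra_simps)
  have s1: "(\<lambda>w. wp_term (z + u) (w + u)) summable_on L" for z
    using summable_on_reindex_bij_betw[OF b, of "wp_term (z+u)"] wp_summable by simp
  have d: "wp_term (z + u) (w + u) - wp_term z w = wp_term u (w + u) - wp_term 0 w" for w z
    unfolding wp_term_def by (simp add: algebra_simps)
  have "wp (z + u) = (\<Sum>\<^sub>\<infinity>w\<in>L. wp_term (z + u) (w + u))"
    unfolding wp_def using infsum_reindex_bij_betw[OF b] by metis
  then have "wp (z + u) - wp z = (\<Sum>\<^sub>\<infinity>w\<in>L. wp_term (z + u) (w + u) - wp_term z w)"
    unfolding wp_def using infsum_add[OF s1[of z] summable_on_uminus[THEN iffD2, OF wp_summable[of z]]] by (simp add: infsum_uminus)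
  also have "\<dots> = (\<Sum>\<^sub>\<infinity>w\<in>L. wp_term u (w + u) - wp_term 0 w)" unfolding d ..
  finally show "wp (z + u) = wp z + (\<Sum>\<^sub>\<infinity>w\<in>L. wp_term u (w + u) - wp_term 0 w)"
    by (simp add: algebra_simps)
qed

lemma wp_periodic_1: "wp (z + 1) = wp z" and wp_periodic_eps: "wp (z + \<epsilon>) = wp z"
proof -
  obtain c where c: "\<And>z. wp (z + 1) = wp z + c" using wp_quasi_periodic[OF L_1] by metis
  \<comment> \<open>At minus half the period the two arguments are opposite, so evenness forces the
    constant to vanish.\<close>
  have "c = 0" using c[of "-1/2"] wp_uminus[of "1/2"] by simp
  then show "wp (z + 1) = wp z" using c[of z] by simp
next
  obtain c where c: "\<And>z. wp (z + \<epsilon>) = wp z + c" using wp_quasi_periodic[OF L_eps] by metis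
  have "c = 0" using c[of "-\<epsilon>/2"] wp_uminus[of "\<epsilon>/2"] by (simp add: field_simps)
  then show "wp (z + \<epsilon>) = wp z" using c[of z] by simp
qed

lemma wp_periodic: "u \<in> L \<Longrightarrow> wp (z + u) = wp z"
proof -
  assume "u \<in> L"
  then obtain a b where u: "u = of_int a + of_int b * \<epsilon>" by (auto simp: L_def)
  have n: "wp (z + of_nat k) = wp z" "wp (z + of_nat k * \<epsilon>) = wp z" for k z
  proof (induction k arbitrary: z)
    case (Suc k) 
    { case 1 show ?case using Suc(1)[of "z + 1"] wp_periodic_1[of z] by (simp add: algebra_simps) }
    { case 2 show ?case using Suc(2)[of "z + \<epsilon>"] wp_periodic_eps[of z] by (simp add: algebra_simps) }
  qed auto
  have i: "wp (z + of_int k) = wp z \<and> wp (z + of_int k * \<epsilon>) = wp z" for k z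
  proof (cases k)
    case (nonneg n) then show ?thesis using n by simp
  next
    case (neg m)
    have "(z + of_int k) + of_nat (Suc m) = z" "(z + of_int k * \<epsilon>) + of_nat (Suc m) * \<epsilon> = z"
      unfolding neg by (simp_all add: algebra_simps)
    then show ?thesis
      using n(1)[of "z + of_int k" "Suc m"] n(2)[of "z + of_int k * \<epsilon>" "Suc m"] by metis
  qed
  show ?thesis using i[of "z + of_int a" b] i[of z a] by (simp add: u add.assoc)
qed

lemma wp_tail_eps: "cmod z < 1/2 \<Longrightarrow> wp_tail (1/2) (\<epsilon> * z) = \<epsilon> * wp_tail (1/2) z"
  and wp_tail_uminus: "cmod z < 1/2 \<Longrightarrow> wp_tail (1/2) (- z) = wp_tail (1/2) z"
proof -
  assume z: "cmod z < 1/2"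
  have e: "inverse ((\<epsilon> * z)^2) = \<epsilon> * inverse (z^2)"
    unfolding power_mult_distrib inverse_mult_distrib eps_inv_sq ..
  show "wp_tail (1/2) (\<epsilon> * z) = \<epsilon> * wp_tail (1/2) z"
    using wp_near_0[of z] wp_near_0[of "\<epsilon> * z"] wp_eps[of z] z
    unfolding e by (simp add: norm_mult algebra_simps)
  show "wp_tail (1/2) (- z) = wp_tail (1/2) z"
    using wp_near_0[of z] wp_near_0[of "- z"] wp_uminus[of z] z by simp
qed

text \<open>The tail is even and is multiplied by \<epsilon> under rotation by \<epsilon>. A Taylor
  coefficient of index k can survive only if k is even and k = 1 modulo 3, and the first such k is
  4.\<close>

lemma wp_tail_deriv_0: "(deriv ^^ k) (wp_tail (1/2)) 0 = 0" if "k < 4" for k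
proof -
  have hol: "wp_tail (1/2) holomorphic_on ball 0 (1/2)" by (rule wp_tail_holomorphic) simp
  have lin: "u^k * (deriv ^^ k) (wp_tail (1/2)) 0 = v * (deriv ^^ k) (wp_tail (1/2)) 0"
    if u: "cmod u = 1" and e: "\<And>z. cmod z < 1/2 \<Longrightarrow> wp_tail (1/2) (u * z) = v * wp_tail (1/2) z" for u v
  proof -
    have "(deriv ^^ k) (\<lambda>w. wp_tail (1/2) (u * w)) 0 = u^k * (deriv ^^ k) (wp_tail (1/2)) (u * 0)"
      by (rule higher_deriv_compose_linear[OF hol, of "ball 0 (1/2)"]) (use u in \<open>auto simp: norm_mult\<close>)
    moreover have "(deriv ^^ k) (\<lambda>w. wp_tail (1/2) (u * w)) 0 = (deriv ^^ k) (\<lambda>w. v * wp_tail (1/2) w) 0"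
      by (rule higher_deriv_cong_ev) (use e in \<open>auto simp: eventually_nhds intro!: exI[of _ "ball 0 (1/2)"]\<close>)
    moreover have "(deriv ^^ k) (\<lambda>w. v * wp_tail (1/2) w) 0 = v * (deriv ^^ k) (wp_tail (1/2)) 0"
      by (rule higher_deriv_cmult[OF hol]) auto
    ultimately show ?thesis by (metis mult_zero_right)
  qed
  have "k = 0 \<or> k = 1 \<or> k = 2 \<or> k = 3" using that by linarith
  moreover have "\<epsilon>^k * (deriv ^^ k) (wp_tail (1/2)) 0 = \<epsilon> * (deriv ^^ k) (wp_tail (1/2)) 0"
    using lin[of \<epsilon> \<epsilon>] wp_tail_eps by simp
  moreover have "(-1)^k * (deriv ^^ k) (wp_tail (1/2)) 0 = 1 * (deriv ^^ k) (wp_tail (1/2)) 0"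
    using lin[of "-1" 1] wp_tail_uminus by simp
  ultimately show ?thesis using eps1 eps_nz by (auto simp: power2_eq_square)
qed

text \<open>The vanishing to order 4 is what makes the principal parts of wp^2 and wp^3 explicit in
  the differential equations.\<close>

lemma wp_tail_factor:
  obtains g r where "r > 0" "r \<le> 1/2" "g holomorphic_on ball 0 r"
    "\<And>z. cmod z < r \<Longrightarrow> wp_tail (1/2) z = z^4 * g z"
proof -
  let ?f = "wp_tail (1/2)"
  define F where "F = fps_expansion ?f 0"
  have hol: "?f holomorphic_on ball 0 (1/2)" by (rule wp_tail_holomorphic) simp
  then have F: "?f has_fps_expansion F" unfolding F_def
    by (intro has_fps_expansion_fps_expansion[of "ball 0 (1/2)"]) auto
  have nz: "fps_nth F k = 0" if "k < 4" for k
    using wp_tail_deriv_0[OF that] by (simp add: F_def fps_expansion_def)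
  define G where "G = fps_shift 4 F"
  have FG: "F = fps_X ^ 4 * G"
    by (rule fps_ext) (use nz in \<open>auto simp: G_def fps_X_power_mult_nth\<close>)
  have "fps_conv_radius G > 0" using F by (auto simp: has_fps_expansion_def G_def)
  then have G: "eval_fps G has_fps_expansion G" by (rule eval_fps_has_fps_expansion)
  have "(\<lambda>z. ?f z - z^4 * eval_fps G z) has_fps_expansion (F - fps_X ^ 4 * G)"
    by (intro fps_expansion_intros F G)
  then have "eventually (\<lambda>z. ?f z - z^4 * eval_fps G z = 0) (nhds 0)"
    unfolding FG diff_self by (simp only: has_fps_expansion_0_iff)
  then obtain d where d: "d > 0" "\<And>z. cmod z < d \<Longrightarrow> ?f z - z^4 * eval_fps G z = 0"
    by (auto simp: eventually_nhds_metric dist_norm)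
  have "eval_fps G analytic_on {0}" using G by (rule has_fps_expansion_imp_analytic_0)
  then obtain s where s: "s > 0" "eval_fps G holomorphic_on ball 0 s"
    by (auto simp: analytic_on_def)
  show ?thesis
  proof (rule that[of "min (1/2) (min d s)" "eval_fps G"])
    show "eval_fps G holomorphic_on ball 0 (min (1/2) (min d s))"
      using s(2) by (rule holomorphic_on_subset) auto
  qed (use d s in auto)
qed

end

section \<open>The differential equations of the Weierstrass function\<close>

context cube_root begin

definition wp' :: "complex \<Rightarrow> complex" where "wp' = deriv wp"

lemma L_not_limpt: "\<not> z islimpt L"
proof
  assume "z islimpt L"
  then have "infinite (L \<inter> ball z 1)" by (simp add: islimpt_eq_infinite_ball)
  moreover have "cmod w < cmod z + 1" if "dist z w < 1" for w
    using that norm_triangle_ineq2[of w z] by (simp add: dist_norm norm_minus_commute)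
  then have "L \<inter> ball z 1 \<subseteq> {w \<in> L. cmod w < cmod z + 1}" by auto
  ultimately show False using finite_L_ball finite_subset by blast
qed

lemma wp_deriv: "z \<notin> L \<Longrightarrow> (wp has_field_derivative wp' z) (at z)"
  unfolding wp'_def using wp_holomorphic open_compl_L by (auto intro: holomorphic_derivI)

lemma wp'_holomorphic: "wp' holomorphic_on - L"
  unfolding wp'_def using wp_holomorphic open_compl_L by (rule holomorphic_deriv)

lemma wp'_deriv: "z \<notin> L \<Longrightarrow> (wp' has_field_derivative deriv wp' z) (at z)"
  using wp'_holomorphic open_compl_L by (auto intro: holomorphic_derivI)

lemma wp'_periodic: "u \<in> L \<Longrightarrow> z \<notin> L \<Longrightarrow> wp' (z + u) = wp' z"
proof -
  assume u: "u \<in> L" and z: "z \<notin> L"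
  then have "(wp has_field_derivative wp' (z + u)) (at (z + u))"
    by (intro wp_deriv) (simp add: L_add_iff)
  then have "((\<lambda>z. wp (z + u)) has_field_derivative wp' (z + u)) (at z)"
    by (simp add: DERIV_shift)
  then show ?thesis using wp_deriv[OF z] wp_periodic[OF u] by (auto intro: DERIV_unique)
qed

lemma deriv_wp'_periodic: "u \<in> L \<Longrightarrow> z \<notin> L \<Longrightarrow> deriv wp' (z + u) = deriv wp' z"
proof -
  assume u: "u \<in> L" and z: "z \<notin> L"
  have "eventually (\<lambda>x. wp' (x + u) = wp' x) (nhds z)"
    using eventually_nhds_in_open[OF open_compl_L, of z, simplified, OF z]
    by (rule eventually_mono) (simp add: wp'_periodic u)
  then have "deriv (\<lambda>x. wp' (x + u)) z = deriv wp' z" by (rule deriv_cong_ev) simp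
  moreover have "deriv (\<lambda>x. wp' (x + u)) z = deriv wp' (z + u)"
    by (rule DERIV_imp_deriv) (use wp'_deriv[of "z + u"] z u in \<open>simp add: DERIV_shift L_add_iff\<close>)
  ultimately show ?thesis by simp
qed

lemma wp'_uminus: "z \<notin> L \<Longrightarrow> wp' (- z) = - wp' z"
proof -
  assume z: "z \<notin> L"
  have "((\<lambda>z. wp (- z)) has_field_derivative - wp' (- z)) (at z)"
    by (rule DERIV_chain2[where g = uminus and Db = "-1", OF wp_deriv, simplified])
       (use z in \<open>auto intro!: derivative_eq_intros\<close>)
  then have "- wp' (- z) = wp' z"
    using wp_deriv[OF z] wp_uminus by (auto intro: DERIV_unique)
  then show ?thesis by (metis minus_minus)
qed

lemma wp'_eps: "z \<notin> L \<Longrightarrow> wp' (\<epsilon> * z) = wp' z"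
proof -
  assume z: "z \<notin> L"
  have "((\<lambda>z. wp (\<epsilon> * z)) has_field_derivative wp' (\<epsilon> * z) * \<epsilon>) (at z)"
    by (rule DERIV_chain2[OF wp_deriv]) (use z in \<open>auto intro!: derivative_eq_intros\<close>)
  moreover have "((\<lambda>z. \<epsilon> * wp z) has_field_derivative \<epsilon> * wp' z) (at z)"
    by (rule DERIV_cmult[OF wp_deriv[OF z]])
  ultimately have "wp' (\<epsilon> * z) * \<epsilon> = \<epsilon> * wp' z"
    unfolding wp_eps by (rule DERIV_unique)
  then show ?thesis using eps_nz by (metis mult.commute mult_cancel_left)
qed

text \<open>Periodicity carries the limit at 0 to every lattice point, so all singularities are
  removable and the extended function is entire and periodic, hence constant.\<close>

lemma periodic_limit_constant:
  assumes hol: "f holomorphic_on - L" and per: "\<And>z u. u \<in> L \<Longrightarrow> z \<notin> L \<Longrightarrow> f (z + u) = f z"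
    and lim: "(f \<longlongrightarrow> l) (at 0)" and z: "z \<notin> L"
  shows "f z = l"
proof -
  define h where "h z = (if z \<in> L then l else f z)" for z
  have lim_u: "(f \<longlongrightarrow> l) (at u)" if u: "u \<in> L" for u
  proof -
    have "((\<lambda>z. f (z - u)) \<longlongrightarrow> l) (at u)"
      using lim unfolding at_to_0[of u] filterlim_filtermap by simp
    moreover have "eventually (\<lambda>z. f (z - u) = f z) (at u)"
    proof -
      have "eventually (\<lambda>z. z \<notin> L) (at u)"
        using L_not_limpt[of u] by (auto simp: islimpt_iff_eventually)
      then show ?thesis by eventually_elim (metis L_uminus_iff per u diff_conv_add_uminus)
    qed
    ultimately show ?thesis using tendsto_cong by fastforce
  qed
  have cont: "isCont h u" for u
  proof (cases "u \<in> L")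
    case True
    have "eventually (\<lambda>z. z \<notin> L) (at u)"
      using L_not_limpt[of u] by (auto simp: islimpt_iff_eventually)
    then have "eventually (\<lambda>z. f z = h z) (at u)" by eventually_elim (simp add: h_def)
    then have "(h \<longlongrightarrow> l) (at u)" using lim_u[OF True] by (rule Lim_transform_eventually[rotated])
    then show ?thesis using True by (simp add: isCont_def h_def)
  next
    case False
    have "isCont f u" using hol open_compl_L False
      by (metis Compl_iff continuous_on_eq_continuous_at holomorphic_on_imp_continuous_on)
    moreover have "eventually (\<lambda>z. f z = h z) (nhds u)"
      using eventually_nhds_in_open[OF open_compl_L, of u, simplified, OF False]
      by (rule eventually_mono) (simp add: h_def)
    ultimately show ?thesis using isCont_cong by fastforce
  qed
  have hol': "h holomorphic_on UNIV - L"
    by (rule holomorphic_transform[of f]) (use hol in \<open>auto simp: h_def Compl_eq_Diff_UNIV\<close>)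
  have "h field_differentiable at u" for u
  proof -
    obtain d where d: "d > 0" "\<forall>x'\<in>L. x' = u \<or> \<not> dist x' u < d"
      using L_not_limpt[of u] by (auto simp: islimpt_approachable)
    have "ball u d - {u} \<subseteq> UNIV - L" using d(2) by (metis Diff_iff UNIV_I dist_commute insertI1 mem_ball subsetI)
    then have "h holomorphic_on ball u d - {u}"
      by (rule holomorphic_on_subset[OF hol'])
    then have "h holomorphic_on ball u d"
      by (rule no_isolated_singularity[rotated]) (auto intro!: continuous_at_imp_continuous_on cont)
    then show ?thesis
      by (rule holomorphic_on_imp_differentiable_at) (use d in auto)
  qed
  then have "h holomorphic_on UNIV" by (simp add: holomorphic_on_def)
  moreover have "h (z + u) = h z" if "u \<in> L" for z u
    using per that by (auto simp: h_def L_add_iff)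
  ultimately have "h z = h 0" by (rule entire_periodic_constant[OF is_lattice_L])
  then show ?thesis using z by (simp add: h_def)
qed

lemma wp_expansion:
  obtains r g where "r > 0" "r \<le> 1/2" "g holomorphic_on ball 0 r"
    "\<And>z. cmod z < r \<Longrightarrow> wp z = inverse z ^ 2 + z^4 * g z"
    "\<And>z. cmod z < r \<Longrightarrow> z \<noteq> 0 \<Longrightarrow> wp' z = - 2 * inverse z ^ 3 + 4 * z^3 * g z + z^4 * deriv g z"
    "\<And>z. cmod z < r \<Longrightarrow> z \<noteq> 0 \<Longrightarrow> deriv wp' z =
       6 * inverse z ^ 4 + 12 * z^2 * g z + 8 * z^3 * deriv g z + z^4 * deriv (deriv g) z"
proof -
  obtain g r where r: "r > 0" "r \<le> 1/2" and g: "g holomorphic_on ball 0 r"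
    and t: "\<And>z. cmod z < r \<Longrightarrow> wp_tail (1/2) z = z^4 * g z"
    by (rule wp_tail_factor) blast
  have g': "deriv g holomorphic_on ball 0 r" using g by (intro holomorphic_deriv) auto
  have notL: "z \<notin> L" if "cmod z < r" "z \<noteq> 0" for z
    using L_norm_ge_1[of z] that r by auto
  have nbhd: "eventually (\<lambda>x. x \<in> ball 0 r - {0}) (nhds z)" if "cmod z < r" "z \<noteq> 0" for z
    using that by (intro eventually_nhds_in_open) auto
  have w: "wp z = inverse z ^ 2 + z^4 * g z" if "cmod z < r" for z
    using wp_near_0[of z] t[OF that] that r by (simp add: power_inverse)
  have w': "wp' z = - 2 * inverse z ^ 3 + 4 * z^3 * g z + z^4 * deriv g z"
    if z: "cmod z < r" "z \<noteq> 0" for z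
  proof -
    have "deriv wp z = deriv (\<lambda>z. inverse z ^ 2 + z^4 * g z) z"
      by (rule deriv_cong_ev) (use nbhd[OF z] w in \<open>auto elim!: eventually_mono\<close>)
    also have "\<dots> = - 2 * inverse z ^ 3 + 4 * z^3 * g z + z^4 * deriv g z"
      by (rule DERIV_imp_deriv)
         (use z in \<open>auto intro!: derivative_eq_intros holomorphic_derivI[OF g] simp: power2_eq_square power3_eq_cube\<close>)
    finally show ?thesis by (simp add: wp'_def)
  qed
  show ?thesis
  proof (rule that[OF r g w w'])
    fix z assume z: "cmod z < r" "z \<noteq> 0"
    have "deriv wp' z = deriv (\<lambda>z. - 2 * inverse z ^ 3 + 4 * z^3 * g z + z^4 * deriv g z) z"
      by (rule deriv_cong_ev) (use nbhd[OF z] w' in \<open>auto elim!: eventually_mono\<close>)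
    also have "\<dots> = 6 * inverse z ^ 4 + 12 * z^2 * g z + 8 * z^3 * deriv g z + z^4 * deriv (deriv g) z"
      by (rule DERIV_imp_deriv)
         (use z in \<open>auto intro!: derivative_eq_intros holomorphic_derivI[OF g] holomorphic_derivI[OF g']
            simp: power2_eq_square power3_eq_cube power4_eq_xxxx algebra_simps\<close>)
    finally show "deriv wp' z = 6 * inverse z ^ 4 + 12 * z^2 * g z + 8 * z^3 * deriv g z + z^4 * deriv (deriv g) z" .
  qed
qed

text \<open>The term with the invariant g_2 of the general equation is absent because of the
  rotation symmetry by \<epsilon>.\<close>

lemma wp''_eq: "z \<notin> L \<Longrightarrow> deriv wp' z = 6 * wp z ^ 2"
proof -
  assume z: "z \<notin> L"
  obtain r g where r: "r > 0" and g: "g holomorphic_on ball 0 r"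
    and e: "\<And>z. cmod z < r \<Longrightarrow> wp z = inverse z ^ 2 + z^4 * g z"
    "\<And>z. cmod z < r \<Longrightarrow> z \<noteq> 0 \<Longrightarrow> deriv wp' z =
       6 * inverse z ^ 4 + 12 * z^2 * g z + 8 * z^3 * deriv g z + z^4 * deriv (deriv g) z"
    by (rule wp_expansion) blast
  \<comment> \<open>This is wp'' - 6 wp^2 after the terms in z^(-4) and z^2 have cancelled; it is
    holomorphic at 0 and vanishes there.\<close>
  define q where "q z = 8 * z^3 * deriv g z + z^4 * deriv (deriv g) z - 6 * z^8 * g z ^ 2" for z
  have "q holomorphic_on ball 0 r" unfolding q_def
    by (intro holomorphic_intros holomorphic_deriv g) auto
  then have "isCont q 0" using r
    by (auto intro!: continuous_on_interior[OF holomorphic_on_imp_continuous_on])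
  then have q: "(q \<longlongrightarrow> 0) (at 0)" by (simp add: isCont_def q_def)
  have "eventually (\<lambda>z. z \<in> ball 0 r - {0}) (at (0::complex))"
    using r by (auto simp: eventually_at dist_norm)
  then have "eventually (\<lambda>z. q z = deriv wp' z - 6 * wp z ^ 2) (at 0)"
  proof eventually_elim
    case (elim z)
    then have z: "cmod z < r" "z \<noteq> 0" by auto
    define p where "p = inverse z"
    have p: "z * p = 1" using z by (simp add: p_def)
    show ?case unfolding q_def e(1)[OF z(1)] e(2)[OF z] p_def[symmetric] using p by algebra
  qed
  then have "((\<lambda>z. deriv wp' z - 6 * wp z ^ 2) \<longlongrightarrow> 0) (at 0)"
    using q by (rule Lim_transform_eventually[rotated])
  moreover have "(\<lambda>z. deriv wp' z - 6 * wp z ^ 2) holomorphic_on - L"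
    by (intro holomorphic_intros holomorphic_deriv wp'_holomorphic wp_holomorphic open_compl_L)
  ultimately have "deriv wp' z - 6 * wp z ^ 2 = 0"
    by (rule periodic_limit_constant[where f = "\<lambda>z. deriv wp' z - 6 * wp z ^ 2", rotated 2, OF _ z])
       (simp_all add: wp_periodic deriv_wp'_periodic)
  then show ?thesis by simp
qed

lemma wp'_sq: obtains k where "\<And>z. z \<notin> L \<Longrightarrow> wp' z ^ 2 = 4 * wp z ^ 3 + k"
proof -
  obtain r g where r: "r > 0" and g: "g holomorphic_on ball 0 r"
    and e: "\<And>z. cmod z < r \<Longrightarrow> wp z = inverse z ^ 2 + z^4 * g z"
    "\<And>z. cmod z < r \<Longrightarrow> z \<noteq> 0 \<Longrightarrow> wp' z = - 2 * inverse z ^ 3 + 4 * z^3 * g z + z^4 * deriv g z"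
    by (rule wp_expansion) blast
  \<comment> \<open>This is wp'^2 - 4 wp^3 with the poles cancelled. The constant of the Weierstrass
    equation is its value at 0, namely -28 g(0).\<close>
  define q where "q z = (4 * z^3 * g z + z^4 * deriv g z)^2 - 4 * z * deriv g z - 28 * g z
      - 12 * z^6 * g z ^ 2 - 4 * z^12 * g z ^ 3" for z
  have "q holomorphic_on ball 0 r" unfolding q_def
    by (intro holomorphic_intros holomorphic_deriv g) auto
  then have "isCont q 0" using r
    by (auto intro!: continuous_on_interior[OF holomorphic_on_imp_continuous_on])
  then have q: "(q \<longlongrightarrow> q 0) (at 0)" by (simp add: isCont_def)
  have "eventually (\<lambda>z. z \<in> ball 0 r - {0}) (at (0::complex))"
    using r by (auto simp: eventually_at dist_norm)
  then have "eventually (\<lambda>z. q z = wp' z ^ 2 - 4 * wp z ^ 3) (at 0)"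
  proof eventually_elim
    case (elim z)
    then have z: "cmod z < r" "z \<noteq> 0" by auto
    define p where "p = inverse z"
    have p: "z * p = 1" using z by (simp add: p_def)
    show ?case unfolding q_def e(1)[OF z(1)] e(2)[OF z] p_def[symmetric] using p by algebra
  qed
  then have lim: "((\<lambda>z. wp' z ^ 2 - 4 * wp z ^ 3) \<longlongrightarrow> q 0) (at 0)"
    using q by (rule Lim_transform_eventually[rotated])
  have "(\<lambda>z. wp' z ^ 2 - 4 * wp z ^ 3) holomorphic_on - L"
    by (intro holomorphic_intros wp'_holomorphic wp_holomorphic)
  then have "wp' z ^ 2 - 4 * wp z ^ 3 = q 0" if "z \<notin> L" for z
    by (rule periodic_limit_constant[OF _ _ lim that]) (simp add: wp_periodic wp'_periodic)
  then show ?thesis by (intro that[of "q 0"]) (simp add: algebra_simps)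
qed

end

text \<open>By the Leibniz rule and induction all derivatives of both functions vanish at z0, and
  the identity theorem finishes. It serves as the uniqueness theorem for the nonlinear system of f
  and g: the difference of two solutions satisfies a linear system of this shape.\<close>

lemma linear_ode_zero:
  assumes S: "open S" "connected S" and z0: "z0 \<in> S" "u z0 = 0" "v z0 = 0"
    and hol: "u holomorphic_on S" "v holomorphic_on S" "a holomorphic_on S" "b holomorphic_on S"
    and der: "\<And>z. z \<in> S \<Longrightarrow> deriv u z = a z * v z" "\<And>z. z \<in> S \<Longrightarrow> deriv v z = b z * u z"
    and z: "z \<in> S"
  shows "u z = 0" and "v z = 0"
proof -
  have ev: "eventually (\<lambda>x. x \<in> S) (nhds z0)" using S z0 by (intro eventually_nhds_in_open) auto
  have d: "(deriv ^^ Suc n) u z0 = (deriv ^^ n) (\<lambda>z. a z * v z) z0"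
    "(deriv ^^ Suc n) v z0 = (deriv ^^ n) (\<lambda>z. b z * u z) z0" for n
    unfolding funpow_Suc_right o_def
    by (rule higher_deriv_cong_ev; use ev der in \<open>auto elim!: eventually_mono\<close>)+
  have "(deriv ^^ n) u z0 = 0 \<and> (deriv ^^ n) v z0 = 0" for n
  proof (induction n rule: less_induct)
    case (less n)
    show ?case
    proof (cases n)
      case 0 then show ?thesis using z0 by simp
    next
      case (Suc m)
      have "(deriv ^^ m) (\<lambda>z. a z * v z) z0 = 0" "(deriv ^^ m) (\<lambda>z. b z * u z) z0 = 0"
        by (subst higher_deriv_mult[where S = S]; use hol S z0 less Suc in \<open>auto intro!: sum.neutral\<close>)+
      then show ?thesis unfolding Suc d by simp
    qed
  qed
  then show "u z = 0" "v z = 0"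
    using holomorphic_fun_eq_0_on_connected[OF hol(1) S _ z0(1) z]
      holomorphic_fun_eq_0_on_connected[OF hol(2) S _ z0(1) z] by auto
qed

section \<open>The curve g^3 = f^2 + f and its uniformisation\<close>

context cube_root begin

definition wk :: complex where "wk = (SOME k. \<forall>z. z \<notin> L \<longrightarrow> wp' z ^ 2 = 4 * wp z ^ 3 + k)"

lemma wp'_sq_wk: "z \<notin> L \<Longrightarrow> wp' z ^ 2 = 4 * wp z ^ 3 + wk"
proof -
  have "\<exists>k. \<forall>z. z \<notin> L \<longrightarrow> wp' z ^ 2 = 4 * wp z ^ 3 + k" using wp'_sq by metis
  from someI_ex[OF this] show "z \<notin> L \<Longrightarrow> wp' z ^ 2 = 4 * wp z ^ 3 + wk" unfolding wk_def by blast
qed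

lemma countable_L: "countable L" unfolding L_lat by simp

lemma connected_compl_countable: "countable S \<Longrightarrow> connected (- S :: complex set)"
  by (intro path_connected_imp_connected path_connected_complement_countable) auto

lemma half_notin_L: "1 / 2 \<notin> L"
  using L_norm_ge_1[of "1/2"] by (auto simp: norm_divide)

lemma eventually_notin_L: "eventually (\<lambda>z. z \<notin> L) (at u)"
  using L_not_limpt[of u] by (simp add: islimpt_iff_eventually)

lemma wp_poles:
  shows "((\<lambda>z. z^2 * wp z) \<longlongrightarrow> 1) (at 0)" and "((\<lambda>z. z^3 * wp' z) \<longlongrightarrow> - 2) (at 0)"
proof -
  obtain r g where r: "r > 0" and g: "g holomorphic_on ball 0 r"
    and e: "\<And>z. cmod z < r \<Longrightarrow> wp z = inverse z ^ 2 + z^4 * g z"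
    "\<And>z. cmod z < r \<Longrightarrow> z \<noteq> 0 \<Longrightarrow> wp' z = - 2 * inverse z ^ 3 + 4 * z^3 * g z + z^4 * deriv g z"
    by (rule wp_expansion) blast
  have ev: "eventually (\<lambda>z. z \<in> ball 0 r - {0}) (at (0::complex))"
    using r by (auto simp: eventually_at dist_norm)
  let ?q = "\<lambda>z. 1 + z^6 * g z" and ?q' = "\<lambda>z. - 2 + 4 * z^6 * g z + z^7 * deriv g z"
  have "?q holomorphic_on ball 0 r" "?q' holomorphic_on ball 0 r"
    by (intro holomorphic_intros holomorphic_deriv g; simp)+
  then have "isCont ?q 0" "isCont ?q' 0" using r
    by (auto intro!: continuous_on_interior[OF holomorphic_on_imp_continuous_on])
  then have q: "(?q \<longlongrightarrow> 1) (at 0)" "(?q' \<longlongrightarrow> - 2) (at 0)" by (simp_all add: isCont_def)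
  have "eventually (\<lambda>z. ?q z = z^2 * wp z) (at 0)"
    using ev by eventually_elim (auto simp: e field_simps)
  then show "((\<lambda>z. z^2 * wp z) \<longlongrightarrow> 1) (at 0)" using q(1) by (rule Lim_transform_eventually[rotated])
  have "eventually (\<lambda>z. ?q' z = z^3 * wp' z) (at 0)"
    using ev
  proof eventually_elim
    case (elim z)
    then have z: "cmod z < r" "z \<noteq> 0" by auto
    define p where "p = inverse z"
    have p: "z * p = 1" using z by (simp add: p_def)
    show ?case unfolding e(2)[OF z] p_def[symmetric] using p by algebra
  qed
  then show "((\<lambda>z. z^3 * wp' z) \<longlongrightarrow> - 2) (at 0)" using q(2) by (rule Lim_transform_eventually[rotated])
qed

text \<open>The derivative of wp is odd and periodic, so it vanishes at 1/2. If the constant were 0,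
  wp would vanish there too. Reading wp'' = 6 wp^2 as a linear equation with coefficient 6 wp would
  then give wp = 0 everywhere, against the double pole.\<close>

lemma wk_nz: "wk \<noteq> 0"
proof
  assume k: "wk = 0"
  have "wp' (1/2) = - wp' (1/2)"
    using wp'_periodic[of 1 "-1/2"] wp'_uminus[of "1/2"] half_notin_L by simp
  then have w': "wp' (1/2) = 0" by simp
  then have w: "wp (1/2) = 0" using wp'_sq_wk[OF half_notin_L] k by simp
  have wz: "wp z = 0" if z: "z \<in> - L" for z
  proof (rule linear_ode_zero(1)[of "- L" "1/2" wp wp' "\<lambda>_. 1" "\<lambda>z. 6 * wp z"])
    show "connected (- L)" by (rule connected_compl_countable[OF countable_L])
    show "(\<lambda>z. 6 * wp z) holomorphic_on - L" by (intro holomorphic_intros wp_holomorphic)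
    show "deriv wp z = 1 * wp' z" for z by (simp add: wp'_def)
    show "deriv wp' z = 6 * wp z * wp z" if "z \<in> - L" for z
      using wp''_eq[of z] that by (simp add: power2_eq_square)
  qed (use z w w' half_notin_L wp_holomorphic wp'_holomorphic open_compl_L in auto)
  have "eventually (\<lambda>z. z^2 * wp z = 0) (at 0)"
    using eventually_notin_L by eventually_elim (simp add: wz)
  then have "((\<lambda>z. z^2 * wp z) \<longlongrightarrow> 0) (at 0)" by (rule tendsto_eventually)
  then show False using wp_poles(1) tendsto_unique[of "at (0::complex)"] by fastforce
qed

text \<open>The constants bring wp'^2 = 4 wp^3 + wk to the form f^2 + f = g^3. With f = wa wp' - 1/2
  and g = wb wp this requires wa^2 wk = 1/4 and wb^3 = 4 wa^2. The constant \<open>wc\<close> is the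
  factor in f' = wc g^2.\<close>

definition wa :: complex where "wa = 1 / (2 * csqrt wk)"
definition wb :: complex where "wb = (SOME b. b^3 = 4 * wa^2)"
definition wc :: complex where "wc = 6 * wa / wb^2"
definition wF :: "complex \<Rightarrow> complex" where "wF z = wa * wp' z - 1 / 2"
definition wG :: "complex \<Rightarrow> complex" where "wG z = wb * wp z"

lemma wa: "wa^2 * wk = 1/4" and wa_nz: "wa \<noteq> 0"
  using wk_nz by (simp_all add: wa_def power_divide power_mult_distrib)

lemma wb: "wb^3 = 4 * wa^2" and wb_nz: "wb \<noteq> 0"
proof -
  obtain b where "4 * wa^2 = b^3" by (rule exists_complex_root[of 3 "4 * wa^2"]) auto
  then have "\<exists>b. b^3 = 4 * wa^2" by metis
  then show "wb^3 = 4 * wa^2" unfolding wb_def by (rule someI_ex)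
  then show "wb \<noteq> 0" using wa_nz by auto
qed

lemma wc_nz: "wc \<noteq> 0" using wa_nz wb_nz by (simp add: wc_def)

lemma FG_curve: "z \<notin> L \<Longrightarrow> wF z ^ 2 + wF z = wG z ^ 3"
proof -
  assume z: "z \<notin> L"
  show ?thesis unfolding wF_def wG_def
    using wp'_sq_wk[OF z] wa wb by algebra
qed

lemma F_deriv: "z \<notin> L \<Longrightarrow> (wF has_field_derivative wc * wG z ^ 2) (at z)"
  unfolding wF_def[abs_def] wG_def wc_def
  by (auto intro!: derivative_eq_intros wp'_deriv simp: wp''_eq wb_nz power_mult_distrib)

lemma G_deriv: "z \<notin> L \<Longrightarrow> (wG has_field_derivative wc / 3 * (2 * wF z + 1)) (at z)"
proof -
  assume z: "z \<notin> L"
  have "4 * wa^2 / wb^2 = wb" using wb wb_nz by (simp add: field_simps power2_eq_square power3_eq_cube)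
  moreover have "wc / 3 * (2 * wF z + 1) = 4 * wa^2 / wb^2 * wp' z"
    unfolding wc_def wF_def by (simp add: power2_eq_square)
  ultimately have "wc / 3 * (2 * wF z + 1) = wb * wp' z" by simp
  then show ?thesis
    unfolding wG_def[abs_def] by (auto intro!: derivative_eq_intros wp_deriv z)
qed

lemma F_holomorphic: "wF holomorphic_on - L" and G_holomorphic: "wG holomorphic_on - L"
  unfolding wF_def[abs_def] wG_def[abs_def]
  by (intro holomorphic_intros wp'_holomorphic wp_holomorphic)+

lemma F_periodic: "u \<in> L \<Longrightarrow> z \<notin> L \<Longrightarrow> wF (z + u) = wF z"
  and G_periodic: "u \<in> L \<Longrightarrow> wG (z + u) = wG z"
  by (simp_all add: wF_def wG_def wp'_periodic wp_periodic)

lemma F_uminus: "z \<notin> L \<Longrightarrow> wF (- z) = - 1 - wF z" and G_uminus: "wG (- z) = wG z"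
  by (simp_all add: wF_def wG_def wp'_uminus wp_uminus)

lemma F_eps: "z \<notin> L \<Longrightarrow> wF (\<epsilon> * z) = wF z" and G_eps: "wG (\<epsilon> * z) = \<epsilon> * wG z"
  by (simp_all add: wF_def wG_def wp'_eps wp_eps)

lemma F_pole: "((\<lambda>z. z^3 * wF z) \<longlongrightarrow> - 2 * wa) (at 0)"
proof -
  have "((\<lambda>z. wa * (z^3 * wp' z) - z^3 * (1/2)) \<longlongrightarrow> wa * (- 2) - 0^3 * (1/2)) (at 0)"
    by (intro tendsto_intros wp_poles)
  then show ?thesis by (simp add: wF_def algebra_simps)
qed

lemma G_pole: "((\<lambda>z. z^2 * wG z) \<longlongrightarrow> wb) (at 0)"
proof -
  have "((\<lambda>z. wb * (z^2 * wp z)) \<longlongrightarrow> wb * 1) (at 0)"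
    by (intro tendsto_intros wp_poles)
  then show ?thesis by (simp add: wG_def algebra_simps)
qed

lemma inverse_G_lim: "((\<lambda>z. inverse (wG z)) \<longlongrightarrow> 0) (at 0)"
proof -
  have "((\<lambda>z. z^2 / (z^2 * wG z)) \<longlongrightarrow> 0^2 / wb) (at 0)"
    by (intro tendsto_intros G_pole wb_nz)
  moreover have "eventually (\<lambda>z. z^2 / (z^2 * wG z) = inverse (wG z)) (at 0)"
    by (auto simp: eventually_at field_simps intro!: exI[of _ 1])
  ultimately show ?thesis by (simp add: Lim_transform_eventually)
qed

lemma F_div_G_lim: "((\<lambda>z. wF z / wG z ^ 2) \<longlongrightarrow> 0) (at 0)"
proof -
  have "((\<lambda>z. z * (z^3 * wF z) / (z^2 * wG z)^2) \<longlongrightarrow> 0 * (- 2 * wa) / wb^2) (at 0)"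
    by (intro tendsto_intros G_pole F_pole) (use wb_nz in auto)
  moreover have "eventually (\<lambda>z. z * (z^3 * wF z) / (z^2 * wG z)^2 = wF z / wG z ^ 2) (at 0)"
    by (auto simp: eventually_at field_simps power2_eq_square power3_eq_cube intro!: exI[of _ 1])
  ultimately show ?thesis by (simp add: Lim_transform_eventually)
qed

lemma shift_L: "(\<lambda>w. w - z1) ` L = {t. z1 + t \<in> L}"
  by (auto simp: image_iff algebra_simps intro!: bexI[of _ "z1 + _"])

lemma open_shift_L: "open (- {t. z1 + t \<in> L})"
  using closed_translation[OF closed_L, of "- z1"] shift_L[of z1] by (auto simp: closed_def)

lemma holomorphic_shift:
  assumes "f holomorphic_on - L" shows "(\<lambda>t. f (z1 + t)) holomorphic_on - {t. z1 + t \<in> L}"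
proof -
  have "(\<lambda>t. t + z1) holomorphic_on - {t. z1 + t \<in> L}" by (intro holomorphic_intros)
  then have "(f \<circ> (\<lambda>t. t + z1)) holomorphic_on - {t. z1 + t \<in> L}"
    by (rule holomorphic_on_compose_gen[OF _ assms]) (auto simp: add.commute)
  then show ?thesis by (simp add: o_def add.commute)
qed

text \<open>The differences of (f, g) along the two translates solve a linear system with zero
  initial values, so g is invariant under translation by z1 - z2. If that number were not in the
  lattice, g would be finite near it, whereas g has a double pole at 0.\<close>

lemma FG_injective:
  assumes z: "z1 \<notin> L" "z2 \<notin> L" and eq: "wF z1 = wF z2" "wG z1 = wG z2"
  shows "z1 - z2 \<in> L"
proof (rule ccontr)
  assume d: "z1 - z2 \<notin> L"
  define S where "S = - ({t. z1 + t \<in> L} \<union> {t. z2 + t \<in> L})"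
  have "open S" unfolding S_def Compl_Un by (intro open_Int open_shift_L)
  moreover have "connected S"
    unfolding S_def shift_L[symmetric] by (rule connected_compl_countable) (use countable_L in auto)
  ultimately have S: "open S" "connected S" by auto
  have holF: "(\<lambda>t. wF (z1 + t)) holomorphic_on S" "(\<lambda>t. wF (z2 + t)) holomorphic_on S"
    and holG: "(\<lambda>t. wG (z1 + t)) holomorphic_on S" "(\<lambda>t. wG (z2 + t)) holomorphic_on S"
    by (rule holomorphic_on_subset[OF holomorphic_shift[OF F_holomorphic]] 
             holomorphic_on_subset[OF holomorphic_shift[OF G_holomorphic]]; auto simp: S_def)+
  have derF: "((\<lambda>t. wF (y + t)) has_field_derivative wc * wG (y + t) ^ 2) (at t)" if "y + t \<notin> L" for y t
    using F_deriv[OF that] by (simp add: DERIV_shift add.commute)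
  have derG: "((\<lambda>t. wG (y + t)) has_field_derivative wc / 3 * (2 * wF (y + t) + 1)) (at t)" if "y + t \<notin> L" for y t
    using G_deriv[OF that] by (simp add: DERIV_shift add.commute)
  have *: "wG (z1 + t) - wG (z2 + t) = 0" if t: "t \<in> S" for t
  proof (rule linear_ode_zero(2)[where u = "\<lambda>t. wF (z1 + t) - wF (z2 + t)" and v = "\<lambda>t. wG (z1 + t) - wG (z2 + t)"
        and S = S and ?z0.0 = 0 and a = "\<lambda>t. wc * (wG (z1 + t) + wG (z2 + t))" and b = "\<lambda>t. 2 * wc / 3"])
    fix t assume "t \<in> S"
    then have t: "z1 + t \<notin> L" "z2 + t \<notin> L" by (auto simp: S_def)
    show "deriv (\<lambda>t. wF (z1 + t) - wF (z2 + t)) t = wc * (wG (z1 + t) + wG (z2 + t)) * (wG (z1 + t) - wG (z2 + t))"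
      by (rule DERIV_imp_deriv, rule DERIV_cong[OF DERIV_diff[OF derF[OF t(1)] derF[OF t(2)]]])
         (simp add: power2_eq_square algebra_simps)
    show "deriv (\<lambda>t. wG (z1 + t) - wG (z2 + t)) t = 2 * wc / 3 * (wF (z1 + t) - wF (z2 + t))"
      by (rule DERIV_imp_deriv, rule DERIV_cong[OF DERIV_diff[OF derG[OF t(1)] derG[OF t(2)]]])
         (simp add: algebra_simps)
  next
    show "0 \<in> S" using z by (simp add: S_def)
  qed (use S holF holG eq t in \<open>auto intro!: holomorphic_intros\<close>)
  have G: "wG (z1 - z2 + w) = wG w" if "w \<notin> L" "z1 - z2 + w \<notin> L" for w
    using *[of "w - z2"] that by (simp add: S_def algebra_simps)
  have "eventually (\<lambda>t. z1 - z2 + t \<notin> L) (at 0)"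
    using eventually_nhds_in_open[OF open_shift_L[of "z1 - z2"], of 0] d by (simp add: eventually_at_filter eventually_mono)
  \<comment> \<open>The factor t^2 turns the pole at 0 into the nonzero limit \<open>wb\<close> and
    the finite value at z1 - z2 into 0.\<close>
  with eventually_notin_L[of 0] have ev: "eventually (\<lambda>t. t^2 * wG (z1 - z2 + t) = t^2 * wG t) (at 0)"
    by eventually_elim (simp add: G)
  have "isCont wG (z1 - z2)" using G_deriv[OF d] by (rule DERIV_isCont)
  then have "((\<lambda>t. wG (z1 - z2 + t)) \<longlongrightarrow> wG (z1 - z2)) (at 0)"
    by (simp add: isCont_iff)
  then have "((\<lambda>t. t^2 * wG (z1 - z2 + t)) \<longlongrightarrow> 0^2 * wG (z1 - z2)) (at 0)"
    by (intro tendsto_intros)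
  then have "((\<lambda>t. t^2 * wG t) \<longlongrightarrow> 0) (at 0)" using ev by (simp add: Lim_transform_eventually)
  then show False using G_pole wb_nz tendsto_unique[of "at (0::complex)"] by fastforce
qed

text \<open>If s were omitted, 1/(f - s) would be periodic and holomorphic off the lattice, with
  limit 0 at the poles of f, hence identically 0.\<close>

lemma F_surjective: obtains z where "z \<notin> L" "wF z = s"
proof (rule ccontr)
  assume n: "\<not> thesis"
  note ex = that
  have ne: "wF z - s \<noteq> 0" if "z \<notin> L" for z using ex[OF that] n by auto
  let ?f = "\<lambda>z. inverse (wF z - s)"
  have hol: "?f holomorphic_on - L" by (intro holomorphic_intros F_holomorphic) (use ne in auto)
  have "((\<lambda>z. z^3 / (z^3 * wF z - z^3 * s)) \<longlongrightarrow> 0^3 / (- 2 * wa - 0^3 * s)) (at 0)"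
    by (intro tendsto_intros F_pole) (use wa_nz in auto)
  moreover have "eventually (\<lambda>z. z^3 / (z^3 * wF z - z^3 * s) = ?f z) (at 0)"
    unfolding right_diff_distrib[symmetric]
    by (auto simp: eventually_at divide_simps intro!: exI[of _ 1])
  ultimately have "(?f \<longlongrightarrow> 0) (at 0)" by (simp add: Lim_transform_eventually)
  from periodic_limit_constant[OF hol _ this half_notin_L]
  have "?f (1/2) = 0" by (simp add: F_periodic)
  then show False using ne[OF half_notin_L] by simp
qed

lemma cube_eq: "x^3 = y^3 \<Longrightarrow> y = x \<or> y = \<epsilon> * x \<or> y = \<epsilon> * (\<epsilon> * x)"
proof -
  assume "x^3 = y^3"
  then have "(y - x) * (y - \<epsilon> * x) * (y - \<epsilon> * (\<epsilon> * x)) = 0"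
    using eps2 by algebra
  then show ?thesis by simp
qed

text \<open>Rotation by \<epsilon> keeps f and multiplies g by \<epsilon>, so a point over s can be
  rotated until its g-coordinate is the prescribed cube root.\<close>

lemma FG_surjective:
  assumes "s^2 + s = r^3" obtains z where "z \<notin> L" "wF z = s" "wG z = r"
proof -
  obtain z where z: "z \<notin> L" "wF z = s" by (rule F_surjective)
  then have "wG z ^ 3 = r ^ 3" using FG_curve assms by metis
  from cube_eq[OF this] show ?thesis
    using that[of z] that[of "\<epsilon> * z"] that[of "\<epsilon> * (\<epsilon> * z)"] z
    by (auto simp: F_eps G_eps)
qed

end

section \<open>The addition theorem\<close>

lemma open_imp_fsigma: "open S \<Longrightarrow> fsigma S" for S :: "complex set"
proof -
  assume "open S"
  then obtain C :: "nat \<Rightarrow> complex set" where C: "\<And>n. compact (C n)" "\<Union>(range C) = S"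
    by (rule open_Union_compact_subsets) blast
  then show "fsigma S" using fsigma.intros[of C] by (auto intro: compact_imp_closed)
qed

context cube_root begin

lemma F_antiperiod:
  assumes "z1 \<notin> L" "z2 \<notin> L" "z1 + z2 \<in> L"
  shows "wF z2 = - 1 - wF z1" "wG z2 = wG z1"
proof -
  have e: "z2 = - z1 + (z1 + z2)" by simp
  show "wF z2 = - 1 - wF z1"
    by (subst e, subst F_periodic) (use assms in \<open>auto simp: F_uminus\<close>)
  show "wG z2 = wG z1"
    by (subst e, subst G_periodic) (use assms in \<open>auto simp: G_uminus\<close>)
qed

text \<open>Fix the sum s and move z. The expression slope^2 - g(z) - g(s - z) has derivative 0, so
  it is constant, and its limit for z tending to 0 is g(s).\<close>

theorem G_addition:
  assumes z: "z1 \<notin> L" "z2 \<notin> L" and ne: "wG z1 \<noteq> wG z2"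
  shows "wG (z1 + z2) = ((wF z1 - wF z2) / (wG z1 - wG z2))^2 - wG z1 - wG z2"
proof -
  define s where "s = z1 + z2"
  have s: "s \<notin> L" using F_antiperiod(2)[OF z] ne by (auto simp: s_def)
  define A where "A = {z. s - z \<in> L}"
  have A_eq: "A = (\<lambda>u. s - u) ` L" by (auto simp: A_def image_iff intro!: bexI[of _ "s - _"])
  have closed_A: "closed A"
    unfolding A_eq using closed_translation[OF closed_negations[OF closed_L], of s] by (simp add: image_image)
  have countA: "countable A" unfolding A_eq by (intro countable_image countable_L)
  define D0 where "D0 = - (L \<union> A)"
  have "open D0" unfolding D0_def Compl_Un using closed_A open_compl_L by (intro open_Int) auto
  moreover have "connected D0"
    unfolding D0_def by (rule connected_compl_countable) (use countable_L countA in auto)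
  ultimately have D0: "open D0" "connected D0" by auto
  have notin: "z \<notin> L" "s - z \<notin> L" if "z \<in> D0" for z using that by (auto simp: D0_def A_def)
  have zD: "z1 \<in> D0" "z2 \<in> D0" using z by (auto simp: D0_def A_def s_def)
  have derF: "((\<lambda>z. wF (s - z)) has_field_derivative - (wc * wG (s - z) ^ 2)) (at z)" if "z \<in> D0" for z
  proof -
    have "((\<lambda>z. s - z) has_field_derivative - 1) (at z)" by (auto intro!: derivative_eq_intros)
    from DERIV_chain2[OF F_deriv[OF notin(2)[OF that]] this] show ?thesis by simp
  qed
  have derG: "((\<lambda>z. wG (s - z)) has_field_derivative - (wc / 3 * (2 * wF (s - z) + 1))) (at z)" if "z \<in> D0" for z
  proof -
    have "((\<lambda>z. s - z) has_field_derivative - 1) (at z)" by (auto intro!: derivative_eq_intros)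
    from DERIV_chain2[OF G_deriv[OF notin(2)[OF that]] this] show ?thesis by simp
  qed
  define Del where "Del z = wG z - wG (s - z)" for z
  have derDel: "(Del has_field_derivative wc / 3 * (2 * wF z + 1) + wc / 3 * (2 * wF (s - z) + 1)) (at z)"
    if "z \<in> D0" for z
    unfolding Del_def[abs_def] using DERIV_diff[OF G_deriv[OF notin(1)[OF that]] derG[OF that]] by simp
  have holDel: "Del holomorphic_on D0"
    using derDel D0(1) by (auto simp: holomorphic_on_open)
  have "\<not> Del constant_on D0"
  proof
    assume "Del constant_on D0"
    then have "Del z1 = Del z2" using zD by (auto simp: constant_on_def)
    then have "2 * (wG z1 - wG z2) = 0" by (simp add: Del_def s_def)
    then show False using ne by simp
  qed
  \<comment> \<open>The points where the slope has denominator 0 are isolated zeros, so there are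
    countably many. Removing a countable set keeps the domain connected, and one constant is valid
    on all of it.\<close>
  then have cZ: "countable {z \<in> D0. Del z = 0}"
    by (intro holomorphic_countable_zeros[OF holDel D0 open_imp_fsigma[OF D0(1)]])
  define D where "D = D0 - {z \<in> D0. Del z = 0}"
  have Deq: "D = - (L \<union> A \<union> {z \<in> D0. Del z = 0})" by (auto simp: D_def D0_def)
  have conD: "connected D"
    unfolding Deq by (rule connected_compl_countable) (use countable_L countA cZ in auto)
  have "D = D0 \<inter> Del -` (- {0})" by (auto simp: D_def)
  then have openD: "open D"
    using continuous_open_preimage[OF holomorphic_on_imp_continuous_on[OF holDel] D0(1), of "- {0}"] by auto
  define Ph where "Ph z = ((wF z - wF (s - z)) / Del z)^2 - wG z - wG (s - z)" for z
  have derPh: "(Ph has_field_derivative 0) (at z)" if zD: "z \<in> D" for z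
  proof -
    have z0: "z \<in> D0" and nz: "Del z \<noteq> 0" using zD by (auto simp: D_def)
    note n = notin[OF z0]
    define a b a' b' where "a = wF z" and "b = wG z" and "a' = wF (s - z)" and "b' = wG (s - z)"
    have d: "Del z = b - b'" by (simp add: Del_def b_def b'_def)
    have c: "a^2 + a = b^3" "a'^2 + a' = b'^3" unfolding a_def b_def a'_def b'_def
      by (rule FG_curve n)+
    define dm where "dm = ((wc * b^2 - (- (wc * b'^2))) * (b - b') - (a - a') * (wc / 3 * (2 * a + 1) + wc / 3 * (2 * a' + 1))) / ((b - b') * (b - b'))"
    have m: "((\<lambda>z. (wF z - wF (s - z)) / Del z) has_field_derivative dm) (at z)"
      using DERIV_divide[OF DERIV_diff[OF F_deriv[OF n(1)] derF[OF z0]] derDel[OF z0] nz]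
      by (simp add: dm_def a_def b_def a'_def b'_def Del_def)
    have "(wc * b^2 - (- (wc * b'^2))) * (b - b') - (a - a') * (wc / 3 * (2 * a + 1) + wc / 3 * (2 * a' + 1))
        = wc / 3 * (b - b') * ((b - b') * (b - b'))"
    proof -
      have k: "(a - a') * (a + a' + 1) = (b - b') * (b^2 + b * b' + b'^2)" using c by algebra
      have "(wc * b^2 - (- (wc * b'^2))) * (b - b') - (a - a') * (wc / 3 * (2 * a + 1) + wc / 3 * (2 * a' + 1))
          = wc * (b^2 + b'^2) * (b - b') - 2 * wc / 3 * ((a - a') * (a + a' + 1))"
        by (simp add: field_simps)
      also have "\<dots> = wc / 3 * (b - b') * ((b - b') * (b - b'))"
        unfolding k by (simp add: field_simps power2_eq_square)
      finally show ?thesis .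
    qed
    \<comment> \<open>The curve equation makes the slope itself have the simple derivative wc/3 (b -
      b'). Twice slope times this is wc/3 (2a - 2a'), which cancels the derivatives of the two
      remaining terms.\<close>
    then have dm: "dm = wc / 3 * (b - b')" using nz by (simp add: dm_def d)
    have "((\<lambda>z. ((wF z - wF (s - z)) / Del z)^2 - wG z - wG (s - z)) has_field_derivative
       (of_nat 2 * (dm * ((wF z - wF (s - z)) / Del z) ^ (2 - Suc 0)) - wc / 3 * (2 * wF z + 1) - - (wc / 3 * (2 * wF (s - z) + 1)))) (at z)"
      by (intro DERIV_diff DERIV_power m G_deriv n derG z0)
    moreover have "of_nat 2 * (dm * ((wF z - wF (s - z)) / Del z) ^ (2 - Suc 0)) - wc / 3 * (2 * wF z + 1) - - (wc / 3 * (2 * wF (s - z) + 1)) = 0"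
      using nz unfolding d dm a_def[symmetric] a'_def[symmetric] by (simp add: field_simps)
    ultimately show ?thesis unfolding Ph_def[abs_def] by simp
  qed
  obtain c where c: "\<And>z. z \<in> D \<Longrightarrow> Ph z = c"
    by (rule DERIV_zero_connected_constant[OF conD openD finite.emptyI])
       (use derPh in \<open>auto intro!: continuous_at_imp_continuous_on DERIV_isCont\<close>)
  have contF: "((\<lambda>z. wF (s - z)) \<longlongrightarrow> wF s) (at 0)" and contG: "((\<lambda>z. wG (s - z)) \<longlongrightarrow> wG s) (at 0)"
  proof -
    have sm: "filterlim (\<lambda>z. s - z) (nhds s) (at 0)"
      by (auto intro!: tendsto_eq_intros)
    have "isCont wF s" "isCont wG s" using F_deriv[OF s] G_deriv[OF s] by (auto intro: DERIV_isCont)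
    then show "((\<lambda>z. wF (s - z)) \<longlongrightarrow> wF s) (at 0)" "((\<lambda>z. wG (s - z)) \<longlongrightarrow> wG s) (at 0)"
      using isCont_tendsto_compose sm by blast+
  qed
  let ?q = "\<lambda>z. inverse (wG z)" and ?t = "\<lambda>z. wF z / wG z ^ 2"
  have Gnz: "eventually (\<lambda>z. wG z \<noteq> 0) (at 0)"
    using tendsto_imp_eventually_ne[OF G_pole wb_nz] by eventually_elim auto
  have "((\<lambda>z. 1 - ?q z * wG (s - z)) \<longlongrightarrow> 1 - 0 * wG s) (at 0)"
    by (intro tendsto_intros inverse_G_lim contG)
  then have Dnz: "eventually (\<lambda>z. 1 - ?q z * wG (s - z) \<noteq> 0) (at 0)"
    by (rule tendsto_imp_eventually_ne) simp
  have ev_s: "eventually (\<lambda>z. s - z \<notin> L) (at 0)"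
  proof -
    have "eventually (\<lambda>z. z \<in> - A) (nhds 0)"
      by (rule eventually_nhds_in_open) (use closed_A s in \<open>auto simp: A_def\<close>)
    then show ?thesis by (simp add: eventually_at_filter A_def eventually_mono)
  qed
  \<comment> \<open>The pole of g at 0 is cancelled by hand: the constant expression is rewritten by
    the curve equation in terms of 1/g and f/g^2, both of which tend to 0.\<close>
  let ?lim = "\<lambda>z. (- ?t z - 2 * ?t z * wF (s - z) + wF (s - z)^2 * ?q z^2 + 2 * wG (s - z) - ?q z * wG (s - z)^2)
       / (1 - ?q z * wG (s - z))^2 - wG (s - z)"
  have "eventually (\<lambda>z. ?lim z = c) (at 0)"
    using Gnz Dnz ev_s eventually_notin_L[of 0]
  proof eventually_elim
    case (elim z)
    define a b a' b' where "a = wF z" and "b = wG z" and "a' = wF (s - z)" and "b' = wG (s - z)"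
    have cur: "a^2 + a = b^3" unfolding a_def b_def using FG_curve elim by blast
    have b0: "b \<noteq> 0" and d0: "1 - inverse b * b' \<noteq> 0" using elim by (auto simp: b_def b'_def)
    have eqd: "1 - inverse b * b' = (b - b') / b" using b0 by (simp add: field_simps)
    then have bb: "b - b' \<noteq> 0" using d0 by auto
    have "z \<in> D" using elim bb by (auto simp: D_def D0_def A_def Del_def b_def b'_def)
    then have "Ph z = c" by (rule c)
    then have c': "((a - a') / (b - b'))^2 - b - b' = c" by (simp add: Ph_def Del_def a_def b_def a'_def b'_def)
    have "(- (a / b^2) - 2 * (a / b^2) * a' + a'^2 * inverse b^2 + 2 * b' - inverse b * b'^2) 
        = (- a - 2 * a * a' + a'^2 + 2 * b^2 * b' - b * b'^2) / b^2"
      using b0 by (simp add: field_simps power2_eq_square)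
    also have "- a - 2 * a * a' + a'^2 + 2 * b^2 * b' - b * b'^2 = (a - a')^2 - b * (b - b')^2"
      using cur by algebra
    finally have num: "(- (a / b^2) - 2 * (a / b^2) * a' + a'^2 * inverse b^2 + 2 * b' - inverse b * b'^2)
        = ((a - a')^2 - b * (b - b')^2) / b^2" .
    have "((a - a')^2 - b * (b - b')^2) / b^2 / ((b - b') / b)^2 = ((a - a') / (b - b'))^2 - b"
      using b0 bb by (simp add: field_simps)
    then show ?case unfolding a_def[symmetric] b_def[symmetric] a'_def[symmetric] b'_def[symmetric] num eqd
      using c' by simp
  qed
  then have "(?lim \<longlongrightarrow> c) (at 0)" by (rule tendsto_eventually)
  moreover have "(?lim \<longlongrightarrow> (- 0 - 2 * 0 * wF s + wF s^2 * 0^2 + 2 * wG s - 0 * wG s^2) / (1 - 0 * wG s)^2 - wG s) (at 0)"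
    by (intro tendsto_intros F_div_G_lim inverse_G_lim contF contG) auto
  ultimately have "c = (- 0 - 2 * 0 * wF s + wF s^2 * 0^2 + 2 * wG s - 0 * wG s^2) / (1 - 0 * wG s)^2 - wG s"
    by (rule tendsto_unique[rotated]) simp
  then have cs: "c = wG s" by simp
  have "z1 \<in> D" using zD ne by (auto simp: D_def Del_def s_def)
  then have "Ph z1 = wG s" using c cs by simp
  then show ?thesis by (simp add: Ph_def Del_def s_def)
qed

end

section \<open>Torsion points and the chord law\<close>

context cube_root begin

text \<open>If g vanishes at z, then z and \<epsilon> z have the same image on the curve, so
  \<epsilon> - 1 multiplies z into the lattice; and 3 is a multiple of \<epsilon> - 1.\<close>

lemma G_zero_imp_3L: "z \<notin> L \<Longrightarrow> wG z = 0 \<Longrightarrow> 3 * z \<in> L"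
proof -
  assume z: "z \<notin> L" "wG z = 0"
  have u: "\<epsilon> * z - z \<in> L"
    by (rule FG_injective) (use z in \<open>auto simp: F_eps G_eps\<close>)
  have "(\<epsilon>^2 - 1) * (\<epsilon> - 1) = 3" using eps2 by algebra
  then have "3 * z = (\<epsilon>^2 - 1) * (\<epsilon> - 1) * z" by simp
  also have "\<dots> = \<epsilon> * (\<epsilon> * (\<epsilon> * z - z)) - (\<epsilon> * z - z)"
    by (simp add: power2_eq_square algebra_simps)
  finally have "3 * z = \<epsilon> * (\<epsilon> * (\<epsilon> * z - z)) - (\<epsilon> * z - z)" .
  also have "\<dots> \<in> L" by (rule L_diff[OF L_eps_mult[OF L_eps_mult[OF u]] u])
  finally show ?thesis .
qed

text \<open>The conditions \<open>z \<notin> L\<close> and \<open>wG z \<noteq> 0\<close> discard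
  exactly the points over the branch values \<infinity>, 0 and -1. The image under f is the torsion
  set with the branch points already removed.\<close>

definition tor :: "nat \<Rightarrow> complex set" where
  "tor m = {z. z \<notin> L \<and> wG z \<noteq> 0 \<and> of_nat (3 * m) * z \<in> L}"

definition SF :: "nat \<Rightarrow> complex set" where "SF m = wF ` tor m"

definition EE :: "nat \<Rightarrow> (complex \<times> complex) set" where "EE m = (\<lambda>z. (wF z, wG z)) ` tor m"

lemma tor_uminus: "z \<in> tor m \<Longrightarrow> - z \<in> tor m"
  by (auto simp: tor_def G_uminus)

lemma tor_eps: "z \<in> tor m \<Longrightarrow> \<epsilon> * z \<in> tor m"
  using L_eps_mult[of "of_nat (3 * m) * z"] by (auto simp: tor_def G_eps eps_nz mult.left_commute)

lemma tor_add:
  assumes "of_nat (3 * m) * z1 \<in> L" "of_nat (3 * m) * z2 \<in> L" "z1 + z2 \<notin> L" "wG (z1 + z2) \<noteq> 0"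
  shows "z1 + z2 \<in> tor m"
  using assms L_add by (auto simp: tor_def distrib_left)

lemma SF_uminus: "f \<in> SF m \<Longrightarrow> - 1 - f \<in> SF m"
  unfolding SF_def
proof clarify
  fix z assume z: "z \<in> tor m"
  show "- 1 - wF z \<in> wF ` tor m"
    by (rule image_eqI[of _ _ "- z"]) (use z tor_uminus in \<open>auto simp: F_uminus tor_def\<close>)
qed

lemma quadratic_eq: "x^2 + x = y^2 + y \<Longrightarrow> x = y \<or> x = - 1 - y" for x y :: complex
proof -
  assume "x^2 + x = y^2 + y"
  then have "(x - y) * (x + y + 1) = 0" by algebra
  moreover have "x = - 1 - y" if "x + y + 1 = 0" using that by algebra
  ultimately show ?thesis by auto
qed

text \<open>The two roots of x^2 + x = g^3 are the values of f at z and -z. Membership in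
  \<open>SF\<close> can therefore be decided from g alone, which is why an addition law for g
  suffices.\<close>

lemma SF_from_G: "z \<in> tor m \<Longrightarrow> x^2 + x = wG z ^ 3 \<Longrightarrow> x \<in> SF m"
proof -
  assume z: "z \<in> tor m" and x: "x^2 + x = wG z ^ 3"
  have "wF z \<in> SF m" using z by (simp add: SF_def)
  moreover have "x = wF z \<or> x = - 1 - wF z"
    by (rule quadratic_eq) (use x z FG_curve in \<open>auto simp: tor_def\<close>)
  ultimately show ?thesis using SF_uminus by blast
qed

lemma SF_nz: "f \<in> SF m \<Longrightarrow> f \<noteq> 0" "f \<in> SF m \<Longrightarrow> f \<noteq> - 1"
proof -
  have "f \<noteq> 0 \<and> f \<noteq> - 1" if f: "f \<in> SF m"
  proof -
    obtain z where z: "z \<notin> L" "wG z \<noteq> 0" "f = wF z" using f by (auto simp: SF_def tor_def)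
    then have "f^2 + f \<noteq> 0" using FG_curve[OF z(1)] by simp
    then show ?thesis by auto
  qed
  then show "f \<in> SF m \<Longrightarrow> f \<noteq> 0" "f \<in> SF m \<Longrightarrow> f \<noteq> - 1" by auto
qed

lemma fixed_point_0: obtains p where "p \<notin> L" "wF p = 0" "wG p = 0" "of_nat (3 * m) * p \<in> L"
proof -
  obtain p where p: "p \<notin> L" "wF p = 0" "wG p = 0" by (rule FG_surjective[of 0 0]) auto
  have "of_nat m * (3 * p) \<in> L" using G_zero_imp_3L[OF p(1,3)] by (rule L_of_nat)
  then show ?thesis using p by (intro that[of p]) (auto simp: mult_ac)
qed

text \<open>Translation by the 3-torsion point p over f = 0 keeps the torsion set. The map f to
  -1/(1+f) cycles \<infinity>, 0, -1; together with f to -1-f it generates all permutations of the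
  three branch points.\<close>

lemma SF_moebius: "f \<in> SF m \<Longrightarrow> - 1 / (1 + f) \<in> SF m"
proof -
  assume f: "f \<in> SF m"
  then obtain z where z: "z \<in> tor m" and fz: "f = wF z" by (auto simp: SF_def)
  obtain p where p: "p \<notin> L" "wF p = 0" "wG p = 0" "of_nat (3 * m) * p \<in> L" by (rule fixed_point_0)
  have zL: "z \<notin> L" "wG z \<noteq> 0" "of_nat (3 * m) * z \<in> L" using z by (auto simp: tor_def)
  define g where "g = wG z"
  have c: "f^2 + f = g^3" using FG_curve[OF zL(1)] by (simp add: fz g_def)
  have g0: "g \<noteq> 0" using zL by (simp add: g_def)
  note f0 = SF_nz[OF f]
  have f1: "1 + f \<noteq> 0" using f0(2) by (metis add.commute add_eq_0_iff)
  have "wG (z + p) = (f / g)^2 - g"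
    using G_addition[OF zL(1) p(1)] p zL by (simp add: fz g_def)
  also have "\<dots> = (f^2 - g^3) / g^2" using g0 by (simp add: field_simps power2_eq_square power3_eq_cube)
  \<comment> \<open>The curve equation turns f^2 - g^3 into -f.\<close>
  finally have G: "wG (z + p) = - f / g^2" using c by (simp add: algebra_simps add_eq_0_iff2 flip: c)
  have notL: "z + p \<notin> L" using F_antiperiod(2)[OF zL(1) p(1)] p zL by auto
  have t: "z + p \<in> tor m"
    by (rule tor_add) (use zL p notL G g0 f0 in auto)
  show ?thesis
  proof (rule SF_from_G[OF t])
    have "g^6 = (g^3)^2" by (simp flip: power_mult)
    then have "wG (z + p) ^ 3 = - (f^3) / (g^3)^2" unfolding G by (simp add: power_divide flip: power_mult)
    also have "g^3 = f * (1 + f)" using c by (simp add: power2_eq_square algebra_simps)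
    finally have "wG (z + p) ^ 3 = - (f^3) / (f * (1 + f))^2" .
    also have "\<dots> = - f / (1 + f)^2"
      using f0 f1 by (simp add: power_mult_distrib power2_eq_square power3_eq_cube)
    also have "\<dots> = (1 - (1 + f)) / (1 + f)^2" by simp
    also have "\<dots> = (- 1 / (1 + f))^2 + - 1 / (1 + f)"
      using f1 by (simp only: diff_divide_distrib) (simp add: power2_eq_square)
    finally show "(- 1 / (1 + f))^2 + - 1 / (1 + f) = wG (z + p) ^ 3" ..
  qed
qed

lemma SF_inverse: "f \<in> SF m \<Longrightarrow> 1 / f \<in> SF m"
  using SF_moebius[OF SF_uminus, of f] by simp

text \<open>A line through two torsion points meets the curve in a third one, whose g-coordinate is
  that of the sum. Where g3 repeats g1 or g2 the claim is immediate, as g determines f up to f to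
  -1-f.\<close>

lemma SF_collinear:
  assumes "(f1, g1) \<in> EE m" "(f2, g2) \<in> EE m" and ne: "(f1, g1) \<noteq> (f2, g2)"
    and c3: "f3^2 + f3 = g3^3" and g3: "g3 \<noteq> 0"
    and det: "(f1 - f3) * (g2 - g3) = (f2 - f3) * (g1 - g3)"
  shows "f3 \<in> SF m"
proof -
  obtain z1 z2 where z: "z1 \<in> tor m" "z2 \<in> tor m" and e: "f1 = wF z1" "g1 = wG z1" "f2 = wF z2" "g2 = wG z2"
    using assms(1,2) by (auto simp: EE_def)
  have zL: "z1 \<notin> L" "z2 \<notin> L" "of_nat (3 * m) * z1 \<in> L" "of_nat (3 * m) * z2 \<in> L" using z by (auto simp: tor_def)
  have c1: "f1^2 + f1 = g1^3" and c2: "f2^2 + f2 = g2^3" using FG_curve zL e by auto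
  show ?thesis
  proof (cases "g3 = g1 \<or> g3 = g2")
    case True
    then show ?thesis using SF_from_G[OF z(1), of f3] SF_from_G[OF z(2), of f3] c3 e by auto
  next
    case False
    have g12: "g1 \<noteq> g2"
    proof
      assume "g1 = g2"
      with det have "(f1 - f2) * (g1 - g3) = 0" by (simp add: algebra_simps)
      then show False using False \<open>g1 = g2\<close> ne by auto
    qed
    define s where "s = (f1 - f2) / (g1 - g2)"
    have f2: "f2 = f1 + s * (g2 - g1)" using g12 by (simp add: s_def field_simps)
    have "f3 * (g1 - g2) = f1 * (g3 - g2) - f2 * (g3 - g1)" using det by (simp add: algebra_simps)
    then have "f3 * (g1 - g2) = (f1 + s * (g3 - g1)) * (g1 - g2)"
      unfolding f2 by (simp add: algebra_simps)
    then have f3: "f3 = f1 + s * (g3 - g1)" using g12 by simp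
    \<comment> \<open>Substituting the line into the curve gives a cubic in g with quadratic
      coefficient -s^2. Two of its roots are g1 and g2, so the third is s^2 - g1 - g2.\<close>
    have "(g3 - g1) * ((g2 - g1) * ((g3 - g2) * (g3 - (s^2 - g1 - g2)))) = 0"
      using c1 c2 c3 unfolding f2 f3 by algebra
    then have G: "g3 = s^2 - g1 - g2" using False g12 by auto
    have "wG (z1 + z2) = s^2 - g1 - g2" unfolding s_def e by (rule G_addition[OF zL(1,2)]) (use g12 e in auto)
    then have gz: "g3 = wG (z1 + z2)" using G by simp
    have "z1 + z2 \<notin> L" using F_antiperiod(2)[OF zL(1,2)] g12 e by auto
    then have "z1 + z2 \<in> tor m" using tor_add zL g3 gz by blast
    then show ?thesis by (rule SF_from_G) (use c3 gz in auto)
  qed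
qed

text \<open>All three cube roots g belong to torsion points, since rotation by \<epsilon> maps
  torsion points to torsion points over the same f.\<close>

lemma EE_iff: "(f, g) \<in> EE m \<longleftrightarrow> f \<in> SF m \<and> g^3 = f^2 + f"
proof
  assume "(f, g) \<in> EE m"
  then show "f \<in> SF m \<and> g^3 = f^2 + f" by (auto simp: EE_def SF_def tor_def FG_curve)
next
  assume a: "f \<in> SF m \<and> g^3 = f^2 + f"
  then obtain z where z: "z \<in> tor m" "f = wF z" by (auto simp: SF_def)
  then have zL: "z \<notin> L" by (simp add: tor_def)
  have "wG z ^ 3 = g^3" using FG_curve[OF zL] a z by simp
  from cube_eq[OF this] show "(f, g) \<in> EE m"
  proof (elim disjE)
    assume "g = wG z" then show ?thesis using z by (auto simp: EE_def)
  next
    assume "g = \<epsilon> * wG z"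
    then show ?thesis unfolding EE_def
      by (intro image_eqI[of _ _ "\<epsilon> * z"]) (use z zL tor_eps in \<open>auto simp: F_eps G_eps\<close>)
  next
    assume "g = \<epsilon> * (\<epsilon> * wG z)"
    then show ?thesis unfolding EE_def
      by (intro image_eqI[of _ _ "\<epsilon> * (\<epsilon> * z)"]) (use z zL tor_eps in \<open>auto simp: F_eps G_eps\<close>)
  qed
qed

definition trep :: "nat \<Rightarrow> nat \<times> nat \<Rightarrow> complex" where
  "trep n = (\<lambda>(a, b). (of_nat a + of_nat b * \<epsilon>) / of_nat n)"

lemma trep_torsion: "n > 0 \<Longrightarrow> of_nat n * trep n ab \<in> L"
  by (auto simp: trep_def L_def split: prod.splits) (metis of_int_of_nat_eq)

lemma trep_surj:
  assumes n: "n > 0" and z: "of_nat n * z \<in> L"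
  obtains ab where "ab \<in> {..<n} \<times> {..<n}" "z - trep n ab \<in> L"
proof -
  obtain a b where ab: "of_nat n * z = of_int a + of_int b * \<epsilon>" using z by (auto simp: L_def)
  define a' b' where "a' = nat (a mod int n)" and "b' = nat (b mod int n)"
  have a: "a = int n * (a div int n) + int a'" and b: "b = int n * (b div int n) + int b'"
    using n by (simp_all add: a'_def b'_def)
  have "of_nat n * (z - trep n (a', b')) = of_int a + of_int b * \<epsilon> - (of_nat a' + of_nat b' * \<epsilon>)"
    using n by (simp add: ab[symmetric] trep_def right_diff_distrib)
  also have "\<dots> = of_nat n * (of_int (a div int n) + of_int (b div int n) * \<epsilon>)"
    by (subst a, subst b) (simp add: algebra_simps)
  finally have "z - trep n (a', b') = of_int (a div int n) * 1 + of_int (b div int n) * \<epsilon>" using n by simp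
  then have "z - trep n (a', b') \<in> L" unfolding L_def by blast
  moreover have "(a', b') \<in> {..<n} \<times> {..<n}" using n by (auto simp: a'_def b'_def nat_less_iff)
  ultimately show ?thesis using that by blast
qed

lemma trep_inj:
  assumes n: "n > 0" and "ab \<in> {..<n} \<times> {..<n}" "cd \<in> {..<n} \<times> {..<n}" and d: "trep n ab - trep n cd \<in> L"
  shows "ab = cd"
proof -
  obtain a b c e where [simp]: "ab = (a, b)" "cd = (c, e)" by (cases ab, cases cd) auto
  obtain x y :: int where xy: "trep n ab - trep n cd = of_int x + of_int y * \<epsilon>" using d by (auto simp: L_def)
  have "of_nat n * (trep n ab - trep n cd) = (of_nat a - of_nat c) + (of_nat b - of_nat e) * \<epsilon>"
    using n by (simp add: trep_def right_diff_distrib) (simp add: algebra_simps)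
  then have "of_real (real_of_int (int a - int c - int n * x)) + of_real (real_of_int (int b - int e - int n * y)) * \<epsilon> = 0"
    unfolding xy by (simp add: algebra_simps)
  from real_indep[OF this] have "int a - int c = int n * x" "int b - int e = int n * y" by linarith+
  moreover have "\<bar>int a - int c\<bar> < int n" "\<bar>int b - int e\<bar> < int n" using assms(2,3) by auto
  moreover have "x = 0" if "\<bar>int n * x\<bar> < int n" for x :: int
  proof -
    have "int n * \<bar>x\<bar> < int n * 1" using that by (simp add: abs_mult)
    then have "\<bar>x\<bar> < 1" using n by (simp only: mult_less_cancel_left_pos of_nat_0_less_iff)
    then show ?thesis by simp
  qed
  ultimately have "x = 0" "y = 0" by metis+
  then show ?thesis using \<open>int a - int c = int n * x\<close> \<open>int b - int e = int n * y\<close> by auto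
qed

text \<open>There are n^2 torsion classes for n = 3m. The three over \<infinity>, 0 and -1 are not
  in \<open>EE m\<close>, and the rest correspond to it bijectively.\<close>

lemma card_EE:
  assumes m: "m \<ge> 1" shows "finite (EE m)" and "card (EE m) = 9 * m^2 - 3"
proof -
  define n where "n = 3 * m"
  have n: "n > 0" using m by (simp add: n_def)
  define I where "I = {..<n} \<times> {..<n}"
  \<comment> \<open>\<open>None\<close> plays the role of the point at infinity, so equality of
    codes is congruence modulo the lattice without exception.\<close>
  define code where "code z = (if z \<in> L then None else Some (wF z, wG z))" for z
  define C where "C = {code z | z. of_nat n * z \<in> L}"
  have code_eq: "code z = code w \<longleftrightarrow> z - w \<in> L" for z w
  proof (cases "z \<in> L \<or> w \<in> L")
    case True
    then show ?thesis using L_diff[of z w] L_add[of "z - w" w] L_diff[of z "z - w"] by (auto simp: code_def)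
  next
    case False
    have "wF z = wF w" "wG z = wG w" if "z - w \<in> L"
      using F_periodic[OF that, of w] G_periodic[OF that, of w] False by simp_all
    then show ?thesis using False FG_injective[of z w] by (auto simp: code_def)
  qed
  have bij: "bij_betw (\<lambda>ab. code (trep n ab)) I C"
  proof (rule bij_betwI')
    show "code (trep n x) = code (trep n y) \<longleftrightarrow> x = y" if "x \<in> I" "y \<in> I" for x y
      using trep_inj[OF n, of x y] that by (auto simp: code_eq I_def)
    show "code (trep n x) \<in> C" for x using trep_torsion[OF n, of x] unfolding C_def by blast
    show "\<exists>x\<in>I. y = code (trep n x)" if yC: "y \<in> C" for y
    proof -
      obtain z where z: "y = code z" "of_nat n * z \<in> L" using yC unfolding C_def by blast
      obtain ab where "ab \<in> {..<n} \<times> {..<n}" "z - trep n ab \<in> L" by (rule trep_surj[OF n z(2)])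
      then show ?thesis using z(1) code_eq by (auto simp: I_def)
    qed
  qed
  have finC: "finite C" and cardC: "card C = n^2"
    using bij_betw_finite[OF bij] bij_betw_same_card[OF bij] by (auto simp: I_def power2_eq_square)
  have C_eq: "C = insert None (insert (Some (0,0)) (insert (Some (-1,0)) (Some ` EE m)))"
  proof (intro equalityI subsetI)
    fix y assume "y \<in> C"
    then obtain z where z: "y = code z" "of_nat n * z \<in> L" unfolding C_def by blast
    show "y \<in> insert None (insert (Some (0,0)) (insert (Some (-1,0)) (Some ` EE m)))"
    proof (cases "z \<in> L")
      case True then show ?thesis using z by (simp add: code_def)
    next
      case False
      show ?thesis
      proof (cases "wG z = 0")
        case True
        then have "wF z * (wF z + 1) = 0" using FG_curve[OF False] by (simp add: power2_eq_square algebra_simps)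
        then have "wF z = 0 \<or> wF z = - 1" by (auto simp: add_eq_0_iff2)
        then show ?thesis using z False True by (auto simp: code_def)
      next
        case nz: False
        then have "z \<in> tor m" using False z by (simp add: tor_def n_def)
        then show ?thesis using z False by (auto simp: code_def EE_def)
      qed
    qed
  next
    fix y assume y: "y \<in> insert None (insert (Some (0,0)) (insert (Some (-1,0)) (Some ` EE m)))"
    obtain p where p: "p \<notin> L" "wF p = 0" "wG p = 0" "of_nat (3 * m) * p \<in> L" by (rule fixed_point_0)
    have inC: "code z \<in> C" if "of_nat n * z \<in> L" for z using that unfolding C_def by blast
    have "None \<in> C" using inC[of 0] by (simp add: code_def)
    moreover have "Some (0,0) \<in> C" using inC[of p] p by (simp add: code_def n_def)
    moreover have "Some (-1,0) \<in> C" using inC[of "- p"] p by (simp add: code_def n_def F_uminus G_uminus)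
    moreover have "Some ` EE m \<subseteq> C"
    proof
      fix y assume "y \<in> Some ` EE m"
      then obtain z where z: "z \<in> tor m" "y = Some (wF z, wG z)" by (auto simp: EE_def)
      then show "y \<in> C" using inC[of z] by (simp add: tor_def n_def code_def)
    qed
    ultimately show "y \<in> C" using y by auto
  qed
  have fS: "finite (Some ` EE m)" using finC C_eq by (auto intro: finite_subset)
  then show fin: "finite (EE m)" by (simp add: finite_image_iff)
  have "(0, 0) \<notin> EE m" "(-1, 0) \<notin> EE m" by (auto simp: EE_def tor_def)
  then have "card C = Suc (Suc (Suc (card (Some ` EE m))))"
    unfolding C_eq using fS by (subst card_insert_disjoint; auto)+
  then have "card (EE m) + 3 = n^2" using cardC by (simp add: card_image)
  then show "card (EE m) = 9 * m^2 - 3" by (simp add: n_def power_mult_distrib)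
qed

lemma card_cube_roots: "w \<noteq> 0 \<Longrightarrow> card {g. g^3 = w} = 3" for w :: complex
proof -
  assume w: "w \<noteq> 0"
  obtain g where g: "w = g^3" by (rule exists_complex_root[of 3 w]) auto
  have g0: "g \<noteq> 0" using w g by auto
  have "{x. x^3 = w} = {g, \<epsilon> * g, \<epsilon> * (\<epsilon> * g)}"
    using cube_eq[of g, OF sym] eps3 by (auto simp: g power_mult_distrib)
  moreover have "\<epsilon> * \<epsilon> \<noteq> 1" using eps3 eps1 by (auto simp: power3_eq_cube)
  ultimately show ?thesis using g0 eps1 eps_nz by (auto simp: mult.assoc[symmetric])
qed

lemma card_SF:
  assumes m: "m \<ge> 1" shows "finite (SF m)" and "card (SF m) = 3 * m^2 - 1"
proof -
  have "SF m = fst ` EE m" by (auto simp: SF_def EE_def image_image)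
  then show fin: "finite (SF m)" using card_EE(1)[OF m] by simp
  have "EE m = Sigma (SF m) (\<lambda>f. {g. g^3 = f^2 + f})" by (auto simp: EE_iff)
  moreover have "card {g. g^3 = f^2 + f} = 3" if "f \<in> SF m" for f
  proof (rule card_cube_roots)
    have "f * (f + 1) \<noteq> 0" using SF_nz[OF that] by (auto simp: add_eq_0_iff2)
    then show "f^2 + f \<noteq> 0" by (simp add: power2_eq_square algebra_simps)
  qed
  ultimately have "card (EE m) = card (SF m) * 3"
    using fin by (simp add: card_SigmaI card_ge_0_finite)
  then show "card (SF m) = 3 * m^2 - 1" using card_EE(2)[OF m] by simp
qed

end

section \<open>Projectivities and torsion parameters\<close>

lemma proj_eqI: "c \<noteq> 0 \<Longrightarrow> w = c *s v \<Longrightarrow> proj v = proj w" for v w :: "complex^'n"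
proof -
  assume c: "c \<noteq> 0" and w: "w = c *s v"
  have "d *s v = (d / c) *s w" "d *s w = (d * c) *s v" for d using c by (simp_all add: w)
  then have "d *s v \<in> proj w" "d *s w \<in> proj v" if "d \<noteq> 0" for d
    using that c unfolding proj_def by fastforce+
  then show "proj v = proj w" unfolding proj_def by blast
qed

lemma self_in_proj: "v \<in> proj v" unfolding proj_def by (auto intro!: exI[of _ 1])

lemma proj_eq_iff: "proj v = proj w \<longleftrightarrow> (\<exists>c. c \<noteq> 0 \<and> w = c *s v)" for v w :: "complex^'n"
proof
  assume "proj v = proj w"
  then have "w \<in> proj v" using self_in_proj[of w] by simp
  then show "\<exists>c. c \<noteq> 0 \<and> w = c *s v" unfolding proj_def by auto
qed (use proj_eqI in blast)

definition pt :: "complex \<Rightarrow> (complex^2) set" where "pt s = proj (vector [s, 1])"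
definition pt_inf :: "(complex^2) set" where "pt_inf = proj (vector [1, 0])"

lemma vec2_eq_iff: "(v::complex^2) = w \<longleftrightarrow> v $ 1 = w $ 1 \<and> v $ 2 = w $ 2"
  by (simp add: vec_eq_iff forall_2)

lemma pt_eq_iff [simp]: "pt s = pt t \<longleftrightarrow> s = t" "pt s \<noteq> pt_inf" "pt_inf \<noteq> pt s"
  by (auto simp: pt_def pt_inf_def proj_eq_iff vec2_eq_iff)

lemma pt_in_proj_space [simp]: "pt s \<in> proj_space" "pt_inf \<in> proj_space"
  unfolding pt_def pt_inf_def proj_space_def by (auto simp: vec2_eq_iff)

lemma proj_space_2: "(proj_space :: (complex^2) set set) = insert pt_inf (range pt)"
proof (intro equalityI subsetI)
  fix q :: "(complex^2) set" assume "q \<in> proj_space"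
  then obtain v where v: "v \<noteq> 0" "q = proj v" unfolding proj_space_def by blast
  show "q \<in> insert pt_inf (range pt)"
  proof (cases "v $ 2 = 0")
    case True
    then have "v $ 1 \<noteq> 0" using v by (auto simp: vec2_eq_iff)
    then have "pt_inf = proj v" unfolding pt_inf_def
      by (intro proj_eqI[of "v $ 1"]) (use True in \<open>auto simp: vec2_eq_iff\<close>)
    then show ?thesis using v by simp
  next
    case False
    then have "pt (v $ 1 / v $ 2) = proj v" unfolding pt_def
      by (intro proj_eqI[of "v $ 2"]) (auto simp: vec2_eq_iff)
    then show ?thesis using v by auto
  qed
qed auto

section \<open>Projectivities of the line as 2 by 2 matrices\<close>

definition act :: "complex^2^2 \<Rightarrow> (complex^2) set \<Rightarrow> (complex^2) set" where
  "act A p = (\<lambda>v. A *v v) ` p"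

lemma act_proj: "act A (proj v) = proj (A *v v)"
  unfolding act_def proj_def by (auto simp: vector_scalar_commute image_iff) (metis vector_scalar_commute)

lemma act_act: "act A (act B p) = act (A ** B) p"
  unfolding act_def image_image matrix_vector_mul_assoc ..

definition m2 :: "complex \<Rightarrow> complex \<Rightarrow> complex \<Rightarrow> complex \<Rightarrow> complex^2^2" where
  "m2 a b c d = vector [vector [a, b], vector [c, d]]"

lemma m2_mult: "m2 a b c d *v v = vector [a * v $ 1 + b * v $ 2, c * v $ 1 + d * v $ 2]"
  by (simp add: m2_def matrix_vector_mult_def vec2_eq_iff sum_2)

lemma m2_m2: "m2 a b c d ** m2 a' b' c' d' = m2 (a * a' + b * c') (a * b' + b * d') (c * a' + d * c') (c * b' + d * d')"
  by (simp add: m2_def matrix_matrix_mult_def vec_eq_iff forall_2 sum_2)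

lemma act_id: "act (m2 1 0 0 1) p = p"
proof -
  have "m2 1 0 0 1 *v v = v" for v by (simp add: m2_mult vec2_eq_iff)
  then show ?thesis by (simp add: act_def)
qed

lemma act_scale:
  assumes "k \<noteq> 0" "p \<in> proj_space" shows "act (m2 (k * a) (k * b) (k * c) (k * d)) p = act (m2 a b c d) p"
proof -
  obtain v where p: "p = proj v" using assms by (auto simp: proj_space_def)
  show ?thesis unfolding p act_proj
    by (rule sym, rule proj_eqI[OF assms(1)]) (simp add: m2_mult vec2_eq_iff algebra_simps)
qed

text \<open>The adjugate serves as inverse: its product with the matrix is the determinant times the
  identity, and nonzero scalars act trivially on projective points. This avoids dividing by the
  determinant.\<close>

lemma act_inverse:
  assumes D: "a * d - b * c \<noteq> 0" and p: "p \<in> proj_space"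
  shows "act (m2 d (- b) (- c) a) (act (m2 a b c d) p) = p" "act (m2 a b c d) (act (m2 d (- b) (- c) a) p) = p"
proof -
  have "m2 d (- b) (- c) a ** m2 a b c d = m2 ((a * d - b * c) * 1) ((a * d - b * c) * 0) ((a * d - b * c) * 0) ((a * d - b * c) * 1)"
    "m2 a b c d ** m2 d (- b) (- c) a = m2 ((a * d - b * c) * 1) ((a * d - b * c) * 0) ((a * d - b * c) * 0) ((a * d - b * c) * 1)"
    by (simp_all add: m2_m2 mult.commute)
  then show "act (m2 d (- b) (- c) a) (act (m2 a b c d) p) = p" "act (m2 a b c d) (act (m2 d (- b) (- c) a) p) = p"
    unfolding act_act by (simp_all only: act_scale[OF D p] act_id)
qed

lemma act_proj_space:
  assumes D: "a * d - b * c \<noteq> 0" and p: "p \<in> proj_space"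
  shows "act (m2 a b c d) p \<in> proj_space"
proof -
  obtain v where v: "p = proj v" "v \<noteq> 0" using p by (auto simp: proj_space_def)
  have "m2 a b c d *v v \<noteq> 0"
  proof
    assume z: "m2 a b c d *v v = 0"
    then have 1: "a * v $ 1 + b * v $ 2 = 0" and 2: "c * v $ 1 + d * v $ 2 = 0" by (auto simp: m2_mult vec2_eq_iff)
    have "(a * d - b * c) * v $ 1 = 0" "(a * d - b * c) * v $ 2 = 0" using 1 2 by algebra+
    then show False using D v by (simp add: vec2_eq_iff)
  qed
  then show ?thesis unfolding v act_proj proj_space_def by blast
qed

lemma P1_value_alt: "P1_value f z = (if is_pole f z then pt_inf else pt (f z))"
  by (simp add: P1_value_def pt_def pt_inf_def)

lemma P1_value_in [simp]: "P1_value f z \<in> proj_space" by (simp add: P1_value_alt)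

text \<open>A local formulation is used, because the rules for orders of zeros and poles ask for
  functions that do not vanish on punctured neighbourhoods.\<close>

definition nonconst :: "(complex \<Rightarrow> complex) \<Rightarrow> bool" where
  "nonconst f \<longleftrightarrow> (\<forall>z c. eventually (\<lambda>w. f w \<noteq> c) (at z))"

lemma nonconstI:
  assumes "f nicely_meromorphic_on UNIV" "\<And>c. \<exists>z. f z \<noteq> c"
  shows "nonconst f"
  unfolding nonconst_def
proof (intro allI)
  fix z c
  have "eventually (\<lambda>w. f w \<noteq> c) (cosparse UNIV)"
    using nicely_meromorphic_imp_constant_or_avoid[OF assms(1), of c] assms(2)[of c] by auto
  then show "eventually (\<lambda>w. f w \<noteq> c) (at z)" by (rule eventually_cosparse_imp_eventually_at) auto
qed

text \<open>A relation rather than a formula for h: a function in the required normal form is 0 at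
  its poles, so its values at isolated points have to be corrected after a fractional linear
  map.\<close>

definition mob :: "complex^2^2 \<Rightarrow> (complex \<Rightarrow> complex) \<Rightarrow> (complex \<Rightarrow> complex) \<Rightarrow> bool" where
  "mob A f h \<longleftrightarrow> h nicely_meromorphic_on UNIV \<and> nonconst h \<and>
     (\<forall>z. P1_value h z = act A (P1_value f z) \<and> ram_index h z = ram_index f z)"

lemma mob_trans: "mob A f h \<Longrightarrow> mob B h k \<Longrightarrow> mob (B ** A) f k"
  by (auto simp: mob_def act_act)

lemma nicely_meromorphic_at:
  assumes "f nicely_meromorphic_on UNIV"
  shows "f meromorphic_on {z}" "isolated_singularity_at f z" "not_essential f z"
    "\<not> is_pole f z \<Longrightarrow> f analytic_on {z}" "is_pole f z \<Longrightarrow> f z = 0"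
  using assms nicely_meromorphic_on_imp_analytic_at[OF assms, of z] is_pole_zero_at_nicely_mero[OF assms, of z]
    meromorphic_on_subset[of f UNIV "{z}"]
  by (auto simp: nicely_meromorphic_on_def meromorphic_at_iff)

lemma analytic_imp_not_pole: "f analytic_on {z} \<Longrightarrow> \<not> is_pole f z"
  using analytic_at_imp_no_pole by blast

lemma mob_affine:
  assumes f: "f nicely_meromorphic_on UNIV" and nc: "nonconst f" and a: "a \<noteq> 0"
  obtains h where "mob (m2 a b 0 1) f h"
proof
  define g where "g = (\<lambda>z. a * f z + b)"
  \<comment> \<open>At a pole of f the expression a f + b takes the value b, because f is 0 there;
    removing singularities resets it to the conventional 0.\<close>
  define h where "h = remove_sings g"
  have gm: "g meromorphic_on UNIV" unfolding g_def
    using f by (auto intro!: meromorphic_intros simp: nicely_meromorphic_on_def)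
  have hn: "h nicely_meromorphic_on UNIV" unfolding h_def by (rule remove_sings_nicely_meromorphic[OF gm])
  have giso: "isolated_singularity_at g z" for z
    using meromorphic_on_subset[OF gm, of "{z}"] by (simp add: meromorphic_at_iff)
  have ev: "eventually (\<lambda>w. h w = g w) (at z)" for z
    unfolding h_def by (rule eventually_remove_sings_eq_at[OF giso])
  have pole: "is_pole h z \<longleftrightarrow> is_pole f z" for z
  proof -
    have "is_pole h z \<longleftrightarrow> is_pole g z" by (rule is_pole_cong[OF ev refl])
    also have "\<dots> \<longleftrightarrow> is_pole f z" unfolding g_def using a by (simp add: is_pole_plus_const_iff[of _ _ b, symmetric])
    finally show ?thesis .
  qed
  have val: "h z = a * f z + b" if "\<not> is_pole f z" for z
  proof -
    have "f analytic_on {z}" using nicely_meromorphic_at[OF f] that by blast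
    then have "g analytic_on {z}" unfolding g_def by (intro analytic_intros)
    then show ?thesis unfolding h_def by (simp add: g_def)
  qed
  have "P1_value h z = act (m2 a b 0 1) (P1_value f z)" for z
    using pole[of z] val[of z] a
    by (auto simp: P1_value_alt pt_def pt_inf_def act_proj m2_mult proj_eq_iff vec2_eq_iff)
  moreover have "ram_index h z = ram_index f z" for z
  proof (cases "is_pole f z")
    case True
    have "zorder h z = zorder g z" by (rule zorder_cong[OF ev refl])
    also have "\<dots> = zorder f z"
    proof (cases "b = 0")
      case True then show ?thesis unfolding g_def using a by (simp add: zorder_cmult)
    next
      case False
      have "zorder f z < 0" using nicely_meromorphic_at[OF f] True by (intro isolated_pole_imp_neg_zorder) auto
      then have "zorder (\<lambda>z. a * f z + b) z = zorder (\<lambda>z. a * f z) z"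
        using nc False a nicely_meromorphic_at[OF f]
        by (intro zorder_add1) (auto simp: zorder_cmult nonconst_def intro!: meromorphic_intros eventually_frequently)
      then show ?thesis unfolding g_def using a by (simp add: zorder_cmult)
    qed
    finally show ?thesis using pole True by (simp add: ram_index_def)
  next
    case False
    have "zorder (\<lambda>w. h w - h z) z = zorder (\<lambda>w. a * (f w - f z)) z"
    proof (rule zorder_cong[OF _ refl])
      show "eventually (\<lambda>w. h w - h z = a * (f w - f z)) (at z)"
        using ev[of z] by eventually_elim (simp add: val[OF False] g_def algebra_simps)
    qed
    then show ?thesis using pole False a by (simp add: ram_index_def zorder_cmult)
  qed
  moreover have "nonconst h" unfolding nonconst_def
  proof (intro allI)
    fix z c
    have "eventually (\<lambda>w. f w \<noteq> (c - b) / a) (at z)" using nc by (simp add: nonconst_def)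
    with ev[of z] show "eventually (\<lambda>w. h w \<noteq> c) (at z)"
      by eventually_elim (use a in \<open>auto simp: g_def field_simps\<close>)
  qed
  ultimately show "mob (m2 a b 0 1) f h" using hn by (simp add: mob_def)
qed

lemma mob_inverse:
  assumes f: "f nicely_meromorphic_on UNIV" and nc: "nonconst f"
  obtains h where "mob (m2 0 1 1 0) f h"
proof
  define h where "h = (\<lambda>z. inverse (f z))"
  note fat = nicely_meromorphic_at[OF f]
  have hn: "h nicely_meromorphic_on UNIV" unfolding h_def by (rule nicely_meromorphic_on_inverse[OF f])
  have nz: "eventually (\<lambda>w. f w \<noteq> 0) (at z)" for z using nc by (simp add: nonconst_def)
  then have fr: "frequently (\<lambda>w. f w \<noteq> 0) (at z)" for z by (simp add: eventually_frequently)
  have zo: "zorder h z = - zorder f z" for z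
    using zorder_divide[of "\<lambda>_. 1" z f] fat(1) fr meromorphic_on_const by (simp add: h_def divide_inverse)
  have pole: "is_pole h z \<longleftrightarrow> \<not> is_pole f z \<and> f z = 0" for z
  proof
    assume "is_pole h z"
    then have iz: "isolated_zero f z" unfolding h_def by (simp add: is_pole_inverse_iff)
    then have np: "\<not> is_pole f z"
      using not_tendsto_and_filterlim_at_infinity[of "at z" f 0] by (auto simp: isolated_zero_def is_pole_def)
    then have "isCont f z" using fat(4) analytic_at_imp_isCont by blast
    then have "f z = 0" using iz tendsto_unique[of "at z" f "f z" 0] by (auto simp: isolated_zero_def isCont_def)
    then show "\<not> is_pole f z \<and> f z = 0" using np by simp
  next
    assume a: "\<not> is_pole f z \<and> f z = 0"
    then have "isCont f z" using fat(4) analytic_at_imp_isCont by blast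
    then have "isolated_zero f z" using a nz[of z] by (auto simp: isolated_zero_def isCont_def)
    then show "is_pole h z" unfolding h_def by (simp add: is_pole_inverse_iff)
  qed
  have "P1_value h z = act (m2 0 1 1 0) (P1_value f z)" for z
  proof -
    consider "is_pole f z" | "\<not> is_pole f z" "f z = 0" | "\<not> is_pole f z" "f z \<noteq> 0" by blast
    then show ?thesis
    proof cases
      case 1
      then have "P1_value h z = pt 0" using pole fat(5) by (simp add: P1_value_alt h_def)
      then show ?thesis using 1 by (auto simp: P1_value_alt pt_def pt_inf_def act_proj m2_mult)
    next
      case 2
      then show ?thesis using pole[of z] by (auto simp: P1_value_alt pt_def pt_inf_def act_proj m2_mult)
    next
      case 3
      then have "P1_value h z = pt (inverse (f z))" using pole by (simp add: P1_value_alt h_def)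
      also have "\<dots> = act (m2 0 1 1 0) (pt (f z))"
        unfolding pt_def act_proj by (rule proj_eqI[of "f z"]) (use 3 in \<open>auto simp: m2_mult vec2_eq_iff\<close>)
      finally show ?thesis using 3 by (simp add: P1_value_alt)
    qed
  qed
  moreover have "ram_index h z = ram_index f z" for z
  proof -
    consider "is_pole f z" | "\<not> is_pole f z" "f z = 0" | "\<not> is_pole f z" "f z \<noteq> 0" by blast
    then show ?thesis
    proof cases
      case 1
      then have "h z = 0" using fat(5) by (simp add: h_def)
      then show ?thesis using 1 pole[of z] zo[of z] by (simp add: ram_index_def)
    next
      case 2
      then show ?thesis using pole[of z] zo[of z] by (simp add: ram_index_def)
    next
      case 3
      \<comment> \<open>The difference 1/f(w) - 1/f(z) is f(w) - f(z) times this factor, which is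
        holomorphic and nonzero at z, so the order is unchanged.\<close>
      define k where "k = (\<lambda>w. - inverse (f w * f z))"
      have an: "f analytic_on {z}" using fat(4) 3 by blast
      have ka: "k analytic_on {z}" unfolding k_def using 3 by (intro analytic_intros an) auto
      have "k z \<noteq> 0" using 3 by (simp add: k_def)
      then have zk: "zorder k z = 0" using ka by (rule zorder_eq_0I[rotated])
      have ne: "eventually (\<lambda>w. f w - f z \<noteq> 0) (at z)" using nc by (simp add: nonconst_def)
      have "zorder (\<lambda>w. h w - h z) z = zorder (\<lambda>w. (f w - f z) * k w) z"
      proof (rule zorder_cong[OF _ refl])
        show "eventually (\<lambda>w. h w - h z = (f w - f z) * k w) (at z)"
          using nz[of z] by eventually_elim (use 3 in \<open>simp add: h_def k_def field_simps\<close>)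
      qed
      also have "\<dots> = zorder (\<lambda>w. f w - f z) z + zorder k z"
      proof (rule zorder_mult)
        show "(\<lambda>w. f w - f z) meromorphic_on {z}" by (intro meromorphic_intros fat(1))
        show "k meromorphic_on {z}" using ka by (rule analytic_on_imp_meromorphic_on)
        show "frequently (\<lambda>w. f w - f z \<noteq> 0) (at z)" using ne by (simp add: eventually_frequently)
        have "eventually (\<lambda>w. k w \<noteq> 0) (at z)" using nz[of z]
          by eventually_elim (use 3 in \<open>simp add: k_def\<close>)
        then show "frequently (\<lambda>w. k w \<noteq> 0) (at z)" by (simp add: eventually_frequently)
      qed
      finally show ?thesis using 3 pole[of z] zk by (simp add: ram_index_def)
    qed
  qed
  moreover have "nonconst h" unfolding nonconst_def
  proof (intro allI)
    fix z c
    have "eventually (\<lambda>w. f w \<noteq> inverse c) (at z)" using nc by (simp add: nonconst_def)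
    then show "eventually (\<lambda>w. h w \<noteq> c) (at z)" by eventually_elim (auto simp: h_def)
  qed
  ultimately show "mob (m2 0 1 1 0) f h" using hn by (simp add: mob_def)
qed

lemma image_eq_singleton_iff: "g ` x = {q} \<longleftrightarrow> x \<noteq> {} \<and> (\<forall>z\<in>x. g z = q)"
  by auto

lemma mob_nice: "mob A f h \<Longrightarrow> h nicely_meromorphic_on UNIV" "mob A f h \<Longrightarrow> nonconst h"
  by (simp_all add: mob_def)

lemma mob_exists:
  assumes f: "f nicely_meromorphic_on UNIV" "nonconst f" and D: "a * d - b * c \<noteq> 0"
  obtains h where "mob (m2 a b c d) f h"
proof (cases "c = 0")
  case True
  then have ad: "a / d \<noteq> 0" "d \<noteq> 0" using D by auto
  obtain h where h: "mob (m2 (a / d) (b / d) 0 1) f h" by (rule mob_affine[OF f ad(1)])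
  have "act (m2 (a / d) (b / d) 0 1) (P1_value f z) = act (m2 a b c d) (P1_value f z)" for z
    using act_scale[OF ad(2) P1_value_in, of "a / d" "b / d" 0 1 f z] True ad by simp
  then show ?thesis using h by (intro that[of h]) (simp add: mob_def)
next
  case False
  \<comment> \<open>From (a f + b)/(c f + d) = a/c + e/(c f + d): an affine map, an inversion and
    another affine map.\<close>
  define e where "e = - ((a * d - b * c) / c)"
  have e: "e \<noteq> 0" using D False by (simp add: e_def)
  obtain h1 where h1: "mob (m2 c d 0 1) f h1" by (rule mob_affine[OF f False])
  obtain h2 where h2: "mob (m2 0 1 1 0) h1 h2" by (rule mob_inverse[OF mob_nice[OF h1]])
  obtain h where h: "mob (m2 e (a / c) 0 1) h2 h" by (rule mob_affine[OF mob_nice[OF h2] e])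
  have "m2 e (a / c) 0 1 ** (m2 0 1 1 0 ** m2 c d 0 1) = m2 a b c d"
    unfolding m2_m2 using False by (simp add: e_def field_simps)
  then show ?thesis using mob_trans[OF mob_trans[OF h1 h2] h] that by simp
qed

lemma ram_index_periodic:
  assumes "\<And>z. f (z + w) = f z" shows "ram_index f (z + w) = ram_index f z" "P1_value f (z + w) = P1_value f z"
proof -
  have e: "f (u + (z + w)) = f (u + z)" for u z using assms[of "u + z"] by (simp add: add.assoc)
  have p: "is_pole f (z + w) \<longleftrightarrow> is_pole f z"
  proof -
    have "(\<lambda>x. f (z + w + x)) = (\<lambda>x. f (z + x))" using e[of _ z] by (metis add.commute)
    then show ?thesis using is_pole_shift_0[of f "z + w"] is_pole_shift_0[of f z] by simp
  qed
  have zo: "zorder g (z + w) = zorder g z" if "\<And>z. g (z + w) = g z" for g :: "complex \<Rightarrow> complex"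
  proof -
    have "zorder g (z + w) = zorder (\<lambda>u. g (u + (z + w))) 0" by (rule zorder_shift)
    also have "(\<lambda>u. g (u + (z + w))) = (\<lambda>u. g (u + z))" using that by (simp add: add.assoc[symmetric])
    also have "zorder \<dots> 0 = zorder g z" by (rule zorder_shift[symmetric])
    finally show ?thesis .
  qed
  show "ram_index f (z + w) = ram_index f z"
    using p zo[of f] zo[of "\<lambda>w. f w - f z"] assms by (simp add: ram_index_def)
  show "P1_value f (z + w) = P1_value f z" using p assms by (simp add: P1_value_alt)
qed

lemma act_eq_iff:
  assumes "a * d - b * c \<noteq> 0" "p \<in> proj_space" "q \<in> proj_space"
  shows "act (m2 a b c d) p = act (m2 a b c d) q \<longleftrightarrow> p = q"
  using act_inverse(1)[OF assms(1,2)] act_inverse(1)[OF assms(1,3)] by metis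

text \<open>A constant function has no pole, so its fibre over infinity is empty and the degree sum
  there is 0 instead of 3.\<close>

lemma equianharmonic_cover_nonconst:
  assumes "equianharmonic_cover \<Lambda> f M" shows "nonconst f"
proof (rule nonconstI)
  show "f nicely_meromorphic_on UNIV" using assms by (simp add: equianharmonic_cover_def)
  fix c
  show "\<exists>z. f z \<noteq> c"
  proof (rule ccontr)
    assume "\<not> (\<exists>z. f z \<noteq> c)"
    then have c: "f = (\<lambda>_. c)" by auto
    have "(\<Sum>x \<in> {x \<in> torus \<Lambda>. P1_value f ` x = {pt_inf}}. torus_ram_index f x) = 3"
      using assms by (simp add: equianharmonic_cover_def has_degree_def)
    then have "{x \<in> torus \<Lambda>. P1_value f ` x = {pt_inf}} \<noteq> {}" by (metis sum.empty zero_neq_numeral)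
    then obtain x where x: "P1_value f ` x = {pt_inf}" by blast
    then have "pt_inf \<in> P1_value f ` x" by simp
    then obtain z where "P1_value f z = pt_inf" by (metis imageE)
    moreover have "\<not> is_pole f z" unfolding c by (rule analytic_imp_not_pole, rule analytic_on_const)
    ultimately show False by (simp add: P1_value_alt)
  qed
qed

lemma equianharmonic_cover_mob:
  assumes cov: "equianharmonic_cover \<Lambda> f M" and D: "a * d - b * c \<noteq> 0" and h: "mob (m2 a b c d) f h"
  shows "equianharmonic_cover \<Lambda> h (act (m2 a b c d) ` M)"
proof -
  let ?A = "m2 a b c d"
  have hn: "h nicely_meromorphic_on UNIV" and P: "\<And>z. P1_value h z = act ?A (P1_value f z)"
    and R: "\<And>z. ram_index h z = ram_index f z" using h by (auto simp: mob_def)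
  have Rf: "ram_index h = ram_index f" using R by auto
  have T: "torus_ram_index h x = torus_ram_index f x" for x by (simp add: torus_ram_index_def Rf)
  have per: "h (z + w) = h z" if "w \<in> \<Lambda>" for z w
  proof -
    have "f (z + w) = f z" for z using cov that by (simp add: equianharmonic_cover_def)
    then have "P1_value h (z + w) = P1_value h z" unfolding P using ram_index_periodic(2)[of f w z] by simp
    \<comment> \<open>Equal projective values give equal function values because h is 0 at each of
      its poles.\<close>
    then show ?thesis using nicely_meromorphic_at(5)[OF hn] by (auto simp: P1_value_alt split: if_splits)
  qed
  have deg: "has_degree \<Lambda> h 3" unfolding has_degree_def
  proof
    fix q :: "(complex^2) set" assume q: "q \<in> proj_space"
    define q' where "q' = act (m2 d (- b) (- c) a) q"
    have q': "q' \<in> proj_space" unfolding q'_def by (rule act_proj_space) (use D q in \<open>auto simp: algebra_simps\<close>)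
    have "act ?A q' = q" unfolding q'_def by (rule act_inverse(2)[OF D q])
    then have "P1_value h z = q \<longleftrightarrow> P1_value f z = q'" for z
      unfolding P using act_eq_iff[OF D P1_value_in q'] by metis
    then have "P1_value h ` x = {q} \<longleftrightarrow> P1_value f ` x = {q'}" for x
      by (simp add: image_eq_singleton_iff)
    then show "(\<Sum>x \<in> {x \<in> torus \<Lambda>. P1_value h ` x = {q}}. torus_ram_index h x) = int 3"
      using cov q' unfolding equianharmonic_cover_def has_degree_def T by simp
  qed
  have "{P1_value h z | z. ram_index h z \<ge> 2} = act ?A ` {P1_value f z | z. ram_index f z \<ge> 2}"
    unfolding P R by blast
  then show ?thesis using cov hn per deg unfolding equianharmonic_cover_def T by simp
qed

lemma torsion_params_subset_act:
  assumes D: "a * d - b * c \<noteq> 0" and M: "M \<subseteq> proj_space"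
  shows "act (m2 a b c d) ` torsion_params M N \<subseteq> torsion_params (act (m2 a b c d) ` M) N"
proof clarify
  let ?A = "m2 a b c d"
  fix q assume "q \<in> torsion_params M N"
  then obtain \<Lambda> f z0 z where cov: "equianharmonic_cover \<Lambda> f M" and r: "ram_index f z0 = 3"
    and z: "of_nat N * (z - z0) \<in> \<Lambda>" and q: "q = P1_value f z" "q \<notin> M"
    unfolding torsion_params_def by blast
  have fn: "f nicely_meromorphic_on UNIV" using cov by (simp add: equianharmonic_cover_def)
  obtain h where h: "mob ?A f h" by (rule mob_exists[OF fn equianharmonic_cover_nonconst[OF cov] D])
  have "act ?A q = P1_value h z" "ram_index h z0 = 3" using h q r by (auto simp: mob_def)
  moreover have "act ?A q \<notin> act ?A ` M"
  proof
    assume "act ?A q \<in> act ?A ` M"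
    then obtain p where p: "p \<in> M" "act ?A q = act ?A p" by blast
    have "q = p" using act_eq_iff[OF D, of q p] p M q(1) by auto
    then show False using p q(2) by simp
  qed
  ultimately show "act ?A q \<in> torsion_params (act ?A ` M) N"
    using equianharmonic_cover_mob[OF cov D h] z unfolding torsion_params_def by blast
qed

lemma torsion_params_in: "torsion_params M N \<subseteq> proj_space"
  unfolding torsion_params_def using P1_value_in by blast

text \<open>One inclusion transports covers along the projectivity; the other is the same inclusion
  for the adjugate matrix. It allows every pencil and every basis to be compared with one standard
  branch set.\<close>

lemma torsion_params_act:
  assumes D: "a * d - b * c \<noteq> 0" and M: "M \<subseteq> proj_space"
  shows "torsion_params (act (m2 a b c d) ` M) N = act (m2 a b c d) ` torsion_params M N"
proof
  let ?A = "m2 a b c d" and ?B = "m2 d (- b) (- c) a"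
  have D': "d * a - (- b) * (- c) \<noteq> 0" using D by (simp add: algebra_simps)
  have AM: "act ?A ` M \<subseteq> proj_space" using act_proj_space[OF D] M by blast
  have inv: "act ?B ` act ?A ` M = M"
    unfolding image_image using act_inverse(1)[OF D] M by (simp add: subset_iff cong: image_cong)
  have "act ?B ` torsion_params (act ?A ` M) N \<subseteq> torsion_params M N"
    using torsion_params_subset_act[OF D' AM] inv by simp
  then have "act ?A ` act ?B ` torsion_params (act ?A ` M) N \<subseteq> act ?A ` torsion_params M N" by blast
  moreover have "act ?A ` act ?B ` torsion_params (act ?A ` M) N = torsion_params (act ?A ` M) N"
    unfolding image_image using act_inverse(2)[OF D] torsion_params_in by (simp add: subset_iff cong: image_cong)
  ultimately show "torsion_params (act ?A ` M) N \<subseteq> act ?A ` torsion_params M N" by simp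
qed (rule torsion_params_subset_act[OF D M])

lemma class_eq_iff: "is_lattice \<Lambda> \<Longrightarrow> (+) z ` \<Lambda> = (+) w ` \<Lambda> \<longleftrightarrow> z - w \<in> \<Lambda>"
proof
  assume L: "is_lattice \<Lambda>" and e: "(+) z ` \<Lambda> = (+) w ` \<Lambda>"
  have "z + 0 \<in> (+) z ` \<Lambda>" using is_lattice_0[OF L] by blast
  then obtain u where "z = w + u" "u \<in> \<Lambda>" using e by auto
  then show "z - w \<in> \<Lambda>" by simp
next
  assume L: "is_lattice \<Lambda>" and d: "z - w \<in> \<Lambda>"
  have "(+) z ` \<Lambda> \<subseteq> (+) w ` \<Lambda>" if "z - w \<in> \<Lambda>" for z w
  proof clarify
    fix u assume "u \<in> \<Lambda>"
    then have "(z - w) + u \<in> \<Lambda>" using that L by (intro is_lattice_add)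
    then show "z + u \<in> (+) w ` \<Lambda>" by (intro image_eqI[of _ _ "(z - w) + u"]) auto
  qed
  then show "(+) z ` \<Lambda> = (+) w ` \<Lambda>" using d is_lattice_uminus[OF L d] by (metis minus_diff_eq subset_antisym)
qed

lemma image_class:
  assumes "is_lattice \<Lambda>" "\<And>w. w \<in> \<Lambda> \<Longrightarrow> g (z + w) = g z"
  shows "g ` (+) z ` \<Lambda> = {g z}"
  using assms is_lattice_0[OF assms(1)] by (auto simp: image_image)

lemma image_periodic:
  assumes "is_lattice \<Lambda>" "\<And>z w. w \<in> \<Lambda> \<Longrightarrow> f (z + w) = f z"
  shows "P1_value f ` (+) z ` \<Lambda> = {P1_value f z}" "torus_ram_index f ((+) z ` \<Lambda>) = ram_index f z"
proof -
  show "P1_value f ` (+) z ` \<Lambda> = {P1_value f z}"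
    by (rule image_class[OF assms(1)], rule ram_index_periodic(2)) (use assms in auto)
  have "ram_index f ` (+) z ` \<Lambda> = {ram_index f z}"
    by (rule image_class[OF assms(1)], rule ram_index_periodic(1)) (use assms in auto)
  then show "torus_ram_index f ((+) z ` \<Lambda>) = ram_index f z" by (simp add: torus_ram_index_def)
qed

text \<open>The branch values of f on the curve g^3 = f^2 + f.\<close>

definition M_std :: "(complex^2) set set" where "M_std = {pt_inf, pt 0, pt (-1)}"

section \<open>The standard cover by the hexagonal torus\<close>

context cube_root begin

text \<open>The value 0 at lattice points is the convention for poles required by
  \<open>nicely_meromorphic_on\<close>.\<close>

definition f0 :: "complex \<Rightarrow> complex" where "f0 z = (if z \<in> L then 0 else wF z)"

lemma f0_periodic: "u \<in> L \<Longrightarrow> f0 (z + u) = f0 z"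
  by (simp add: f0_def L_add_iff F_periodic)

lemma f0_near_0:
  obtains r h where "r > 0" "h holomorphic_on ball 0 r" "h 0 \<noteq> 0"
    "\<And>w. cmod w < r \<Longrightarrow> w \<noteq> 0 \<Longrightarrow> f0 w = h w * w powi (-3)"
proof -
  obtain r g where r: "r > 0" "r \<le> 1/2" and g: "g holomorphic_on ball 0 r"
    and e: "\<And>z. cmod z < r \<Longrightarrow> z \<noteq> 0 \<Longrightarrow> wp' z = - 2 * inverse z ^ 3 + 4 * z^3 * g z + z^4 * deriv g z"
    by (rule wp_expansion) blast
  define h where "h w = wa * (- 2 + 4 * w^6 * g w + w^7 * deriv g w) - w^3 / 2" for w
  show ?thesis
  proof (rule that[OF r(1)])
    show "h holomorphic_on ball 0 r" unfolding h_def by (intro holomorphic_intros holomorphic_deriv g) auto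
    show "h 0 \<noteq> 0" using wa_nz by (simp add: h_def)
    fix w assume w: "cmod w < r" "w \<noteq> 0"
    define p where "p = inverse w"
    have p: "w * p = 1" using w by (simp add: p_def)
    have "w \<notin> L" using L_norm_ge_1[of w] w r by auto
    then have "f0 w = wa * (- 2 * p ^ 3 + 4 * w^3 * g w + w^4 * deriv g w) - 1/2"
      using e[OF w] by (simp add: f0_def wF_def p_def)
    also have "\<dots> = h w * p^3"
    proof -
      have "w^6 * p^3 = w^3" "w^7 * p^3 = w^4" "w^3 * p^3 = 1" using p by algebra+
      then have "wa * (- 2 * p ^ 3 + 4 * (w^6 * p^3) * g w + (w^7 * p^3) * deriv g w) - (w^3 * p^3) / 2
        = wa * (- 2 * p ^ 3 + 4 * w^3 * g w + w^4 * deriv g w) - 1/2" by simp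
      then show ?thesis by (simp add: h_def algebra_simps)
    qed
    finally show "f0 w = h w * w powi (-3)" by (simp add: p_def power_int_minus power_inverse)
  qed
qed

lemma f0_pole_0: "is_pole f0 0" and f0_zorder_0: "zorder f0 0 = - 3"
proof -
  obtain r h where h: "r > 0" "h holomorphic_on ball 0 r" "h 0 \<noteq> 0"
    "\<And>w. cmod w < r \<Longrightarrow> w \<noteq> 0 \<Longrightarrow> f0 w = h w * w powi (-3)" by (rule f0_near_0) blast
  show "zorder f0 0 = - 3"
    by (rule zorder_eqI[of "ball 0 r" 0 h]) (use h in auto)
  have "is_pole (\<lambda>w. h w / w ^ 3) 0" by (rule is_pole_basic'[of h "ball 0 r"]) (use h in auto)
  moreover have "eventually (\<lambda>w. w \<in> ball 0 r - {0}) (at (0::complex))"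
    using h(1) by (intro eventually_at_in_open) auto
  then have "eventually (\<lambda>w. h w / w ^ 3 = f0 w) (at 0)"
    by eventually_elim (auto simp: h(4) power_int_minus divide_inverse)
  from is_pole_cong[OF this refl] have "is_pole (\<lambda>w. h w / w ^ 3) 0 \<longleftrightarrow> is_pole f0 0" .
  ultimately show "is_pole f0 0" by simp
qed

lemma f0_ev_eq: "z \<notin> L \<Longrightarrow> eventually (\<lambda>w. f0 w = wF w) (nhds z)"
  using eventually_nhds_in_open[OF open_compl_L, of z] by (auto elim!: eventually_mono simp: f0_def)

lemma F_analytic: "z \<notin> L \<Longrightarrow> wF analytic_on {z}" and G_analytic: "z \<notin> L \<Longrightarrow> wG analytic_on {z}"
  using F_holomorphic G_holomorphic open_compl_L by (auto simp: analytic_at)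

lemma f0_analytic: "z \<notin> L \<Longrightarrow> f0 analytic_on {z}"
  using F_analytic analytic_at_cong[OF f0_ev_eq refl] by blast

lemma f0_pole_iff: "is_pole f0 z \<longleftrightarrow> z \<in> L"
proof
  assume "z \<in> L"
  then have "(\<lambda>x. f0 (z + x)) = (\<lambda>x. f0 (0 + x))" using f0_periodic[of z] by (simp add: add.commute[of z])
  then have "is_pole (\<lambda>x. f0 (z + x)) 0" using f0_pole_0 by simp
  then show "is_pole f0 z" by (simp only: is_pole_shift_0[of f0 z])
next
  assume "is_pole f0 z"
  then show "z \<in> L" using analytic_imp_not_pole[OF f0_analytic[of z]] by (cases "z \<in> L") auto
qed

lemma f0_nice: "f0 nicely_meromorphic_on UNIV"
proof (rule nicely_meromorphic_onI_open[of UNIV f0 L])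
  show "f0 analytic_on UNIV - L" using f0_analytic by (subst analytic_on_analytic_at) auto
  show "is_pole f0 x \<and> f0 x = 0" if "x \<in> L" for x using that f0_pole_iff by (simp add: f0_def)
  show "isolated_singularity_at f0 x" for x
  proof -
    obtain d where d: "d > 0" "\<forall>x'\<in>L. x' = x \<or> \<not> dist x' x < d"
      using L_not_limpt[of x] by (auto simp: islimpt_approachable)
    have "f0 analytic_on ball x d - {x}"
      by (subst analytic_on_analytic_at) (use f0_analytic d in \<open>force simp: dist_commute\<close>)
    then show ?thesis using d(1) by (auto simp: isolated_singularity_at_def)
  qed
qed auto

lemma f0_P1: "P1_value f0 z = (if z \<in> L then pt_inf else pt (wF z))"
  by (simp add: P1_value_alt f0_pole_iff f0_def)

lemma f0_nonconst: "nonconst f0"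
proof (rule nonconstI[OF f0_nice])
  fix c
  obtain z where "z \<notin> L" "wF z = c + 1" by (rule F_surjective)
  then show "\<exists>z. f0 z \<noteq> c" by (intro exI[of _ z]) (simp add: f0_def)
qed

text \<open>Since f' = wc g^2, the map is unramified where g is nonzero. At a zero z of g one has f
  - f(z) = g^3 / (f + 1 + f(z)); the denominator is nonzero there and g has a simple zero, so the
  index is 3.\<close>

lemma f0_ram: "ram_index f0 z = (if z \<in> L \<or> wG z = 0 then 3 else 1)"
proof (cases "z \<in> L")
  case True
  then have "ram_index f0 (0 + z) = ram_index f0 0" by (intro ram_index_periodic f0_periodic)
  then show ?thesis using True f0_pole_0 f0_zorder_0 by (simp add: ram_index_def)
next
  case False
  have "ram_index f0 z = zorder (\<lambda>w. f0 w - f0 z) z" using False f0_pole_iff by (simp add: ram_index_def)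
  also have "\<dots> = zorder (\<lambda>w. wF w - wF z) z"
  proof (rule zorder_cong[OF _ refl])
    show "eventually (\<lambda>w. f0 w - f0 z = wF w - wF z) (at z)"
      using eventually_notin_L[of z] by eventually_elim (use False in \<open>simp add: f0_def\<close>)
  qed
  finally have ram: "ram_index f0 z = zorder (\<lambda>w. wF w - wF z) z" .
  show ?thesis
  proof (cases "wG z = 0")
    case nz: False
    have "zorder (\<lambda>w. wF w - wF z) z = 1"
    proof (rule zorder_zero_eqI)
      show "(\<lambda>w. wF w - wF z) holomorphic_on - L" by (intro holomorphic_intros F_holomorphic)
      have "deriv (\<lambda>w. wF w - wF z) z = wc * wG z ^ 2"
        using F_deriv[OF False] by (intro DERIV_imp_deriv) (auto intro!: derivative_eq_intros)
      then show "(deriv ^^ nat 1) (\<lambda>w. wF w - wF z) z \<noteq> 0" using wc_nz nz by simp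
    qed (use False open_compl_L in auto)
    then show ?thesis using ram nz False by simp
  next
    case z: True
    have zG: "zorder wG z = 1"
    proof (rule zorder_zero_eqI[OF G_holomorphic open_compl_L])
      have "wF z * (wF z + 1) = 0" using FG_curve[OF False] z by (simp add: power2_eq_square algebra_simps)
      then have "2 * wF z + 1 \<noteq> 0" by (auto simp: add_eq_0_iff2)
      moreover have d: "(deriv ^^ nat 1) wG z = wc / 3 * (2 * wF z + 1)"
        using DERIV_imp_deriv[OF G_deriv[OF False]] by (simp only: nat_one_as_int[symmetric] One_nat_def funpow.simps o_def id_def)
      ultimately show "(deriv ^^ nat 1) wG z \<noteq> 0" unfolding d using wc_nz by simp
    qed (use False z in auto)
    define k where "k = (\<lambda>w. wF w + 1 + wF z)"
    have kz: "k z \<noteq> 0"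
    proof -
      have "wF z * (wF z + 1) = 0" using FG_curve[OF False] z by (simp add: power2_eq_square algebra_simps)
      then show ?thesis by (auto simp: k_def add_eq_0_iff2)
    qed
    have ka: "k analytic_on {z}" unfolding k_def by (intro analytic_intros F_analytic False)
    have nz: "eventually (\<lambda>w. wG w ^ 3 \<noteq> 0) (at z)"
    proof -
      have "eventually (\<lambda>w. f0 w \<noteq> 0) (at z)" "eventually (\<lambda>w. f0 w \<noteq> - 1) (at z)"
        using f0_nonconst by (simp_all add: nonconst_def)
      then show ?thesis using eventually_notin_L[of z]
      proof eventually_elim
        case (elim w)
        then have "wF w * (wF w + 1) \<noteq> 0" by (auto simp: f0_def add_eq_0_iff2)
        then show ?case using FG_curve[of w] elim by (simp add: power2_eq_square algebra_simps)
      qed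
    qed
    have ksmall: "eventually (\<lambda>w. k w \<noteq> 0) (at z)"
      by (rule tendsto_imp_eventually_ne[OF _ kz]) (use analytic_at_imp_isCont[OF ka] in \<open>simp add: isCont_def\<close>)
    have "zorder (\<lambda>w. wF w - wF z) z = zorder (\<lambda>w. wG w ^ 3 / k w) z"
    proof (rule zorder_cong[OF _ refl])
      show "eventually (\<lambda>w. wF w - wF z = wG w ^ 3 / k w) (at z)"
        using ksmall eventually_notin_L[of z]
      proof eventually_elim
        case (elim w)
        have "wF w ^ 2 + wF w = wG w ^ 3" "wF z ^ 2 + wF z = 0" using FG_curve elim False z by auto
        then have "(wF w - wF z) * k w = wG w ^ 3" unfolding k_def by algebra
        then show ?case using elim by (simp add: field_simps)
      qed
    qed
    also have "\<dots> = zorder (\<lambda>w. wG w ^ 3) z - zorder k z"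
      by (rule zorder_divide)
         (use ka nz ksmall False G_analytic in \<open>auto intro!: analytic_on_imp_meromorphic_on analytic_intros intro: eventually_frequently\<close>)
    also have "zorder k z = 0" by (rule zorder_eq_0I[OF ka kz])
    also have "zorder (\<lambda>w. wG w ^ 3) z = 3 * zorder wG z"
      using zorder_power[of wG z 3] nz analytic_on_imp_meromorphic_on[OF G_analytic[OF False]]
      by (simp add: eventually_frequently)
    finally show ?thesis using ram z zG by simp
  qed
qed

lemma fixed_values: "z \<notin> L \<Longrightarrow> wG z = 0 \<longleftrightarrow> wF z = 0 \<or> wF z = - 1"
proof -
  assume z: "z \<notin> L"
  have "wF z * (wF z + 1) = wG z ^ 3" using FG_curve[OF z] by (simp add: power2_eq_square algebra_simps)
  then show ?thesis by (metis add.commute add_eq_0_iff mult_eq_0_iff power_eq_0_iff zero_neq_numeral power_zero_numeral)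
qed

lemma torus_cases: "x \<in> torus L \<Longrightarrow> \<exists>z. x = (+) z ` L" unfolding torus_def by blast

lemma f0_fibre_class:
  "{x \<in> torus L. P1_value f0 ` x = {q}} = (\<lambda>z. (+) z ` L) ` {z. P1_value f0 z = q}"
  using image_periodic(1)[OF is_lattice_L f0_periodic] unfolding torus_def by auto

text \<open>Here \<open>A\<close> is a system of representatives of the fibre modulo the lattice,
  which reduces the degree to a finite sum over complex numbers.\<close>

lemma f0_sum:
  assumes A: "\<And>z. P1_value f0 z = q \<longleftrightarrow> (\<exists>a\<in>A. z - a \<in> L)" and fin: "finite A"
    and d: "\<And>a b. a \<in> A \<Longrightarrow> b \<in> A \<Longrightarrow> a - b \<in> L \<Longrightarrow> a = b"
  shows "(\<Sum>x \<in> {x \<in> torus L. P1_value f0 ` x = {q}}. torus_ram_index f0 x) = (\<Sum>a\<in>A. ram_index f0 a)"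
proof -
  let ?c = "\<lambda>z. (+) z ` L"
  have "{x \<in> torus L. P1_value f0 ` x = {q}} = ?c ` A"
    unfolding f0_fibre_class
  proof (intro equalityI subsetI)
    fix x assume "x \<in> ?c ` {z. P1_value f0 z = q}"
    then obtain z where z: "x = ?c z" "P1_value f0 z = q" by blast
    then obtain a where a: "a \<in> A" "z - a \<in> L" using A by blast
    then show "x \<in> ?c ` A" using z class_eq_iff[OF is_lattice_L, of z a] by blast
  next
    fix x assume "x \<in> ?c ` A"
    then obtain a where "x = ?c a" "a \<in> A" by blast
    moreover have "P1_value f0 a = q" using A[of a] \<open>a \<in> A\<close> by (metis L_0 diff_self)
    ultimately show "x \<in> ?c ` {z. P1_value f0 z = q}" by blast
  qed
  moreover have "inj_on ?c A"
    by (rule inj_onI) (use d class_eq_iff[OF is_lattice_L] in blast)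
  ultimately have "(\<Sum>x \<in> {x \<in> torus L. P1_value f0 ` x = {q}}. torus_ram_index f0 x)
      = (\<Sum>a\<in>A. torus_ram_index f0 (?c a))" by (simp add: sum.reindex)
  also have "\<dots> = (\<Sum>a\<in>A. ram_index f0 a)"
    by (rule sum.cong[OF refl]) (rule image_periodic(2)[OF is_lattice_L f0_periodic])
  finally show ?thesis .
qed

lemma FG_eq_iff: "z \<notin> L \<Longrightarrow> w \<notin> L \<Longrightarrow> z - w \<in> L \<longleftrightarrow> wF z = wF w \<and> wG z = wG w"
  using FG_injective[of z w] F_periodic[of "z - w" w] G_periodic[of "z - w" w] by auto

lemma L_diff_iff: "a \<notin> L \<Longrightarrow> z - a \<in> L \<Longrightarrow> z \<notin> L"
  using L_diff[of z "z - a"] by auto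

text \<open>A fibre is either a single class of index 3 or consists of the three unramified classes
  of z, \<epsilon> z and \<epsilon>^2 z.\<close>

lemma f0_degree: "has_degree L f0 3"
  unfolding has_degree_def
proof
  fix q :: "(complex^2) set" assume "q \<in> proj_space"
  then consider "q = pt_inf" | s where "q = pt s" unfolding proj_space_2 by blast
  then show "(\<Sum>x \<in> {x \<in> torus L. P1_value f0 ` x = {q}}. torus_ram_index f0 x) = int 3"
  proof cases
    case 1
    show ?thesis by (subst f0_sum[of q "{0}"]) (auto simp: 1 f0_P1 f0_ram)
  next
    case (2 s)
    obtain z where z: "z \<notin> L" "wF z = s" by (rule F_surjective)
    show ?thesis
    proof (cases "wG z = 0")
      case True
      have "P1_value f0 w = q \<longleftrightarrow> (\<exists>a\<in>{z}. w - a \<in> L)" for w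
      proof (cases "w \<in> L")
        case True then show ?thesis using L_diff_iff[OF z(1), of w] by (auto simp: 2 f0_P1)
      next
        case False
        then show ?thesis using FG_eq_iff[OF False z(1)] fixed_values[OF False] fixed_values[OF z(1)] z True
          by (auto simp: 2 f0_P1)
      qed
      then show ?thesis by (subst f0_sum[of q "{z}"]) (use True in \<open>auto simp: f0_ram\<close>)
    next
      case nz: False
      let ?A = "{z, \<epsilon> * z, \<epsilon> * (\<epsilon> * z)}"
      have AL: "a \<notin> L" "wF a = s" if "a \<in> ?A" for a using that z by (auto simp: F_eps)
      have G3: "wG (\<epsilon> * z) = \<epsilon> * wG z" "wG (\<epsilon> * (\<epsilon> * z)) = \<epsilon> * (\<epsilon> * wG z)" by (simp_all add: G_eps)
      have e2: "\<epsilon> * \<epsilon> \<noteq> 1" using eps3 eps1 by (auto simp: power3_eq_cube)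
      have d: "a = b" if ab: "a \<in> ?A" "b \<in> ?A" "a - b \<in> L" for a b
      proof -
        have "wG a = wG b" using FG_eq_iff[OF AL(1)[OF ab(1)] AL(1)[OF ab(2)]] ab(3) by blast
        then show ?thesis using ab(1,2) G3 nz eps1 eps_nz e2 by (auto simp: mult.assoc[symmetric])
      qed
      have zz: "z \<noteq> 0" using z by auto
      have "P1_value f0 w = q \<longleftrightarrow> (\<exists>a\<in>?A. w - a \<in> L)" for w
      proof (cases "w \<in> L")
        case True then show ?thesis using L_diff_iff[OF AL(1), of _ w] by (auto simp: 2 f0_P1)
      next
        case False
        show ?thesis
        proof
          assume "P1_value f0 w = q"
          then have w: "wF w = s" using False by (simp add: 2 f0_P1)
          then have "wG z ^ 3 = wG w ^ 3" using FG_curve[OF False] FG_curve[OF z(1)] z by simp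
          from cube_eq[OF this] have "\<exists>a\<in>?A. wG w = wG a" by (auto simp: G3)
          then obtain a where a: "a \<in> ?A" "wG w = wG a" by blast
          then show "\<exists>a\<in>?A. w - a \<in> L" using FG_eq_iff[OF False AL(1)[OF a(1)]] w AL(2)[OF a(1)] by blast
        next
          assume "\<exists>a\<in>?A. w - a \<in> L"
          then obtain a where a: "a \<in> ?A" "w - a \<in> L" by blast
          then show "P1_value f0 w = q" using FG_eq_iff[OF False AL(1)[OF a(1)]] AL(2)[OF a(1)] False by (simp add: 2 f0_P1)
        qed
      qed
      then have "(\<Sum>x \<in> {x \<in> torus L. P1_value f0 ` x = {q}}. torus_ram_index f0 x) = (\<Sum>a\<in>?A. ram_index f0 a)"
      proof (rule f0_sum)
        show "finite ?A" by simp
        show "a = b" if "a \<in> ?A" "b \<in> ?A" "a - b \<in> L" for a b by (rule d[OF that])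
      qed
      also have "\<dots> = (\<Sum>a\<in>?A. 1)"
        by (rule sum.cong[OF refl]) (use AL nz G3 eps_nz in \<open>auto simp: f0_ram\<close>)
      also have "\<dots> = 3" using zz eps1 eps_nz e2 by (simp add: mult.assoc[symmetric])
      finally show ?thesis by simp
    qed
  qed
qed

lemma std_cover: "equianharmonic_cover L f0 M_std"
proof -
  obtain p where p: "p \<notin> L" "wF p = 0" "wG p = 0" "of_nat (3 * 1) * p \<in> L" by (rule fixed_point_0)
  have p': "- p \<notin> L" "wF (- p) = - 1" "wG (- p) = 0" using p by (auto simp: F_uminus G_uminus)
  let ?c = "\<lambda>z. (+) z ` L"
  have fixed: "z \<in> L \<or> wG z = 0 \<longleftrightarrow> ?c z = ?c 0 \<or> ?c z = ?c p \<or> ?c z = ?c (- p)" for z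
  proof (cases "z \<in> L")
    case True then show ?thesis using class_eq_iff[OF is_lattice_L, of z 0] by simp
  next
    case False
    then show ?thesis
      unfolding class_eq_iff[OF is_lattice_L] FG_eq_iff[OF False p(1)] FG_eq_iff[OF False p'(1)]
      using fixed_values[OF False] p p' by auto
  qed
  have "{x \<in> torus L. torus_ram_index f0 x = 3} = {?c 0, ?c p, ?c (- p)}"
  proof (intro equalityI subsetI)
    fix x assume x: "x \<in> {x \<in> torus L. torus_ram_index f0 x = 3}"
    then obtain z where z: "x = ?c z" using torus_cases by blast
    have "ram_index f0 z = 3" using x image_periodic(2)[OF is_lattice_L f0_periodic, of z] z by simp
    then show "x \<in> {?c 0, ?c p, ?c (- p)}" using fixed[of z] z by (auto simp: f0_ram split: if_splits)
  next
    fix x assume "x \<in> {?c 0, ?c p, ?c (- p)}"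
    then obtain z where z: "x = ?c z" "z = 0 \<or> z = p \<or> z = - p" by blast
    then have "ram_index f0 z = 3" using p p' by (auto simp: f0_ram)
    then have "torus_ram_index f0 x = 3" unfolding z(1) by (simp add: image_periodic(2)[OF is_lattice_L f0_periodic])
    moreover have "x \<in> torus L" unfolding z(1) torus_def by blast
    ultimately show "x \<in> {x \<in> torus L. torus_ram_index f0 x = 3}" by simp
  qed
  moreover have "card {?c 0, ?c p, ?c (- p)} = 3"
  proof -
    have "?c 0 \<noteq> ?c p" "?c 0 \<noteq> ?c (- p)" "?c p \<noteq> ?c (- p)"
      unfolding class_eq_iff[OF is_lattice_L] FG_eq_iff[OF p(1) p'(1)] using p p' by auto
    then show ?thesis by simp
  qed
  moreover have "{P1_value f0 z | z. ram_index f0 z \<ge> 2} = M_std"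
  proof (intro equalityI subsetI)
    fix q assume "q \<in> {P1_value f0 z | z. ram_index f0 z \<ge> 2}"
    then obtain z where "q = P1_value f0 z" "ram_index f0 z \<ge> 2" by blast
    then show "q \<in> M_std" using fixed_values[of z] by (auto simp: f0_P1 f0_ram M_std_def split: if_splits)
  next
    fix q assume "q \<in> M_std"
    then have "q = P1_value f0 0 \<or> q = P1_value f0 p \<or> q = P1_value f0 (- p)"
      using p p' by (auto simp: M_std_def f0_P1)
    moreover have "ram_index f0 0 \<ge> 2" "ram_index f0 p \<ge> 2" "ram_index f0 (- p) \<ge> 2" using p p' by (auto simp: f0_ram)
    ultimately show "q \<in> {P1_value f0 z | z. ram_index f0 z \<ge> 2}" by blast
  qed
  ultimately show ?thesis
    using is_lattice_L f0_nice f0_periodic f0_degree by (simp add: equianharmonic_cover_def)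
qed

lemma torsion_params_std_superset: "pt ` SF m \<subseteq> torsion_params M_std (3 * m)"
proof clarify
  fix s assume "s \<in> SF m"
  then obtain z where z: "z \<in> tor m" "s = wF z" by (auto simp: SF_def)
  then have zL: "z \<notin> L" "wG z \<noteq> 0" "of_nat (3 * m) * z \<in> L" by (auto simp: tor_def)
  have "pt s = P1_value f0 z" using zL z by (simp add: f0_P1)
  moreover have "of_nat (3 * m) * (z - 0) \<in> L" using zL by simp
  moreover have "ram_index f0 0 = 3" by (simp add: f0_ram)
  moreover have "pt s \<notin> M_std" using zL z fixed_values[OF zL(1)] by (simp add: M_std_def)
  ultimately show "pt s \<in> torsion_params M_std (3 * m)"
    unfolding torsion_params_def using std_cover by blast
qed

end

section \<open>Uniqueness of equianharmonic covers\<close>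

lemma ram_index_ge_1:
  assumes f: "f nicely_meromorphic_on UNIV" and nc: "nonconst f" shows "ram_index f z \<ge> 1"
proof (cases "is_pole f z")
  case True
  then show ?thesis using isolated_pole_imp_neg_zorder[of f z] nicely_meromorphic_at[OF f, of z]
    by (simp add: ram_index_def)
next
  case False
  then have an: "f analytic_on {z}" using nicely_meromorphic_at[OF f] by blast
  have "((\<lambda>w. f w - f z) \<longlongrightarrow> f z - f z) (at z)"
    using analytic_at_imp_isCont[OF an] by (intro tendsto_intros) (simp add: isCont_def)
  moreover have "eventually (\<lambda>w. f w \<noteq> f z) (at z)" using nc by (simp add: nonconst_def)
  ultimately have "isolated_zero (\<lambda>w. f w - f z) z" by (simp add: isolated_zero_def)
  then have "zorder (\<lambda>w. f w - f z) z > 0"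
    by (rule zorder_isolated_zero_pos) (intro analytic_intros an)
  then show ?thesis using False by (simp add: ram_index_def)
qed

lemma M_std_card: "card M_std = 3" "finite M_std" by (simp_all add: M_std_def)

lemma M_std_sub: "M_std \<subseteq> proj_space" by (simp add: M_std_def)

text \<open>A class of index 3 exhausts the degree, so it is alone in its fibre. The three such
  classes therefore have different values, and these fill the three branch points.\<close>

lemma cover_std_ram:
  assumes cov: "equianharmonic_cover \<Lambda> f M_std" and z: "P1_value f z \<in> M_std"
  shows "ram_index f z = 3"
proof -
  have lat: "is_lattice \<Lambda>" and f: "f nicely_meromorphic_on UNIV"
    and per: "\<And>z w. w \<in> \<Lambda> \<Longrightarrow> f (z + w) = f z" and deg: "has_degree \<Lambda> f 3"
    and cY: "card {x \<in> torus \<Lambda>. torus_ram_index f x = 3} = 3"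
    and M: "{P1_value f z | z. ram_index f z \<ge> 2} = M_std"
    using cov by (auto simp: equianharmonic_cover_def)
  note nc = equianharmonic_cover_nonconst[OF cov]
  let ?c = "\<lambda>z. (+) z ` \<Lambda>"
  let ?R = "torus_ram_index f"
  note img = image_periodic[OF lat per]
  define Y where "Y = {x \<in> torus \<Lambda>. ?R x = 3}"
  have finY: "finite Y" using cY unfolding Y_def by (metis card.infinite zero_neq_numeral)
  define val where "val x = the_elem (P1_value f ` x)" for x
  have val: "val (?c z) = P1_value f z" for z using img(1)[of z] by (simp add: val_def)
  define Fib where "Fib q = {x \<in> torus \<Lambda>. P1_value f ` x = {q}}" for q
  have cls: "\<exists>z. x = ?c z" if "x \<in> torus \<Lambda>" for x using that unfolding torus_def by blast
  have in_torus: "?c z \<in> torus \<Lambda>" for z unfolding torus_def by blast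
  have Fib_iff: "?c z \<in> Fib q \<longleftrightarrow> P1_value f z = q" for z q using img(1)[of z] in_torus[of z] by (simp add: Fib_def)
  have Rge: "?R x \<ge> 1" if "x \<in> torus \<Lambda>" for x
    using cls[OF that] img(2) ram_index_ge_1[OF f nc] by auto
  have sum3: "sum ?R (Fib q) = 3" if "q \<in> proj_space" for q
    using deg that unfolding has_degree_def Fib_def by simp
  have two: "?R x + ?R y \<le> 3" if "x \<in> Fib q" "y \<in> Fib q" "x \<noteq> y" "q \<in> proj_space" for x y q
  proof -
    have "finite (Fib q)" using sum3[OF that(4)] by (metis sum.infinite zero_neq_numeral)
    then have "sum ?R {x, y} \<le> sum ?R (Fib q)"
      by (intro sum_mono2) (use that Rge in \<open>auto simp: Fib_def intro: order_trans[of 0 1]\<close>)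
    then show ?thesis using sum3[OF that(4)] that(3) by simp
  qed
  have valY: "val ` Y \<subseteq> M_std"
  proof clarify
    fix x assume x: "x \<in> Y"
    then have "x \<in> torus \<Lambda>" by (simp add: Y_def)
    from cls[OF this] obtain z where z: "x = ?c z" by blast
    then have "ram_index f z = 3" using x img(2)[of z] by (simp add: Y_def)
    then show "val x \<in> M_std" unfolding M[symmetric] z val by force
  qed
  have FibY: "x \<in> Fib (val x)" if "x \<in> torus \<Lambda>" for x using cls[OF that] Fib_iff val by auto
  have "inj_on val Y"
  proof (rule inj_onI, rule ccontr)
    fix x y assume xy: "x \<in> Y" "y \<in> Y" "val x = val y" "x \<noteq> y"
    then have "x \<in> torus \<Lambda>" "y \<in> torus \<Lambda>" by (simp_all add: Y_def)
    then have "x \<in> Fib (val x)" "y \<in> Fib (val x)" using FibY[of x] FibY[of y] xy(3) by simp_all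
    moreover have "val x \<in> proj_space" using xy valY M_std_sub by blast
    ultimately have "?R x + ?R y \<le> 3" using two xy(4) by blast
    then show False using xy by (simp add: Y_def)
  qed
  then have "card (val ` Y) = card M_std" using cY by (simp add: card_image Y_def M_std_card)
  then have "val ` Y = M_std" using valY M_std_card by (intro card_subset_eq) auto
  then obtain y where y: "y \<in> Y" "val y = P1_value f z" using z by (metis imageE)
  have "y = ?c z"
  proof (rule ccontr)
    assume ne: "y \<noteq> ?c z"
    have "y \<in> Fib (P1_value f z)" using FibY[of y] y by (simp add: Y_def)
    moreover have "?c z \<in> Fib (P1_value f z)" using Fib_iff by blast
    ultimately have "?R y + ?R (?c z) \<le> 3" using two ne by simp
    then show False using y Rge[OF in_torus, of z] by (simp add: Y_def)
  qed
  then show ?thesis using y img(2)[of z] by (simp add: Y_def)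
qed

lemma local_form_deriv:
  assumes g: "g holomorphic_on ball z r" and f: "\<And>w. w \<in> ball z r - {z} \<Longrightarrow> f w = c + g w * (w - z) powi n"
    and w: "w \<in> ball z r - {z}"
  shows "deriv f w = (w - z) powi (n - 1) * (deriv g w * (w - z) + of_int n * g w)"
proof -
  have "open (ball z r - {z})" by (intro open_Diff) auto
  from eventually_nhds_in_open[OF this w]
  have "eventually (\<lambda>x. f x = c + g x * (x - z) powi n) (nhds w)"
    by (rule eventually_mono) (rule f)
  then have "deriv f w = deriv (\<lambda>x. c + g x * (x - z) powi n) w" by (rule deriv_cong_ev) simp
  also have "\<dots> = g w * (of_int n * (w - z) powi (n - 1)) + deriv g w * (w - z) powi n"
    by (rule DERIV_imp_deriv) (use w in \<open>auto intro!: derivative_eq_intros holomorphic_derivI[OF g]\<close>)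
  also have "(w - z) powi n = (w - z) powi (n - 1) * (w - z)"
    using power_int_add[of "w - z" "n - 1" 1] w by simp
  finally show ?thesis by (simp add: algebra_simps)
qed

text \<open>The quotient has order 0 everywhere. At a triple pole numerator and denominator both
  have order -12, at a triple value 0 or -1 both have order 6, and elsewhere f is unramified, so
  neither vanishes.\<close>

lemma cover_std_quotient_limit:
  assumes cov: "equianharmonic_cover \<Lambda> f M_std"
  shows "\<exists>l. l \<noteq> 0 \<and> ((\<lambda>z. deriv f z ^ 3 / (f z * (f z + 1))^2) \<longlongrightarrow> l) (at z)"
proof -
  have f: "f nicely_meromorphic_on UNIV" and M: "{P1_value f z | z. ram_index f z \<ge> 2} = M_std"
    using cov by (auto simp: equianharmonic_cover_def)
  note nc = equianharmonic_cover_nonconst[OF cov] and fat = nicely_meromorphic_at[OF f]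
  let ?q = "\<lambda>z. deriv f z ^ 3 / (f z * (f z + 1))^2"
  show ?thesis
  proof (cases "P1_value f z \<in> M_std")
    case True
    then have ram: "ram_index f z = 3" using cover_std_ram[OF cov] by blast
    show ?thesis
    proof (cases "is_pole f z")
      case pole: True
      then have zo: "zorder f z = - 3" using ram by (simp add: ram_index_def)
      have fr: "frequently (\<lambda>w. f w \<noteq> 0) (at z)" using nc by (simp add: nonconst_def eventually_frequently)
      define g where "g = zor_poly f z"
      obtain r where r: "r > 0" "g holomorphic_on cball z r" "g z \<noteq> 0"
        "\<forall>w\<in>cball z r - {z}. f w = g w * (w - z) powi (-3) \<and> g w \<noteq> 0"
        using zorder_exist[OF fat(2,3) fr] unfolding g_def[symmetric] zo by blast
      have g: "g holomorphic_on ball z r" using r(2) by (rule holomorphic_on_subset) auto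
      \<comment> \<open>Obtained by inserting f = g p^(-3) with p = w - z and cancelling
        p^(-12).\<close>
      let ?k = "\<lambda>w. (deriv g w * (w - z) - 3 * g w)^3 / (g w * (g w + (w - z)^3))^2"
      have ev: "eventually (\<lambda>w. w \<in> ball z r - {z}) (at z)" using r(1) by (intro eventually_at_in_open) auto
      have "eventually (\<lambda>w. ?k w = ?q w) (at z)" using ev
      proof eventually_elim
        case (elim w)
        define p where "p = w - z"
        have p0: "p \<noteq> 0" using elim by (simp add: p_def)
        have fw: "f w = g w / p^3" using r(4) elim by (auto simp: p_def power_int_minus divide_inverse)
        have "deriv f w = (w - z) powi (-3 - 1) * (deriv g w * (w - z) + of_int (-3) * g w)"
          by (rule local_form_deriv[OF g _ elim, where c = 0]) (use r(4) in auto)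
        then have "deriv f w = (deriv g w * p - 3 * g w) / p^4"
          by (simp add: p_def power_int_minus divide_inverse mult.commute)
        moreover have "f w * (f w + 1) = g w * (g w + p^3) / p^6"
        proof -
          have "p^6 = p^3 * p^3" by (simp flip: power_add)
          then show ?thesis unfolding fw using p0 by (simp add: field_simps)
        qed
        ultimately show ?case unfolding p_def[symmetric] using p0 by (simp add: power_divide flip: power_mult)
      qed
      moreover have "(?k \<longlongrightarrow> (deriv g z * (z - z) - 3 * g z)^3 / (g z * (g z + (z - z)^3))^2) (at z)"
      proof (intro tendsto_intros)
        have "isCont g z" "isCont (deriv g) z"
          using r(1) g holomorphic_deriv[OF g] by (auto intro!: continuous_on_interior[OF holomorphic_on_imp_continuous_on])
        then show "(g \<longlongrightarrow> g z) (at z)" "(g \<longlongrightarrow> g z) (at z)" "(g \<longlongrightarrow> g z) (at z)" "(deriv g \<longlongrightarrow> deriv g z) (at z)" by (auto simp: isCont_def)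
      qed (use r(3) in auto)
      ultimately have "(?q \<longlongrightarrow> (deriv g z * (z - z) - 3 * g z)^3 / (g z * (g z + (z - z)^3))^2) (at z)"
        by (rule Lim_transform_eventually[rotated])
      then show ?thesis using r(3) by (intro exI conjI) (auto simp: power_mult_distrib)
    next
      case np: False
      define e where "e = f z"
      have e01: "e = 0 \<or> e = - 1" using True np by (auto simp: P1_value_alt M_std_def e_def)
      have zo: "zorder (\<lambda>w. f w - e) z = 3" using ram np by (simp add: ram_index_def e_def)
      have an: "(\<lambda>w. f w - e) analytic_on {z}" using fat np by (intro analytic_intros) auto
      have fr: "frequently (\<lambda>w. f w - e \<noteq> 0) (at z)" using nc by (simp add: nonconst_def eventually_frequently)
      define g where "g = zor_poly (\<lambda>w. f w - e) z"
      obtain r where r: "r > 0" "g holomorphic_on cball z r" "g z \<noteq> 0"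
        "\<forall>w\<in>cball z r - {z}. f w - e = g w * (w - z) powi 3 \<and> g w \<noteq> 0"
        using zorder_exist[OF isolated_singularity_at_analytic[OF an] not_essential_analytic[OF an] fr]
        unfolding g_def[symmetric] zo by blast
      have g: "g holomorphic_on ball z r" using r(2) by (rule holomorphic_on_subset) auto
      \<comment> \<open>Since e (e + 1) = 0, the product f (f + 1) is p^3 g (g p^3 + 2e + 1) with p
        = w - z, and 2e + 1 is 1 or -1.\<close>
      let ?k = "\<lambda>w. (deriv g w * (w - z) + 3 * g w)^3 / (g w * (g w * (w - z)^3 + (2 * e + 1)))^2"
      have ev: "eventually (\<lambda>w. w \<in> ball z r - {z}) (at z)" using r(1) by (intro eventually_at_in_open) auto
      have "eventually (\<lambda>w. ?k w = ?q w) (at z)" using ev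
      proof eventually_elim
        case (elim w)
        define p where "p = w - z"
        have p0: "p \<noteq> 0" using elim by (simp add: p_def)
        have fe: "f w = e + g w * (w - z) powi 3" if "w \<in> ball z r - {z}" for w
          using r(4) that by (auto simp: algebra_simps dest!: bspec[of _ _ w])
        then have fw: "f w = e + g w * p^3" using elim by (simp add: p_def)
        have "deriv f w = (w - z) powi (3 - 1) * (deriv g w * (w - z) + of_int 3 * g w)"
          by (rule local_form_deriv[OF g fe elim])
        then have d: "deriv f w = p^2 * (deriv g w * p + 3 * g w)" by (simp add: p_def)
        have ff: "f w * (f w + 1) = p^3 * (g w * (g w * p^3 + (2 * e + 1)))"
          unfolding fw using e01 by (auto simp: algebra_simps)
        have "(p^2)^3 = (p^3)^2" by (simp flip: power_mult)
        then show ?case unfolding d ff p_def[symmetric] power_mult_distrib using p0 by simp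
      qed
      moreover have "(?k \<longlongrightarrow> (deriv g z * (z - z) + 3 * g z)^3 / (g z * (g z * (z - z)^3 + (2 * e + 1)))^2) (at z)"
      proof (intro tendsto_intros)
        have "isCont g z" "isCont (deriv g) z"
          using r(1) g holomorphic_deriv[OF g] by (auto intro!: continuous_on_interior[OF holomorphic_on_imp_continuous_on])
        then show "(g \<longlongrightarrow> g z) (at z)" "(g \<longlongrightarrow> g z) (at z)" "(g \<longlongrightarrow> g z) (at z)" "(deriv g \<longlongrightarrow> deriv g z) (at z)" by (auto simp: isCont_def)
      qed (use r(3) e01 in auto)
      ultimately have "(?q \<longlongrightarrow> (deriv g z * (z - z) + 3 * g z)^3 / (g z * (g z * (z - z)^3 + (2 * e + 1)))^2) (at z)"
        by (rule Lim_transform_eventually[rotated])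
      then show ?thesis using r(3) e01 by (intro exI conjI) (auto simp: power_mult_distrib)
    qed
  next
    case False
    then have np: "\<not> is_pole f z" and f01: "f z \<noteq> 0" "f z \<noteq> - 1"
      by (auto simp: P1_value_alt M_std_def split: if_splits)
    have an: "f analytic_on {z}" using fat np by blast
    then obtain S where S: "open S" "z \<in> S" "f holomorphic_on S" by (auto simp: analytic_at)
    have "\<not> ram_index f z \<ge> 2" using False M by blast
    then have r1: "ram_index f z = 1" using ram_index_ge_1[OF f nc, of z] by simp
    have dnz: "deriv f z \<noteq> 0"
    proof
      assume d0: "deriv f z = 0"
      define u where "u = (\<lambda>w. f w - f z)"
      have zo: "zorder u z = 1" using r1 np by (simp add: ram_index_def u_def)
      have ua: "u analytic_on {z}" unfolding u_def by (intro analytic_intros an)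
      have fr: "frequently (\<lambda>w. u w \<noteq> 0) (at z)" using nc by (simp add: u_def nonconst_def eventually_frequently)
      define g where "g = zor_poly u z"
      obtain r where r: "r > 0" "g holomorphic_on cball z r" "g z \<noteq> 0"
        "\<forall>w\<in>cball z r - {z}. u w = g w * (w - z) powi 1 \<and> g w \<noteq> 0"
        using zorder_exist[OF isolated_singularity_at_analytic[OF ua] not_essential_analytic[OF ua] fr]
        unfolding g_def[symmetric] zo by blast
      have g: "g holomorphic_on ball z r" using r(2) by (rule holomorphic_on_subset) auto
      have fg: "f w = f z + g w * (w - z)" if "w \<in> ball z r" for w
        using r(4) that by (cases "w = z") (auto simp: u_def algebra_simps dest!: bspec[of _ _ w])
      have "z \<in> ball z r" using r(1) by simp
      from eventually_nhds_in_open[OF open_ball this]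
      have "eventually (\<lambda>w. f w = f z + g w * (w - z)) (nhds z)"
        by (rule eventually_mono) (rule fg)
      then have "deriv f z = deriv (\<lambda>w. f z + g w * (w - z)) z" by (rule deriv_cong_ev) simp
      also have "\<dots> = g z"
      proof (rule DERIV_imp_deriv)
        have "(g has_field_derivative deriv g z) (at z)" using r(1) by (intro holomorphic_derivI[OF g]) auto
        from DERIV_add[OF DERIV_const[of "f z"] DERIV_mult[OF this DERIV_diff[OF DERIV_ident DERIV_const[of z]]]]
        show "((\<lambda>w. f z + g w * (w - z)) has_field_derivative g z) (at z)" by simp
      qed
      finally show False using d0 r(3) by simp
    qed
    have f1: "f z + 1 \<noteq> 0" using f01(2) by (simp add: add_eq_0_iff2)
    have "isCont f z" "isCont (deriv f) z"
      using S holomorphic_deriv[OF S(3,1)] by (auto intro!: continuous_on_interior[OF holomorphic_on_imp_continuous_on] simp: interior_open)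
    then have "(?q \<longlongrightarrow> ?q z) (at z)"
      using f01 f1 by (intro tendsto_intros) (auto simp: isCont_def)
    then show ?thesis using dnz f01 f1 by (intro exI conjI) auto
  qed
qed

text \<open>Filling in its limits makes the quotient an entire periodic function, hence a constant;
  it is nonzero because all the limits are.\<close>

lemma cover_std_ode:
  assumes cov: "equianharmonic_cover \<Lambda> f M_std"
  obtains C where "C \<noteq> 0" "\<And>z. P1_value f z \<notin> M_std \<Longrightarrow> deriv f z ^ 3 = C * (f z ^ 2 + f z) ^ 2"
proof -
  have lat: "is_lattice \<Lambda>" and f: "f nicely_meromorphic_on UNIV"
    and per: "\<And>z w. w \<in> \<Lambda> \<Longrightarrow> f (z + w) = f z"
    using cov by (auto simp: equianharmonic_cover_def)
  note fat = nicely_meromorphic_at[OF f]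
  define q where "q = (\<lambda>z. deriv f z ^ 3 / (f z * (f z + 1))^2)"
  define h where "h = remove_sings q"
  have lim: "\<exists>l. l \<noteq> 0 \<and> (q \<longlongrightarrow> l) (at z)" for z
    unfolding q_def by (rule cover_std_quotient_limit[OF cov])
  have hl: "h z \<noteq> 0" "(q \<longlongrightarrow> h z) (at z)" for z
  proof -
    obtain l where l: "l \<noteq> 0" "(q \<longlongrightarrow> l) (at z)" using lim by blast
    have "h z = l" unfolding h_def by (rule remove_sings_eqI[OF l(2)])
    then show "h z \<noteq> 0" "(q \<longlongrightarrow> h z) (at z)" using l by auto
  qed
  have fm: "f meromorphic_on UNIV" using f by (simp add: nicely_meromorphic_on_def)
  have qm: "q meromorphic_on UNIV" unfolding q_def by (intro meromorphic_intros fm)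
  have hn: "h nicely_meromorphic_on UNIV" unfolding h_def by (rule remove_sings_nicely_meromorphic[OF qm])
  have "\<not> is_pole h z" for z
  proof
    assume "is_pole h z"
    moreover have "isolated_singularity_at q z" using meromorphic_on_subset[OF qm, of "{z}"] by (simp add: meromorphic_at_iff)
    ultimately have "is_pole q z" unfolding h_def by simp
    then show False using hl(2)[of z] not_tendsto_and_filterlim_at_infinity[of "at z" q] by (auto simp: is_pole_def)
  qed
  then have "h analytic_on {z}" for z using nicely_meromorphic_at(4)[OF hn] by blast
  then have hol: "h holomorphic_on UNIV" by (intro analytic_imp_holomorphic) (subst analytic_on_analytic_at, blast)
  have dper: "deriv f (z + w) = deriv f z" if "w \<in> \<Lambda>" for z w
    unfolding deriv_def DERIV_shift using per[OF that] by simp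
  have qper: "q (z + w) = q z" if "w \<in> \<Lambda>" for z w
    using per[OF that] dper[OF that] by (simp add: q_def)
  have hper: "h (z + w) = h z" if w: "w \<in> \<Lambda>" for z w
  proof -
    have "((\<lambda>x. q (x + w)) \<longlongrightarrow> h (z + w)) (at (z + w - w))" by (rule LIM_offset[OF hl(2)])
    then have "(q \<longlongrightarrow> h (z + w)) (at z)" by (simp add: qper[OF w])
    then show ?thesis using hl(2)[of z] by (rule tendsto_unique[rotated]) simp
  qed
  have const: "h z = h 0" for z using entire_periodic_constant[OF lat hol hper] by blast
  show ?thesis
  proof (rule that[of "h 0"])
    show "h 0 \<noteq> 0" by (rule hl)
    fix z assume z: "P1_value f z \<notin> M_std"
    then have np: "\<not> is_pole f z" and f01: "f z \<noteq> 0" "f z \<noteq> - 1"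
      by (auto simp: P1_value_alt M_std_def split: if_splits)
    have f1: "f z + 1 \<noteq> 0" using f01(2) by (simp add: add_eq_0_iff2)
    have an: "f analytic_on {z}" using fat np by blast
    have "q analytic_on {z}" unfolding q_def by (intro analytic_intros an) (use f01 f1 in auto)
    then have "q z = h z" unfolding h_def by simp
    then have "deriv f z ^ 3 / (f z * (f z + 1))^2 = h 0" using const[of z] by (simp add: q_def)
    moreover have "(f z * (f z + 1))^2 \<noteq> 0" using f01 f1 by simp
    ultimately have "deriv f z ^ 3 = h 0 * (f z * (f z + 1))^2" by (metis nonzero_divide_eq_eq)
    then show "deriv f z ^ 3 = h 0 * (f z ^ 2 + f z) ^ 2" by (simp add: power2_eq_square algebra_simps)
  qed
qed

lemma no_islimpt_imp_countable:
  fixes X :: "complex set"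
  assumes "\<And>z. \<not> z islimpt X" shows "countable X"
proof -
  have "finite (cball 0 (real n) \<inter> X)" for n
    by (rule finite_not_islimpt_in_compact) (use assms in auto)
  then have "countable (\<Union>n. cball 0 (real n) \<inter> X)" by (intro countable_UN) (auto intro: countable_finite)
  moreover have "X \<subseteq> (\<Union>n. cball 0 (real n) \<inter> X)"
    using real_arch_simple by (auto simp: dist_norm)
  ultimately show ?thesis using countable_subset by blast
qed

context cube_root begin

text \<open>A cube root of the constant turns the equation for f into the first-order system
  satisfied by \<open>wF\<close> and \<open>wG\<close>, up to a factor in the time variable.
  Matching one initial point makes the two solutions agree.\<close>

lemma cover_std_affine:
  assumes cov: "equianharmonic_cover \<Lambda> f M_std"
  obtains \<alpha> \<beta> where "\<alpha> \<noteq> 0" "\<And>z. P1_value f z = P1_value f0 (\<alpha> * z + \<beta>)"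
proof -
  have f: "f nicely_meromorphic_on UNIV" using cov by (simp add: equianharmonic_cover_def)
  note nc = equianharmonic_cover_nonconst[OF cov] and fat = nicely_meromorphic_at[OF f]
  obtain C where C: "C \<noteq> 0" "\<And>z. P1_value f z \<notin> M_std \<Longrightarrow> deriv f z ^ 3 = C * (f z ^ 2 + f z) ^ 2"
    by (rule cover_std_ode[OF cov]) blast
  obtain \<kappa> where \<kappa>: "C = \<kappa>^3" by (rule exists_complex_root[of 3 C]) auto
  have \<kappa>0: "\<kappa> \<noteq> 0" using C(1) \<kappa> by auto
  define X where "X = {z. P1_value f z \<in> M_std}"
  have X_iff: "z \<notin> X \<longleftrightarrow> \<not> is_pole f z \<and> f z \<noteq> 0 \<and> f z \<noteq> - 1" for z
    by (auto simp: X_def P1_value_alt M_std_def)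
  have ev: "eventually (\<lambda>w. w \<notin> X) (at z)" for z
  proof -
    obtain r where r: "r > 0" "f analytic_on ball z r - {z}" using fat(2) by (auto simp: isolated_singularity_at_def)
    have "eventually (\<lambda>w. w \<in> ball z r - {z}) (at z)" using r(1) by (intro eventually_at_in_open) auto
    moreover have "eventually (\<lambda>w. f w \<noteq> 0) (at z)" "eventually (\<lambda>w. f w \<noteq> - 1) (at z)"
      using nc by (simp_all add: nonconst_def)
    ultimately show ?thesis
    proof eventually_elim
      case (elim w)
      then have "f analytic_on {w}" using r(2) by (auto intro: analytic_on_subset)
      then show ?case using elim analytic_imp_not_pole X_iff by blast
    qed
  qed
  have Xlim: "\<not> z islimpt X" for z using ev[of z] by (simp add: islimpt_iff_eventually)
  then have closedX: "closed X" and countX: "countable X"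
    using no_islimpt_imp_countable by (auto simp: closed_limpt)
  have fan: "f analytic_on {z}" if "z \<notin> X" for z using fat(4) X_iff that by blast
  have fd: "(f has_field_derivative deriv f z) (at z)" if "z \<notin> X" for z
    using analytic_on_imp_differentiable_at[OF fan[OF that]] by (simp add: DERIV_deriv_iff_field_differentiable)
  have f1: "f z ^ 2 + f z \<noteq> 0" if "z \<notin> X" for z
  proof -
    have "f z * (f z + 1) \<noteq> 0" using X_iff that by (simp add: add_eq_0_iff2)
    then show ?thesis by (simp add: power2_eq_square algebra_simps)
  qed
  have ode: "deriv f z ^ 3 = \<kappa>^3 * (f z ^ 2 + f z) ^ 2" if "z \<notin> X" for z
    using C(2) that \<kappa> by (simp add: X_def)
  have d0: "deriv f z \<noteq> 0" if "z \<notin> X" for z using ode[OF that] f1[OF that] \<kappa>0 by auto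
  \<comment> \<open>The missing second coordinate of the curve. The differential equation says
    exactly that its cube is f^2 + f, and then f' = \<kappa> g^2.\<close>
  define g where "g z = \<kappa> * (f z ^ 2 + f z) / deriv f z" for z
  have g3: "g z ^ 3 = f z ^ 2 + f z" if "z \<notin> X" for z
  proof -
    have "g z ^ 3 = \<kappa>^3 * (f z ^ 2 + f z)^3 / deriv f z ^ 3" by (simp add: g_def power_divide power_mult_distrib)
    also have "\<dots> = f z ^ 2 + f z" unfolding ode[OF that] using f1[OF that] \<kappa>0
      by (simp add: power2_eq_square power3_eq_cube)
    finally show ?thesis .
  qed
  have g0: "g z \<noteq> 0" if "z \<notin> X" for z using g3[OF that] f1[OF that] by auto
  have f': "deriv f z = \<kappa> * g z ^ 2" if "z \<notin> X" for z
  proof -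
    have "g z * deriv f z = \<kappa> * g z ^ 3" using d0[OF that] unfolding g3[OF that] by (simp add: g_def)
    then show ?thesis using g0[OF that] by (simp add: power2_eq_square power3_eq_cube)
  qed
  have gan: "g analytic_on {z}" if "z \<notin> X" for z
    unfolding g_def using fan[OF that] d0[OF that] by (intro analytic_intros) auto
  have gd: "(g has_field_derivative \<kappa> / 3 * (2 * f z + 1)) (at z)" if z: "z \<notin> X" for z
  proof -
    have gd': "(g has_field_derivative deriv g z) (at z)"
      using analytic_on_imp_differentiable_at[OF gan[OF z]] by (simp add: DERIV_deriv_iff_field_differentiable)
    have "((\<lambda>z. g z ^ 3) has_field_derivative of_nat 3 * (deriv g z * g z ^ (3 - Suc 0))) (at z)"
      by (rule DERIV_power[OF gd'])
    moreover have "((\<lambda>z. f z ^ 2 + f z) has_field_derivative of_nat 2 * (deriv f z * f z ^ (2 - Suc 0)) + deriv f z) (at z)"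
      by (intro DERIV_add DERIV_power fd z)
    moreover have evz: "eventually (\<lambda>z. g z ^ 3 = f z ^ 2 + f z) (nhds z)"
    proof -
      have "z \<in> - X" using z by simp
      from eventually_nhds_in_open[OF open_Compl[OF closedX] this] show ?thesis
        by (rule eventually_mono) (simp add: g3)
    qed
    ultimately have "of_nat 3 * (deriv g z * g z ^ (3 - Suc 0)) = of_nat 2 * (deriv f z * f z ^ (2 - Suc 0)) + deriv f z"
      using DERIV_unique unfolding DERIV_cong_ev[OF refl evz refl] by blast
    then have "3 * deriv g z * g z ^ 2 = \<kappa> * (2 * f z + 1) * g z ^ 2" unfolding f'[OF z] by (simp add: algebra_simps)
    then have "3 * deriv g z = \<kappa> * (2 * f z + 1)" using g0[OF z] by simp
    then have "deriv g z = \<kappa> / 3 * (2 * f z + 1)" by (metis mult.commute nonzero_mult_div_cancel_left times_divide_eq_left zero_neq_numeral)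
    then show ?thesis using gd' by (simp only:)
  qed
  have "X \<noteq> UNIV" using countX uncountable_UNIV_complex by auto
  then obtain z1 where z1: "z1 \<notin> X" by blast
  obtain z2 where z2: "z2 \<notin> L" "wF z2 = f z1" "wG z2 = g z1"
    by (rule FG_surjective[of "f z1" "g z1"]) (use g3[OF z1] in auto)
  \<comment> \<open>The scale \<alpha> converts the factor \<open>wc\<close> into \<kappa>, and
    \<beta> sends z1 to the point z2 with the same coordinates.\<close>
  define \<alpha> where "\<alpha> = \<kappa> / wc"
  have \<alpha>: "\<alpha> \<noteq> 0" "\<alpha> * wc = \<kappa>" using \<kappa>0 wc_nz by (auto simp: \<alpha>_def)
  define \<beta> where "\<beta> = z2 - \<alpha> * z1"
  define B where "B = {z. \<alpha> * z + \<beta> \<in> L}"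
  have B_eq: "B = (\<lambda>u. (u - \<beta>) / \<alpha>) ` L"
    using \<alpha>(1) by (auto simp: B_def image_iff field_simps intro!: bexI[of _ "\<alpha> * _ + \<beta>"])
  have countB: "countable B" unfolding B_eq by (intro countable_image countable_L)
  have "continuous_on UNIV (\<lambda>z. \<alpha> * z + \<beta>)" by (intro continuous_intros)
  then have closedB: "closed B" unfolding B_def using closed_vimage[OF closed_L, of "\<lambda>z. \<alpha> * z + \<beta>"]
    by (simp add: vimage_def)
  define S where "S = - (X \<union> B)"
  have "open S" unfolding S_def using closedX closedB by (intro open_Compl closed_Un)
  moreover have "connected S" unfolding S_def by (rule connected_compl_countable) (use countX countB in auto)
  ultimately have S: "open S" "connected S" by auto
  have dF: "((\<lambda>z. wF (\<alpha> * z + \<beta>)) has_field_derivative wc * wG (\<alpha> * z + \<beta>) ^ 2 * \<alpha>) (at z)"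
    and dG: "((\<lambda>z. wG (\<alpha> * z + \<beta>)) has_field_derivative wc / 3 * (2 * wF (\<alpha> * z + \<beta>) + 1) * \<alpha>) (at z)"
    if "z \<notin> B" for z
  proof -
    have l: "((\<lambda>z. \<alpha> * z + \<beta>) has_field_derivative \<alpha>) (at z)" by (auto intro!: derivative_eq_intros)
    have n: "\<alpha> * z + \<beta> \<notin> L" using that by (simp add: B_def)
    show "((\<lambda>z. wF (\<alpha> * z + \<beta>)) has_field_derivative wc * wG (\<alpha> * z + \<beta>) ^ 2 * \<alpha>) (at z)"
      by (rule DERIV_chain2[OF F_deriv[OF n] l])
    show "((\<lambda>z. wG (\<alpha> * z + \<beta>)) has_field_derivative wc / 3 * (2 * wF (\<alpha> * z + \<beta>) + 1) * \<alpha>) (at z)"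
      by (rule DERIV_chain2[OF G_deriv[OF n] l])
  qed
  define u where "u z = f z - wF (\<alpha> * z + \<beta>)" for z
  define v where "v z = g z - wG (\<alpha> * z + \<beta>)" for z
  have du: "(u has_field_derivative \<kappa> * (g z + wG (\<alpha> * z + \<beta>)) * v z) (at z)" if "z \<in> S" for z
  proof -
    have z: "z \<notin> X" "z \<notin> B" using that by (auto simp: S_def)
    have "(u has_field_derivative deriv f z - wc * wG (\<alpha> * z + \<beta>) ^ 2 * \<alpha>) (at z)"
      unfolding u_def[abs_def] by (intro DERIV_diff fd dF z)
    moreover have "deriv f z - wc * wG (\<alpha> * z + \<beta>) ^ 2 * \<alpha> = \<kappa> * (g z + wG (\<alpha> * z + \<beta>)) * v z"
      unfolding f'[OF z(1)] \<alpha>(2)[symmetric] v_def by (simp add: power2_eq_square algebra_simps)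
    ultimately show ?thesis by simp
  qed
  have dv: "(v has_field_derivative 2 * \<kappa> / 3 * u z) (at z)" if "z \<in> S" for z
  proof -
    have z: "z \<notin> X" "z \<notin> B" using that by (auto simp: S_def)
    have "(v has_field_derivative \<kappa> / 3 * (2 * f z + 1) - wc / 3 * (2 * wF (\<alpha> * z + \<beta>) + 1) * \<alpha>) (at z)"
      unfolding v_def[abs_def] by (intro DERIV_diff gd dG z)
    moreover have "\<kappa> / 3 * (2 * f z + 1) - wc / 3 * (2 * wF (\<alpha> * z + \<beta>) + 1) * \<alpha> = 2 * \<kappa> / 3 * u z"
      unfolding \<alpha>(2)[symmetric] u_def by (simp add: algebra_simps)
    ultimately show ?thesis by (simp only:)
  qed
  have holu: "u holomorphic_on S" and holv: "v holomorphic_on S"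
    using du dv S(1) by (auto simp: holomorphic_on_open)
  have holg: "(\<lambda>z. \<kappa> * (g z + wG (\<alpha> * z + \<beta>))) holomorphic_on S"
  proof (intro holomorphic_intros)
    show "g holomorphic_on S" "(\<lambda>z. wG (\<alpha> * z + \<beta>)) holomorphic_on S"
      using gd dG S(1) by (auto simp: holomorphic_on_open S_def)
  qed
  have z1S: "z1 \<in> S" "u z1 = 0" "v z1 = 0" using z1 z2 by (auto simp: S_def B_def u_def v_def \<beta>_def)
  have u0: "u z = 0" if z: "z \<in> S" for z
    by (rule linear_ode_zero(1)[OF S z1S holu holv holg holomorphic_on_const _ _ z])
       (rule DERIV_imp_deriv, erule du, rule DERIV_imp_deriv, erule dv)
  have evS: "eventually (\<lambda>w. w \<in> S) (at z)" for z
  proof -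
    have l: "filterlim (\<lambda>w. \<alpha> * w + \<beta>) (at (\<alpha> * z + \<beta>)) (at z)"
    proof (rule filterlim_atI)
      show "((\<lambda>w. \<alpha> * w + \<beta>) \<longlongrightarrow> \<alpha> * z + \<beta>) (at z)" by (intro tendsto_intros)
      show "eventually (\<lambda>w. \<alpha> * w + \<beta> \<noteq> \<alpha> * z + \<beta>) (at z)"
        using \<alpha>(1) by (auto simp: eventually_at intro!: exI[of _ 1])
    qed
    have "eventually (\<lambda>w. \<alpha> * w + \<beta> \<notin> L) (at z)"
      using eventually_compose_filterlim[OF eventually_notin_L l] .
    with ev[of z] show ?thesis by eventually_elim (simp add: S_def B_def)
  qed
  show ?thesis
  proof (rule that[OF \<alpha>(1)])
    fix z
    \<comment> \<open>The coincidence is known on punctured neighbourhoods; the value at the centre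
      follows by comparing poles or limits.\<close>
    have eveq: "eventually (\<lambda>w. f w = f0 (\<alpha> * w + \<beta>)) (at z)"
      using evS[of z] by eventually_elim (use u0 in \<open>auto simp: u_def S_def B_def f0_def\<close>)
    have "is_pole f z \<longleftrightarrow> is_pole (\<lambda>w. f0 (\<alpha> * w + \<beta>)) z" by (rule is_pole_cong[OF eveq refl])
    also have "\<dots> \<longleftrightarrow> is_pole f0 (\<alpha> * z + \<beta>)"
    proof -
      have an: "(\<lambda>w. f0 (\<alpha> * w + \<beta>)) analytic_on {z}" if "\<alpha> * z + \<beta> \<notin> L"
      proof -
        have "(f0 \<circ> (\<lambda>w. \<alpha> * w + \<beta>)) analytic_on {z}"
          by (rule analytic_on_compose[OF _ analytic_on_subset[OF f0_analytic[OF that]]]) (auto intro!: analytic_intros)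
        then show ?thesis by (simp add: o_def)
      qed
      have "is_pole (\<lambda>w. f0 (\<alpha> * w + \<beta>)) z" if "\<alpha> * z + \<beta> \<in> L"
      proof -
        have "filterlim (\<lambda>w. \<alpha> * w + \<beta>) (at (\<alpha> * z + \<beta>)) (at z)"
        proof (rule filterlim_atI)
          show "((\<lambda>w. \<alpha> * w + \<beta>) \<longlongrightarrow> \<alpha> * z + \<beta>) (at z)" by (intro tendsto_intros)
          show "eventually (\<lambda>w. \<alpha> * w + \<beta> \<noteq> \<alpha> * z + \<beta>) (at z)"
            using \<alpha>(1) by (auto simp: eventually_at intro!: exI[of _ 1])
        qed
        moreover have "filterlim f0 at_infinity (at (\<alpha> * z + \<beta>))"
          using that f0_pole_iff by (simp add: is_pole_def)
        ultimately show ?thesis unfolding is_pole_def by (rule filterlim_compose[rotated])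
      qed
      then show ?thesis using f0_pole_iff an analytic_imp_not_pole by blast
    qed
    finally have pole: "is_pole f z \<longleftrightarrow> is_pole f0 (\<alpha> * z + \<beta>)" .
    show "P1_value f z = P1_value f0 (\<alpha> * z + \<beta>)"
    proof (cases "is_pole f z")
      case True then show ?thesis using pole by (simp add: P1_value_alt)
    next
      case False
      then have nL: "\<alpha> * z + \<beta> \<notin> L" using pole f0_pole_iff by blast
      have "(f \<longlongrightarrow> f z) (at z)" using analytic_at_imp_isCont[OF fat(4)[OF False]] by (simp add: isCont_def)
      moreover have "isCont (\<lambda>w. f0 (\<alpha> * w + \<beta>)) z"
        by (rule isCont_o2[where f = "\<lambda>w. \<alpha> * w + \<beta>" and g = f0])
           (auto intro!: continuous_intros analytic_at_imp_isCont f0_analytic nL)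
      then have "((\<lambda>w. f0 (\<alpha> * w + \<beta>)) \<longlongrightarrow> f0 (\<alpha> * z + \<beta>)) (at z)" by (simp add: isCont_def)
      then have "(f \<longlongrightarrow> f0 (\<alpha> * z + \<beta>)) (at z)" by (simp only: tendsto_cong[OF eveq])
      ultimately have "f z = f0 (\<alpha> * z + \<beta>)" by (rule tendsto_unique[rotated]) simp
      then show ?thesis using pole False by (simp add: P1_value_alt)
    qed
  qed
qed

text \<open>The affine map sends the periods of the cover into \<open>L\<close> and the chosen
  origin to a ramification point of \<open>f0\<close>. That point is 3-torsion, so changing the
  origin does not change the 3m-torsion condition.\<close>

lemma torsion_params_std: "torsion_params M_std (3 * m) = pt ` SF m"
proof
  show "torsion_params M_std (3 * m) \<subseteq> pt ` SF m"
  proof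
    fix q assume "q \<in> torsion_params M_std (3 * m)"
    then obtain \<Lambda> f z0 z where cov: "equianharmonic_cover \<Lambda> f M_std" and r: "ram_index f z0 = 3"
      and z: "of_nat (3 * m) * (z - z0) \<in> \<Lambda>" and q: "q = P1_value f z" "q \<notin> M_std"
      unfolding torsion_params_def by blast
    have per: "\<And>z w. w \<in> \<Lambda> \<Longrightarrow> f (z + w) = f z" and M: "{P1_value f z | z. ram_index f z \<ge> 2} = M_std"
      using cov by (auto simp: equianharmonic_cover_def)
    obtain \<alpha> \<beta> where \<alpha>: "\<alpha> \<noteq> 0" and P: "\<And>z. P1_value f z = P1_value f0 (\<alpha> * z + \<beta>)"
      by (rule cover_std_affine[OF cov]) blast
    have La: "\<alpha> * w \<in> L" if w: "w \<in> \<Lambda>" for w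
    proof -
      \<comment> \<open>At the point carried to 0 the function has a pole; translating by a period
        keeps the pole, and the poles of \<open>f0\<close> are exactly the lattice points.\<close>
      have "P1_value f (- \<beta> / \<alpha> + w) = P1_value f (- \<beta> / \<alpha>)" by (rule ram_index_periodic(2)) (rule per[OF w])
      moreover have "\<alpha> * (- \<beta> / \<alpha> + w) + \<beta> = \<alpha> * w" "\<alpha> * (- \<beta> / \<alpha>) + \<beta> = 0"
        using \<alpha> by (simp_all add: field_simps)
      ultimately have "P1_value f0 (\<alpha> * w) = P1_value f0 0" unfolding P by simp
      then show ?thesis by (simp add: f0_P1 split: if_splits)
    qed
    define w0 w where "w0 = \<alpha> * z0 + \<beta>" and "w = \<alpha> * z + \<beta>"
    have "P1_value f z0 \<in> M_std" unfolding M[symmetric] using r by force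
    then have "P1_value f0 w0 \<in> M_std" using P[of z0] by (simp add: w0_def)
    then have "w0 \<in> L \<or> wG w0 = 0" using fixed_values[of w0] by (auto simp: f0_P1 M_std_def split: if_splits)
    then have "3 * w0 \<in> L" using G_zero_imp_3L L_of_nat[of w0 3] by auto
    then have w0: "of_nat (3 * m) * w0 \<in> L" using L_of_nat[of "3 * w0" m] by (simp add: mult_ac)
    have "of_nat (3 * m) * w = \<alpha> * (of_nat (3 * m) * (z - z0)) + of_nat (3 * m) * w0"
      by (simp add: w_def w0_def algebra_simps)
    then have wt: "of_nat (3 * m) * w \<in> L" using La[OF z] w0 L_add by simp
    have "P1_value f0 w = q" using P[of z] q by (simp add: w_def)
    then have "w \<notin> L" "wG w \<noteq> 0" "q = pt (wF w)"
      using q(2) fixed_values[of w] by (auto simp: f0_P1 M_std_def split: if_splits)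
    then show "q \<in> pt ` SF m" using wt by (auto simp: SF_def tor_def)
  qed
qed (rule torsion_params_std_superset)

end

section \<open>Multiplicities of products\<close>

lemma bipoly_unique:
  assumes "\<And>s t. poly (poly P [:s:]) t = poly (poly Q [:s:]) t"
  shows "P = (Q :: complex poly poly)"
proof -
  have e: "poly (P - Q) [:s:] = 0" for s
    using assms by (intro poly_eq_poly_eq_iff[THEN iffD1]) (auto simp: fun_eq_iff)
  have "inj (\<lambda>s::complex. [:s:])" by (simp add: inj_def)
  then have "infinite (range (\<lambda>s::complex. [:s:]))" using finite_imageD infinite_UNIV_char_0 by blast
  moreover have "range (\<lambda>s. [:s:]) \<subseteq> {x. poly (P - Q) x = 0}" using e by auto
  ultimately have "P - Q = 0" using poly_roots_finite[of "P - Q"] infinite_super by blast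
  then show ?thesis by simp
qed

lemma bipoly_eqI: "(\<And>s t. poly (poly P [:s:]) t = g s t) \<Longrightarrow> bipoly g = P"
  unfolding bipoly_def by (rule the_equality) (auto intro: bipoly_unique)

definition cf :: "complex poly poly \<Rightarrow> nat \<Rightarrow> nat \<Rightarrow> complex" where
  "cf P i j = coeff (coeff P i) j"

lemma cf_mult: "cf (P * Q) n k = (\<Sum>i\<le>n. \<Sum>j\<le>k. cf P i j * cf Q (n - i) (k - j))"
  by (simp add: cf_def coeff_mult coeff_sum)

lemma cf_nonzero: "P \<noteq> 0 \<Longrightarrow> \<exists>i j. cf P i j \<noteq> 0"
  unfolding cf_def by (metis leading_coeff_0_iff)

lemma mult_origin_cf: "mult_origin P = (LEAST k. \<exists>i j. i + j = k \<and> cf P i j \<noteq> 0)"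
  by (simp add: mult_origin_def cf_def)

lemma mult_origin_lower: "i + j < mult_origin P \<Longrightarrow> cf P i j = 0"
  unfolding mult_origin_cf using not_less_Least by blast

text \<open>Among the monomials of lowest total degree the one with the least exponent of the outer
  variable is singled out; this tie-break makes leading monomials multiply.\<close>

lemma mult_origin_attained:
  assumes "P \<noteq> 0" obtains i j where "i + j = mult_origin P" "cf P i j \<noteq> 0" "\<And>i' j'. i' + j' = mult_origin P \<Longrightarrow> i' < i \<Longrightarrow> cf P i' j' = 0"
proof -
  obtain a b where "cf P a b \<noteq> 0" using cf_nonzero[OF assms] by blast
  then have "\<exists>k. \<exists>i j. i + j = k \<and> cf P i j \<noteq> 0" by blast
  from LeastI_ex[OF this] have ex: "\<exists>i. \<exists>j. i + j = mult_origin P \<and> cf P i j \<noteq> 0" unfolding mult_origin_cf .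
  define i where "i = (LEAST i. \<exists>j. i + j = mult_origin P \<and> cf P i j \<noteq> 0)"
  have "\<exists>j. i + j = mult_origin P \<and> cf P i j \<noteq> 0" unfolding i_def by (rule LeastI_ex[OF ex])
  moreover have "cf P i' j' = 0" if "i' + j' = mult_origin P" "i' < i" for i' j'
    using not_less_Least[of i' "\<lambda>i. \<exists>j. i + j = mult_origin P \<and> cf P i j \<noteq> 0"] that unfolding i_def by blast
  ultimately show ?thesis using that by blast
qed

lemma mult_origin_eqI:
  assumes "cf P i j \<noteq> 0" "i + j = k" "\<And>i j. i + j < k \<Longrightarrow> cf P i j = 0"
  shows "mult_origin P = k"
  unfolding mult_origin_cf by (rule Least_equality) (use assms in \<open>auto simp: not_less[symmetric]\<close>)

text \<open>In the coefficient at the sum of the two leading exponents only the product of the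
  leading terms survives: every other pair contains an exponent of too low a degree or too early in
  the tie-break.\<close>

lemma mult_origin_mult:
  assumes "P \<noteq> 0" "Q \<noteq> 0" shows "mult_origin (P * Q) = mult_origin P + mult_origin Q"
proof -
  obtain a b where P: "a + b = mult_origin P" "cf P a b \<noteq> 0" "\<And>i j. i + j = mult_origin P \<Longrightarrow> i < a \<Longrightarrow> cf P i j = 0"
    by (rule mult_origin_attained[OF assms(1)]) blast
  obtain c d where Q: "c + d = mult_origin Q" "cf Q c d \<noteq> 0" "\<And>i j. i + j = mult_origin Q \<Longrightarrow> i < c \<Longrightarrow> cf Q i j = 0"
    by (rule mult_origin_attained[OF assms(2)]) blast
  have z: "cf P i j * cf Q (n - i) (k - j) = 0"
    if "i \<le> n" "j \<le> k" "n + k \<le> mult_origin P + mult_origin Q" "n \<le> a + c"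
      "(i, j) \<noteq> (a, b) \<or> n + k < mult_origin P + mult_origin Q" for i j n k
  proof (rule ccontr)
    assume nz: "cf P i j * cf Q (n - i) (k - j) \<noteq> 0"
    then have "i + j \<ge> mult_origin P" "(n - i) + (k - j) \<ge> mult_origin Q"
      using mult_origin_lower[of i j P] mult_origin_lower[of "n - i" "k - j" Q] by (auto simp: not_less[symmetric])
    then have e: "i + j = mult_origin P" "(n - i) + (k - j) = mult_origin Q" "n + k = mult_origin P + mult_origin Q"
      using that by linarith+
    then have "i \<ge> a" "n - i \<ge> c" using P(3)[OF e(1)] Q(3)[OF e(2)] nz by (auto simp: not_less[symmetric])
    then have "i = a" using that(1,4) by linarith
    then show False using that(5) e P(1) by auto
  qed
  show ?thesis
  proof (rule mult_origin_eqI[of _ "a + c" "b + d"])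
    have "cf (P * Q) (a + c) (b + d) = (\<Sum>i\<le>a+c. \<Sum>j\<le>b+d. if i = a \<and> j = b then cf P a b * cf Q c d else 0)"
      unfolding cf_mult
    proof (intro sum.cong refl)
      fix i j assume "i \<in> {..a + c}" "j \<in> {..b + d}"
      then show "cf P i j * cf Q (a + c - i) (b + d - j) = (if i = a \<and> j = b then cf P a b * cf Q c d else 0)"
        using z[of i "a + c" j "b + d"] P(1) Q(1) by auto
    qed
    also have "\<dots> = (\<Sum>i\<le>a+c. if i = a then cf P a b * cf Q c d else 0)"
      by (rule sum.cong[OF refl]) simp
    also have "\<dots> = cf P a b * cf Q c d" by simp
    finally show "cf (P * Q) (a + c) (b + d) \<noteq> 0" using P(2) Q(2) by simp
    show "a + c + (b + d) = mult_origin P + mult_origin Q" using P(1) Q(1) by simp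
    show "cf (P * Q) n k = 0" if nk: "n + k < mult_origin P + mult_origin Q" for n k
      unfolding cf_mult
    proof (intro sum.neutral ballI)
      fix i j assume ij: "i \<in> {..n}" "j \<in> {..k}"
      show "cf P i j * cf Q (n - i) (k - j) = 0"
      proof (cases "i + j < mult_origin P")
        case True then show ?thesis using mult_origin_lower by simp
      next
        case False
        then have "(n - i) + (k - j) < mult_origin Q" using ij nk by auto
        then show ?thesis using mult_origin_lower by simp
      qed
    qed
  qed
qed

lemma mult_origin_prod:
  "finite I \<Longrightarrow> (\<And>i. i \<in> I \<Longrightarrow> P i \<noteq> 0) \<Longrightarrow> mult_origin (\<Prod>i\<in>I. P i) = (\<Sum>i\<in>I. mult_origin (P i))"
proof (induction I rule: finite_induct)
  case empty
  have "mult_origin 1 = 0" by (rule mult_origin_eqI[of _ 0 0]) (auto simp: cf_def)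
  then show ?case by simp
next
  case (insert x I)
  then show ?case by (simp add: mult_origin_mult)
qed

lemma mult_origin_0: "cf P 0 0 \<noteq> 0 \<Longrightarrow> mult_origin P = 0"
  by (rule mult_origin_eqI[of _ 0 0]) auto

lemma mult_origin_1: "cf P 0 0 = 0 \<Longrightarrow> cf P 1 0 \<noteq> 0 \<or> cf P 0 1 \<noteq> 0 \<Longrightarrow> mult_origin P = 1"
  by (elim disjE; rule mult_origin_eqI) auto

lemma mult_origin_ge_2:
  assumes "P \<noteq> 0" "cf P 0 0 = 0" "cf P 1 0 = 0" "cf P 0 1 = 0" shows "mult_origin P \<ge> 2"
proof (rule ccontr)
  obtain i j where ij: "i + j = mult_origin P" "cf P i j \<noteq> 0" by (rule mult_origin_attained[OF assms(1)])
  assume "\<not> mult_origin P \<ge> 2"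
  then have "(i, j) = (0, 0) \<or> (i, j) = (1, 0) \<or> (i, j) = (0, 1)" using ij(1) by auto
  then show False using ij(2) assms by auto
qed

text \<open>The operation inside \<open>strict_transform\<close>, detached from the chart so that
  its multiplicativity can be stated.\<close>

definition strict :: "complex poly poly \<Rightarrow> complex poly poly" where
  "strict T = poly_shift (order 0 T) T"

lemma poly_shift_monom_mult: "poly_shift n (monom 1 n * p) = (p :: complex poly poly)"
  by (rule poly_eqI) (simp add: coeff_poly_shift coeff_monom_mult)

lemma strict_decomp:
  assumes "T \<noteq> 0" shows "T = monom 1 (order 0 T) * strict T" "coeff (strict T) 0 \<noteq> 0"
proof -
  obtain Q where Q: "T = [:- 0, 1:] ^ order 0 T * Q" "\<not> [:- 0, 1:] dvd Q"
    using order_decomp[OF assms, of 0] by blast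
  have m: "[:- 0, 1:] ^ order 0 T = (monom 1 (order 0 T) :: complex poly poly)"
    by (metis minus_zero monom_altdef mult_1 smult_1_left)
  have "strict T = Q" unfolding strict_def by (subst Q(1)) (simp only: m poly_shift_monom_mult)
  then show "T = monom 1 (order 0 T) * strict T" using Q(1) m by simp
  show "coeff (strict T) 0 \<noteq> 0" using Q(2) \<open>strict T = Q\<close> poly_eq_0_iff_dvd[of Q 0] by (simp add: poly_0_coeff_0)
qed

lemma strict_nz: "T \<noteq> 0 \<Longrightarrow> strict T \<noteq> 0" using strict_decomp(2) by fastforce

text \<open>The order along the exceptional curve u = 0 is additive, so the cancelled powers of u
  multiply.\<close>

lemma strict_mult:
  assumes "S \<noteq> 0" "T \<noteq> 0" shows "strict (S * T) = strict S * strict T"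
proof -
  have "S * T = (monom 1 (order 0 S) * monom 1 (order 0 T)) * (strict S * strict T)"
    using strict_decomp(1)[OF assms(1)] strict_decomp(1)[OF assms(2)] by (metis mult.assoc mult.left_commute)
  also have "monom 1 (order 0 S) * monom 1 (order 0 T) = (monom 1 (order 0 (S * T)) :: complex poly poly)"
    using assms by (simp add: mult_monom order_mult)
  finally show ?thesis unfolding strict_def[of "S * T"] by (metis poly_shift_monom_mult)
qed

lemma strict_1: "strict 1 = 1" by (simp add: strict_def)

lemma strict_prod:
  "finite I \<Longrightarrow> (\<And>i. i \<in> I \<Longrightarrow> P i \<noteq> 0) \<Longrightarrow> strict (\<Prod>i\<in>I. P i) = (\<Prod>i\<in>I. strict (P i))"
  by (induction I rule: finite_induct) (auto simp: strict_1 strict_mult)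

lemma strict_no_root: "coeff T 0 \<noteq> 0 \<Longrightarrow> strict T = T"
proof -
  assume "coeff T 0 \<noteq> 0"
  then have "order 0 T = 0" by (intro order_0I) (simp add: poly_0_coeff_0)
  then show ?thesis by (simp add: strict_def poly_shift_0)
qed

lemma strict_simple_root: "coeff T 0 = 0 \<Longrightarrow> coeff T 1 \<noteq> 0 \<Longrightarrow> strict T = poly_shift 1 T"
proof -
  assume a: "coeff T 0 = 0" "coeff T 1 \<noteq> 0"
  then have T: "T \<noteq> 0" by auto
  have c: "coeff T k = 0" if "k < order 0 T" for k
    using strict_decomp(1)[OF T] that by (metis coeff_monom_mult not_less)
  have "order 0 T \<le> 1" using c[of 1] a by (meson not_less)
  moreover have "order 0 T \<noteq> 0" using strict_decomp[OF T] a by (metis coeff_monom_mult diff_zero less_numeral_extra(3) mult_1 not_less0)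
  ultimately show ?thesis by (simp add: strict_def le_Suc_eq)
qed

section \<open>Charts and independence of the chosen basis\<close>

lemma vec3_eq_iff: "(v::complex^3) = w \<longleftrightarrow> v $ 1 = w $ 1 \<and> v $ 2 = w $ 2 \<and> v $ 3 = w $ 3"
  by (simp add: vec_eq_iff forall_3)

lemma span2: "vec.span {v, d} = {a *s v + b *s d | a b. True}" for v d :: "complex^3"
  by (auto simp: vec.span_insert vec.span_singleton algebra_simps)

lemma span3: "x \<in> vec.span {v, d, e} \<Longrightarrow> \<exists>a b c. x = a *s v + b *s d + c *s e" for v d e :: "complex^3"
  by (auto simp: vec.span_insert vec.span_singleton algebra_simps)

lemma basis_completion:
  fixes S :: "(complex^3) set"
  assumes "vec.independent S"
  obtains B where "S \<subseteq> B" "card B = 3" "vec.span B = UNIV"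
proof
  let ?B = "vec.extend_basis S"
  have i: "vec.independent ?B" by (rule vec.independent_extend_basis[OF assms])
  show "S \<subseteq> ?B" by (rule vec.extend_basis_superset[OF assms])
  show s: "vec.span ?B = UNIV" by (rule vec.span_extend_basis[OF assms])
  show "card ?B = 3" using vec.dim_eq_card_independent[OF i] vec.dim_span[of ?B] s vec.dim_UNIV by (simp add: card_cart_basis)
qed

lemma chart_exists:
  fixes v :: "complex^3" assumes "v \<noteq> 0" obtains d e where "vec.span {v, d, e} = UNIV"
proof -
  have "vec.independent {v}" using assms by simp
  then obtain B where B: "{v} \<subseteq> B" "card B = 3" "vec.span B = UNIV" by (rule basis_completion)
  then obtain a b c where "B = {a, b, c}" by (auto simp: card_3_iff)
  then have "B = {v, a, b} \<or> B = {v, a, c} \<or> B = {v, b, c}" using B(1) by auto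
  then show ?thesis using B(3) that by auto
qed

lemma chart_exists_2:
  fixes v d :: "complex^3" assumes "v \<noteq> 0" "d \<notin> vec.span {v}" obtains e where "vec.span {v, d, e} = UNIV"
proof -
  have "vec.independent {d, v}" using assms by (intro vec.independent_insertI) (auto simp: vec.independent_empty)
  then obtain B where B: "{d, v} \<subseteq> B" "card B = 3" "vec.span B = UNIV" by (rule basis_completion)
  have "d \<noteq> v" using assms vec.span_base by blast
  obtain a b c where abc: "B = {a, b, c}" using B(2) by (auto simp: card_3_iff)
  have "\<exists>e. B = {v, d, e}" using B(1) \<open>d \<noteq> v\<close> unfolding abc by auto
  then show ?thesis using B(3) that by auto
qed

text \<open>Nothing is known about the basis returned by \<open>SOME\<close> except that it is
  admissible once one exists, so the value has to be established for all admissible bases.\<close>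

lemma multiplicity_at_eqI:
  assumes p: "p \<in> proj_space"
    and k: "\<And>v d e. v \<in> p \<Longrightarrow> vec.span {v, d, e} = UNIV \<Longrightarrow> mult_origin (bipoly (\<lambda>s t. F (v + s *s d + t *s e))) = k"
  shows "multiplicity_at F p = k"
proof -
  obtain v0 where "p = proj v0" "v0 \<noteq> 0" using p by (auto simp: proj_space_def)
  moreover obtain d0 e0 where "vec.span {v0, d0, e0} = UNIV" by (rule chart_exists[OF \<open>v0 \<noteq> 0\<close>])
  ultimately have ex: "\<exists>x. case x of (v, d, e) \<Rightarrow> v \<in> p \<and> vec.span {v, d, e} = UNIV" using self_in_proj by auto
  define y where "y = (SOME x. case x of (v, d, e) \<Rightarrow> v \<in> p \<and> vec.span {v, d, e} = UNIV)"
  have "case y of (v, d, e) \<Rightarrow> v \<in> p \<and> vec.span {v, d, e} = UNIV" unfolding y_def by (rule someI_ex[OF ex])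
  then show ?thesis unfolding multiplicity_at_def y_def[symmetric] using k by (auto split: prod.splits)
qed

lemma inf_near_eqI:
  assumes p: "p \<in> proj_space" and l: "l \<in> exceptional_curve p"
    and k: "\<And>v d e. v \<in> p \<Longrightarrow> vec.span {v, d} = l \<Longrightarrow> vec.span {v, d, e} = UNIV \<Longrightarrow>
       mult_origin (strict (bipoly (\<lambda>u w. F (v + u *s d + (u * w) *s e)))) = k"
  shows "inf_near_multiplicity F p l = k"
proof -
  obtain v0 d0 where l: "l = vec.span {v0, d0}" "v0 \<in> p" "d0 \<notin> vec.span {v0}" using l unfolding exceptional_curve_def by blast
  obtain w where w: "p = proj w" "w \<noteq> 0" using p by (auto simp: proj_space_def)
  have "v0 \<noteq> 0" using l(2) w by (auto simp: proj_def)
  obtain e0 where "vec.span {v0, d0, e0} = UNIV" by (rule chart_exists_2[OF \<open>v0 \<noteq> 0\<close> l(3)])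
  then have ex: "\<exists>x. case x of (v, d, e) \<Rightarrow> v \<in> p \<and> vec.span {v, d} = l \<and> vec.span {v, d, e} = UNIV" using l by auto
  define y where "y = (SOME x. case x of (v, d, e) \<Rightarrow> v \<in> p \<and> vec.span {v, d} = l \<and> vec.span {v, d, e} = UNIV)"
  have "case y of (v, d, e) \<Rightarrow> v \<in> p \<and> vec.span {v, d} = l \<and> vec.span {v, d, e} = UNIV" unfolding y_def by (rule someI_ex[OF ex])
  then show ?thesis unfolding inf_near_multiplicity_def y_def[symmetric] strict_transform_def Let_def
    using k by (auto split: prod.splits simp: strict_def)
qed

section \<open>Coordinates adapted to the vertex types\<close>

context cube_root begin

lemma ee: "\<epsilon> * \<epsilon> = - 1 - \<epsilon>" "\<epsilon> * (\<epsilon> * x) = - x - \<epsilon> * x"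
proof -
  show e: "\<epsilon> * \<epsilon> = - 1 - \<epsilon>" using eps2 by (simp add: power2_eq_square)
  have "\<epsilon> * (\<epsilon> * x) = (\<epsilon> * \<epsilon>) * x" by (simp only: mult.assoc)
  then show "\<epsilon> * (\<epsilon> * x) = - x - \<epsilon> * x" unfolding e by (simp add: left_diff_distrib)
qed

lemmas eps_simps = power2_eq_square power3_eq_cube algebra_simps ee

text \<open>The discrete Fourier transform of order 3; it carries the three vertices of type h to
  the coordinate axes.\<close>

definition dft :: "complex^3 \<Rightarrow> complex^3" where
  "dft v = vector [v $ 1 + v $ 2 + v $ 3, v $ 1 + \<epsilon> * v $ 2 + \<epsilon>^2 * v $ 3, v $ 1 + \<epsilon>^2 * v $ 2 + \<epsilon> * v $ 3]"

definition idft :: "complex^3 \<Rightarrow> complex^3" where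
  "idft v = vector [(v $ 1 + v $ 2 + v $ 3) / 3, (v $ 1 + \<epsilon>^2 * v $ 2 + \<epsilon> * v $ 3) / 3, (v $ 1 + \<epsilon> * v $ 2 + \<epsilon>^2 * v $ 3) / 3]"

text \<open>Linear coordinates in which the three vertices of the given type become the coordinate
  points. The factor 1 - \<epsilon> for type v makes the four systems comparable: all of them then
  produce the same constant (1 - \<epsilon>)^3 in \<open>T_R\<close>, and only powers of \<epsilon>
  occur in \<open>D_relations\<close>.\<close>

fun co :: "vertex_type \<Rightarrow> complex^3 \<Rightarrow> complex^3" where
  "co V_type v = (1 - \<epsilon>) *s v"
| "co H_type v = dft v"
| "co D_type v = dft (vector [\<epsilon>^2 * v $ 1, v $ 2, v $ 3])"
| "co G_type v = dft (vector [\<epsilon> * v $ 1, v $ 2, v $ 3])"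

fun ci :: "vertex_type \<Rightarrow> complex^3 \<Rightarrow> complex^3" where
  "ci V_type v = ((1 - \<epsilon>^2) / 3) *s v"
| "ci H_type v = idft v"
| "ci D_type v = vector [\<epsilon> * idft v $ 1, idft v $ 2, idft v $ 3]"
| "ci G_type v = vector [\<epsilon>^2 * idft v $ 1, idft v $ 2, idft v $ 3]"

lemma dft_idft: "dft (idft v) = v" "idft (dft v) = v"
  by (simp_all add: dft_def idft_def vec3_eq_iff) (simp_all add: field_simps ee power2_eq_square)

lemma co_ci: "co t (ci t v) = v"
proof (cases t)
  case V_type
  have "(1 - \<epsilon>) * ((1 - \<epsilon>^2) / 3) = 1" by (simp add: field_simps power2_eq_square ee)
  then show ?thesis by (simp only: V_type co.simps ci.simps vector_smult_assoc vector_smult_lid mult.commute)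
next
  case D_type
  have "vector [\<epsilon>^2 * (vector [\<epsilon> * idft v $ 1, idft v $ 2, idft v $ 3] :: complex^3) $ 1, idft v $ 2, idft v $ 3] = idft v"
    by (simp add: vec3_eq_iff power2_eq_square mult.assoc ee) (simp add: algebra_simps ee)
  then show ?thesis using D_type by (simp add: dft_idft)
next
  case G_type
  have "vector [\<epsilon> * (vector [\<epsilon>^2 * idft v $ 1, idft v $ 2, idft v $ 3] :: complex^3) $ 1, idft v $ 2, idft v $ 3] = idft v"
    by (simp add: vec3_eq_iff power2_eq_square mult.assoc ee) (simp add: algebra_simps ee)
  then show ?thesis using G_type by (simp add: dft_idft)
qed (simp add: dft_idft)

lemma ci_co: "ci t (co t v) = v"
proof (cases t)
  case V_type
  have "(1 - \<epsilon>) * ((1 - \<epsilon>^2) / 3) = 1" by (simp add: field_simps power2_eq_square ee)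
  then show ?thesis by (simp only: V_type co.simps ci.simps vector_smult_assoc vector_smult_lid mult.commute)
next
  case D_type
  have "vector [\<epsilon> * (\<epsilon>^2 * v $ 1), v $ 2, v $ 3] = v"
    by (simp add: vec3_eq_iff power2_eq_square mult.assoc ee) (simp add: algebra_simps ee)
  then show ?thesis using D_type by (simp add: dft_idft)
next
  case G_type
  have "vector [\<epsilon>^2 * (\<epsilon> * v $ 1), v $ 2, v $ 3] = v"
    by (simp add: vec3_eq_iff power2_eq_square mult.assoc ee) (simp add: algebra_simps ee)
  then show ?thesis using G_type by (simp add: dft_idft)
qed (simp add: dft_idft)

lemma co_add: "co t (v + w) = co t v + co t w"
  by (cases t) (simp_all add: dft_def vec3_eq_iff algebra_simps)

lemma co_scale: "co t (c *s v) = c *s co t v"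
  by (cases t) (simp_all add: dft_def vec3_eq_iff algebra_simps)

lemma co_eq_iff: "co t v = co t w \<longleftrightarrow> v = w" by (metis ci_co)

lemma co_0: "co t 0 = 0" using co_scale[of t 0 0] by simp

lemma ci_add: "ci t (v + w) = ci t v + ci t w" by (metis ci_co co_ci co_add)
lemma ci_scale: "ci t (c *s v) = c *s ci t v" by (metis ci_co co_ci co_scale)

definition axis_val :: "nat \<Rightarrow> complex \<Rightarrow> complex^3" where
  "axis_val k c = vector [if k = 1 then c else 0, if k = 2 then c else 0, if k = 3 then c else 0]"

fun vpos :: "vertex_type \<Rightarrow> vertex_index \<Rightarrow> nat" where
  "vpos V_type Idx_0 = 1" | "vpos V_type Idx_1 = 2" | "vpos V_type Idx_inf = 3"
| "vpos H_type Idx_0 = 1" | "vpos H_type Idx_1 = 3" | "vpos H_type Idx_inf = 2"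
| "vpos D_type Idx_0 = 1" | "vpos D_type Idx_1 = 2" | "vpos D_type Idx_inf = 3"
| "vpos G_type Idx_0 = 1" | "vpos G_type Idx_1 = 3" | "vpos G_type Idx_inf = 2"

lemma vpos_inj: "vpos t u = vpos t u' \<Longrightarrow> u = u'"
  by (cases t; cases u; cases u') auto

lemma vpos_range: "vpos t u = 1 \<or> vpos t u = 2 \<or> vpos t u = 3"
  by (cases t; cases u) auto

lemma one_minus_eps: "1 - \<epsilon> \<noteq> 0" using eps1 by simp

lemma co_own: "\<exists>c. c \<noteq> 0 \<and> co t (vertex_coords \<epsilon> t u) = axis_val (vpos t u) c"
proof -
  have n: "1 - \<epsilon> \<noteq> 0" "(3::complex) \<noteq> 0" "3 * \<epsilon> \<noteq> 0" "- 3 - 3 * \<epsilon> \<noteq> 0"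
  proof -
    have "\<epsilon> * (- 3 - 3 * \<epsilon>) = 3" by (simp add: eps_simps)
    then show "- 3 - 3 * \<epsilon> \<noteq> 0" by auto
  qed (use eps1 eps_nz in auto)
  show ?thesis
  proof (cases t)
    case V_type then show ?thesis using n(1) by (cases u) (auto intro!: exI[of _ "1 - \<epsilon>"] simp: axis_val_def vec3_eq_iff)
  next
    case H_type then show ?thesis using n(2) by (cases u) (auto intro!: exI[of _ 3] simp: axis_val_def vec3_eq_iff dft_def eps_simps)
  next
    case D_type
    then show ?thesis using n
      by (cases u) (auto intro!: exI[of _ 3] exI[of _ "- 3 - 3 * \<epsilon>"] simp: axis_val_def vec3_eq_iff dft_def eps_simps)
  next
    case G_type
    then show ?thesis using n
      by (cases u) (auto intro!: exI[of _ 3] exI[of _ "3 * \<epsilon>"] simp: axis_val_def vec3_eq_iff dft_def eps_simps)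
  qed
qed

text \<open>All coordinate ratios are cube roots of unity. The factors 1, \<epsilon> and -1 -
  \<epsilon> (which is \<epsilon>^2) are kept visible so that one rewrite rule for cubes applies to
  every entry.\<close>

lemma co_other_ratios:
  "co V_type (vertex_coords \<epsilon> H_type Idx_0) $ 2 = 1 * co V_type (vertex_coords \<epsilon> H_type Idx_0) $ 1"
  "co V_type (vertex_coords \<epsilon> H_type Idx_0) $ 3 = 1 * co V_type (vertex_coords \<epsilon> H_type Idx_0) $ 1"
  "co V_type (vertex_coords \<epsilon> H_type Idx_1) $ 2 = \<epsilon> * co V_type (vertex_coords \<epsilon> H_type Idx_1) $ 1"
  "co V_type (vertex_coords \<epsilon> H_type Idx_1) $ 3 = (- 1 - \<epsilon>) * co V_type (vertex_coords \<epsilon> H_type Idx_1) $ 1"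
  "co V_type (vertex_coords \<epsilon> H_type Idx_inf) $ 2 = (- 1 - \<epsilon>) * co V_type (vertex_coords \<epsilon> H_type Idx_inf) $ 1"
  "co V_type (vertex_coords \<epsilon> H_type Idx_inf) $ 3 = \<epsilon> * co V_type (vertex_coords \<epsilon> H_type Idx_inf) $ 1"
  "co V_type (vertex_coords \<epsilon> D_type Idx_0) $ 2 = (- 1 - \<epsilon>) * co V_type (vertex_coords \<epsilon> D_type Idx_0) $ 1"
  "co V_type (vertex_coords \<epsilon> D_type Idx_0) $ 3 = (- 1 - \<epsilon>) * co V_type (vertex_coords \<epsilon> D_type Idx_0) $ 1"
  "co V_type (vertex_coords \<epsilon> D_type Idx_1) $ 2 = \<epsilon> * co V_type (vertex_coords \<epsilon> D_type Idx_1) $ 1"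
  "co V_type (vertex_coords \<epsilon> D_type Idx_1) $ 3 = 1 * co V_type (vertex_coords \<epsilon> D_type Idx_1) $ 1"
  "co V_type (vertex_coords \<epsilon> D_type Idx_inf) $ 2 = 1 * co V_type (vertex_coords \<epsilon> D_type Idx_inf) $ 1"
  "co V_type (vertex_coords \<epsilon> D_type Idx_inf) $ 3 = \<epsilon> * co V_type (vertex_coords \<epsilon> D_type Idx_inf) $ 1"
  "co V_type (vertex_coords \<epsilon> G_type Idx_0) $ 2 = \<epsilon> * co V_type (vertex_coords \<epsilon> G_type Idx_0) $ 1"
  "co V_type (vertex_coords \<epsilon> G_type Idx_0) $ 3 = \<epsilon> * co V_type (vertex_coords \<epsilon> G_type Idx_0) $ 1"
  "co V_type (vertex_coords \<epsilon> G_type Idx_1) $ 2 = (- 1 - \<epsilon>) * co V_type (vertex_coords \<epsilon> G_type Idx_1) $ 1"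
  "co V_type (vertex_coords \<epsilon> G_type Idx_1) $ 3 = 1 * co V_type (vertex_coords \<epsilon> G_type Idx_1) $ 1"
  "co V_type (vertex_coords \<epsilon> G_type Idx_inf) $ 2 = 1 * co V_type (vertex_coords \<epsilon> G_type Idx_inf) $ 1"
  "co V_type (vertex_coords \<epsilon> G_type Idx_inf) $ 3 = (- 1 - \<epsilon>) * co V_type (vertex_coords \<epsilon> G_type Idx_inf) $ 1"
  "co H_type (vertex_coords \<epsilon> V_type Idx_0) $ 2 = 1 * co H_type (vertex_coords \<epsilon> V_type Idx_0) $ 1"
  "co H_type (vertex_coords \<epsilon> V_type Idx_0) $ 3 = 1 * co H_type (vertex_coords \<epsilon> V_type Idx_0) $ 1"
  "co H_type (vertex_coords \<epsilon> V_type Idx_1) $ 2 = \<epsilon> * co H_type (vertex_coords \<epsilon> V_type Idx_1) $ 1"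
  "co H_type (vertex_coords \<epsilon> V_type Idx_1) $ 3 = (- 1 - \<epsilon>) * co H_type (vertex_coords \<epsilon> V_type Idx_1) $ 1"
  "co H_type (vertex_coords \<epsilon> V_type Idx_inf) $ 2 = (- 1 - \<epsilon>) * co H_type (vertex_coords \<epsilon> V_type Idx_inf) $ 1"
  "co H_type (vertex_coords \<epsilon> V_type Idx_inf) $ 3 = \<epsilon> * co H_type (vertex_coords \<epsilon> V_type Idx_inf) $ 1"
  "co H_type (vertex_coords \<epsilon> D_type Idx_0) $ 2 = \<epsilon> * co H_type (vertex_coords \<epsilon> D_type Idx_0) $ 1"
  "co H_type (vertex_coords \<epsilon> D_type Idx_0) $ 3 = \<epsilon> * co H_type (vertex_coords \<epsilon> D_type Idx_0) $ 1"
  "co H_type (vertex_coords \<epsilon> D_type Idx_1) $ 2 = (- 1 - \<epsilon>) * co H_type (vertex_coords \<epsilon> D_type Idx_1) $ 1"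
  "co H_type (vertex_coords \<epsilon> D_type Idx_1) $ 3 = 1 * co H_type (vertex_coords \<epsilon> D_type Idx_1) $ 1"
  "co H_type (vertex_coords \<epsilon> D_type Idx_inf) $ 2 = 1 * co H_type (vertex_coords \<epsilon> D_type Idx_inf) $ 1"
  "co H_type (vertex_coords \<epsilon> D_type Idx_inf) $ 3 = (- 1 - \<epsilon>) * co H_type (vertex_coords \<epsilon> D_type Idx_inf) $ 1"
  "co H_type (vertex_coords \<epsilon> G_type Idx_0) $ 2 = (- 1 - \<epsilon>) * co H_type (vertex_coords \<epsilon> G_type Idx_0) $ 1"
  "co H_type (vertex_coords \<epsilon> G_type Idx_0) $ 3 = (- 1 - \<epsilon>) * co H_type (vertex_coords \<epsilon> G_type Idx_0) $ 1"
  "co H_type (vertex_coords \<epsilon> G_type Idx_1) $ 2 = 1 * co H_type (vertex_coords \<epsilon> G_type Idx_1) $ 1"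
  "co H_type (vertex_coords \<epsilon> G_type Idx_1) $ 3 = \<epsilon> * co H_type (vertex_coords \<epsilon> G_type Idx_1) $ 1"
  "co H_type (vertex_coords \<epsilon> G_type Idx_inf) $ 2 = \<epsilon> * co H_type (vertex_coords \<epsilon> G_type Idx_inf) $ 1"
  "co H_type (vertex_coords \<epsilon> G_type Idx_inf) $ 3 = 1 * co H_type (vertex_coords \<epsilon> G_type Idx_inf) $ 1"
  "co D_type (vertex_coords \<epsilon> V_type Idx_0) $ 2 = 1 * co D_type (vertex_coords \<epsilon> V_type Idx_0) $ 1"
  "co D_type (vertex_coords \<epsilon> V_type Idx_0) $ 3 = 1 * co D_type (vertex_coords \<epsilon> V_type Idx_0) $ 1"
  "co D_type (vertex_coords \<epsilon> V_type Idx_1) $ 2 = \<epsilon> * co D_type (vertex_coords \<epsilon> V_type Idx_1) $ 1"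
  "co D_type (vertex_coords \<epsilon> V_type Idx_1) $ 3 = (- 1 - \<epsilon>) * co D_type (vertex_coords \<epsilon> V_type Idx_1) $ 1"
  "co D_type (vertex_coords \<epsilon> V_type Idx_inf) $ 2 = (- 1 - \<epsilon>) * co D_type (vertex_coords \<epsilon> V_type Idx_inf) $ 1"
  "co D_type (vertex_coords \<epsilon> V_type Idx_inf) $ 3 = \<epsilon> * co D_type (vertex_coords \<epsilon> V_type Idx_inf) $ 1"
  "co D_type (vertex_coords \<epsilon> H_type Idx_0) $ 2 = (- 1 - \<epsilon>) * co D_type (vertex_coords \<epsilon> H_type Idx_0) $ 1"
  "co D_type (vertex_coords \<epsilon> H_type Idx_0) $ 3 = (- 1 - \<epsilon>) * co D_type (vertex_coords \<epsilon> H_type Idx_0) $ 1"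
  "co D_type (vertex_coords \<epsilon> H_type Idx_1) $ 2 = 1 * co D_type (vertex_coords \<epsilon> H_type Idx_1) $ 1"
  "co D_type (vertex_coords \<epsilon> H_type Idx_1) $ 3 = \<epsilon> * co D_type (vertex_coords \<epsilon> H_type Idx_1) $ 1"
  "co D_type (vertex_coords \<epsilon> H_type Idx_inf) $ 2 = \<epsilon> * co D_type (vertex_coords \<epsilon> H_type Idx_inf) $ 1"
  "co D_type (vertex_coords \<epsilon> H_type Idx_inf) $ 3 = 1 * co D_type (vertex_coords \<epsilon> H_type Idx_inf) $ 1"
  "co D_type (vertex_coords \<epsilon> G_type Idx_0) $ 2 = \<epsilon> * co D_type (vertex_coords \<epsilon> G_type Idx_0) $ 1"
  "co D_type (vertex_coords \<epsilon> G_type Idx_0) $ 3 = \<epsilon> * co D_type (vertex_coords \<epsilon> G_type Idx_0) $ 1"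
  "co D_type (vertex_coords \<epsilon> G_type Idx_1) $ 2 = 1 * co D_type (vertex_coords \<epsilon> G_type Idx_1) $ 1"
  "co D_type (vertex_coords \<epsilon> G_type Idx_1) $ 3 = (- 1 - \<epsilon>) * co D_type (vertex_coords \<epsilon> G_type Idx_1) $ 1"
  "co D_type (vertex_coords \<epsilon> G_type Idx_inf) $ 2 = (- 1 - \<epsilon>) * co D_type (vertex_coords \<epsilon> G_type Idx_inf) $ 1"
  "co D_type (vertex_coords \<epsilon> G_type Idx_inf) $ 3 = 1 * co D_type (vertex_coords \<epsilon> G_type Idx_inf) $ 1"
  "co G_type (vertex_coords \<epsilon> V_type Idx_0) $ 2 = 1 * co G_type (vertex_coords \<epsilon> V_type Idx_0) $ 1"
  "co G_type (vertex_coords \<epsilon> V_type Idx_0) $ 3 = 1 * co G_type (vertex_coords \<epsilon> V_type Idx_0) $ 1"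
  "co G_type (vertex_coords \<epsilon> V_type Idx_1) $ 2 = \<epsilon> * co G_type (vertex_coords \<epsilon> V_type Idx_1) $ 1"
  "co G_type (vertex_coords \<epsilon> V_type Idx_1) $ 3 = (- 1 - \<epsilon>) * co G_type (vertex_coords \<epsilon> V_type Idx_1) $ 1"
  "co G_type (vertex_coords \<epsilon> V_type Idx_inf) $ 2 = (- 1 - \<epsilon>) * co G_type (vertex_coords \<epsilon> V_type Idx_inf) $ 1"
  "co G_type (vertex_coords \<epsilon> V_type Idx_inf) $ 3 = \<epsilon> * co G_type (vertex_coords \<epsilon> V_type Idx_inf) $ 1"
  "co G_type (vertex_coords \<epsilon> H_type Idx_0) $ 2 = \<epsilon> * co G_type (vertex_coords \<epsilon> H_type Idx_0) $ 1"
  "co G_type (vertex_coords \<epsilon> H_type Idx_0) $ 3 = \<epsilon> * co G_type (vertex_coords \<epsilon> H_type Idx_0) $ 1"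
  "co G_type (vertex_coords \<epsilon> H_type Idx_1) $ 2 = 1 * co G_type (vertex_coords \<epsilon> H_type Idx_1) $ 1"
  "co G_type (vertex_coords \<epsilon> H_type Idx_1) $ 3 = (- 1 - \<epsilon>) * co G_type (vertex_coords \<epsilon> H_type Idx_1) $ 1"
  "co G_type (vertex_coords \<epsilon> H_type Idx_inf) $ 2 = (- 1 - \<epsilon>) * co G_type (vertex_coords \<epsilon> H_type Idx_inf) $ 1"
  "co G_type (vertex_coords \<epsilon> H_type Idx_inf) $ 3 = 1 * co G_type (vertex_coords \<epsilon> H_type Idx_inf) $ 1"
  "co G_type (vertex_coords \<epsilon> D_type Idx_0) $ 2 = (- 1 - \<epsilon>) * co G_type (vertex_coords \<epsilon> D_type Idx_0) $ 1"
  "co G_type (vertex_coords \<epsilon> D_type Idx_0) $ 3 = (- 1 - \<epsilon>) * co G_type (vertex_coords \<epsilon> D_type Idx_0) $ 1"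
  "co G_type (vertex_coords \<epsilon> D_type Idx_1) $ 2 = \<epsilon> * co G_type (vertex_coords \<epsilon> D_type Idx_1) $ 1"
  "co G_type (vertex_coords \<epsilon> D_type Idx_1) $ 3 = 1 * co G_type (vertex_coords \<epsilon> D_type Idx_1) $ 1"
  "co G_type (vertex_coords \<epsilon> D_type Idx_inf) $ 2 = 1 * co G_type (vertex_coords \<epsilon> D_type Idx_inf) $ 1"
  "co G_type (vertex_coords \<epsilon> D_type Idx_inf) $ 3 = \<epsilon> * co G_type (vertex_coords \<epsilon> D_type Idx_inf) $ 1"
  by (simp_all add: dft_def eps_simps)

lemma co_other_first:
  "co V_type (vertex_coords \<epsilon> H_type Idx_0) $ 1 = (1 - \<epsilon>) * 1"
  "co V_type (vertex_coords \<epsilon> H_type Idx_1) $ 1 = (1 - \<epsilon>) * 1"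
  "co V_type (vertex_coords \<epsilon> H_type Idx_inf) $ 1 = (1 - \<epsilon>) * 1"
  "co V_type (vertex_coords \<epsilon> D_type Idx_0) $ 1 = (1 - \<epsilon>) * \<epsilon>"
  "co V_type (vertex_coords \<epsilon> D_type Idx_1) $ 1 = (1 - \<epsilon>) * 1"
  "co V_type (vertex_coords \<epsilon> D_type Idx_inf) $ 1 = (1 - \<epsilon>) * 1"
  "co V_type (vertex_coords \<epsilon> G_type Idx_0) $ 1 = (1 - \<epsilon>) * (- 1 - \<epsilon>)"
  "co V_type (vertex_coords \<epsilon> G_type Idx_1) $ 1 = (1 - \<epsilon>) * 1"
  "co V_type (vertex_coords \<epsilon> G_type Idx_inf) $ 1 = (1 - \<epsilon>) * 1"
  "co H_type (vertex_coords \<epsilon> V_type Idx_0) $ 1 = (1::complex) * 1"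
  "co H_type (vertex_coords \<epsilon> V_type Idx_1) $ 1 = (1::complex) * 1"
  "co H_type (vertex_coords \<epsilon> V_type Idx_inf) $ 1 = (1::complex) * 1"
  "co H_type (vertex_coords \<epsilon> D_type Idx_0) $ 1 = - (1 - \<epsilon>) * (- 1 - \<epsilon>)"
  "co H_type (vertex_coords \<epsilon> D_type Idx_1) $ 1 = - (1 - \<epsilon>) * (- 1 - \<epsilon>)"
  "co H_type (vertex_coords \<epsilon> D_type Idx_inf) $ 1 = - (1 - \<epsilon>) * (- 1 - \<epsilon>)"
  "co H_type (vertex_coords \<epsilon> G_type Idx_0) $ 1 = (1 - \<epsilon>) * 1"
  "co H_type (vertex_coords \<epsilon> G_type Idx_1) $ 1 = (1 - \<epsilon>) * 1"
  "co H_type (vertex_coords \<epsilon> G_type Idx_inf) $ 1 = (1 - \<epsilon>) * 1"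
  "co D_type (vertex_coords \<epsilon> V_type Idx_0) $ 1 = (1::complex) * (- 1 - \<epsilon>)"
  "co D_type (vertex_coords \<epsilon> V_type Idx_1) $ 1 = (1::complex) * 1"
  "co D_type (vertex_coords \<epsilon> V_type Idx_inf) $ 1 = (1::complex) * 1"
  "co D_type (vertex_coords \<epsilon> H_type Idx_0) $ 1 = (1 - \<epsilon>) * 1"
  "co D_type (vertex_coords \<epsilon> H_type Idx_1) $ 1 = (1 - \<epsilon>) * (- 1 - \<epsilon>)"
  "co D_type (vertex_coords \<epsilon> H_type Idx_inf) $ 1 = (1 - \<epsilon>) * (- 1 - \<epsilon>)"
  "co D_type (vertex_coords \<epsilon> G_type Idx_0) $ 1 = - (1 - \<epsilon>) * (- 1 - \<epsilon>)"
  "co D_type (vertex_coords \<epsilon> G_type Idx_1) $ 1 = - (1 - \<epsilon>) * \<epsilon>"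
  "co D_type (vertex_coords \<epsilon> G_type Idx_inf) $ 1 = - (1 - \<epsilon>) * \<epsilon>"
  "co G_type (vertex_coords \<epsilon> V_type Idx_0) $ 1 = (1::complex) * \<epsilon>"
  "co G_type (vertex_coords \<epsilon> V_type Idx_1) $ 1 = (1::complex) * 1"
  "co G_type (vertex_coords \<epsilon> V_type Idx_inf) $ 1 = (1::complex) * 1"
  "co G_type (vertex_coords \<epsilon> H_type Idx_0) $ 1 = - (1 - \<epsilon>) * (- 1 - \<epsilon>)"
  "co G_type (vertex_coords \<epsilon> H_type Idx_1) $ 1 = - (1 - \<epsilon>) * 1"
  "co G_type (vertex_coords \<epsilon> H_type Idx_inf) $ 1 = - (1 - \<epsilon>) * 1"
  "co G_type (vertex_coords \<epsilon> D_type Idx_0) $ 1 = (1 - \<epsilon>) * 1"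
  "co G_type (vertex_coords \<epsilon> D_type Idx_1) $ 1 = (1 - \<epsilon>) * \<epsilon>"
  "co G_type (vertex_coords \<epsilon> D_type Idx_inf) $ 1 = (1 - \<epsilon>) * \<epsilon>"
  by (simp_all add: dft_def eps_simps)

text \<open>The nine vertices of the other types are base points of the Fermat pencil: their adapted
  coordinates have equal nonzero cubes.\<close>

lemma co_other:
  assumes "t' \<noteq> t"
  shows "(co t (vertex_coords \<epsilon> t' u) $ 1)^3 \<noteq> 0 \<and>
    (co t (vertex_coords \<epsilon> t' u) $ 2)^3 = (co t (vertex_coords \<epsilon> t' u) $ 1)^3 \<and>
    (co t (vertex_coords \<epsilon> t' u) $ 3)^3 = (co t (vertex_coords \<epsilon> t' u) $ 1)^3"
proof -
  have "- 1 - \<epsilon> \<noteq> 0" using eps2 eps_nz by (metis power_not_zero)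
  then have n: "(1 - \<epsilon>) * 1 \<noteq> 0" "(1 - \<epsilon>) * \<epsilon> \<noteq> 0" "(1 - \<epsilon>) * (- 1 - \<epsilon>) \<noteq> 0"
    "(1::complex) * 1 \<noteq> 0" "1 * \<epsilon> \<noteq> 0" "1 * (- 1 - \<epsilon>) \<noteq> 0"
    "- (1::complex) * 1 \<noteq> 0" "- 1 * \<epsilon> \<noteq> 0" "- 1 * (- 1 - \<epsilon>) \<noteq> 0"
    "- (1 - \<epsilon>) * 1 \<noteq> 0" "- (1 - \<epsilon>) * \<epsilon> \<noteq> 0" "- (1 - \<epsilon>) * (- 1 - \<epsilon>) \<noteq> 0"
    using one_minus_eps eps_nz by (simp_all only: mult_eq_0_iff neg_equal_0_iff_equal simp_thms one_neq_zero)
  have nz: "co t (vertex_coords \<epsilon> t' u) $ 1 \<noteq> 0"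
    using assms by (cases t; cases t'; cases u) (simp_all only: co_other_first n simp_thms)
  have "(- 1 - \<epsilon>)^3 = 1" using eps2 by algebra
  then have e3: "(\<epsilon> * x)^3 = x^3" "((- 1 - \<epsilon>) * x)^3 = x^3" "(1 * x)^3 = x^3" for x
    by (simp_all only: power_mult_distrib eps3 mult_1 power_one)
  have "(co t (vertex_coords \<epsilon> t' u) $ 2)^3 = (co t (vertex_coords \<epsilon> t' u) $ 1)^3"
    using assms by (cases t; cases t'; cases u) (simp_all only: co_other_ratios e3 simp_thms)
  moreover have "(co t (vertex_coords \<epsilon> t' u) $ 3)^3 = (co t (vertex_coords \<epsilon> t' u) $ 1)^3"
    using assms by (cases t; cases t'; cases u) (simp_all only: co_other_ratios e3 simp_thms)
  ultimately show ?thesis using nz by simp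
qed

lemma UNIV_vertex_type: "(UNIV :: vertex_type set) = {V_type, H_type, D_type, G_type}"
  using vertex_type.exhaust by auto

lemma UNIV_vertex_index: "(UNIV :: vertex_index set) = {Idx_0, Idx_1, Idx_inf}"
  using vertex_index.exhaust by auto

lemma finite_types [simp]: "finite (A :: vertex_type set)" "finite (B :: vertex_index set)"
  by (rule finite_subset[OF subset_UNIV], simp add: UNIV_vertex_type)
     (rule finite_subset[OF subset_UNIV], simp add: UNIV_vertex_index)

lemma axis_val_nth: "axis_val k c $ 1 = (if k = 1 then c else 0)" "axis_val k c $ 2 = (if k = 2 then c else 0)"
  "axis_val k c $ 3 = (if k = 3 then c else 0)"
  by (simp_all add: axis_val_def)

abbreviation vx :: "vertex_type \<Rightarrow> vertex_index \<Rightarrow> (complex^3) set" where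
  "vx t u \<equiv> proj (vertex_coords \<epsilon> t u)"

lemma co_other_nz:
  assumes "t' \<noteq> t"
  shows "co t (vertex_coords \<epsilon> t' u) $ 1 \<noteq> 0" "co t (vertex_coords \<epsilon> t' u) $ 2 \<noteq> 0" "co t (vertex_coords \<epsilon> t' u) $ 3 \<noteq> 0"
proof -
  note c = co_other[OF assms, of u]
  have z: "(0::complex)^3 = 0" by simp
  show "co t (vertex_coords \<epsilon> t' u) $ 1 \<noteq> 0" "co t (vertex_coords \<epsilon> t' u) $ 2 \<noteq> 0" "co t (vertex_coords \<epsilon> t' u) $ 3 \<noteq> 0"
    using c z by metis+
qed

lemma vx_inj: "vx t u = vx t' u' \<longleftrightarrow> t = t' \<and> u = u'"
proof
  assume "vx t u = vx t' u'"
  then obtain c where c: "c \<noteq> 0" "vertex_coords \<epsilon> t' u' = c *s vertex_coords \<epsilon> t u" by (auto simp: proj_eq_iff)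
  obtain k where k: "k \<noteq> 0" "co t (vertex_coords \<epsilon> t u) = axis_val (vpos t u) k" using co_own by blast
  have e: "co t (vertex_coords \<epsilon> t' u') = c *s axis_val (vpos t u) k" using c k by (simp add: co_scale)
  have tt: "t = t'"
  proof (rule ccontr)
    assume "t \<noteq> t'"
    then have "co t (vertex_coords \<epsilon> t' u') $ 1 \<noteq> 0" "co t (vertex_coords \<epsilon> t' u') $ 2 \<noteq> 0" using co_other_nz by metis+
    then show False unfolding e using vpos_range[of t u] by (auto simp: axis_val_nth split: if_splits)
  qed
  obtain k' where k': "k' \<noteq> 0" "co t (vertex_coords \<epsilon> t u') = axis_val (vpos t u') k'" using co_own by blast
  have "axis_val (vpos t u') k' = c *s axis_val (vpos t u) k" using e k' tt by simp
  then have "vpos t u = vpos t u'" using vpos_range[of t u] vpos_range[of t u'] k'(1)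
    by (auto simp: axis_val_nth vec3_eq_iff split: if_splits)
  then show "t = t' \<and> u = u'" using vpos_inj tt by simp
qed auto

lemma vertices_image: "vertices \<epsilon> = (\<lambda>(t, u). vx t u) ` UNIV"
  unfolding vertices_def by auto

lemma card_vertices: "card (vertices \<epsilon>) = 12"
proof -
  have "inj (\<lambda>(t, u). vx t u)" by (auto simp: inj_def vx_inj)
  then have "card (vertices \<epsilon>) = card (UNIV :: (vertex_type \<times> vertex_index) set)"
    unfolding vertices_image by (rule card_image)
  also have "\<dots> = 12"
    unfolding UNIV_Times_UNIV[symmetric] card_cartesian_product UNIV_vertex_type UNIV_vertex_index by simp
  finally show ?thesis .
qed

lemma vertices_off_eq: "vertices_off \<epsilon> t = {vx t' u | t' u. t' \<noteq> t}"
  unfolding vertices_off_def vertices_def using vx_inj by blast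

text \<open>In adapted coordinates \<open>T0\<close>, \<open>T1\<close>, \<open>T2\<close> are the
  singular members of the pencil. Each is a difference of two cubes, hence the product of the three
  lines through one vertex of type t.\<close>

definition T0 :: "vertex_type \<Rightarrow> complex^3 \<Rightarrow> complex" where "T0 t v = (co t v $ 2)^3 - (co t v $ 3)^3"
definition T1 :: "vertex_type \<Rightarrow> complex^3 \<Rightarrow> complex" where "T1 t v = (co t v $ 3)^3 - (co t v $ 1)^3"
definition T2 :: "vertex_type \<Rightarrow> complex^3 \<Rightarrow> complex" where "T2 t v = (co t v $ 1)^3 - (co t v $ 2)^3"

lemma T_sum: "T0 t v + T1 t v + T2 t v = 0" by (simp add: T0_def T1_def T2_def)

lemma T_scale: "T0 t (c *s v) = c^3 * T0 t v" "T1 t (c *s v) = c^3 * T1 t v" "T2 t (c *s v) = c^3 * T2 t v"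
  by (simp_all add: T0_def T1_def T2_def co_scale power_mult_distrib algebra_simps)

lemma cubic_form_add: "cubic_form F \<Longrightarrow> cubic_form G \<Longrightarrow> cubic_form (\<lambda>x. F x + G x)"
  unfolding cubic_form_def
proof (elim exE, goal_cases)
  case (1 c d)
  then show ?case by (intro exI[of _ "\<lambda>i j. c i j + d i j"]) (simp add: sum.distrib algebra_simps)
qed

lemma cubic_form_cmult: "cubic_form F \<Longrightarrow> cubic_form (\<lambda>x. k * F x)"
  unfolding cubic_form_def
proof (elim exE, goal_cases)
  case (1 c)
  then show ?case by (intro exI[of _ "\<lambda>i j. k * c i j"]) (simp add: sum_distrib_left mult.assoc)
qed

lemma atMost_sets: "{..3::nat} = {0,1,2,3}" "{..2::nat} = {0,1,2}" "{..Suc 0} = {0,1}" by auto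

lemma cubic_sum_expand:
  "(\<Sum>i\<le>(3::nat). \<Sum>j\<le>3 - i. c i j * x^i * y^j * z^(3 - i - j)) =
    c 0 0 * z^3 + c 0 1 * y * z^2 + c 0 2 * y^2 * z + c 0 3 * y^3 + c 1 0 * x * z^2 + c 1 1 * x * y * z + c 1 2 * x * y^2
    + c 2 0 * x^2 * z + c 2 1 * x^2 * y + c 3 0 * x^3" for c :: "nat \<Rightarrow> nat \<Rightarrow> complex"
  by (simp add: atMost_sets)

lemma cubic_form_triple:
  "cubic_form (\<lambda>v. (a1 * v $ 1 + a2 * v $ 2 + a3 * v $ 3) * (b1 * v $ 1 + b2 * v $ 2 + b3 * v $ 3) * (c1 * v $ 1 + c2 * v $ 2 + c3 * v $ 3))"
  unfolding cubic_form_def cubic_sum_expand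
  by (intro exI[of _ "\<lambda>i j. if i = 0 then (if j = 0 then a3*b3*c3 else if j = 1 then a2*b3*c3 + a3*b2*c3 + a3*b3*c2
        else if j = 2 then a2*b2*c3 + a2*b3*c2 + a3*b2*c2 else a2*b2*c2)
      else if i = 1 then (if j = 0 then a1*b3*c3 + a3*b1*c3 + a3*b3*c1 else if j = 1 then
        a1*b2*c3 + a1*b3*c2 + a2*b1*c3 + a2*b3*c1 + a3*b1*c2 + a3*b2*c1 else a1*b2*c2 + a2*b1*c2 + a2*b2*c1)
      else if i = 2 then (if j = 0 then a1*b1*c3 + a1*b3*c1 + a3*b1*c1 else a1*b1*c2 + a1*b2*c1 + a2*b1*c1)
      else a1*b1*c1"]) (simp add: power2_eq_square power3_eq_cube algebra_simps)

definition lin_form :: "(complex^3 \<Rightarrow> complex) \<Rightarrow> bool" where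
  "lin_form l \<longleftrightarrow> (\<exists>a b c. \<forall>v. l v = a * v $ 1 + b * v $ 2 + c * v $ 3)"

lemma cubic_form_prod: "lin_form l1 \<Longrightarrow> lin_form l2 \<Longrightarrow> lin_form l3 \<Longrightarrow> cubic_form (\<lambda>v. l1 v * l2 v * l3 v)"
  unfolding lin_form_def by (elim exE) (simp add: cubic_form_triple)

lemma lin_form_additive:
  assumes "\<And>v w. l (v + w) = l v + l w" "\<And>c v. l (c *s v) = c * l v" shows "lin_form l"
proof -
  have "l v = l (axis_val 1 1) * v $ 1 + l (axis_val 2 1) * v $ 2 + l (axis_val 3 1) * v $ 3" for v
  proof -
    have "v = v $ 1 *s axis_val 1 1 + v $ 2 *s axis_val 2 1 + v $ 3 *s axis_val 3 1"
      by (simp add: vec3_eq_iff axis_val_nth)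
    then have "l v = l (v $ 1 *s axis_val 1 1 + v $ 2 *s axis_val 2 1 + v $ 3 *s axis_val 3 1)" by simp
    then show ?thesis by (simp add: assms mult.commute)
  qed
  then show ?thesis unfolding lin_form_def by blast
qed

lemma lin_form_co: "lin_form (\<lambda>v. co t v $ i)"
  by (rule lin_form_additive) (simp_all add: co_add co_scale)

lemma lin_form_ci: "lin_form (\<lambda>v. ci t v $ i)"
  by (rule lin_form_additive) (simp_all add: ci_add ci_scale)

lemma cubic_form_T0: "cubic_form (T0 t)" and cubic_form_T1: "cubic_form (T1 t)"
proof -
  have c: "cubic_form (\<lambda>v. (co t v $ i)^3)" for i
    using cubic_form_prod[OF lin_form_co lin_form_co lin_form_co, of t i t i t i] by (simp add: power3_eq_cube)
  have "cubic_form (\<lambda>v. (co t v $ i)^3 + (- 1) * (co t v $ j)^3)" for i j by (intro cubic_form_add cubic_form_cmult c)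
  then show "cubic_form (T0 t)" "cubic_form (T1 t)" unfolding T0_def[abs_def] T1_def[abs_def] by simp_all
qed

text \<open>Each of the ten monomials becomes a product of three linear forms.\<close>

lemma cubic_form_ci: assumes "cubic_form F" shows "cubic_form (\<lambda>v. F (ci t v))"
proof -
  obtain c where c: "\<And>x. F x = (\<Sum>i\<le>3. \<Sum>j\<le>3 - i. c i j * (x$1)^i * (x$2)^j * (x$3)^(3 - i - j))"
    using assms by (auto simp: cubic_form_def)
  have p: "cubic_form (\<lambda>v. k * (ci t v $ i1 * ci t v $ i2 * ci t v $ i3))" for k i1 i2 i3
    by (intro cubic_form_cmult cubic_form_prod lin_form_ci)
  have "cubic_form (\<lambda>v. c 0 0 * (ci t v $ 3 * ci t v $ 3 * ci t v $ 3) + (c 0 1 * (ci t v $ 2 * ci t v $ 3 * ci t v $ 3)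
    + (c 0 2 * (ci t v $ 2 * ci t v $ 2 * ci t v $ 3) + (c 0 3 * (ci t v $ 2 * ci t v $ 2 * ci t v $ 2)
    + (c 1 0 * (ci t v $ 1 * ci t v $ 3 * ci t v $ 3) + (c 1 1 * (ci t v $ 1 * ci t v $ 2 * ci t v $ 3)
    + (c 1 2 * (ci t v $ 1 * ci t v $ 2 * ci t v $ 2) + (c 2 0 * (ci t v $ 1 * ci t v $ 1 * ci t v $ 3)
    + (c 2 1 * (ci t v $ 1 * ci t v $ 1 * ci t v $ 2) + c 3 0 * (ci t v $ 1 * ci t v $ 1 * ci t v $ 1))))))))))"
    by (intro cubic_form_add p)
  then show ?thesis unfolding c cubic_sum_expand by (simp add: power2_eq_square power3_eq_cube mult_ac add_ac)
qed

text \<open>A polynomial of degree at most 2 with the three cube roots of unity as zeros is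
  zero.\<close>

lemma quadratic_three_roots:
  fixes p q r :: complex
  assumes "\<And>x. x^3 = 1 \<Longrightarrow> p + q * x + r * x^2 = 0" shows "p = 0" "q = 0" "r = 0"
proof -
  have 1: "p + q + r = 0" using assms[of 1] by simp
  have 2: "p + q * \<epsilon> + r * (- 1 - \<epsilon>) = 0" using assms[of \<epsilon>] eps3 eps2 by simp
  have "(\<epsilon>^2)^3 = 1" "(\<epsilon>^2)^2 = \<epsilon>" using eps3 by algebra+
  then have 3: "p + q * (- 1 - \<epsilon>) + r * \<epsilon> = 0" using assms[of "\<epsilon>^2"] by (simp only: eps2)
  have "3 * p = 0" using 1 2 3 by algebra
  then show p: "p = 0" by simp
  have "(q - r) * (1 + 2 * \<epsilon>) = 0" using 2 3 by algebra
  moreover have "1 + 2 * \<epsilon> \<noteq> 0"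
  proof
    assume "1 + 2 * \<epsilon> = 0"
    moreover have "(1 + 2 * \<epsilon>)^2 = - 3" by (simp add: eps_simps)
    ultimately show False by simp
  qed
  ultimately have "q = r" by simp
  then show "q = 0" "r = 0" using 1 p by (auto simp: mult_2[symmetric])
qed

text \<open>Interpolation at the nine points (1, a, b) with a^3 = b^3 = 1, first in a and then in b.
  Only the coefficients of the three cubes survive, and their sum is 0.\<close>

lemma fermat_pencil:
  assumes "cubic_form F" and z: "\<And>a b. a^3 = 1 \<Longrightarrow> b^3 = 1 \<Longrightarrow> F (vector [1, a, b]) = 0"
  obtains p q where "\<And>v. F v = p * ((v $ 2)^3 - (v $ 3)^3) + q * ((v $ 3)^3 - (v $ 1)^3)"
proof -
  obtain c where c: "\<And>x. F x = (\<Sum>i\<le>3. \<Sum>j\<le>3 - i. c i j * (x$1)^i * (x$2)^j * (x$3)^(3 - i - j))"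
    using assms by (auto simp: cubic_form_def)
  \<comment> \<open>Reduction modulo a^3 = b^3 = 1 leaves degree at most 2 in each variable.\<close>
  have e: "((c 0 0 + c 0 3 + c 3 0) + c 2 0 * b + c 1 0 * b^2) + (c 2 1 + c 1 1 * b + c 0 1 * b^2) * a + (c 1 2 + c 0 2 * b) * a^2 = 0"
    if "a^3 = 1" "b^3 = 1" for a b
    using z[OF that] that unfolding c cubic_sum_expand by (simp add: algebra_simps)
  have q: "(c 0 0 + c 0 3 + c 3 0) + c 2 0 * b + c 1 0 * b^2 = 0" "c 2 1 + c 1 1 * b + c 0 1 * b^2 = 0" "c 1 2 + c 0 2 * b + 0 * b^2 = 0"
    if "b^3 = 1" for b
    using quadratic_three_roots[OF e[OF _ that]] by simp_all
  have z0: "c 0 0 + c 0 3 + c 3 0 = 0" "c 2 0 = 0" "c 1 0 = 0" "c 2 1 = 0" "c 1 1 = 0" "c 0 1 = 0" "c 1 2 = 0" "c 0 2 = 0"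
    using quadratic_three_roots[OF q(1)] quadratic_three_roots[OF q(2)] quadratic_three_roots[OF q(3)] by simp_all
  show ?thesis
  proof (rule that[of "c 0 3" "- c 3 0"])
    fix v
    have "c 0 0 = - c 0 3 - c 3 0" using z0(1) by algebra
    then show "F v = c 0 3 * ((v $ 2)^3 - (v $ 3)^3) + - c 3 0 * ((v $ 3)^3 - (v $ 1)^3)"
      unfolding c cubic_sum_expand \<open>c 0 0 = _\<close> using z0(2-) by (simp add: left_diff_distrib right_diff_distrib)
  qed
qed

end

section \<open>The pencils and their Halphen cubics\<close>

context cube_root begin

definition fer :: "vertex_type \<Rightarrow> complex \<Rightarrow> complex \<Rightarrow> complex \<Rightarrow> complex^3 \<Rightarrow> complex" where
  "fer t \<alpha> \<beta> \<gamma> v = \<alpha> * (co t v $ 1)^3 + \<beta> * (co t v $ 2)^3 + \<gamma> * (co t v $ 3)^3"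

text \<open>The directional derivative at v along d of the diagonal cubic
  \<open>fer\<close>.\<close>

definition Dfer :: "vertex_type \<Rightarrow> complex \<Rightarrow> complex \<Rightarrow> complex \<Rightarrow> complex^3 \<Rightarrow> complex^3 \<Rightarrow> complex" where
  "Dfer t \<alpha> \<beta> \<gamma> v d = 3 * (\<alpha> * (co t v $ 1)^2 * co t d $ 1 + \<beta> * (co t v $ 2)^2 * co t d $ 2 + \<gamma> * (co t v $ 3)^2 * co t d $ 3)"

text \<open>The i-th adapted coordinate of v + s d + t e as a polynomial with outer variable s and
  inner variable t. Its companion \<open>lq\<close> is the same coordinate in the blow-up, for v + u
  (d + w e).\<close>

definition lp :: "vertex_type \<Rightarrow> complex^3 \<Rightarrow> complex^3 \<Rightarrow> complex^3 \<Rightarrow> 3 \<Rightarrow> complex poly poly" where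
  "lp t v d e i = [:[:co t v $ i, co t e $ i:], [:co t d $ i:]:]"

definition lq :: "vertex_type \<Rightarrow> complex^3 \<Rightarrow> complex^3 \<Rightarrow> complex^3 \<Rightarrow> 3 \<Rightarrow> complex poly poly" where
  "lq t v d e i = [:[:co t v $ i:], [:co t d $ i, co t e $ i:]:]"

definition chart where
  "chart t \<alpha> \<beta> \<gamma> v d e = [:[:\<alpha>:]:] * lp t v d e 1 ^ 3 + [:[:\<beta>:]:] * lp t v d e 2 ^ 3 + [:[:\<gamma>:]:] * lp t v d e 3 ^ 3"

definition blow where
  "blow t \<alpha> \<beta> \<gamma> v d e = [:[:\<alpha>:]:] * lq t v d e 1 ^ 3 + [:[:\<beta>:]:] * lq t v d e 2 ^ 3 + [:[:\<gamma>:]:] * lq t v d e 3 ^ 3"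

lemma chart_eval: "poly (poly (chart t \<alpha> \<beta> \<gamma> v d e) [:s:]) r = fer t \<alpha> \<beta> \<gamma> (v + s *s d + r *s e)"
proof -
  have "poly (poly (lp t v d e i) [:s:]) r = co t (v + s *s d + r *s e) $ i" for i
    by (simp add: lp_def co_add co_scale algebra_simps)
  then show ?thesis by (simp add: chart_def fer_def)
qed

lemma blow_eval: "poly (poly (blow t \<alpha> \<beta> \<gamma> v d e) [:s:]) r = fer t \<alpha> \<beta> \<gamma> (v + s *s d + (s * r) *s e)"
proof -
  have "poly (poly (lq t v d e i) [:s:]) r = co t (v + s *s d + (s * r) *s e) $ i" for i
    by (simp add: lq_def co_add co_scale algebra_simps)
  then show ?thesis by (simp add: blow_def fer_def)
qed

lemma lin_cube: "[:p, q:]^3 = [:p^3, 3 * p^2 * q, 3 * p * q^2, q^3:]" for p q :: "complex poly"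
  by (simp add: power2_eq_square power3_eq_cube algebra_simps)

lemma lin_cube': "[:p, q:]^3 = [:p^3, 3 * p^2 * q, 3 * p * q^2, q^3:]" for p q :: complex
  by (simp add: power2_eq_square power3_eq_cube algebra_simps)

lemma const_cube: "[:p:]^3 = [:p^3:]" "[:p:]^2 = [:p^2:]" for p :: complex
  by (simp_all add: power2_eq_square power3_eq_cube)

lemma chart_cf:
  "cf (chart t \<alpha> \<beta> \<gamma> v d e) 0 0 = fer t \<alpha> \<beta> \<gamma> v"
  "cf (chart t \<alpha> \<beta> \<gamma> v d e) 1 0 = Dfer t \<alpha> \<beta> \<gamma> v d"
  "cf (chart t \<alpha> \<beta> \<gamma> v d e) 0 1 = Dfer t \<alpha> \<beta> \<gamma> v e"
proof -
  have c: "cf ([:[:k:]:] * lp t v d e i ^ 3) a b = k * cf (lp t v d e i ^ 3) a b" for k i a b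
    by (simp add: cf_def)
  have s: "cf (P + Q) a b = cf P a b + cf Q a b" for P Q a b by (simp add: cf_def)
  have three: "(3 :: complex poly) = [:3:]" by (simp add: numeral_poly)
  have l: "cf (lp t v d e i ^ 3) 0 0 = (co t v $ i)^3" "cf (lp t v d e i ^ 3) 1 0 = 3 * (co t v $ i)^2 * co t d $ i"
    "cf (lp t v d e i ^ 3) 0 1 = 3 * (co t v $ i)^2 * co t e $ i" for i
    unfolding lp_def lin_cube cf_def by (simp_all add: three lin_cube' power2_eq_square coeff_mult)
  show "cf (chart t \<alpha> \<beta> \<gamma> v d e) 0 0 = fer t \<alpha> \<beta> \<gamma> v"
    "cf (chart t \<alpha> \<beta> \<gamma> v d e) 1 0 = Dfer t \<alpha> \<beta> \<gamma> v d"
    "cf (chart t \<alpha> \<beta> \<gamma> v d e) 0 1 = Dfer t \<alpha> \<beta> \<gamma> v e"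
    unfolding chart_def s c l fer_def Dfer_def by (simp_all add: algebra_simps)
qed

lemma blow_coeff:
  "coeff (blow t \<alpha> \<beta> \<gamma> v d e) 0 = [:fer t \<alpha> \<beta> \<gamma> v:]"
  "coeff (blow t \<alpha> \<beta> \<gamma> v d e) 1 = [:Dfer t \<alpha> \<beta> \<gamma> v d, Dfer t \<alpha> \<beta> \<gamma> v e:]"
proof -
  have three: "(3 :: complex poly) = [:3:]" by (simp add: numeral_poly)
  have l: "coeff (lq t v d e i ^ 3) 0 = [:(co t v $ i)^3:]"
    "coeff (lq t v d e i ^ 3) 1 = [:3 * (co t v $ i)^2 * co t d $ i, 3 * (co t v $ i)^2 * co t e $ i:]" for i
    unfolding lq_def lin_cube const_cube by (simp_all add: three)
  have c: "coeff ([:[:k:]:] * P) a = smult k (coeff P a)" for k a and P :: "complex poly poly" by simp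
  show "coeff (blow t \<alpha> \<beta> \<gamma> v d e) 0 = [:fer t \<alpha> \<beta> \<gamma> v:]"
    "coeff (blow t \<alpha> \<beta> \<gamma> v d e) 1 = [:Dfer t \<alpha> \<beta> \<gamma> v d, Dfer t \<alpha> \<beta> \<gamma> v e:]"
    unfolding blow_def coeff_add c l fer_def Dfer_def by (simp_all add: algebra_simps)
qed

lemma fer_scale: "fer t \<alpha> \<beta> \<gamma> (c *s v) = c^3 * fer t \<alpha> \<beta> \<gamma> v"
  by (simp add: fer_def co_scale power_mult_distrib algebra_simps)

lemma Dfer_linear: "Dfer t \<alpha> \<beta> \<gamma> v (a *s x + b *s y) = a * Dfer t \<alpha> \<beta> \<gamma> v x + b * Dfer t \<alpha> \<beta> \<gamma> v y"
  by (simp add: Dfer_def co_add co_scale algebra_simps)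

lemma Dfer_euler: "Dfer t \<alpha> \<beta> \<gamma> v v = 3 * fer t \<alpha> \<beta> \<gamma> v"
  by (simp add: Dfer_def fer_def power2_eq_square power3_eq_cube mult.assoc)

text \<open>If both derivatives vanish, Euler's relation adds the direction v, so the gradient
  vanishes. As no coefficient is 0, all coordinates of v are then 0.\<close>

lemma fer_smooth:
  assumes nz: "\<alpha> \<noteq> 0" "\<beta> \<noteq> 0" "\<gamma> \<noteq> 0" and v: "v \<noteq> 0" and sp: "vec.span {v, d, e} = UNIV"
    and z: "fer t \<alpha> \<beta> \<gamma> v = 0"
  shows "Dfer t \<alpha> \<beta> \<gamma> v d \<noteq> 0 \<or> Dfer t \<alpha> \<beta> \<gamma> v e \<noteq> 0"
proof (rule ccontr)
  assume "\<not> ?thesis"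
  then have de: "Dfer t \<alpha> \<beta> \<gamma> v d = 0" "Dfer t \<alpha> \<beta> \<gamma> v e = 0" by auto
  have all: "Dfer t \<alpha> \<beta> \<gamma> v x = 0" for x
  proof -
    obtain a b c where x: "x = a *s v + b *s d + c *s e" using span3[of x v d e] sp by auto
    have "x = 1 *s (a *s v + b *s d) + c *s e" using x by simp
    then show ?thesis using de Dfer_euler[of t \<alpha> \<beta> \<gamma> v] z by (simp only: Dfer_linear) simp
  qed
  have "co t v $ 1 = 0" using all[of "ci t (axis_val 1 1)"] nz by (simp add: Dfer_def co_ci axis_val_nth)
  moreover have "co t v $ 2 = 0" using all[of "ci t (axis_val 2 1)"] nz by (simp add: Dfer_def co_ci axis_val_nth)
  moreover have "co t v $ 3 = 0" using all[of "ci t (axis_val 3 1)"] nz by (simp add: Dfer_def co_ci axis_val_nth)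
  ultimately have "co t v = co t 0" by (simp add: co_0 vec3_eq_iff)
  then show False using v co_eq_iff by blast
qed

lemma mult_origin_chart:
  assumes nz: "\<alpha> \<noteq> 0" "\<beta> \<noteq> 0" "\<gamma> \<noteq> 0" and v: "v \<noteq> 0" and sp: "vec.span {v, d, e} = UNIV"
  shows "mult_origin (chart t \<alpha> \<beta> \<gamma> v d e) = (if fer t \<alpha> \<beta> \<gamma> v = 0 then 1 else 0)" "chart t \<alpha> \<beta> \<gamma> v d e \<noteq> 0"
proof -
  have "mult_origin (chart t \<alpha> \<beta> \<gamma> v d e) = (if fer t \<alpha> \<beta> \<gamma> v = 0 then 1 else 0) \<and> chart t \<alpha> \<beta> \<gamma> v d e \<noteq> 0"
  proof (cases "fer t \<alpha> \<beta> \<gamma> v = 0")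
    case True
    have g: "cf (chart t \<alpha> \<beta> \<gamma> v d e) 1 0 \<noteq> 0 \<or> cf (chart t \<alpha> \<beta> \<gamma> v d e) 0 1 \<noteq> 0"
      unfolding chart_cf by (rule fer_smooth[OF nz v sp True])
    have "mult_origin (chart t \<alpha> \<beta> \<gamma> v d e) = 1" by (rule mult_origin_1[OF _ g]) (use True in \<open>simp add: chart_cf\<close>)
    moreover have "chart t \<alpha> \<beta> \<gamma> v d e \<noteq> 0" using g by (auto simp: cf_def)
    ultimately show ?thesis using True by simp
  next
    case False
    then have g: "cf (chart t \<alpha> \<beta> \<gamma> v d e) 0 0 \<noteq> 0" by (simp add: chart_cf)
    then have "chart t \<alpha> \<beta> \<gamma> v d e \<noteq> 0" by (auto simp: cf_def)
    then show ?thesis using mult_origin_0[OF g] False by simp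
  qed
  then show "mult_origin (chart t \<alpha> \<beta> \<gamma> v d e) = (if fer t \<alpha> \<beta> \<gamma> v = 0 then 1 else 0)" "chart t \<alpha> \<beta> \<gamma> v d e \<noteq> 0" by auto
qed

text \<open>For a point on the curve, division by u leaves the derivative along d plus w times the
  derivative along e at u = 0. By smoothness at least one of the two is nonzero, so the strict
  transform is smooth there and contains the origin exactly for a tangent direction d.\<close>

lemma mult_origin_blow:
  assumes nz: "\<alpha> \<noteq> 0" "\<beta> \<noteq> 0" "\<gamma> \<noteq> 0" and v: "v \<noteq> 0" and sp: "vec.span {v, d, e} = UNIV"
  shows "mult_origin (strict (blow t \<alpha> \<beta> \<gamma> v d e)) = (if fer t \<alpha> \<beta> \<gamma> v = 0 \<and> Dfer t \<alpha> \<beta> \<gamma> v d = 0 then 1 else 0)"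
    "blow t \<alpha> \<beta> \<gamma> v d e \<noteq> 0"
proof -
  let ?B = "blow t \<alpha> \<beta> \<gamma> v d e"
  have "mult_origin (strict ?B) = (if fer t \<alpha> \<beta> \<gamma> v = 0 \<and> Dfer t \<alpha> \<beta> \<gamma> v d = 0 then 1 else 0) \<and> ?B \<noteq> 0"
  proof (cases "fer t \<alpha> \<beta> \<gamma> v = 0")
    case True
    have g: "Dfer t \<alpha> \<beta> \<gamma> v d \<noteq> 0 \<or> Dfer t \<alpha> \<beta> \<gamma> v e \<noteq> 0" by (rule fer_smooth[OF nz v sp True])
    have c0: "coeff ?B 0 = 0" using True by (simp add: blow_coeff(1))
    have c1: "coeff ?B 1 = [:Dfer t \<alpha> \<beta> \<gamma> v d, Dfer t \<alpha> \<beta> \<gamma> v e:]" by (rule blow_coeff(2))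
    then have c1nz: "coeff ?B 1 \<noteq> 0" using g by auto
    then have B0: "?B \<noteq> 0" by (metis coeff_0)
    have st: "strict ?B = poly_shift 1 ?B" by (rule strict_simple_root[OF c0 c1nz])
    have cs: "coeff (strict ?B) 0 = [:Dfer t \<alpha> \<beta> \<gamma> v d, Dfer t \<alpha> \<beta> \<gamma> v e:]"
      unfolding st coeff_poly_shift using c1 by simp
    have cfs: "cf (strict ?B) 0 0 = Dfer t \<alpha> \<beta> \<gamma> v d" "cf (strict ?B) 0 1 = Dfer t \<alpha> \<beta> \<gamma> v e" by (simp_all add: cf_def cs)
    show ?thesis
    proof (cases "Dfer t \<alpha> \<beta> \<gamma> v d = 0")
      case d0: True
      then have "mult_origin (strict ?B) = 1" using mult_origin_1[of "strict ?B"] cfs g by simp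
      then show ?thesis using d0 True B0 by simp
    next
      case False
      then have "mult_origin (strict ?B) = 0" using mult_origin_0[of "strict ?B"] cfs by simp
      then show ?thesis using False B0 by simp
    qed
  next
    case False
    then have c0: "coeff ?B 0 \<noteq> 0" by (simp add: blow_coeff(1))
    then have "?B \<noteq> 0" by (metis coeff_0)
    moreover have "mult_origin (strict ?B) = 0"
      unfolding strict_no_root[OF c0] by (rule mult_origin_0) (use False in \<open>simp add: cf_def blow_coeff(1)\<close>)
    ultimately show ?thesis using False by simp
  qed
  then show "mult_origin (strict ?B) = (if fer t \<alpha> \<beta> \<gamma> v = 0 \<and> Dfer t \<alpha> \<beta> \<gamma> v d = 0 then 1 else 0)" "?B \<noteq> 0" by auto
qed

lemma proj_space_nonzero: "p \<in> proj_space \<Longrightarrow> v \<in> p \<Longrightarrow> v \<noteq> 0" for v :: "complex^'n"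
  by (auto simp: proj_space_def proj_def)

lemma fer_multiplicity_le_1:
  assumes nz: "\<alpha> \<noteq> 0" "\<beta> \<noteq> 0" "\<gamma> \<noteq> 0" and p: "p \<in> proj_space"
  shows "multiplicity_at (fer t \<alpha> \<beta> \<gamma>) p \<le> 1"
proof -
  obtain v0 where v0: "p = proj v0" "v0 \<noteq> 0" using p by (auto simp: proj_space_def)
  have "multiplicity_at (fer t \<alpha> \<beta> \<gamma>) p = (if fer t \<alpha> \<beta> \<gamma> v0 = 0 then 1 else 0)"
  proof (rule multiplicity_at_eqI[OF p])
    fix v d e assume v: "v \<in> p" and sp: "vec.span {v, d, e} = UNIV"
    obtain c where c: "c \<noteq> 0" "v = c *s v0" using v v0 by (auto simp: proj_def)
    have "bipoly (\<lambda>s r. fer t \<alpha> \<beta> \<gamma> (v + s *s d + r *s e)) = chart t \<alpha> \<beta> \<gamma> v d e" by (rule bipoly_eqI) (rule chart_eval)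
    then show "mult_origin (bipoly (\<lambda>s r. fer t \<alpha> \<beta> \<gamma> (v + s *s d + r *s e))) = (if fer t \<alpha> \<beta> \<gamma> v0 = 0 then 1 else 0)"
      using mult_origin_chart(1)[OF nz proj_space_nonzero[OF p v] sp] c by (simp add: fer_scale)
  qed
  then show ?thesis by simp
qed

text \<open>A diagonal cubic that lacks one cube is a cone with its vertex on the corresponding
  axis. The point x with nonzero value ensures that the chart polynomial is not 0, where the least
  degree would be meaningless.\<close>

lemma fer_multiplicity_ge_2:
  assumes k: "co t v0 = axis_val k c0" "v0 \<noteq> 0"
    and coef: "k = 1 \<and> \<alpha> = 0 \<or> k = 2 \<and> \<beta> = 0 \<or> k = 3 \<and> \<gamma> = 0" and x: "fer t \<alpha> \<beta> \<gamma> x \<noteq> 0"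
  shows "multiplicity_at (fer t \<alpha> \<beta> \<gamma>) (proj v0) \<ge> 2"
proof -
  let ?F = "fer t \<alpha> \<beta> \<gamma>"
  define p where "p = proj v0"
  have p: "p \<in> proj_space" using k(2) by (auto simp: p_def proj_space_def)
  have ge: "mult_origin (bipoly (\<lambda>s r. ?F (v + s *s d + r *s e))) \<ge> 2"
    if v: "v \<in> p" and sp: "vec.span {v, d, e} = UNIV" for v d e
  proof -
    obtain c where c: "c \<noteq> 0" "v = c *s v0" using v by (auto simp: p_def proj_def)
    have cov: "co t v = axis_val k (c * c0)" unfolding c(2) co_scale k(1) by (simp add: vec3_eq_iff axis_val_nth)
    \<comment> \<open>Moving in the direction v does not change the form; this brings the witness x
      into the affine chart centred at v.\<close>
    have inv: "?F (r *s v + y) = ?F y" for r y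
      using coef cov by (auto simp: fer_def co_add co_scale axis_val_nth)
    have bip: "bipoly (\<lambda>s r. ?F (v + s *s d + r *s e)) = chart t \<alpha> \<beta> \<gamma> v d e" by (rule bipoly_eqI) (rule chart_eval)
    obtain a b c' where xe: "x = a *s v + b *s d + c' *s e" using span3[of x v d e] sp by auto
    have "?F (v + b *s d + c' *s e) = ?F (b *s d + c' *s e)" using inv[of 1 "b *s d + c' *s e"] by (simp add: add.assoc)
    also have "\<dots> = ?F x" using inv[of a "b *s d + c' *s e"] by (simp add: xe add.assoc)
    finally have "poly (poly (chart t \<alpha> \<beta> \<gamma> v d e) [:b:]) c' \<noteq> 0" using x by (simp add: chart_eval)
    then have nz: "chart t \<alpha> \<beta> \<gamma> v d e \<noteq> 0" by auto
    show ?thesis unfolding bip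
      by (rule mult_origin_ge_2[OF nz]; unfold chart_cf; use coef cov in \<open>auto simp: fer_def Dfer_def axis_val_nth\<close>)
  qed
  obtain d0 e0 where "vec.span {v0, d0, e0} = UNIV" by (rule chart_exists[OF k(2)])
  then have ex: "\<exists>x. case x of (v, d, e) \<Rightarrow> v \<in> p \<and> vec.span {v, d, e} = UNIV" using self_in_proj p_def by auto
  define y where "y = (SOME x. case x of (v, d, e) \<Rightarrow> v \<in> p \<and> vec.span {v, d, e} = UNIV)"
  have "case y of (v, d, e) \<Rightarrow> v \<in> p \<and> vec.span {v, d, e} = UNIV" unfolding y_def by (rule someI_ex[OF ex])
  then show ?thesis unfolding multiplicity_at_def p_def[symmetric] y_def[symmetric] using ge by (auto split: prod.splits)
qed

text \<open>Surjectivity by counting: the nine vertices of the other types give nine different pairs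
  of ratios, and there are only nine pairs of cube roots of unity.\<close>

lemma nine_points:
  assumes "a^3 = 1" "b^3 = 1" obtains p where "p \<in> vertices_off \<epsilon> t" "ci t (vector [1, a, b]) \<in> p"
proof -
  define w where "w = (\<lambda>(t', u). co t (vertex_coords \<epsilon> t' u))"
  define f where "f i = (w i $ 2 / w i $ 1, w i $ 3 / w i $ 1)" for i
  define I where "I = (UNIV - {t}) \<times> (UNIV :: vertex_index set)"
  define R where "R = {a::complex. a^3 = 1} \<times> {b::complex. b^3 = 1}"
  have w1: "w i $ 1 \<noteq> 0" and w3: "(w i $ 2)^3 = (w i $ 1)^3" "(w i $ 3)^3 = (w i $ 1)^3" if "i \<in> I" for i
    using that co_other[of "fst i" t "snd i"] co_other_nz[of "fst i" t "snd i"] by (auto simp: I_def w_def split: prod.splits)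
  have sub: "f ` I \<subseteq> R" using w1 w3 by (auto simp: f_def R_def power_divide)
  have "inj_on f I"
  proof (rule inj_onI)
    fix i j assume ij: "i \<in> I" "j \<in> I" "f i = f j"
    define c where "c = w j $ 1 / w i $ 1"
    have "c \<noteq> 0" using w1 ij by (simp add: c_def)
    have "w j = c *s w i" using ij w1[OF ij(1)] w1[OF ij(2)] by (simp add: vec3_eq_iff f_def c_def field_simps)
    then have "co t (vertex_coords \<epsilon> (fst j) (snd j)) = co t (c *s vertex_coords \<epsilon> (fst i) (snd i))"
      by (simp add: w_def co_scale case_prod_unfold)
    then have "vertex_coords \<epsilon> (fst j) (snd j) = c *s vertex_coords \<epsilon> (fst i) (snd i)" by (simp add: co_eq_iff)
    then have "vx (fst i) (snd i) = vx (fst j) (snd j)" by (rule proj_eqI[OF \<open>c \<noteq> 0\<close>])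
    then show "i = j" by (simp add: vx_inj prod_eq_iff)
  qed
  then have "card (f ` I) = card I" by (rule card_image)
  also have "\<dots> = 9" unfolding I_def card_cartesian_product UNIV_vertex_type UNIV_vertex_index by (cases t) auto
  also have "\<dots> = card R" using card_cube_roots[of 1] by (simp add: R_def card_cartesian_product)
  finally have ceq: "card (f ` I) = card R" .
  have "card R = 9" using card_cube_roots[of 1] by (simp add: R_def card_cartesian_product)
  then have "finite R" by (metis card.infinite zero_neq_numeral)
  then have "f ` I = R" using sub ceq by (intro card_subset_eq)
  then have "(a, b) \<in> f ` I" using assms by (simp add: R_def)
  then obtain t' u where i: "(t', u) \<in> I" "(a, b) = f (t', u)" by auto
  have "t' \<noteq> t" using i by (simp add: I_def)
  have n1: "w (t', u) $ 1 \<noteq> 0" using w1[OF i(1)] .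
  have "vector [1, a, b] = inverse (w (t', u) $ 1) *s w (t', u)"
    using i(2) n1 by (simp add: f_def vec3_eq_iff divide_inverse mult.commute)
  then have "ci t (vector [1, a, b]) = inverse (w (t', u) $ 1) *s vertex_coords \<epsilon> t' u"
    by (simp add: ci_scale w_def ci_co)
  then have "ci t (vector [1, a, b]) \<in> vx t' u" unfolding proj_def using n1 by (auto intro!: exI[of _ "inverse (w (t', u) $ 1)"])
  moreover have "vx t' u \<in> vertices_off \<epsilon> t" unfolding vertices_off_eq using \<open>t' \<noteq> t\<close> by blast
  ultimately show ?thesis using that by blast
qed

lemma T_vertex_off: "t' \<noteq> t \<Longrightarrow> v \<in> vx t' u \<Longrightarrow> T0 t v = 0 \<and> T1 t v = 0"
proof -
  assume t: "t' \<noteq> t" and v: "v \<in> vx t' u"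
  then obtain c where c: "v = c *s vertex_coords \<epsilon> t' u" by (auto simp: proj_def)
  have "T0 t (vertex_coords \<epsilon> t' u) = 0" "T1 t (vertex_coords \<epsilon> t' u) = 0" using co_other[OF t, of u] by (simp_all add: T0_def T1_def)
  then show ?thesis unfolding c by (simp add: T_scale)
qed

lemma pencil_forms_iff: "F \<in> pencil_forms \<epsilon> t \<longleftrightarrow> (\<exists>p q. F = (\<lambda>v. p * T0 t v + q * T1 t v))"
proof
  assume F: "F \<in> pencil_forms \<epsilon> t"
  then have cub: "cubic_form (\<lambda>v. F (ci t v))" by (intro cubic_form_ci) (simp add: pencil_forms_def)
  have zero: "\<forall>p \<in> vertices_off \<epsilon> t. \<forall>v \<in> p. F v = 0" using F by (simp add: pencil_forms_def)
  have van: "F (ci t (vector [1, a, b])) = 0" if ab: "a^3 = 1" "b^3 = 1" for a b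
  proof -
    obtain p where "p \<in> vertices_off \<epsilon> t" "ci t (vector [1, a, b]) \<in> p" by (rule nine_points[OF ab])
    then show ?thesis by (rule zero[rule_format])
  qed
  obtain p q where pq: "\<And>v. F (ci t v) = p * ((v $ 2)^3 - (v $ 3)^3) + q * ((v $ 3)^3 - (v $ 1)^3)"
  proof (rule fermat_pencil[OF cub van])
    fix p q assume thesis_if: "\<And>v. F (ci t v) = p * ((v $ 2)^3 - (v $ 3)^3) + q * ((v $ 3)^3 - (v $ 1)^3)"
    then show ?thesis by (rule that)
  qed
  have "F v = p * T0 t v + q * T1 t v" for v using pq[of "co t v"] by (simp add: ci_co T0_def T1_def)
  then show "\<exists>p q. F = (\<lambda>v. p * T0 t v + q * T1 t v)" by blast
next
  assume "\<exists>p q. F = (\<lambda>v. p * T0 t v + q * T1 t v)"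
  then obtain p q where F: "F = (\<lambda>v. p * T0 t v + q * T1 t v)" by blast
  have "cubic_form F" unfolding F by (intro cubic_form_add cubic_form_cmult cubic_form_T0 cubic_form_T1)
  moreover have "F v = 0" if p: "p' \<in> vertices_off \<epsilon> t" and v: "v \<in> p'" for p' v
  proof -
    obtain t' u where "p' = vx t' u" "t' \<noteq> t" using p unfolding vertices_off_eq by blast
    then show ?thesis using T_vertex_off v by (simp add: F)
  qed
  ultimately show "F \<in> pencil_forms \<epsilon> t" by (simp add: pencil_forms_def)
qed

text \<open>The minus sign makes the parameter f belong to the member T1 - f T0, so that f is the
  ratio T1/T0. The singular members T0, T1 and T2 then have the parameters \<infinity>, 0 and -1,
  which is the set \<open>M_std\<close>.\<close>

definition FB :: "vertex_type \<Rightarrow> complex^3 \<Rightarrow> complex" where "FB t = (\<lambda>v. - T0 t v)"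

lemma T_independent: "(\<And>v. a * FB t v + b * T1 t v = 0) \<Longrightarrow> a = 0 \<and> b = 0"
proof -
  assume a: "\<And>v. a * FB t v + b * T1 t v = 0"
  have "a = 0" using a[of "ci t (axis_val 2 1)"] by (simp add: FB_def T0_def T1_def co_ci axis_val_nth)
  moreover have "b = 0" using a[of "ci t (axis_val 1 1)"] by (simp add: FB_def T0_def T1_def co_ci axis_val_nth)
  ultimately show ?thesis by simp
qed

lemma pencil_basis_std: "pencil_basis \<epsilon> t (FB t) (T1 t)"
  unfolding pencil_basis_def
proof (intro conjI)
  show "pencil_forms \<epsilon> t = {\<lambda>x. a * FB t x + b * T1 t x | a b. True}"
  proof (intro equalityI subsetI)
    fix F assume "F \<in> pencil_forms \<epsilon> t"
    then obtain p q where "F = (\<lambda>v. p * T0 t v + q * T1 t v)" using pencil_forms_iff by blast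
    then have "F = (\<lambda>x. (- p) * FB t x + q * T1 t x)" by (simp add: FB_def)
    then show "F \<in> {\<lambda>x. a * FB t x + b * T1 t x | a b. True}" by blast
  next
    fix F assume "F \<in> {\<lambda>x. a * FB t x + b * T1 t x | a b. True}"
    then obtain a b where "F = (\<lambda>x. a * FB t x + b * T1 t x)" by blast
    then have "F = (\<lambda>v. (- a) * T0 t v + b * T1 t v)" by (simp add: FB_def)
    then show "F \<in> pencil_forms \<epsilon> t" using pencil_forms_iff by blast
  qed
  show "\<forall>a b. (\<forall>x. a * FB t x + b * T1 t x = 0) \<longrightarrow> a = 0 \<and> b = 0" using T_independent by blast
qed

definition cm :: "vertex_type \<Rightarrow> complex \<Rightarrow> complex^3 \<Rightarrow> complex" where "cm t f v = T1 t v - f * T0 t v"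

lemma cm_fer: "c * cm t f v = fer t (- c) (- (c * f)) (c * (1 + f)) v"
  by (simp add: cm_def fer_def T0_def T1_def algebra_simps)

lemma pencil_member_iff: "H \<in> pencil_member F G q \<longleftrightarrow> (\<exists>w\<in>q. H = (\<lambda>x. w $ 1 * F x + w $ 2 * G x))"
  by (simp only: pencil_member_def mem_Collect_eq Bex_def conj_commute)

definition cls :: "vertex_type \<Rightarrow> complex \<Rightarrow> (complex^3 \<Rightarrow> complex) set" where
  "cls t f = {F. \<exists>c. c \<noteq> 0 \<and> F = (\<lambda>v. c * cm t f v)}"

lemma member_pt: "pencil_member (FB t) (T1 t) (pt f) = cls t f"
proof (intro equalityI subsetI)
  fix F assume "F \<in> pencil_member (FB t) (T1 t) (pt f)"
  then obtain w where w: "w \<in> pt f" "F = (\<lambda>x. w $ 1 * FB t x + w $ 2 * T1 t x)" by (auto simp only: pencil_member_iff)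
  obtain c where c: "c \<noteq> 0" "w = c *s vector [f, 1]" using w(1) by (auto simp: pt_def proj_def)
  have "F = (\<lambda>v. c * cm t f v)" unfolding w(2) by (rule ext) (simp add: c(2) cm_def FB_def algebra_simps)
  then show "F \<in> cls t f" using c(1) by (auto simp only: cls_def)
next
  fix F assume "F \<in> cls t f"
  then obtain c where c: "c \<noteq> 0" "F = (\<lambda>v. c * cm t f v)" by (auto simp only: cls_def)
  have w: "c *s vector [f, 1] \<in> pt f" using c(1) by (auto simp: pt_def proj_def)
  have "F = (\<lambda>x. (c *s vector [f, 1] :: complex^2) $ 1 * FB t x + (c *s vector [f, 1] :: complex^2) $ 2 * T1 t x)"
    unfolding c(2) by (rule ext) (simp add: cm_def FB_def algebra_simps)
  then show "F \<in> pencil_member (FB t) (T1 t) (pt f)" unfolding pencil_member_iff using w by (rule bexI)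
qed

lemma ci_axis: "co t (ci t (axis_val k 1)) = axis_val k 1" "k \<in> {1,2,3} \<Longrightarrow> ci t (axis_val k 1) \<noteq> 0"
proof -
  show "co t (ci t (axis_val k 1)) = axis_val k 1" by (rule co_ci)
  assume k: "k \<in> {1,2,3}"
  show "ci t (axis_val k 1) \<noteq> 0"
  proof
    assume "ci t (axis_val k 1) = 0"
    then have "axis_val k 1 = 0" using co_ci[of t "axis_val k 1"] co_0[of t] by simp
    then show False using k by (auto simp: vec3_eq_iff axis_val_nth)
  qed
qed

lemma singular_fer:
  fixes k :: nat
  assumes "fer t \<alpha> \<beta> \<gamma> \<in> C" "k = 1 \<and> \<alpha> = 0 \<or> k = 2 \<and> \<beta> = 0 \<or> k = 3 \<and> \<gamma> = 0" "fer t \<alpha> \<beta> \<gamma> x \<noteq> 0"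
  shows "singular_cubic C"
proof -
  have k: "k \<in> {1,2,3}" using assms(2) by auto
  have "multiplicity_at (fer t \<alpha> \<beta> \<gamma>) (proj (ci t (axis_val k 1))) \<ge> 2"
    by (rule fer_multiplicity_ge_2[OF ci_axis(1) ci_axis(2)[OF k] assms(2,3)])
  moreover have "proj (ci t (axis_val k 1)) \<in> proj_space" using ci_axis(2)[OF k] by (auto simp: proj_space_def)
  ultimately show ?thesis using assms(1) by (auto simp: singular_cubic_def)
qed

lemma singular_members: "{q \<in> proj_space. singular_cubic (pencil_member (FB t) (T1 t) q)} = M_std"
proof -
  have inf: "singular_cubic (pencil_member (FB t) (T1 t) pt_inf)"
  proof (rule singular_fer[where k = 1 and x = "ci t (axis_val 2 1)" and \<alpha> = 0 and \<beta> = "-1" and \<gamma> = 1])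
    have "fer t 0 (-1) 1 = (\<lambda>x. (vector [1, 0] :: complex^2) $ 1 * FB t x + (vector [1, 0] :: complex^2) $ 2 * T1 t x)"
      by (auto simp: fer_def FB_def T0_def)
    then show "fer t 0 (-1) 1 \<in> pencil_member (FB t) (T1 t) pt_inf" unfolding pencil_member_iff pt_inf_def using self_in_proj by (rule bexI)
  qed (simp_all add: fer_def co_ci axis_val_nth)
  have z: "singular_cubic (pencil_member (FB t) (T1 t) (pt 0))"
  proof (rule singular_fer[where k = 2 and x = "ci t (axis_val 1 1)" and \<alpha> = "-1" and \<beta> = 0 and \<gamma> = 1])
    have "fer t (-1) 0 1 = (\<lambda>v. 1 * cm t 0 v)" by (rule ext) (simp add: cm_fer)
    then show "fer t (-1) 0 1 \<in> pencil_member (FB t) (T1 t) (pt 0)" unfolding member_pt cls_def by (intro CollectI exI[of _ 1]) simp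
  qed (simp_all add: fer_def co_ci axis_val_nth)
  have m: "singular_cubic (pencil_member (FB t) (T1 t) (pt (-1)))"
  proof (rule singular_fer[where k = 3 and x = "ci t (axis_val 1 1)" and \<alpha> = "-1" and \<beta> = 1 and \<gamma> = 0])
    have "fer t (-1) 1 0 = (\<lambda>v. 1 * cm t (-1) v)" by (rule ext) (simp add: cm_fer)
    then show "fer t (-1) 1 0 \<in> pencil_member (FB t) (T1 t) (pt (-1))" unfolding member_pt cls_def by (intro CollectI exI[of _ 1]) simp
  qed (simp_all add: fer_def co_ci axis_val_nth)
  have o: "\<not> singular_cubic (pencil_member (FB t) (T1 t) (pt f))" if f: "f \<noteq> 0" "f \<noteq> - 1" for f
  proof
    assume "singular_cubic (pencil_member (FB t) (T1 t) (pt f))"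
    then obtain c p where c: "c \<noteq> 0" and p: "p \<in> proj_space" "multiplicity_at (\<lambda>v. c * cm t f v) p \<ge> 2"
      by (auto simp only: singular_cubic_def member_pt cls_def)
    have "(\<lambda>v. c * cm t f v) = fer t (- c) (- (c * f)) (c * (1 + f))" by (rule ext) (rule cm_fer)
    moreover have "multiplicity_at (fer t (- c) (- (c * f)) (c * (1 + f))) p \<le> 1"
      by (rule fer_multiplicity_le_1[OF _ _ _ p(1)]) (use c f in \<open>auto simp: add_eq_0_iff\<close>)
    ultimately show False using p(2) by simp
  qed
  show ?thesis
  proof (intro equalityI subsetI)
    fix q assume "q \<in> {q \<in> proj_space. singular_cubic (pencil_member (FB t) (T1 t) q)}"
    then have q: "q \<in> proj_space" "singular_cubic (pencil_member (FB t) (T1 t) q)" by auto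
    show "q \<in> M_std"
    proof (cases "q = pt_inf")
      case False
      then obtain f where f: "q = pt f" using q(1) unfolding proj_space_2 by blast
      then have "f = 0 \<or> f = - 1" using o[of f] q(2) by blast
      then show ?thesis by (auto simp: f M_std_def)
    qed (simp add: M_std_def)
  next
    fix q assume "q \<in> M_std"
    then show "q \<in> {q \<in> proj_space. singular_cubic (pencil_member (FB t) (T1 t) q)}" using inf z m by (auto simp: M_std_def)
  qed
qed

lemma pencil_basis_independent: "pencil_basis \<epsilon> t F G \<Longrightarrow> \<forall>x. p * F x + q * G x = 0 \<Longrightarrow> p = 0 \<and> q = 0"
  unfolding pencil_basis_def by (drule conjunct2, drule spec[of _ p], drule spec[of _ q], drule mp, assumption+)

text \<open>Two bases differ by an invertible matrix that acts on the parameters. The parameters of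
  singular members and hence the torsion parameters move along with it, so the resulting set of
  cubics is that of the standard basis.\<close>

lemma halphen_basis_change:
  assumes b: "pencil_basis \<epsilon> t F G"
  shows "pencil_member F G ` torsion_params {q \<in> proj_space. singular_cubic (pencil_member F G q)} (3 * m) = cls t ` SF m"
proof -
  have "F \<in> {\<lambda>x. a * F x + b * G x | a b. True}" "G \<in> {\<lambda>x. a * F x + b * G x | a b. True}"
    by (rule CollectI, rule exI[of _ 1], rule exI[of _ 0], simp, rule CollectI, rule exI[of _ 0], rule exI[of _ 1], simp)
  then have FG: "F \<in> pencil_forms \<epsilon> t" "G \<in> pencil_forms \<epsilon> t" using b[unfolded pencil_basis_def, THEN conjunct1] by (simp_all only:)
  note std = pencil_basis_std[of t, unfolded pencil_basis_def, THEN conjunct1]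
  obtain a c where F: "F = (\<lambda>x. a * FB t x + c * T1 t x)" using FG(1) unfolding std by (elim CollectE exE conjE)
  obtain b' d where G: "G = (\<lambda>x. b' * FB t x + d * T1 t x)" using FG(2) unfolding std by (elim CollectE exE conjE)
  note ind = pencil_basis_independent[OF b]
  have D: "a * d - b' * c \<noteq> 0"
  proof
    assume D0: "a * d - b' * c = 0"
    have "\<forall>x. d * F x + (- c) * G x = 0"
    proof
      fix x
      have "d * F x + (- c) * G x = (a * d - b' * c) * FB t x" by (simp add: F G algebra_simps)
      then show "d * F x + (- c) * G x = 0" using D0 by simp
    qed
    from ind[OF this] have dc: "d = 0" "c = 0" by auto
    have "\<forall>x. b' * F x + (- a) * G x = 0"
      by (simp add: F G dc algebra_simps)
    from ind[OF this] have "a = 0" "b' = 0" by auto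
    then have "\<forall>x. 1 * F x + 0 * G x = 0" using dc by (simp add: F)
    from ind[OF this] show False by simp
  qed
  \<comment> \<open>The columns are the coordinates of F and G in the standard basis.\<close>
  let ?N = "m2 a b' c d"
  have mem: "pencil_member F G q = pencil_member (FB t) (T1 t) (act ?N q)" for q
  proof -
    have e: "(\<lambda>x. w $ 1 * F x + w $ 2 * G x) = (\<lambda>x. (?N *v w) $ 1 * FB t x + (?N *v w) $ 2 * T1 t x)" for w
      by (simp add: F G m2_mult algebra_simps)
    show ?thesis
    proof (intro equalityI subsetI)
      fix H assume "H \<in> pencil_member F G q"
      then obtain w where w: "w \<in> q" "H = (\<lambda>x. w $ 1 * F x + w $ 2 * G x)" by (auto simp only: pencil_member_iff)
      have "?N *v w \<in> act ?N q" using w(1) by (simp add: act_def)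
      with w(2)[unfolded e] show "H \<in> pencil_member (FB t) (T1 t) (act ?N q)" unfolding pencil_member_iff by (rule bexI)
    next
      fix H assume "H \<in> pencil_member (FB t) (T1 t) (act ?N q)"
      then obtain w where w: "w \<in> q" "H = (\<lambda>x. (?N *v w) $ 1 * FB t x + (?N *v w) $ 2 * T1 t x)"
        unfolding pencil_member_iff act_def by (elim bexE imageE) simp
      show "H \<in> pencil_member F G q" unfolding pencil_member_iff using w(2)[folded e] w(1) by (rule bexI)
    qed
  qed
  let ?M = "{q \<in> proj_space. singular_cubic (pencil_member F G q)}"
  have MN: "act ?N ` ?M = M_std"
  proof (intro equalityI subsetI)
    fix q assume "q \<in> act ?N ` ?M"
    then show "q \<in> M_std" unfolding singular_members[of t, symmetric] using act_proj_space[OF D] mem by auto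
  next
    fix q assume "q \<in> M_std"
    then have q: "q \<in> proj_space" "singular_cubic (pencil_member (FB t) (T1 t) q)" unfolding singular_members[of t, symmetric] by auto
    define q' where "q' = act (m2 d (- b') (- c) a) q"
    have "act ?N q' = q" unfolding q'_def by (rule act_inverse(2)[OF D q(1)])
    moreover have "q' \<in> proj_space" unfolding q'_def by (rule act_proj_space[OF _ q(1)]) (use D in \<open>simp add: algebra_simps\<close>)
    ultimately show "q \<in> act ?N ` ?M" using q(2) mem[of q'] by (intro image_eqI[of _ _ q']) auto
  qed
  have "pencil_member F G ` torsion_params ?M (3 * m) = pencil_member (FB t) (T1 t) ` act ?N ` torsion_params ?M (3 * m)"
    unfolding image_image mem ..
  also have "act ?N ` torsion_params ?M (3 * m) = torsion_params (act ?N ` ?M) (3 * m)"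
    by (rule torsion_params_act[OF D, symmetric]) auto
  also have "\<dots> = pt ` SF m" unfolding MN by (rule torsion_params_std)
  finally show ?thesis unfolding image_image member_pt .
qed

lemma halphen_cubics_eq: "halphen_cubics \<epsilon> m = (\<lambda>(t, f). cls t f) ` (UNIV \<times> SF m)"
proof (intro equalityI subsetI)
  fix C assume "C \<in> halphen_cubics \<epsilon> m"
  then obtain t F G q where b: "pencil_basis \<epsilon> t F G" and C: "C = pencil_member F G q"
    and q: "q \<in> torsion_params {q \<in> proj_space. singular_cubic (pencil_member F G q)} (3 * m)"
    by (auto simp only: halphen_cubics_def)
  have "C \<in> cls t ` SF m" unfolding halphen_basis_change[OF b, symmetric] C using q by blast
  then show "C \<in> (\<lambda>(t, f). cls t f) ` (UNIV \<times> SF m)" by auto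
next
  fix C assume "C \<in> (\<lambda>(t, f). cls t f) ` (UNIV \<times> SF m)"
  then obtain t where "C \<in> cls t ` SF m" by auto
  then have "C \<in> pencil_member (FB t) (T1 t) ` torsion_params {q \<in> proj_space. singular_cubic (pencil_member (FB t) (T1 t) q)} (3 * m)"
    unfolding halphen_basis_change[OF pencil_basis_std] .
  then obtain q where "q \<in> torsion_params {q \<in> proj_space. singular_cubic (pencil_member (FB t) (T1 t) q)} (3 * m)"
    "C = pencil_member (FB t) (T1 t) q" by (rule imageE)
  then show "C \<in> halphen_cubics \<epsilon> m" unfolding halphen_cubics_def
    by (intro CollectI exI[of _ t] exI[of _ "FB t"] exI[of _ "T1 t"] exI[of _ q] conjI pencil_basis_std)
qed

end

section \<open>Tangent directions, and multiplicities of the union as counts\<close>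

context cube_root begin

text \<open>Directional derivatives of \<open>T0\<close>, \<open>T1\<close>, \<open>T2\<close> with
  the common factor 3 omitted.\<close>

definition D0 :: "vertex_type \<Rightarrow> complex^3 \<Rightarrow> complex^3 \<Rightarrow> complex" where
  "D0 t v d = (co t v $ 2)^2 * co t d $ 2 - (co t v $ 3)^2 * co t d $ 3"
definition D1 :: "vertex_type \<Rightarrow> complex^3 \<Rightarrow> complex^3 \<Rightarrow> complex" where
  "D1 t v d = (co t v $ 3)^2 * co t d $ 3 - (co t v $ 1)^2 * co t d $ 1"
definition D2 :: "vertex_type \<Rightarrow> complex^3 \<Rightarrow> complex^3 \<Rightarrow> complex" where
  "D2 t v d = (co t v $ 1)^2 * co t d $ 1 - (co t v $ 2)^2 * co t d $ 2"

definition Dcm :: "vertex_type \<Rightarrow> complex \<Rightarrow> complex^3 \<Rightarrow> complex^3 \<Rightarrow> complex" where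
  "Dcm t f v d = D1 t v d - f * D0 t v d"

lemma Dcm_fer: "Dfer t (- c) (- (c * f)) (c * (1 + f)) v d = 3 * c * Dcm t f v d"
  by (simp add: Dcm_def D0_def D1_def Dfer_def algebra_simps)

lemma D_linear:
  "D0 t v (a *s x + b *s y) = a * D0 t v x + b * D0 t v y" "D1 t v (a *s x + b *s y) = a * D1 t v x + b * D1 t v y"
  by (simp_all add: D0_def D1_def co_add co_scale algebra_simps)

lemma Dcm_linear: "Dcm t f v (a *s x + b *s y) = a * Dcm t f v x + b * Dcm t f v y"
  by (simp add: Dcm_def D_linear algebra_simps)

lemma D_self: "D0 t v v = T0 t v" "D1 t v v = T1 t v"
  by (simp_all add: D0_def D1_def T0_def T1_def power2_eq_square power3_eq_cube)

lemma Dcm_self: "Dcm t f v v = cm t f v" by (simp add: Dcm_def cm_def D_self)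

lemma Dcm_scale: "Dcm t f (c *s v) d = c^2 * Dcm t f v d"
  by (simp add: Dcm_def D0_def D1_def co_scale power_mult_distrib algebra_simps)

lemma cm_scale: "cm t f (c *s v) = c^3 * cm t f v"
  by (simp add: cm_def T_scale algebra_simps)

lemma cm_own: "f \<noteq> 0 \<Longrightarrow> f \<noteq> - 1 \<Longrightarrow> v \<in> vx t u \<Longrightarrow> cm t f v \<noteq> 0"
proof -
  assume f: "f \<noteq> 0" "f \<noteq> - 1" and v: "v \<in> vx t u"
  obtain c where c: "c \<noteq> 0" "v = c *s vertex_coords \<epsilon> t u" using v by (auto simp: proj_def)
  obtain k where k: "k \<noteq> 0" "co t (vertex_coords \<epsilon> t u) = axis_val (vpos t u) k" using co_own by blast
  have f': "1 + f \<noteq> 0" using f(2) by (auto simp: add_eq_0_iff)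
  have "cm t f (vertex_coords \<epsilon> t u) = fer t (- 1) (- f) (1 + f) (vertex_coords \<epsilon> t u)"
    using cm_fer[of 1 t f "vertex_coords \<epsilon> t u"] by simp
  also have "\<dots> \<noteq> 0" using vpos_range[of t u] f f' k(1) by (auto simp: fer_def k(2) axis_val_nth)
  finally show ?thesis using c by (simp add: cm_scale)
qed

lemma cm_off: "t' \<noteq> t \<Longrightarrow> v \<in> vx t' u \<Longrightarrow> cm t f v = 0"
  using T_vertex_off[of t' t v u] by (simp add: cm_def)

lemma clsI: "c \<noteq> 0 \<Longrightarrow> F = (\<lambda>v. c * cm t f v) \<Longrightarrow> F \<in> cls t f"
  unfolding cls_def by (intro CollectI exI[of _ c] conjI)

lemma clsE: "F \<in> cls t f \<Longrightarrow> (\<And>c. c \<noteq> 0 \<Longrightarrow> F = (\<lambda>v. c * cm t f v) \<Longrightarrow> P) \<Longrightarrow> P"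
  unfolding cls_def by (elim CollectE exE conjE)

text \<open>The type is recognised at its own vertices, where members of the other pencils vanish
  and this one does not; the parameter is read off from two coordinate points.\<close>

lemma cls_inj:
  assumes f: "f \<noteq> 0" "f \<noteq> - 1" and e: "cls t f = cls t' f'" shows "t = t' \<and> f = f'"
proof -
  have "(\<lambda>v. 1 * cm t' f' v) \<in> cls t' f'" by (rule clsI[OF one_neq_zero refl])
  then have "(\<lambda>v. 1 * cm t' f' v) \<in> cls t f" using e by simp
  then obtain c where c: "c \<noteq> 0" "(\<lambda>v. 1 * cm t' f' v) = (\<lambda>v. c * cm t f v)" by (rule clsE)
  have e: "cm t' f' v = c * cm t f v" for v using fun_cong[OF c(2), of v] by simp
  have tt: "t = t'"
  proof (rule ccontr)
    assume "t \<noteq> t'"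
    then have "cm t' f' (vertex_coords \<epsilon> t Idx_0) = 0" by (rule cm_off) (rule self_in_proj)
    moreover have "cm t f (vertex_coords \<epsilon> t Idx_0) \<noteq> 0" by (rule cm_own[OF f]) (rule self_in_proj)
    ultimately show False using e c(1) by simp
  qed
  have "c = 1" using e[of "ci t (axis_val 1 1)"] tt by (simp add: cm_def T0_def T1_def co_ci axis_val_nth)
  moreover have "f' = c * f" using e[of "ci t (axis_val 2 1)"] tt by (simp add: cm_def T0_def T1_def co_ci axis_val_nth)
  ultimately show ?thesis using tt by simp
qed

text \<open>The scalars k i record which equation \<open>SOME\<close> picks in each class; they are
  absorbed into the diagonal coefficients and do not affect multiplicities.\<close>

lemma halphen_union_prod:
  "\<exists>k. (\<forall>i. k i \<noteq> 0) \<and> (\<forall>x. halphen_union \<epsilon> m x =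
    (\<Prod>i\<in>UNIV \<times> SF m. fer (fst i) (- k i) (- (k i * snd i)) (k i * (1 + snd i)) x))"
proof -
  have "\<exists>k. k \<noteq> 0 \<and> (SOME F. F \<in> cls (fst i) (snd i)) = (\<lambda>v. k * cm (fst i) (snd i) v)" for i
  proof -
    have "(\<lambda>v. 1 * cm (fst i) (snd i) v) \<in> cls (fst i) (snd i)" by (rule clsI[OF one_neq_zero refl])
    then have "(SOME F. F \<in> cls (fst i) (snd i)) \<in> cls (fst i) (snd i)" by (rule someI[of "\<lambda>F. F \<in> cls (fst i) (snd i)"])
    then show ?thesis by (rule clsE) (rule exI, rule conjI)
  qed
  then have "\<exists>k. \<forall>i. k i \<noteq> 0 \<and> (SOME F. F \<in> cls (fst i) (snd i)) = (\<lambda>v. k i * cm (fst i) (snd i) v)"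
    by (intro choice allI)
  then obtain k where kk: "\<forall>i. k i \<noteq> 0 \<and> (SOME F. F \<in> cls (fst i) (snd i)) = (\<lambda>v. k i * cm (fst i) (snd i) v)" by (rule exE)
  have k: "\<And>i. k i \<noteq> 0" "\<And>i. (SOME F. F \<in> cls (fst i) (snd i)) = (\<lambda>v. k i * cm (fst i) (snd i) v)"
    by (rule kk[THEN spec, THEN conjunct1], rule kk[THEN spec, THEN conjunct2])
  have inj: "inj_on (\<lambda>i. cls (fst i) (snd i)) (UNIV \<times> SF m)"
  proof (rule inj_onI)
    fix i j assume i: "i \<in> UNIV \<times> SF m" and e: "cls (fst i) (snd i) = cls (fst j) (snd j)"
    have f: "snd i \<in> SF m" using i by auto
    show "i = j" using cls_inj[OF SF_nz(1)[OF f] SF_nz(2)[OF f] e] by (simp add: prod_eq_iff)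
  qed
  have "halphen_union \<epsilon> m x = (\<Prod>i\<in>UNIV \<times> SF m. fer (fst i) (- k i) (- (k i * snd i)) (k i * (1 + snd i)) x)" for x
    unfolding halphen_union_def halphen_cubics_eq case_prod_unfold prod.reindex[OF inj] comp_def k(2) cm_fer ..
  then show ?thesis using k(1) by (intro exI[of _ k] conjI allI)
qed

lemma card_filter_sum: "finite I \<Longrightarrow> (\<Sum>i\<in>I. if P i then 1 else 0) = card {i \<in> I. P i}"
  by (simp add: sum.If_cases Int_def)

lemma span_scale: "c \<noteq> 0 \<Longrightarrow> vec.span {c *s v, d} = vec.span {v, d}" for v d :: "complex^3"
  unfolding span2
proof (intro equalityI subsetI, goal_cases)
  case (1 x)
  then obtain a b where "x = a *s (c *s v) + b *s d" by blast
  then have "x = (a * c) *s v + b *s d" by simp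
  then show ?case by blast
next
  case (2 x)
  then obtain a b where "x = a *s v + b *s d" by blast
  then have "x = (a / c) *s (c *s v) + b *s d" using 2 by simp
  then show ?case by blast
qed

text \<open>Every factor is a smooth cubic, so it adds 1 when it passes through the point, or
  through the infinitely near point, and 0 otherwise.\<close>

lemma multiplicity_union:
  assumes m: "m \<ge> 1" and p: "p \<in> proj_space" and v0: "v0 \<in> p"
  shows "multiplicity_at (halphen_union \<epsilon> m) p = card {i \<in> UNIV \<times> SF m. cm (fst i) (snd i) v0 = 0}"
    and "l \<in> exceptional_curve p \<Longrightarrow> l = vec.span {v0, d0} \<Longrightarrow> inf_near_multiplicity (halphen_union \<epsilon> m) p l =
      card {i \<in> UNIV \<times> SF m. cm (fst i) (snd i) v0 = 0 \<and> Dcm (fst i) (snd i) v0 d0 = 0}"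
proof -
  let ?I = "UNIV \<times> SF m :: (vertex_type \<times> complex) set"
  obtain k where kU: "(\<forall>i. k i \<noteq> 0) \<and> (\<forall>x. halphen_union \<epsilon> m x =
      (\<Prod>i\<in>?I. fer (fst i) (- k i) (- (k i * snd i)) (k i * (1 + snd i)) x))" using halphen_union_prod[of m] by (rule exE)
  note k = kU[THEN conjunct1, rule_format] and U = kU[THEN conjunct2, rule_format]
  have fin: "finite ?I" using card_SF(1)[OF m] by simp
  have nz: "- k i \<noteq> 0" "- (k i * snd i) \<noteq> 0" "k i * (1 + snd i) \<noteq> 0" if "i \<in> ?I" for i
  proof -
    have "snd i \<in> SF m" using that by auto
    then have "snd i \<noteq> 0" "1 + snd i \<noteq> 0" using SF_nz[of "snd i" m] by (auto simp: add_eq_0_iff)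
    then show "- k i \<noteq> 0" "- (k i * snd i) \<noteq> 0" "k i * (1 + snd i) \<noteq> 0" using k by auto
  qed
  have vz: "v \<noteq> 0" if "v \<in> p" for v by (rule proj_space_nonzero[OF p that])
  have vc: "\<exists>c. c \<noteq> 0 \<and> v = c *s v0" if "v \<in> p" for v
  proof -
    obtain w where w: "p = proj w" using p by (auto simp: proj_space_def)
    obtain a where "a \<noteq> 0" "v0 = a *s w" using v0 unfolding w proj_def by blast
    moreover obtain b where "b \<noteq> 0" "v = b *s w" using \<open>v \<in> p\<close> unfolding w proj_def by blast
    ultimately have a: "a \<noteq> 0" "v0 = a *s w" "b \<noteq> 0" "v = b *s w" by blast+
    then show ?thesis by (intro exI[of _ "b / a"]) simp
  qed
  show "multiplicity_at (halphen_union \<epsilon> m) p = card {i \<in> ?I. cm (fst i) (snd i) v0 = 0}"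
  proof (rule multiplicity_at_eqI[OF p])
    fix v d e assume v: "v \<in> p" and sp: "vec.span {v, d, e} = UNIV"
    obtain c where c: "c \<noteq> 0" "v = c *s v0" using vc[OF v] by blast
    let ?P = "\<lambda>i. chart (fst i) (- k i) (- (k i * snd i)) (k i * (1 + snd i)) v d e"
    have b: "bipoly (\<lambda>s r. halphen_union \<epsilon> m (v + s *s d + r *s e)) = (\<Prod>i\<in>?I. ?P i)"
      by (rule bipoly_eqI) (simp add: U poly_prod chart_eval)
    have "mult_origin (\<Prod>i\<in>?I. ?P i) = (\<Sum>i\<in>?I. mult_origin (?P i))"
      by (rule mult_origin_prod[OF fin]) (rule mult_origin_chart(2)[OF nz vz[OF v] sp])
    also have "\<dots> = (\<Sum>i\<in>?I. if cm (fst i) (snd i) v0 = 0 then 1 else 0)"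
    proof (rule sum.cong[OF refl])
      fix i assume i: "i \<in> ?I"
      have "fer (fst i) (- k i) (- (k i * snd i)) (k i * (1 + snd i)) v = 0 \<longleftrightarrow> cm (fst i) (snd i) v0 = 0"
        unfolding cm_fer[symmetric] using k[of i] c by (simp add: cm_scale)
      then show "mult_origin (?P i) = (if cm (fst i) (snd i) v0 = 0 then 1 else 0)"
        using mult_origin_chart(1)[OF nz[OF i] vz[OF v] sp] by simp
    qed
    also have "\<dots> = card {i \<in> ?I. cm (fst i) (snd i) v0 = 0}" by (rule card_filter_sum[OF fin])
    finally show "mult_origin (bipoly (\<lambda>s r. halphen_union \<epsilon> m (v + s *s d + r *s e))) = card {i \<in> ?I. cm (fst i) (snd i) v0 = 0}"
      unfolding b .
  qed
  assume l: "l \<in> exceptional_curve p" and l0: "l = vec.span {v0, d0}"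
  show "inf_near_multiplicity (halphen_union \<epsilon> m) p l = card {i \<in> ?I. cm (fst i) (snd i) v0 = 0 \<and> Dcm (fst i) (snd i) v0 d0 = 0}"
  proof (rule inf_near_eqI[OF p l])
    fix v d e assume v: "v \<in> p" and vd: "vec.span {v, d} = l" and sp: "vec.span {v, d, e} = UNIV"
    obtain c where c: "c \<noteq> 0" "v = c *s v0" using vc[OF v] by blast
    let ?P = "\<lambda>i. blow (fst i) (- k i) (- (k i * snd i)) (k i * (1 + snd i)) v d e"
    have b: "bipoly (\<lambda>s r. halphen_union \<epsilon> m (v + s *s d + (s * r) *s e)) = (\<Prod>i\<in>?I. ?P i)"
      by (rule bipoly_eqI) (simp add: U poly_prod blow_eval)
    have bnz: "?P i \<noteq> 0" if "i \<in> ?I" for i by (rule mult_origin_blow(2)[OF nz[OF that] vz[OF v] sp])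
    have sd: "vec.span {v0, d} = vec.span {v0, d0}" using vd l0 span_scale[OF c(1)] unfolding c(2) by simp
    have "d \<in> vec.span {v0, d}" "d0 \<in> vec.span {v0, d0}" by (simp_all add: vec.span_base)
    then have "d \<in> vec.span {v0, d0}" "d0 \<in> vec.span {v0, d}" unfolding sd by auto
    then obtain a1 b1 a2 b2 where d: "d = a1 *s v0 + b1 *s d0" "d0 = a2 *s v0 + b2 *s d" unfolding span2 by blast
    \<comment> \<open>Tangency depends only on the line spanned: the derivative along v0 itself is
      the value at v0, which is 0.\<close>
    have Diff: "Dcm t f v0 d = 0 \<longleftrightarrow> Dcm t f v0 d0 = 0" if "cm t f v0 = 0" for t f
    proof -
      have "Dcm t f v0 d = b1 * Dcm t f v0 d0" "Dcm t f v0 d0 = b2 * Dcm t f v0 d"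
        using that by (subst d(1), simp add: Dcm_linear Dcm_self, subst d(2), simp add: Dcm_linear Dcm_self)
      then show ?thesis by auto
    qed
    have "mult_origin (strict (\<Prod>i\<in>?I. ?P i)) = mult_origin (\<Prod>i\<in>?I. strict (?P i))"
      by (simp only: strict_prod[OF fin bnz])
    also have "\<dots> = (\<Sum>i\<in>?I. mult_origin (strict (?P i)))"
      by (rule mult_origin_prod[OF fin]) (rule strict_nz[OF bnz])
    also have "\<dots> = (\<Sum>i\<in>?I. if cm (fst i) (snd i) v0 = 0 \<and> Dcm (fst i) (snd i) v0 d0 = 0 then 1 else 0)"
    proof (rule sum.cong[OF refl])
      fix i assume i: "i \<in> ?I"
      have f: "fer (fst i) (- k i) (- (k i * snd i)) (k i * (1 + snd i)) v = 0 \<longleftrightarrow> cm (fst i) (snd i) v0 = 0"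
        unfolding cm_fer[symmetric] using k[of i] c by (simp add: cm_scale)
      have D: "Dfer (fst i) (- k i) (- (k i * snd i)) (k i * (1 + snd i)) v d = 0 \<longleftrightarrow> Dcm (fst i) (snd i) v0 d = 0"
        unfolding Dcm_fer using k[of i] c by (simp add: Dcm_scale)
      show "mult_origin (strict (?P i)) = (if cm (fst i) (snd i) v0 = 0 \<and> Dcm (fst i) (snd i) v0 d0 = 0 then 1 else 0)"
        unfolding mult_origin_blow(1)[OF nz[OF i] vz[OF v] sp] f D using Diff by auto
    qed
    also have "\<dots> = card {i \<in> ?I. cm (fst i) (snd i) v0 = 0 \<and> Dcm (fst i) (snd i) v0 d0 = 0}" by (rule card_filter_sum[OF fin])
    finally show "mult_origin (strict (bipoly (\<lambda>s r. halphen_union \<epsilon> m (v + s *s d + (s * r) *s e)))) =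
      card {i \<in> ?I. cm (fst i) (snd i) v0 = 0 \<and> Dcm (fst i) (snd i) v0 d0 = 0}"
      unfolding b .
  qed
qed

text \<open>Applied to \<open>T0\<close>, \<open>T1\<close>, \<open>T2\<close> at a point, this says
  that the member through the point has a torsion parameter T1/T0. The condition is put on a triple
  with sum 0 because it is invariant under permuting the entries.\<close>

definition tors :: "nat \<Rightarrow> complex \<Rightarrow> complex \<Rightarrow> complex \<Rightarrow> bool" where
  "tors m a b c \<longleftrightarrow> a + b + c = 0 \<and> a \<noteq> 0 \<and> b / a \<in> SF m"

lemma tors_nz: "tors m a b c \<Longrightarrow> a \<noteq> 0 \<and> b \<noteq> 0 \<and> c \<noteq> 0"
proof -
  assume t: "tors m a b c"
  then have a: "a \<noteq> 0" "b / a \<in> SF m" "a + b + c = 0" by (auto simp: tors_def)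
  have "b / a \<noteq> 0" "b / a \<noteq> - 1" using SF_nz[OF a(2)] by auto
  then show ?thesis using a by (auto simp: divide_eq_eq add_eq_0_iff)
qed

text \<open>Exchanging the first two entries replaces f by 1/f, exchanging the last two replaces it
  by -1-f; both preserve \<open>SF m\<close>.\<close>

lemma tors_swap: "tors m a b c \<longleftrightarrow> tors m b a c"
proof -
  have "tors m b a c" if t: "tors m a b c" for a b c
    using t tors_nz[OF t] SF_inverse[of "b / a" m] by (auto simp: tors_def add_ac)
  then show ?thesis by blast
qed

lemma tors_swap': "tors m a b c \<longleftrightarrow> tors m a c b"
proof -
  have "tors m a c b" if t: "tors m a b c" for a b c
  proof -
    have a: "a \<noteq> 0" "b / a \<in> SF m" "a + b + c = 0" using t by (auto simp: tors_def)
    have c: "c = - a - b" using a(3) by algebra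
    have "c / a = - 1 - b / a" unfolding c using a(1) by (simp add: diff_divide_distrib)
    then show ?thesis using SF_uminus[OF a(2)] a by (simp add: tors_def add_ac)
  qed
  then show ?thesis by blast
qed

lemma tors_scale: "k \<noteq> 0 \<Longrightarrow> tors m (k * a) (k * b) (k * c) \<longleftrightarrow> tors m a b c"
  by (auto simp: tors_def simp flip: distrib_left)

lemma card_ratio:
  assumes "a \<noteq> 0 \<or> b \<noteq> 0" "a + b + c = 0"
  shows "card {f \<in> SF m. b - f * a = 0} = (if tors m a b c then 1 else 0)"
proof (cases "a = 0")
  case True
  then show ?thesis using assms by (simp add: tors_def)
next
  case False
  then have "{f \<in> SF m. b - f * a = 0} = (if b / a \<in> SF m then {b / a} else {})" by (auto simp: field_simps)
  then show ?thesis using False assms by (simp add: tors_def)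
qed

lemma card_product_filter:
  assumes "finite B" shows "card {i \<in> UNIV \<times> B. P (fst i) (snd i)} = (\<Sum>t\<in>(UNIV :: vertex_type set). card {f \<in> B. P t f})"
proof -
  have "{i \<in> UNIV \<times> B. P (fst i) (snd i)} = Sigma UNIV (\<lambda>t. {f \<in> B. P t f})" by auto
  then show ?thesis using assms by simp
qed

lemma D_sum: "D0 t v d + D1 t v d + D2 t v d = 0" by (simp add: D0_def D1_def D2_def)

text \<open>At each vertex the tangent data of the three pencils having it as base point are
  compared with those of one reference pencil: they agree up to a cube root of unity and a
  permutation of the three branch points.\<close>

lemma D_relations:
  "D0 D_type (vertex_coords \<epsilon> V_type Idx_0) d = \<epsilon> * D0 H_type (vertex_coords \<epsilon> V_type Idx_0) d"
  "D1 D_type (vertex_coords \<epsilon> V_type Idx_0) d = \<epsilon> * D1 H_type (vertex_coords \<epsilon> V_type Idx_0) d"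
  "D2 D_type (vertex_coords \<epsilon> V_type Idx_0) d = \<epsilon> * D2 H_type (vertex_coords \<epsilon> V_type Idx_0) d"
  "D0 G_type (vertex_coords \<epsilon> V_type Idx_0) d = \<epsilon>^2 * D0 H_type (vertex_coords \<epsilon> V_type Idx_0) d"
  "D1 G_type (vertex_coords \<epsilon> V_type Idx_0) d = \<epsilon>^2 * D1 H_type (vertex_coords \<epsilon> V_type Idx_0) d"
  "D2 G_type (vertex_coords \<epsilon> V_type Idx_0) d = \<epsilon>^2 * D2 H_type (vertex_coords \<epsilon> V_type Idx_0) d"
  "D0 D_type (vertex_coords \<epsilon> V_type Idx_1) d = \<epsilon> * D2 H_type (vertex_coords \<epsilon> V_type Idx_1) d"
  "D1 D_type (vertex_coords \<epsilon> V_type Idx_1) d = \<epsilon> * D0 H_type (vertex_coords \<epsilon> V_type Idx_1) d"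
  "D2 D_type (vertex_coords \<epsilon> V_type Idx_1) d = \<epsilon> * D1 H_type (vertex_coords \<epsilon> V_type Idx_1) d"
  "D0 G_type (vertex_coords \<epsilon> V_type Idx_1) d = \<epsilon>^2 * D1 H_type (vertex_coords \<epsilon> V_type Idx_1) d"
  "D1 G_type (vertex_coords \<epsilon> V_type Idx_1) d = \<epsilon>^2 * D2 H_type (vertex_coords \<epsilon> V_type Idx_1) d"
  "D2 G_type (vertex_coords \<epsilon> V_type Idx_1) d = \<epsilon>^2 * D0 H_type (vertex_coords \<epsilon> V_type Idx_1) d"
  "D0 D_type (vertex_coords \<epsilon> V_type Idx_inf) d = \<epsilon> * D1 H_type (vertex_coords \<epsilon> V_type Idx_inf) d"
  "D1 D_type (vertex_coords \<epsilon> V_type Idx_inf) d = \<epsilon> * D2 H_type (vertex_coords \<epsilon> V_type Idx_inf) d"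
  "D2 D_type (vertex_coords \<epsilon> V_type Idx_inf) d = \<epsilon> * D0 H_type (vertex_coords \<epsilon> V_type Idx_inf) d"
  "D0 G_type (vertex_coords \<epsilon> V_type Idx_inf) d = \<epsilon>^2 * D2 H_type (vertex_coords \<epsilon> V_type Idx_inf) d"
  "D1 G_type (vertex_coords \<epsilon> V_type Idx_inf) d = \<epsilon>^2 * D0 H_type (vertex_coords \<epsilon> V_type Idx_inf) d"
  "D2 G_type (vertex_coords \<epsilon> V_type Idx_inf) d = \<epsilon>^2 * D1 H_type (vertex_coords \<epsilon> V_type Idx_inf) d"
  "D0 D_type (vertex_coords \<epsilon> H_type Idx_0) d = \<epsilon>^2 * D0 V_type (vertex_coords \<epsilon> H_type Idx_0) d"
  "D1 D_type (vertex_coords \<epsilon> H_type Idx_0) d = \<epsilon>^2 * D1 V_type (vertex_coords \<epsilon> H_type Idx_0) d"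
  "D2 D_type (vertex_coords \<epsilon> H_type Idx_0) d = \<epsilon>^2 * D2 V_type (vertex_coords \<epsilon> H_type Idx_0) d"
  "D0 G_type (vertex_coords \<epsilon> H_type Idx_0) d = \<epsilon> * D0 V_type (vertex_coords \<epsilon> H_type Idx_0) d"
  "D1 G_type (vertex_coords \<epsilon> H_type Idx_0) d = \<epsilon> * D2 V_type (vertex_coords \<epsilon> H_type Idx_0) d"
  "D2 G_type (vertex_coords \<epsilon> H_type Idx_0) d = \<epsilon> * D1 V_type (vertex_coords \<epsilon> H_type Idx_0) d"
  "D0 D_type (vertex_coords \<epsilon> H_type Idx_1) d = \<epsilon>^2 * D1 V_type (vertex_coords \<epsilon> H_type Idx_1) d"
  "D1 D_type (vertex_coords \<epsilon> H_type Idx_1) d = \<epsilon>^2 * D2 V_type (vertex_coords \<epsilon> H_type Idx_1) d"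
  "D2 D_type (vertex_coords \<epsilon> H_type Idx_1) d = \<epsilon>^2 * D0 V_type (vertex_coords \<epsilon> H_type Idx_1) d"
  "D0 G_type (vertex_coords \<epsilon> H_type Idx_1) d = \<epsilon> * D2 V_type (vertex_coords \<epsilon> H_type Idx_1) d"
  "D1 G_type (vertex_coords \<epsilon> H_type Idx_1) d = \<epsilon> * D1 V_type (vertex_coords \<epsilon> H_type Idx_1) d"
  "D2 G_type (vertex_coords \<epsilon> H_type Idx_1) d = \<epsilon> * D0 V_type (vertex_coords \<epsilon> H_type Idx_1) d"
  "D0 D_type (vertex_coords \<epsilon> H_type Idx_inf) d = \<epsilon>^2 * D2 V_type (vertex_coords \<epsilon> H_type Idx_inf) d"
  "D1 D_type (vertex_coords \<epsilon> H_type Idx_inf) d = \<epsilon>^2 * D0 V_type (vertex_coords \<epsilon> H_type Idx_inf) d"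
  "D2 D_type (vertex_coords \<epsilon> H_type Idx_inf) d = \<epsilon>^2 * D1 V_type (vertex_coords \<epsilon> H_type Idx_inf) d"
  "D0 G_type (vertex_coords \<epsilon> H_type Idx_inf) d = \<epsilon> * D1 V_type (vertex_coords \<epsilon> H_type Idx_inf) d"
  "D1 G_type (vertex_coords \<epsilon> H_type Idx_inf) d = \<epsilon> * D0 V_type (vertex_coords \<epsilon> H_type Idx_inf) d"
  "D2 G_type (vertex_coords \<epsilon> H_type Idx_inf) d = \<epsilon> * D2 V_type (vertex_coords \<epsilon> H_type Idx_inf) d"
  "D0 H_type (vertex_coords \<epsilon> D_type Idx_0) d = \<epsilon> * D0 V_type (vertex_coords \<epsilon> D_type Idx_0) d"
  "D1 H_type (vertex_coords \<epsilon> D_type Idx_0) d = \<epsilon> * D2 V_type (vertex_coords \<epsilon> D_type Idx_0) d"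
  "D2 H_type (vertex_coords \<epsilon> D_type Idx_0) d = \<epsilon> * D1 V_type (vertex_coords \<epsilon> D_type Idx_0) d"
  "D0 G_type (vertex_coords \<epsilon> D_type Idx_0) d = \<epsilon>^2 * D0 V_type (vertex_coords \<epsilon> D_type Idx_0) d"
  "D1 G_type (vertex_coords \<epsilon> D_type Idx_0) d = \<epsilon>^2 * D1 V_type (vertex_coords \<epsilon> D_type Idx_0) d"
  "D2 G_type (vertex_coords \<epsilon> D_type Idx_0) d = \<epsilon>^2 * D2 V_type (vertex_coords \<epsilon> D_type Idx_0) d"
  "D0 H_type (vertex_coords \<epsilon> D_type Idx_1) d = \<epsilon> * D1 V_type (vertex_coords \<epsilon> D_type Idx_1) d"
  "D1 H_type (vertex_coords \<epsilon> D_type Idx_1) d = \<epsilon> * D0 V_type (vertex_coords \<epsilon> D_type Idx_1) d"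
  "D2 H_type (vertex_coords \<epsilon> D_type Idx_1) d = \<epsilon> * D2 V_type (vertex_coords \<epsilon> D_type Idx_1) d"
  "D0 G_type (vertex_coords \<epsilon> D_type Idx_1) d = \<epsilon>^2 * D2 V_type (vertex_coords \<epsilon> D_type Idx_1) d"
  "D1 G_type (vertex_coords \<epsilon> D_type Idx_1) d = \<epsilon>^2 * D0 V_type (vertex_coords \<epsilon> D_type Idx_1) d"
  "D2 G_type (vertex_coords \<epsilon> D_type Idx_1) d = \<epsilon>^2 * D1 V_type (vertex_coords \<epsilon> D_type Idx_1) d"
  "D0 H_type (vertex_coords \<epsilon> D_type Idx_inf) d = \<epsilon> * D2 V_type (vertex_coords \<epsilon> D_type Idx_inf) d"
  "D1 H_type (vertex_coords \<epsilon> D_type Idx_inf) d = \<epsilon> * D1 V_type (vertex_coords \<epsilon> D_type Idx_inf) d"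
  "D2 H_type (vertex_coords \<epsilon> D_type Idx_inf) d = \<epsilon> * D0 V_type (vertex_coords \<epsilon> D_type Idx_inf) d"
  "D0 G_type (vertex_coords \<epsilon> D_type Idx_inf) d = \<epsilon>^2 * D1 V_type (vertex_coords \<epsilon> D_type Idx_inf) d"
  "D1 G_type (vertex_coords \<epsilon> D_type Idx_inf) d = \<epsilon>^2 * D2 V_type (vertex_coords \<epsilon> D_type Idx_inf) d"
  "D2 G_type (vertex_coords \<epsilon> D_type Idx_inf) d = \<epsilon>^2 * D0 V_type (vertex_coords \<epsilon> D_type Idx_inf) d"
  "D0 H_type (vertex_coords \<epsilon> G_type Idx_0) d = \<epsilon>^2 * D0 V_type (vertex_coords \<epsilon> G_type Idx_0) d"
  "D1 H_type (vertex_coords \<epsilon> G_type Idx_0) d = \<epsilon>^2 * D1 V_type (vertex_coords \<epsilon> G_type Idx_0) d"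
  "D2 H_type (vertex_coords \<epsilon> G_type Idx_0) d = \<epsilon>^2 * D2 V_type (vertex_coords \<epsilon> G_type Idx_0) d"
  "D0 D_type (vertex_coords \<epsilon> G_type Idx_0) d = \<epsilon> * D0 V_type (vertex_coords \<epsilon> G_type Idx_0) d"
  "D1 D_type (vertex_coords \<epsilon> G_type Idx_0) d = \<epsilon> * D2 V_type (vertex_coords \<epsilon> G_type Idx_0) d"
  "D2 D_type (vertex_coords \<epsilon> G_type Idx_0) d = \<epsilon> * D1 V_type (vertex_coords \<epsilon> G_type Idx_0) d"
  "D0 H_type (vertex_coords \<epsilon> G_type Idx_1) d = \<epsilon>^2 * D1 V_type (vertex_coords \<epsilon> G_type Idx_1) d"
  "D1 H_type (vertex_coords \<epsilon> G_type Idx_1) d = \<epsilon>^2 * D2 V_type (vertex_coords \<epsilon> G_type Idx_1) d"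
  "D2 H_type (vertex_coords \<epsilon> G_type Idx_1) d = \<epsilon>^2 * D0 V_type (vertex_coords \<epsilon> G_type Idx_1) d"
  "D0 D_type (vertex_coords \<epsilon> G_type Idx_1) d = \<epsilon> * D2 V_type (vertex_coords \<epsilon> G_type Idx_1) d"
  "D1 D_type (vertex_coords \<epsilon> G_type Idx_1) d = \<epsilon> * D1 V_type (vertex_coords \<epsilon> G_type Idx_1) d"
  "D2 D_type (vertex_coords \<epsilon> G_type Idx_1) d = \<epsilon> * D0 V_type (vertex_coords \<epsilon> G_type Idx_1) d"
  "D0 H_type (vertex_coords \<epsilon> G_type Idx_inf) d = \<epsilon>^2 * D2 V_type (vertex_coords \<epsilon> G_type Idx_inf) d"
  "D1 H_type (vertex_coords \<epsilon> G_type Idx_inf) d = \<epsilon>^2 * D0 V_type (vertex_coords \<epsilon> G_type Idx_inf) d"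
  "D2 H_type (vertex_coords \<epsilon> G_type Idx_inf) d = \<epsilon>^2 * D1 V_type (vertex_coords \<epsilon> G_type Idx_inf) d"
  "D0 D_type (vertex_coords \<epsilon> G_type Idx_inf) d = \<epsilon> * D1 V_type (vertex_coords \<epsilon> G_type Idx_inf) d"
  "D1 D_type (vertex_coords \<epsilon> G_type Idx_inf) d = \<epsilon> * D0 V_type (vertex_coords \<epsilon> G_type Idx_inf) d"
  "D2 D_type (vertex_coords \<epsilon> G_type Idx_inf) d = \<epsilon> * D2 V_type (vertex_coords \<epsilon> G_type Idx_inf) d"
  by (simp_all add: D0_def D1_def D2_def dft_def eps_simps)

text \<open>Scalars and permutations do not affect \<open>tors\<close>, so the table of relations
  reduces every type to the reference type h (at vertices of type v) or v (at all others).\<close>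

lemma tors_D:
  assumes "t \<noteq> s" "t' \<noteq> s"
  shows "tors m (D0 t (vertex_coords \<epsilon> s u) d) (D1 t (vertex_coords \<epsilon> s u) d) (D2 t (vertex_coords \<epsilon> s u) d) \<longleftrightarrow>
    tors m (D0 t' (vertex_coords \<epsilon> s u) d) (D1 t' (vertex_coords \<epsilon> s u) d) (D2 t' (vertex_coords \<epsilon> s u) d)"
proof -
  let ?r = "if s = V_type then H_type else V_type"
  have e2: "\<epsilon>^2 \<noteq> 0" using eps_nz by simp
  have rot: "tors m b c a \<longleftrightarrow> tors m a b c" "tors m c a b \<longleftrightarrow> tors m a b c" "tors m c b a \<longleftrightarrow> tors m a b c"
    "tors m b a c \<longleftrightarrow> tors m a b c" "tors m a c b \<longleftrightarrow> tors m a b c" for a b c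
    using tors_swap tors_swap' by metis+
  have "tors m (D0 t (vertex_coords \<epsilon> s u) d) (D1 t (vertex_coords \<epsilon> s u) d) (D2 t (vertex_coords \<epsilon> s u) d) \<longleftrightarrow>
    tors m (D0 ?r (vertex_coords \<epsilon> s u) d) (D1 ?r (vertex_coords \<epsilon> s u) d) (D2 ?r (vertex_coords \<epsilon> s u) d)" if "t \<noteq> s" for t
    using that
    by (cases s; cases t; cases u)
       (simp_all only: D_relations tors_scale[OF eps_nz] tors_scale[OF e2] rot if_True if_False vertex_type.distinct simp_thms refl)
  then show ?thesis using assms by blast
qed

text \<open>The members of a pencil separate the tangent directions at a base point: both
  derivatives vanish only along the vertex vector itself, which is no direction.\<close>

lemma D_nondegenerate:
  assumes t: "t \<noteq> s" and z: "D0 t (vertex_coords \<epsilon> s u) d = 0" "D1 t (vertex_coords \<epsilon> s u) d = 0"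
  shows "\<exists>k. d = k *s vertex_coords \<epsilon> s u"
proof -
  let ?v = "vertex_coords \<epsilon> s u"
  obtain x y w where x: "co t ?v $ 1 = x" "co t ?v $ 2 = y" "co t ?v $ 3 = w" by blast
  have c: "x^3 \<noteq> 0" "y^3 = x^3" "w^3 = x^3" using co_other[OF t[symmetric], of u] by (simp_all add: x)
  have nz: "x \<noteq> 0" "y \<noteq> 0" "w \<noteq> 0" using co_other_nz[OF t[symmetric], of u] by (simp_all add: x)
  define k where "k = co t d $ 1 / x"
  have 1: "co t d $ 1 = k * x" using nz by (simp add: k_def)
  have "w^2 * co t d $ 3 = x^2 * (k * x)" using z(2) 1 by (simp add: D1_def x)
  then have "w^2 * co t d $ 3 = w^2 * (k * w)" using c(3) by algebra
  then have 3: "co t d $ 3 = k * w" using nz by simp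
  have "y^2 * co t d $ 2 = w^2 * (k * w)" using z(1) 3 by (simp add: D0_def x)
  then have "y^2 * co t d $ 2 = y^2 * (k * y)" using c(2,3) by algebra
  then have 2: "co t d $ 2 = k * y" using nz by simp
  have "co t d = co t (k *s ?v)" by (simp add: vec3_eq_iff co_scale x 1 2 3)
  then show ?thesis unfolding co_eq_iff by blast
qed

end

section \<open>Multiplicities at the vertices\<close>

context cube_root begin

lemma vertex_coords_nz: "vertex_coords \<epsilon> t u \<noteq> 0"
  by (cases t; cases u) (simp_all add: vec3_eq_iff)

lemma vx_proj_space: "vx t u \<in> proj_space"
  unfolding proj_space_def using vertex_coords_nz[of t u] by blast

lemma card_other_types: "card (UNIV - {s :: vertex_type}) = 3"
  by (cases s) (simp_all add: UNIV_vertex_type insert_Diff_if)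

lemma cm_own_vertex: "f \<in> SF m \<Longrightarrow> cm s f (vertex_coords \<epsilon> s u) \<noteq> 0"
  by (rule cm_own[OF SF_nz(1) SF_nz(2) self_in_proj])

lemma cm_off_vertex: "t \<noteq> s \<Longrightarrow> cm t f (vertex_coords \<epsilon> s u) = 0"
  by (rule cm_off[OF not_sym self_in_proj])

text \<open>No Halphen cubic passes through a vertex of its own type, and all of them pass through
  the vertices of the three other types.\<close>

lemma vertex_multiplicity:
  assumes m: "m \<ge> 1"
  shows "multiplicity_at (halphen_union \<epsilon> m) (vx s u) = 3 * (3 * m^2 - 1)"
proof -
  let ?v = "vertex_coords \<epsilon> s u"
  have "cm t f ?v = 0 \<longleftrightarrow> t \<noteq> s" if "f \<in> SF m" for t f
    using cm_own_vertex[OF that, of s u] cm_off_vertex[of t s f u] by (cases "t = s") simp_all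
  then have "{i \<in> UNIV \<times> SF m. cm (fst i) (snd i) ?v = 0} = (UNIV - {s}) \<times> SF m" by auto
  then show ?thesis
    using multiplicity_union(1)[OF m vx_proj_space self_in_proj, of s u] card_SF(2)[OF m] card_other_types[of s]
    by (simp add: card_cartesian_product)
qed

lemma exceptional_vertexI:
  "d \<notin> vec.span {vertex_coords \<epsilon> s u} \<Longrightarrow> vec.span {vertex_coords \<epsilon> s u, d} \<in> exceptional_curve (vx s u)"
  unfolding exceptional_curve_def
  by (intro CollectI exI[of _ "vertex_coords \<epsilon> s u"] exI[of _ d] conjI refl self_in_proj)

text \<open>In each of the three other pencils exactly one member is tangent to the given direction.
  By \<open>tors_D\<close> these members are torsion members all together or not at all, hence the
  multiplicity is 3 or 0.\<close>

lemma inf_near_vertex: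
  assumes m: "m \<ge> 1" and d: "d \<notin> vec.span {vertex_coords \<epsilon> s u}" and t0: "t0 \<noteq> s"
  shows "inf_near_multiplicity (halphen_union \<epsilon> m) (vx s u) (vec.span {vertex_coords \<epsilon> s u, d}) =
    (if tors m (D0 t0 (vertex_coords \<epsilon> s u) d) (D1 t0 (vertex_coords \<epsilon> s u) d) (D2 t0 (vertex_coords \<epsilon> s u) d) then 3 else 0)"
proof -
  let ?v = "vertex_coords \<epsilon> s u"
  let ?tors = "\<lambda>t. tors m (D0 t ?v d) (D1 t ?v d) (D2 t ?v d)"
  have l: "vec.span {?v, d} \<in> exceptional_curve (vx s u)" by (rule exceptional_vertexI[OF d])
  have c: "card {f \<in> SF m. cm t f ?v = 0 \<and> Dcm t f ?v d = 0} = (if t = s then 0 else if ?tors t0 then 1 else 0)" for t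
  proof (cases "t = s")
    case True
    have "cm t f ?v \<noteq> 0" if "f \<in> SF m" for f unfolding True by (rule cm_own_vertex[OF that])
    then have e: "{f \<in> SF m. cm t f ?v = 0 \<and> Dcm t f ?v d = 0} = {}" by blast
    show ?thesis unfolding e using True by simp
  next
    case False
    have "D0 t ?v d \<noteq> 0 \<or> D1 t ?v d \<noteq> 0"
    proof (rule ccontr)
      assume "\<not> ?thesis"
      then have z: "D0 t ?v d = 0" "D1 t ?v d = 0" by simp_all
      obtain k where "d = k *s ?v" using D_nondegenerate[OF False z] by (rule exE)
      then have "d \<in> vec.span {?v}" unfolding vec.span_singleton by (rule range_eqI)
      with d show False by (rule notE)
    qed
    note r = card_ratio[OF this D_sum, of m]
    have e: "{f \<in> SF m. cm t f ?v = 0 \<and> Dcm t f ?v d = 0} = {f \<in> SF m. D1 t ?v d - f * D0 t ?v d = 0}"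
      by (simp only: cm_off_vertex[OF False] Dcm_def simp_thms)
    show ?thesis unfolding e r tors_D[OF False t0] using False by simp
  qed
  have "inf_near_multiplicity (halphen_union \<epsilon> m) (vx s u) (vec.span {?v, d}) = (\<Sum>t\<in>UNIV. if t = s then 0 else if ?tors t0 then 1 else 0)"
    unfolding multiplicity_union(2)[OF m vx_proj_space self_in_proj l refl]
      card_product_filter[OF card_SF(1)[OF m], of "\<lambda>t f. cm t f ?v = 0 \<and> Dcm t f ?v d = 0"] c ..
  also have "\<dots> = (if ?tors t0 then 3 else 0)" by (cases s) (simp_all add: UNIV_vertex_type)
  finally show ?thesis .
qed

lemma exceptional_curve_vertex:
  assumes "l \<in> exceptional_curve (vx s u)"
  obtains d where "l = vec.span {vertex_coords \<epsilon> s u, d}" "d \<notin> vec.span {vertex_coords \<epsilon> s u}"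
proof -
  obtain w d where w: "w \<in> vx s u" "l = vec.span {w, d}" "d \<notin> vec.span {w}"
    using assms unfolding exceptional_curve_def by (elim CollectE exE conjE, intro that)
  obtain c where c: "c \<noteq> 0" "w = c *s vertex_coords \<epsilon> s u" using w(1) unfolding proj_def by blast
  have "d \<notin> vec.span {vertex_coords \<epsilon> s u}"
  proof
    assume "d \<in> vec.span {vertex_coords \<epsilon> s u}"
    then obtain k where "d = k *s vertex_coords \<epsilon> s u" unfolding vec.span_singleton by (rule rangeE)
    then have "d = (k / c) *s w" using c by simp
    then have "d \<in> vec.span {w}" unfolding vec.span_singleton by (rule range_eqI)
    with w(3) show False by (rule notE)
  qed
  moreover have "l = vec.span {vertex_coords \<epsilon> s u, d}" unfolding w(2) c(2) by (rule span_scale[OF c(1)])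
  ultimately show thesis by (intro that)
qed

lemma span_replace:
  fixes v d d' :: "complex^3" assumes "b \<noteq> 0" "d = a *s v + b *s d'" shows "vec.span {v, d} = vec.span {v, d'}"
  unfolding span2
proof (intro equalityI subsetI, goal_cases)
  case (1 x)
  then obtain p q where "x = p *s v + q *s d" by blast
  then have "x = (p + q * a) *s v + (q * b) *s d'"
    unfolding assms(2) by (simp only:) (simp add: vec3_eq_iff algebra_simps)
  then show ?case by blast
next
  case (2 x)
  then obtain p q where "x = p *s v + q *s d'" by blast
  then have "x = (p - q * a / b) *s v + (q / b) *s d"
    unfolding assms(2) using assms(1) by (simp only:) (simp add: vec3_eq_iff field_simps)
  then show ?case by blast
qed

text \<open>The ratio D1/D0 is a coordinate on the exceptional curve, and the triple points are its
  values in \<open>SF m\<close>.\<close>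

lemma triple_directions:
  assumes m: "m \<ge> 1"
    and DD: "DD = {l \<in> exceptional_curve (vx s u). inf_near_multiplicity (halphen_union \<epsilon> m) (vx s u) l = 3}"
  shows "finite DD" "card DD = 3 * m^2 - 1"
proof -
  let ?v = "vertex_coords \<epsilon> s u"
  obtain t where t: "t \<noteq> s" by (metis vertex_type.distinct(1))
  note nz = co_other_nz[OF t[symmetric], of u]
  \<comment> \<open>The vectors d0 and d1 are dual to the functionals D0 and D1, so e f below is a
    direction with coordinate f.\<close>
  define d0 where "d0 = ci t (vector [0, 1 / (co t ?v $ 2)^2, 0])"
  define d1 where "d1 = ci t (vector [- 1 / (co t ?v $ 1)^2, 0, 0])"
  have D: "D0 t ?v d0 = 1" "D1 t ?v d0 = 0" "D0 t ?v d1 = 0" "D1 t ?v d1 = 1"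
    using nz by (simp_all add: d0_def d1_def D0_def D1_def co_ci)
  have Dv: "D0 t ?v ?v = 0" "D1 t ?v ?v = 0"
    unfolding D_self using T_vertex_off[OF t[symmetric] self_in_proj, of u] by simp_all
  define e where "e f = d0 + f *s d1" for f
  have De: "D0 t ?v (e f) = 1" "D1 t ?v (e f) = f" for f
    using D_linear(1)[of t ?v 1 d0 f d1] D_linear(2)[of t ?v 1 d0 f d1] by (simp_all add: e_def D)
  have e_out: "e f \<notin> vec.span {?v}" for f
  proof
    assume "e f \<in> vec.span {?v}"
    then obtain k where "e f = k *s ?v" unfolding vec.span_singleton by (rule rangeE)
    then have "e f = k *s ?v + 0 *s ?v" by simp
    then have "D0 t ?v (e f) = 0" by (simp only: D_linear Dv) simp
    then show False using De(1)[of f] by simp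
  qed
  have "DD = (\<lambda>f. vec.span {?v, e f}) ` SF m"
  proof (intro equalityI subsetI)
    fix l assume "l \<in> DD"
    then have l: "l \<in> exceptional_curve (vx s u)" "inf_near_multiplicity (halphen_union \<epsilon> m) (vx s u) l = 3" by (auto simp: DD)
    obtain d where d: "l = vec.span {?v, d}" "d \<notin> vec.span {?v}" by (rule exceptional_curve_vertex[OF l(1)])
    have "tors m (D0 t ?v d) (D1 t ?v d) (D2 t ?v d)"
      using inf_near_vertex[OF m d(2) t] l(2) unfolding d(1) by (simp split: if_splits)
    then have a: "D0 t ?v d \<noteq> 0" "D1 t ?v d / D0 t ?v d \<in> SF m" by (auto simp: tors_def)
    define a where "a = D0 t ?v d"
    define f where "f = D1 t ?v d / a"
    \<comment> \<open>This combination is killed by D0 and D1, hence is a multiple of v; so d and e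
      f span the same line with v.\<close>
    let ?w = "1 *s d + (- a) *s e f"
    have z: "D0 t ?v ?w = 0" "D1 t ?v ?w = 0" unfolding D_linear De using a(1) by (simp_all add: a_def f_def)
    obtain k where "?w = k *s ?v" using D_nondegenerate[OF t z] by (rule exE)
    then have "d = k *s ?v + a *s e f" by (simp add: vec3_eq_iff algebra_simps)
    from span_replace[OF _ this] have "l = vec.span {?v, e f}" using a(1) d(1) by (simp add: a_def)
    then show "l \<in> (\<lambda>f. vec.span {?v, e f}) ` SF m" using a(2) by (auto simp: f_def a_def)
  next
    fix l assume "l \<in> (\<lambda>f. vec.span {?v, e f}) ` SF m"
    then obtain f where f: "f \<in> SF m" "l = vec.span {?v, e f}" by blast
    have "l \<in> exceptional_curve (vx s u)" unfolding f(2) by (rule exceptional_vertexI[OF e_out])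
    moreover have "tors m (D0 t ?v (e f)) (D1 t ?v (e f)) (D2 t ?v (e f))"
      unfolding tors_def using D_sum[of t ?v "e f"] f(1) by (simp add: De)
    then have "inf_near_multiplicity (halphen_union \<epsilon> m) (vx s u) l = 3"
      unfolding f(2) using inf_near_vertex[OF m e_out t] by simp
    ultimately show "l \<in> DD" by (simp add: DD)
  qed
  moreover have "inj_on (\<lambda>f. vec.span {?v, e f}) (SF m)"
  proof (rule inj_onI)
    fix f g assume eq: "vec.span {?v, e f} = vec.span {?v, e g}"
    have "e g \<in> vec.span {?v, e g}" by (simp add: vec.span_base)
    then have "e g \<in> vec.span {?v, e f}" by (simp only: eq)
    then obtain a b where e: "e g = a *s ?v + b *s e f" unfolding span2 by blast
    have "D0 t ?v (e g) = b" "D1 t ?v (e g) = b * f" unfolding e D_linear Dv De by simp_all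
    then show "f = g" by (simp add: De)
  qed
  ultimately show "finite DD" "card DD = 3 * m^2 - 1" using card_SF[OF m] by (simp_all add: card_image)
qed

lemma in_proj_eq: "v \<in> proj w \<Longrightarrow> proj v = proj w" for v w :: "complex^'n"
proof -
  assume "v \<in> proj w"
  then obtain c where "c \<noteq> 0" "v = c *s w" unfolding proj_def by blast
  then have "proj w = proj v" unfolding proj_eq_iff by blast
  then show ?thesis by simp
qed

text \<open>The equations say that the three adapted coordinates have equal cubes, so their ratios
  are cube roots of unity and the point is one of the nine.\<close>

lemma base_point_vertex:
  assumes z: "T0 t v = 0" "T1 t v = 0" and v: "v \<noteq> 0" obtains t' u where "t' \<noteq> t" "v \<in> vx t' u"
proof -
  let ?X = "co t v $ 1" and ?Y = "co t v $ 2" and ?Z = "co t v $ 3"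
  have c: "?Y^3 = ?X^3" "?Z^3 = ?X^3" using z by (simp_all add: T0_def T1_def)
  have X: "?X \<noteq> 0"
  proof
    assume X0: "?X = 0"
    then have "?Y^3 = 0" "?Z^3 = 0" using c by simp_all
    then have "co t v = co t 0" using X0 by (simp add: co_0 vec3_eq_iff)
    then show False using v unfolding co_eq_iff by simp
  qed
  have "(?Y / ?X)^3 = 1" "(?Z / ?X)^3 = 1" using c X by (simp_all add: power_divide)
  then obtain p where p: "p \<in> vertices_off \<epsilon> t" "ci t (vector [1, ?Y / ?X, ?Z / ?X]) \<in> p" by (rule nine_points)
  obtain t' u where t: "p = vx t' u" "t' \<noteq> t" using p(1) unfolding vertices_off_eq by blast
  obtain c where c: "c \<noteq> 0" "ci t (vector [1, ?Y / ?X, ?Z / ?X]) = c *s vertex_coords \<epsilon> t' u"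
    using p(2) unfolding t(1) proj_def by blast
  have "co t v = ?X *s vector [1, ?Y / ?X, ?Z / ?X]" using X by (simp add: vec3_eq_iff)
  then have "ci t (co t v) = ci t (?X *s vector [1, ?Y / ?X, ?Z / ?X])" by (rule arg_cong)
  then have "v = ?X *s ci t (vector [1, ?Y / ?X, ?Z / ?X])" unfolding ci_co ci_scale .
  then have "v = (?X * c) *s vertex_coords \<epsilon> t' u" unfolding c(2) by simp
  then have "v \<in> vx t' u" unfolding proj_def using X c(1) by (intro CollectI exI[of _ "?X * c"]) simp
  with t(2) show thesis by (rule that)
qed

text \<open>Away from the base points each pencil has exactly one member through the point, so each
  type contributes at most 1.\<close>

lemma nonvertex_multiplicity:
  assumes m: "m \<ge> 1" and p: "p \<in> proj_space" "p \<notin> vertices \<epsilon>" and v: "v \<in> p"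
  shows "multiplicity_at (halphen_union \<epsilon> m) p = card {t. tors m (T0 t v) (T1 t v) (T2 t v)}"
proof -
  obtain w where w: "p = proj w" using p(1) by (auto simp: proj_space_def)
  have vp: "p = proj v" using in_proj_eq[of v w] v w by simp
  have "card {f \<in> SF m. cm t f v = 0} = (if tors m (T0 t v) (T1 t v) (T2 t v) then 1 else 0)" for t
  proof -
    have "T0 t v \<noteq> 0 \<or> T1 t v \<noteq> 0"
    proof (rule ccontr)
      assume "\<not> ?thesis"
      then have z: "T0 t v = 0" "T1 t v = 0" by auto
      obtain t' u where "v \<in> vx t' u" by (rule base_point_vertex[OF z proj_space_nonzero[OF p(1) v]])
      then have "p = vx t' u" unfolding vp by (rule in_proj_eq)
      then show False using p(2) unfolding vertices_def by blast
    qed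
    from card_ratio[OF this T_sum, of m] show ?thesis by (simp add: cm_def)
  qed
  then have "multiplicity_at (halphen_union \<epsilon> m) p = (\<Sum>t\<in>UNIV. if tors m (T0 t v) (T1 t v) (T2 t v) then 1 else 0)"
    unfolding multiplicity_union(1)[OF m p(1) v] card_product_filter[OF card_SF(1)[OF m], of "\<lambda>t f. cm t f v = 0"] by simp
  also have "\<dots> = card {t. tors m (T0 t v) (T1 t v) (T2 t v)}" by (subst card_filter_sum) simp_all
  finally show ?thesis .
qed

end

section \<open>Collinear parameters of the four pencils\<close>

context cube_root begin

definition rv :: "complex \<Rightarrow> complex \<Rightarrow> complex \<Rightarrow> complex^3" where
  "rv x y z = vector [y^3 - z^3, z^3 - x^3, x^3 - y^3]"

text \<open>A vector with coordinate sum 0 in Fourier form: A and -B are its coefficients at the two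
  nontrivial characters. The product of its entries is A^3 - B^3.\<close>

definition hv :: "complex \<Rightarrow> complex \<Rightarrow> complex^3" where
  "hv A B = vector [A - B, \<epsilon>^2 * A - \<epsilon> * B, \<epsilon> * A - \<epsilon>^2 * B]"

definition ha :: "complex \<Rightarrow> complex \<Rightarrow> complex \<Rightarrow> complex" where "ha x y z = x * y^2 + y * z^2 + z * x^2"
definition hb :: "complex \<Rightarrow> complex \<Rightarrow> complex \<Rightarrow> complex" where "hb x y z = x^2 * y + y^2 * z + z^2 * x"

text \<open>The triple \<open>T0\<close>, \<open>T1\<close>, \<open>T2\<close> with (1 -
  \<epsilon>)^3 divided out. For type h the cubes of the Fourier coordinates share the part x^3 +
  y^3 + z^3 + 6xyz, so their differences involve only the cyclic sums \<open>ha\<close> and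
  \<open>hb\<close>. Types \<delta> and \<gamma> arise by scaling the first coordinate.\<close>

fun R :: "vertex_type \<Rightarrow> complex^3 \<Rightarrow> complex^3" where
  "R V_type v = rv (v $ 1) (v $ 2) (v $ 3)"
| "R H_type v = hv (ha (v $ 1) (v $ 2) (v $ 3)) (hb (v $ 1) (v $ 2) (v $ 3))"
| "R D_type v = hv (ha (\<epsilon>^2 * v $ 1) (v $ 2) (v $ 3)) (hb (\<epsilon>^2 * v $ 1) (v $ 2) (v $ 3))"
| "R G_type v = hv (ha (\<epsilon> * v $ 1) (v $ 2) (v $ 3)) (hb (\<epsilon> * v $ 1) (v $ 2) (v $ 3))"

lemma hv_nth: "hv A B $ 1 = A - B" "hv A B $ 2 = \<epsilon>^2 * A - \<epsilon> * B" "hv A B $ 3 = \<epsilon> * A - \<epsilon>^2 * B"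
  by (simp_all add: hv_def)

lemma rv_nth: "rv x y z $ 1 = y^3 - z^3" "rv x y z $ 2 = z^3 - x^3" "rv x y z $ 3 = x^3 - y^3"
  by (simp_all add: rv_def)

lemma T_H: "T0 H_type (vector [x, y, z]) = (1 - \<epsilon>)^3 * hv (ha x y z) (hb x y z) $ 1"
  "T1 H_type (vector [x, y, z]) = (1 - \<epsilon>)^3 * hv (ha x y z) (hb x y z) $ 2"
  "T2 H_type (vector [x, y, z]) = (1 - \<epsilon>)^3 * hv (ha x y z) (hb x y z) $ 3"
  unfolding T0_def T1_def T2_def co.simps dft_def vector_3 hv_nth ha_def hb_def
  using eps2 by algebra+

lemma T_V: "T0 V_type v = (1 - \<epsilon>)^3 * R V_type v $ 1" "T1 V_type v = (1 - \<epsilon>)^3 * R V_type v $ 2"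
  "T2 V_type v = (1 - \<epsilon>)^3 * R V_type v $ 3"
  unfolding T0_def T1_def T2_def co.simps R.simps rv_nth vector_smult_component by algebra+

lemma T_R: "T0 t v = (1 - \<epsilon>)^3 * R t v $ 1" "T1 t v = (1 - \<epsilon>)^3 * R t v $ 2" "T2 t v = (1 - \<epsilon>)^3 * R t v $ 3"
proof -
  have v: "vector [v $ 1, v $ 2, v $ 3] = v" by (simp add: vec3_eq_iff)
  have D: "T0 D_type v = T0 H_type (vector [\<epsilon>^2 * v $ 1, v $ 2, v $ 3])" "T1 D_type v = T1 H_type (vector [\<epsilon>^2 * v $ 1, v $ 2, v $ 3])"
    "T2 D_type v = T2 H_type (vector [\<epsilon>^2 * v $ 1, v $ 2, v $ 3])"
    "T0 G_type v = T0 H_type (vector [\<epsilon> * v $ 1, v $ 2, v $ 3])" "T1 G_type v = T1 H_type (vector [\<epsilon> * v $ 1, v $ 2, v $ 3])"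
    "T2 G_type v = T2 H_type (vector [\<epsilon> * v $ 1, v $ 2, v $ 3])"
    by (simp_all add: T0_def T1_def T2_def)
  note H = T_H[of "v $ 1" "v $ 2" "v $ 3", unfolded v]
  show "T0 t v = (1 - \<epsilon>)^3 * R t v $ 1" by (cases t) (simp_all only: T_V H D T_H R.simps)
  show "T1 t v = (1 - \<epsilon>)^3 * R t v $ 2" by (cases t) (simp_all only: T_V H D T_H R.simps)
  show "T2 t v = (1 - \<epsilon>)^3 * R t v $ 3" by (cases t) (simp_all only: T_V H D T_H R.simps)
qed

text \<open>An affine model of the curve: sum 0 and product 1 correspond to f = b/a and g = -1/a. In
  this model permuting the coordinates is a symmetry, and \<open>X m\<close> consists of its torsion
  points off the branch fibres.\<close>

definition nrm :: "complex^3 \<Rightarrow> bool" where "nrm w \<longleftrightarrow> w $ 1 + w $ 2 + w $ 3 = 0 \<and> w $ 1 * w $ 2 * w $ 3 = 1"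
definition tv :: "nat \<Rightarrow> complex^3 \<Rightarrow> bool" where "tv m w \<longleftrightarrow> tors m (w $ 1) (w $ 2) (w $ 3)"
definition X :: "nat \<Rightarrow> (complex^3) set" where "X m = {w. tv m w \<and> w $ 1 * w $ 2 * w $ 3 = 1}"

lemma X_nrm: "w \<in> X m \<Longrightarrow> nrm w" by (simp add: X_def tv_def nrm_def tors_def)

lemma X_iff: "nrm w \<Longrightarrow> w \<in> X m \<longleftrightarrow> tv m w" by (simp add: X_def nrm_def)

lemma tv_T: "tors m (T0 t v) (T1 t v) (T2 t v) \<longleftrightarrow> tv m (R t v)"
  unfolding T_R tv_def by (rule tors_scale) (use eps1 in simp)

lemma R_sum: "R t v $ 1 + R t v $ 2 + R t v $ 3 = 0"
proof -
  have "hv A B $ 1 + hv A B $ 2 + hv A B $ 3 = 0" for A B unfolding hv_nth using eps2 by algebra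
  then show ?thesis by (cases t) (simp_all add: rv_nth)
qed

lemma hv_prod: "hv A B $ 1 * hv A B $ 2 * hv A B $ 3 = A^3 - B^3" unfolding hv_nth using eps2 by algebra

lemma hab: "ha x y z^3 - hb x y z^3 = (y^3 - z^3) * (z^3 - x^3) * (x^3 - y^3)" unfolding ha_def hb_def by algebra

text \<open>The three singular members of any pencil together make up the nine lines, so all four
  products are one form. This permits normalising the four triples simultaneously.\<close>

lemma R_prod: "R t v $ 1 * R t v $ 2 * R t v $ 3 = R V_type v $ 1 * R V_type v $ 2 * R V_type v $ 3"
proof -
  have "(\<epsilon>^2 * x)^3 = x^3" "(\<epsilon> * x)^3 = x^3" for x using eps3 by algebra+
  then show ?thesis by (cases t) (simp_all only: R.simps hv_prod hab rv_nth)
qed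

lemma R_scale: "R t (c *s v) = c^3 *s R t v"
proof -
  have h: "ha (c * x) (c * y) (c * z) = c^3 * ha x y z" "hb (c * x) (c * y) (c * z) = c^3 * hb x y z" for x y z
    unfolding ha_def hb_def by algebra+
  have hs: "hv (k * A) (k * B) = k *s hv A B" for k A B by (simp add: vec3_eq_iff hv_nth algebra_simps)
  have c: "k * (c * x) = c * (k * x)" for k x :: complex by simp
  have "rv (c * x) (c * y) (c * z) = c^3 *s rv x y z" for x y z
    by (simp add: vec3_eq_iff rv_nth power_mult_distrib right_diff_distrib)
  then show ?thesis by (cases t) (simp_all only: R.simps vector_smult_component c h hs)
qed

lemma tv_scale: "c \<noteq> 0 \<Longrightarrow> tv m (R t (c *s v)) \<longleftrightarrow> tv m (R t v)"
  unfolding R_scale tv_def vector_smult_component by (rule tors_scale) simp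

text \<open>The symmetries of the curve: permuting the coordinates and multiplying by a cube root of
  unity.\<close>

definition prm :: "3 \<Rightarrow> 3 \<Rightarrow> 3 \<Rightarrow> complex \<Rightarrow> complex^3 \<Rightarrow> complex^3" where
  "prm i j k c w = vector [c * w $ i, c * w $ j, c * w $ k]"

lemma prm_nth: "prm i j k c w $ 1 = c * w $ i" "prm i j k c w $ 2 = c * w $ j" "prm i j k c w $ 3 = c * w $ k"
  by (simp_all add: prm_def)

lemma prm_closed:
  assumes c: "c^3 = 1"
  shows "tv m (prm 1 2 3 c w) = tv m w" "tv m (prm 2 3 1 c w) = tv m w" "tv m (prm 3 1 2 c w) = tv m w"
    "tv m (prm 1 3 2 c w) = tv m w" "tv m (prm 2 1 3 c w) = tv m w" "tv m (prm 3 2 1 c w) = tv m w"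
    "nrm w \<Longrightarrow> nrm (prm 1 2 3 c w)" "nrm w \<Longrightarrow> nrm (prm 2 3 1 c w)" "nrm w \<Longrightarrow> nrm (prm 3 1 2 c w)"
    "nrm w \<Longrightarrow> nrm (prm 1 3 2 c w)" "nrm w \<Longrightarrow> nrm (prm 2 1 3 c w)" "nrm w \<Longrightarrow> nrm (prm 3 2 1 c w)"
proof -
  have c0: "c \<noteq> 0" using c by auto
  have rot: "tors m b c a \<longleftrightarrow> tors m a b c" "tors m c a b \<longleftrightarrow> tors m a b c" "tors m c b a \<longleftrightarrow> tors m a b c"
    "tors m b a c \<longleftrightarrow> tors m a b c" "tors m a c b \<longleftrightarrow> tors m a b c" for a b c
    using tors_swap tors_swap' by metis+
  show "tv m (prm 1 2 3 c w) = tv m w" "tv m (prm 2 3 1 c w) = tv m w" "tv m (prm 3 1 2 c w) = tv m w"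
    "tv m (prm 1 3 2 c w) = tv m w" "tv m (prm 2 1 3 c w) = tv m w" "tv m (prm 3 2 1 c w) = tv m w"
    unfolding tv_def prm_nth tors_scale[OF c0] by (rule refl rot)+
  have s: "c * p + c * q + c * r = 0 \<and> c * p * (c * q) * (c * r) = 1" if "p + q + r = 0 \<and> p * q * r = 1" for p q r
    using that c by algebra
  show "nrm w \<Longrightarrow> nrm (prm 1 2 3 c w)" "nrm w \<Longrightarrow> nrm (prm 2 3 1 c w)" "nrm w \<Longrightarrow> nrm (prm 3 1 2 c w)"
    "nrm w \<Longrightarrow> nrm (prm 1 3 2 c w)" "nrm w \<Longrightarrow> nrm (prm 2 1 3 c w)" "nrm w \<Longrightarrow> nrm (prm 3 2 1 c w)"
    unfolding nrm_def prm_nth by (rule s; simp add: algebra_simps)+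
qed

text \<open>The third coordinate is determined by sum 0, so the determinant of the first two
  suffices.\<close>

definition col :: "complex^3 \<Rightarrow> complex^3 \<Rightarrow> complex^3 \<Rightarrow> bool" where
  "col p q r \<longleftrightarrow> (p $ 1 - r $ 1) * (q $ 2 - r $ 2) = (q $ 1 - r $ 1) * (p $ 2 - r $ 2)"

lemma col_sym: "col p q r \<Longrightarrow> col p r q" "col p q r \<Longrightarrow> col q r p"
  unfolding col_def by algebra+

lemma nrm_eqI: "nrm p \<Longrightarrow> nrm q \<Longrightarrow> p $ 1 = q $ 1 \<Longrightarrow> p $ 2 = q $ 2 \<Longrightarrow> p = q"
  unfolding nrm_def vec3_eq_iff by (metis add_left_cancel)

lemma nrm_nz: "nrm w \<Longrightarrow> w $ 1 \<noteq> 0 \<and> w $ 2 \<noteq> 0 \<and> w $ 3 \<noteq> 0" by (auto simp: nrm_def)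

lemma nrm_EE:
  assumes "nrm w" shows "w \<in> X m \<longleftrightarrow> (w $ 2 / w $ 1, - 1 / w $ 1) \<in> EE m"
    and "(- 1 / w $ 1)^3 = (w $ 2 / w $ 1)^2 + w $ 2 / w $ 1"
proof -
  have n: "w $ 1 \<noteq> 0" "w $ 1 + w $ 2 + w $ 3 = 0" "w $ 1 * w $ 2 * w $ 3 = 1" using assms nrm_nz by (auto simp: nrm_def)
  define f where "f = w $ 2 / w $ 1" define g where "g = - 1 / w $ 1"
  have "f * w $ 1 = w $ 2" "g * w $ 1 = - 1" using n by (simp_all add: f_def g_def)
  then have w: "w $ 2 = f * w $ 1" "g * w $ 1 = - 1" by simp_all
  have w3: "w $ 3 = - w $ 1 - f * w $ 1" using n(2) w(1) by algebra
  have a: "- (w $ 1 ^ 3) * (f^2 + f) = 1" using n(3) unfolding w3 w(1) by algebra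
  have b: "g^3 * w $ 1 ^ 3 = - 1" using w(2) by (simp flip: power_mult_distrib)
  have "g^3 = g^3 * (- (w $ 1 ^ 3) * (f^2 + f))" unfolding a by simp
  also have "\<dots> = - (g^3 * w $ 1 ^ 3) * (f^2 + f)" by algebra
  finally have "g^3 = f^2 + f" unfolding b by simp
  then show e: "(- 1 / w $ 1)^3 = (w $ 2 / w $ 1)^2 + w $ 2 / w $ 1" by (simp add: f_def g_def)
  show "w \<in> X m \<longleftrightarrow> (w $ 2 / w $ 1, - 1 / w $ 1) \<in> EE m"
    unfolding X_iff[OF assms] EE_iff tv_def tors_def using e n by simp
qed

text \<open>The passage from (a, b) to (b/a, -1/a) is a projective map of the plane, so it preserves
  collinearity and \<open>SF_collinear\<close> applies.\<close>

lemma third_point: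
  assumes p: "p \<in> X m" and q: "q \<in> X m" and r: "nrm r" and ne: "p \<noteq> q" and c: "col p q r" shows "r \<in> X m"
proof -
  note np = X_nrm[OF p] and nq = X_nrm[OF q]
  define f1 g1 where "f1 = p $ 2 / p $ 1" and "g1 = - 1 / p $ 1"
  define f2 g2 where "f2 = q $ 2 / q $ 1" and "g2 = - 1 / q $ 1"
  define f3 g3 where "f3 = r $ 2 / r $ 1" and "g3 = - 1 / r $ 1"
  note defs = f1_def f2_def f3_def g1_def g2_def g3_def
  have nz: "p $ 1 \<noteq> 0" "q $ 1 \<noteq> 0" "r $ 1 \<noteq> 0" using nrm_nz np nq r by auto
  have E: "f1 * p $ 1 = p $ 2" "g1 * p $ 1 = - 1" "f2 * q $ 1 = q $ 2" "g2 * q $ 1 = - 1" "f3 * r $ 1 = r $ 2" "g3 * r $ 1 = - 1"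
    using nz by (simp_all add: defs)
  have 1: "(f1, g1) \<in> EE m" "(f2, g2) \<in> EE m" using nrm_EE(1)[OF np] nrm_EE(1)[OF nq] p q by (simp_all add: defs)
  have 2: "(f1, g1) \<noteq> (f2, g2)"
  proof
    assume "(f1, g1) = (f2, g2)"
    then have fg: "f1 = f2" "g1 = g2" by auto
    then have "p $ 1 = q $ 1" using nz by (simp add: defs)
    moreover from this have "p $ 2 = q $ 2" using E fg by metis
    ultimately show False using nrm_eqI[OF np nq] ne by blast
  qed
  \<comment> \<open>The two collinearity determinants agree up to the product of the first
    coordinates.\<close>
  have "(p $ 1 * q $ 1 * r $ 1) * ((f1 - f3) * (g2 - g3) - (f2 - f3) * (g1 - g3)) =
    (f1 * p $ 1) * (g2 * q $ 1) * r $ 1 - (f1 * p $ 1) * (g3 * r $ 1) * q $ 1 - (f3 * r $ 1) * (g2 * q $ 1) * p $ 1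
    - (f2 * q $ 1) * (g1 * p $ 1) * r $ 1 + (f2 * q $ 1) * (g3 * r $ 1) * p $ 1 + (f3 * r $ 1) * (g1 * p $ 1) * q $ 1"
    by algebra
  also have "\<dots> = 0" unfolding E using c[unfolded col_def] by algebra
  finally have "(p $ 1 * q $ 1 * r $ 1) * ((f1 - f3) * (g2 - g3) - (f2 - f3) * (g1 - g3)) = 0" .
  then have 3: "(f1 - f3) * (g2 - g3) = (f2 - f3) * (g1 - g3)" using nz by simp
  have 4: "f3^2 + f3 = g3^3" using nrm_EE(2)[OF r] by (simp add: defs)
  have 5: "g3 \<noteq> 0" using nz by (simp add: defs)
  have "f3 \<in> SF m" by (rule SF_collinear[OF 1 2 4 5 3])
  then have "(f3, g3) \<in> EE m" using 4 by (simp add: EE_iff)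
  then show ?thesis using nrm_EE(1)[OF r] by (simp add: defs)
qed

text \<open>If p = q, the chord is undefined, and the second relation with p', q', r' is used
  instead; its third point is equivalent to the first one for torsion.\<close>

lemma third_point_pair:
  assumes "tv m p" "tv m q" "tv m p'" "tv m q'" "nrm p" "nrm q" "nrm r" "nrm p'" "nrm q'" "nrm r'"
    and "col p q r" "col p' q' r'" and "\<not> (p = q \<and> p' = q')" and "tv m r = tv m r'"
  shows "tv m r"
proof (cases "p = q")
  case False
  then have "r \<in> X m" using third_point[of p m q r] assms by (simp add: X_iff)
  then show ?thesis using assms by (simp add: X_iff)
next
  case True
  then have "r' \<in> X m" using third_point[of p' m q' r'] assms by (simp add: X_iff)
  then show ?thesis using assms by (simp add: X_iff)
qed

text \<open>Equal coordinates with sum 0 are all 0, against product 1. Every degenerate coincidence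
  below is excluded by this.\<close>

lemma nrm_not_const: "nrm w \<Longrightarrow> w $ 1 = w $ 2 \<Longrightarrow> w $ 2 = w $ 3 \<Longrightarrow> False"
proof -
  assume a: "nrm w" "w $ 1 = w $ 2" "w $ 2 = w $ 3"
  then have "3 * w $ 3 = 0" unfolding nrm_def by algebra
  then show False using nrm_nz[OF a(1)] by simp
qed

text \<open>For q and for r the two relations use different permutations of the coordinates. If a
  pair of points coincided in both relations, the coordinates of q or of r would all be
  equal.\<close>

lemma triple_rot:
  assumes c: "c^3 = 1" "c'^3 = 1" and n: "nrm p" "nrm q" "nrm r"
    and col: "col p (prm 1 2 3 c q) (prm 1 3 2 c' r)" "col p (prm 2 3 1 c q) (prm 2 1 3 c' r)"
  shows "tv m p \<Longrightarrow> tv m q \<Longrightarrow> tv m r" "tv m p \<Longrightarrow> tv m r \<Longrightarrow> tv m q" "tv m q \<Longrightarrow> tv m r \<Longrightarrow> tv m p"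
proof -
  let ?q = "prm 1 2 3 c q" and ?q' = "prm 2 3 1 c q" and ?r = "prm 1 3 2 c' r" and ?r' = "prm 2 1 3 c' r"
  have c0: "c \<noteq> 0" "c' \<noteq> 0" using c by auto
  note t = prm_closed(1,2,5)[OF c(1)] prm_closed(4,5)[OF c(2)]
  note N = prm_closed(7)[OF c(1) n(2)] prm_closed(8)[OF c(1) n(2)] prm_closed(10)[OF c(2) n(3)] prm_closed(11)[OF c(2) n(3)]
  have pq: "\<not> (p = ?q \<and> p = ?q')"
  proof
    assume a: "p = ?q \<and> p = ?q'"
    have e: "?q = ?q'" using a[THEN conjunct1, symmetric] a[THEN conjunct2] by (rule trans)
    have e1: "c * q $ 1 = c * q $ 2" using arg_cong[OF e, of "\<lambda>x. x $ 1"] by (simp only: prm_nth)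
    have e2: "c * q $ 2 = c * q $ 3" using arg_cong[OF e, of "\<lambda>x. x $ 2"] by (simp only: prm_nth)
    have "q $ 1 = q $ 2" using e1 c0 by simp
    moreover have "q $ 2 = q $ 3" using e2 c0 by simp
    ultimately show False by (rule nrm_not_const[OF n(2)])
  qed
  have pr: "\<not> (p = ?r \<and> p = ?r')"
  proof
    assume a: "p = ?r \<and> p = ?r'"
    have e: "?r = ?r'" using a[THEN conjunct1, symmetric] a[THEN conjunct2] by (rule trans)
    have e1: "c' * r $ 1 = c' * r $ 2" using arg_cong[OF e, of "\<lambda>x. x $ 1"] by (simp only: prm_nth)
    have e2: "c' * r $ 3 = c' * r $ 1" using arg_cong[OF e, of "\<lambda>x. x $ 2"] by (simp only: prm_nth)
    have r12: "r $ 1 = r $ 2" using e1 c0 by simp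
    have r31: "r $ 3 = r $ 1" using e2 c0 by simp
    show False by (rule nrm_not_const[OF n(3) r12 trans[OF r12[symmetric] r31[symmetric]]])
  qed
  have qr: "\<not> (?q = ?r \<and> ?q' = ?r')"
  proof
    assume a: "?q = ?r \<and> ?q' = ?r'"
    have e: "?q = ?r" "?q' = ?r'" using a by blast+
    have e2: "c * q $ 2 = c' * r $ 3" using arg_cong[OF e(1), of "\<lambda>x. x $ 2"] by (simp only: prm_nth)
    have e3: "c * q $ 3 = c' * r $ 2" using arg_cong[OF e(1), of "\<lambda>x. x $ 3"] by (simp only: prm_nth)
    have e4: "c * q $ 2 = c' * r $ 2" using arg_cong[OF e(2), of "\<lambda>x. x $ 1"] by (simp only: prm_nth)
    have e5: "c * q $ 3 = c' * r $ 1" using arg_cong[OF e(2), of "\<lambda>x. x $ 2"] by (simp only: prm_nth)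
    have r12: "r $ 1 = r $ 2" using trans[OF e5[symmetric] e3] c0 by simp
    have r23: "r $ 2 = r $ 3" using trans[OF e4[symmetric] e2] c0 by simp
    show False by (rule nrm_not_const[OF n(3) r12 r23])
  qed
  show "tv m r" if h: "tv m p" "tv m q"
  proof -
    have "tv m ?r"
      by (rule third_point_pair[of m p ?q p ?q' ?r ?r']) (simp_all only: h n N t col pq not_False_eq_True)
    then show ?thesis by (simp only: t)
  qed
  show "tv m q" if h: "tv m p" "tv m r"
  proof -
    have "tv m ?q"
      by (rule third_point_pair[of m p ?r p ?r' ?q ?q'])
        (simp_all only: h n N t col_sym(1)[OF col(1)] col_sym(1)[OF col(2)] pr not_False_eq_True)
    then show ?thesis by (simp only: t)
  qed
  show "tv m p" if h: "tv m q" "tv m r"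
    by (rule third_point_pair[of m ?q ?r ?q' ?r' p p])
      (simp_all only: h n N t col_sym(2)[OF col(1)] col_sym(2)[OF col(2)] qr not_False_eq_True)
qed

text \<open>A polynomial identity in the plane coordinates modulo \<epsilon>^2 = -1 - \<epsilon>; it
  holds before any normalisation.\<close>

lemma col_VHD: "col (R V_type v) (prm 1 2 3 (\<epsilon>^2) (R H_type v)) (prm 1 3 2 \<epsilon> (R D_type v))"
  "col (R V_type v) (prm 2 3 1 (\<epsilon>^2) (R H_type v)) (prm 2 1 3 \<epsilon> (R D_type v))"
  unfolding col_def prm_nth R.simps rv_nth hv_nth ha_def hb_def using eps2 by algebra+

lemma col_VGH: "col (R V_type v) (prm 1 2 3 (\<epsilon>^2) (R G_type v)) (prm 1 3 2 \<epsilon> (R H_type v))"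
  "col (R V_type v) (prm 2 3 1 (\<epsilon>^2) (R G_type v)) (prm 2 1 3 \<epsilon> (R H_type v))"
  unfolding col_def prm_nth R.simps rv_nth hv_nth ha_def hb_def using eps2 by algebra+

lemma col_VDG: "col (R V_type v) (prm 1 2 3 (\<epsilon>^2) (R D_type v)) (prm 1 3 2 \<epsilon> (R G_type v))"
  "col (R V_type v) (prm 2 3 1 (\<epsilon>^2) (R D_type v)) (prm 2 1 3 \<epsilon> (R G_type v))"
  unfolding col_def prm_nth R.simps rv_nth hv_nth ha_def hb_def using eps2 by algebra+

text \<open>The common product of the entries has degree 9 in the plane vector, so a ninth root
  scales it to 1 for all four types at once.\<close>

lemma normalise:
  assumes "tv m (R t v)" obtains c where "c \<noteq> 0" "\<forall>t. nrm (R t (c *s v))"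
proof -
  define P where "P = R V_type v $ 1 * R V_type v $ 2 * R V_type v $ 3"
  have "R t v $ 1 * R t v $ 2 * R t v $ 3 \<noteq> 0" using tors_nz[of m "R t v $ 1" "R t v $ 2" "R t v $ 3"] assms by (simp add: tv_def)
  then have P: "P \<noteq> 0" unfolding R_prod[of t] P_def .
  obtain c where c: "c^9 = 1 / P" using exists_complex_root[of 9 "1 / P"] by (metis zero_neq_numeral)
  have c0: "c \<noteq> 0" using c P by auto
  have "nrm (R s (c *s v))" for s
  proof -
    have e: "c^3 * x * (c^3 * y) * (c^3 * z) = c^9 * (x * y * z)" for x y z by algebra
    have "c^3 * R s v $ 1 * (c^3 * R s v $ 2) * (c^3 * R s v $ 3) = 1"
      unfolding e R_prod[of s] P_def[symmetric] c using P by simp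
    then show ?thesis unfolding nrm_def using R_sum[of s "c *s v"] by (simp add: R_scale)
  qed
  with c0 show thesis by (intro that allI)
qed

text \<open>The three triples containing v cover every pair of types, so any two types generate the
  other two.\<close>

lemma four_types:
  fixes P :: "vertex_type \<Rightarrow> bool"
  assumes h: "P V_type \<and> P H_type \<longrightarrow> P D_type" "P V_type \<and> P D_type \<longrightarrow> P H_type" "P H_type \<and> P D_type \<longrightarrow> P V_type"
    "P V_type \<and> P G_type \<longrightarrow> P H_type" "P V_type \<and> P H_type \<longrightarrow> P G_type" "P G_type \<and> P H_type \<longrightarrow> P V_type"
    "P V_type \<and> P D_type \<longrightarrow> P G_type" "P V_type \<and> P G_type \<longrightarrow> P D_type" "P D_type \<and> P G_type \<longrightarrow> P V_type"
    and t: "t1 \<noteq> t2" "P t1" "P t2"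
  shows "P t"
proof -
  have "P V_type \<and> P H_type \<or> P V_type \<and> P D_type \<or> P V_type \<and> P G_type \<or> P H_type \<and> P D_type \<or> P H_type \<and> P G_type \<or> P D_type \<and> P G_type"
    using t by (cases t1; cases t2) simp_all
  then have "P V_type \<and> P H_type \<and> P D_type \<and> P G_type" using h by blast
  then show ?thesis by (cases t) simp_all
qed

lemma two_imply_all:
  assumes "t1 \<noteq> t2" "tv m (R t1 v)" "tv m (R t2 v)" shows "tv m (R t v)"
proof -
  obtain c where c0: "c \<noteq> 0" "\<forall>t. nrm (R t (c *s v))" by (rule normalise[OF assms(2)])
  define w where "w = c *s v"
  have n: "nrm (R t w)" for t unfolding w_def using c0(2) by (rule spec)
  have T: "tv m (R t w) = tv m (R t v)" for t unfolding w_def by (rule tv_scale[OF c0(1)])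
  have e: "(\<epsilon>^2)^3 = 1" using eps3 by algebra
  have VHD: "tv m (R V_type w) \<and> tv m (R H_type w) \<longrightarrow> tv m (R D_type w)" "tv m (R V_type w) \<and> tv m (R D_type w) \<longrightarrow> tv m (R H_type w)"
    "tv m (R H_type w) \<and> tv m (R D_type w) \<longrightarrow> tv m (R V_type w)"
    by (intro impI; elim conjE; erule (1) triple_rot[OF e eps3 n n n col_VHD])+
  have VGH: "tv m (R V_type w) \<and> tv m (R G_type w) \<longrightarrow> tv m (R H_type w)" "tv m (R V_type w) \<and> tv m (R H_type w) \<longrightarrow> tv m (R G_type w)"
    "tv m (R G_type w) \<and> tv m (R H_type w) \<longrightarrow> tv m (R V_type w)"
    by (intro impI; elim conjE; erule (1) triple_rot[OF e eps3 n n n col_VGH])+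
  have VDG: "tv m (R V_type w) \<and> tv m (R D_type w) \<longrightarrow> tv m (R G_type w)" "tv m (R V_type w) \<and> tv m (R G_type w) \<longrightarrow> tv m (R D_type w)"
    "tv m (R D_type w) \<and> tv m (R G_type w) \<longrightarrow> tv m (R V_type w)"
    by (intro impI; elim conjE; erule (1) triple_rot[OF e eps3 n n n col_VDG])+
  have "tv m (R t w)"
    by (rule four_types[of "\<lambda>t. tv m (R t w)" t1 t2, OF VHD VGH VDG assms(1)]) (simp_all only: T assms(2,3))
  then show ?thesis unfolding T .
qed

end

section \<open>Counting the quadruple points\<close>

context cube_root begin

lemma card_X:
  assumes m: "m \<ge> 1" shows "finite (X m)" "card (X m) = 9 * m^2 - 3"
proof -
  define p where "p = (\<lambda>(f, g). vector [- 1 / g, - f / g, (1 + f) / g] :: complex^3)"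
  have p: "p (f, g) $ 1 = - 1 / g" "p (f, g) $ 2 = - f / g" "p (f, g) $ 3 = (1 + f) / g" for f g by (simp_all add: p_def)
  have E: "g \<noteq> 0 \<and> nrm (p (f, g)) \<and> (p (f, g) $ 2 / p (f, g) $ 1, - 1 / p (f, g) $ 1) = (f, g)" if fg: "(f, g) \<in> EE m" for f g
  proof -
    have f: "f \<in> SF m" "g^3 = f^2 + f" using fg by (auto simp: EE_iff)
    have "f^2 + f = f * (f + 1)" by algebra
    then have "f^2 + f \<noteq> 0" using SF_nz[OF f(1)] by (auto simp: add_eq_0_iff2)
    then have g: "g \<noteq> 0" "f^2 + f \<noteq> 0" using f(2) by auto
    have "- 1 / g * (- f / g) * ((1 + f) / g) = (f^2 + f) / g^3"
      using g(1) by (simp add: field_simps power2_eq_square power3_eq_cube)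
    then have "- 1 / g * (- f / g) * ((1 + f) / g) = 1" using f(2) g by simp
    moreover have "- 1 / g + - f / g + (1 + f) / g = 0" using g(1) by (simp add: field_simps)
    ultimately have "nrm (p (f, g))" by (simp only: nrm_def p simp_thms)
    then show ?thesis using g(1) by (simp add: p)
  qed
  have im: "X m = p ` EE m"
  proof (intro equalityI subsetI)
    fix w assume w: "w \<in> X m"
    have n: "w $ 1 \<noteq> 0" "w $ 1 + w $ 2 + w $ 3 = 0" using nrm_nz[OF X_nrm[OF w]] X_nrm[OF w] by (auto simp: nrm_def)
    have w3: "w $ 3 = - w $ 1 - w $ 2" using n(2) by algebra
    have "w = p (w $ 2 / w $ 1, - 1 / w $ 1)" using n(1) by (simp add: vec3_eq_iff p w3 field_simps)
    moreover have "(w $ 2 / w $ 1, - 1 / w $ 1) \<in> EE m" using nrm_EE(1)[OF X_nrm[OF w], of m] w by (rule iffD1)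
    ultimately show "w \<in> p ` EE m" by (rule image_eqI)
  next
    fix w assume "w \<in> p ` EE m"
    then obtain f g where fg: "(f, g) \<in> EE m" "w = p (f, g)" by auto
    show "w \<in> X m" unfolding fg(2) using nrm_EE(1)[of "p (f, g)" m] E[OF fg(1)] fg(1) by simp
  qed
  have "inj_on p (EE m)"
  proof (rule inj_onI)
    fix i j assume ij: "i \<in> EE m" "j \<in> EE m" "p i = p j"
    show "i = j" using E[of "fst i" "snd i", unfolded prod.collapse, OF ij(1)] E[of "fst j" "snd j", unfolded prod.collapse, OF ij(2)] ij(3) by metis
  qed
  then show "finite (X m)" "card (X m) = 9 * m^2 - 3" unfolding im using card_EE[OF m] by (simp_all add: card_image)
qed

text \<open>The kernel of the matrix with rows (A, -B, -c), (-a, A, -B), (-B, -b, A) for V = (a, b,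
  c). The equations are linear in v and are satisfied by v itself when A, B, V are its own data, so
  they recover the plane point from these.\<close>

definition ker :: "complex \<Rightarrow> complex \<Rightarrow> complex^3 \<Rightarrow> complex^3 \<Rightarrow> bool" where
  "ker A B V v \<longleftrightarrow> A * v $ 1 - B * v $ 2 = v $ 3 * V $ 3 \<and> A * v $ 2 - B * v $ 3 = v $ 1 * V $ 1 \<and> A * v $ 3 - B * v $ 1 = v $ 2 * V $ 2"

lemma ker_R: "ker (ha (v $ 1) (v $ 2) (v $ 3)) (hb (v $ 1) (v $ 2) (v $ 3)) (R V_type v) v"
  unfolding ker_def R.simps rv_nth ha_def hb_def by (intro conjI; algebra)

lemma ker_scale: "c \<noteq> 0 \<Longrightarrow> ker A B V (c *s v) \<longleftrightarrow> ker A B V v"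
proof -
  assume c: "c \<noteq> 0"
  have "A * (c * x) - B * (c * y) = c * z * w \<longleftrightarrow> A * x - B * y = z * w" for x y z w
  proof -
    have "A * (c * x) - B * (c * y) = c * (A * x - B * y)" "c * z * w = c * (z * w)" by algebra+
    then show ?thesis using c by simp
  qed
  then show ?thesis by (simp only: ker_def vector_smult_component)
qed

text \<open>These six are 2 by 2 minors up to sign. Their common vanishing would give B V1 = B V2 =
  B V3 with B nonzero, or A = B = 0; hence the rank is at least 2.\<close>

lemma ker_minors:
  assumes V: "nrm V" and AB: "A^3 - B^3 = 1"
    and "B^2 + A * V $ 1 = 0" "B^2 + A * V $ 2 = 0" "B^2 + A * V $ 3 = 0" "A^2 = B * V $ 1" "A^2 = B * V $ 2" "A^2 = B * V $ 3"
  shows False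
proof (cases "A = 0")
  case True
  then have "B = 0" using assms(3) by simp
  then show False using True AB by simp
next
  case False
  then have "B \<noteq> 0" using assms(6) by auto
  then have B: "x = y" if "B * x = B * y" for x y using that by simp
  show False
    by (rule nrm_not_const[OF V B[OF trans[OF assms(6)[symmetric] assms(7)]] B[OF trans[OF assms(7)[symmetric] assms(8)]]])
qed

text \<open>The determinant is A^3 - B^3 - abc - AB (a + b + c), which is 0 for normalised data. The
  candidates below are the cross products of pairs of rows; at least one is nonzero because the rank
  is 2.\<close>

lemma ker_exists:
  assumes V: "nrm V" and AB: "A^3 - B^3 = 1" shows "\<exists>v. v \<noteq> 0 \<and> ker A B V v"
proof (rule ccontr)
  assume "\<not> ?thesis"
  then have no: "v = 0" if "ker A B V v" for v using that by blast
  obtain a b c where V3: "V $ 1 = a" "V $ 2 = b" "V $ 3 = c" by blast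
  have s: "a + b + c = 0" "a * b * c = 1" using V by (simp_all add: nrm_def V3)
  have K: "A^3 - B^3 = a * b * c + A * B * (a + b + c)" using AB s by simp
  have k1: "A * (A^2 - B * a) - B * (B^2 + A * c) = (a * c + A * B) * b"
  proof -
    have "A * (A^2 - B * a) - B * (B^2 + A * c) - (a * c + A * B) * b = (A^3 - B^3) - (a * b * c + A * B * (a + b + c))" by algebra
    then show ?thesis unfolding K by (simp only: diff_self right_minus_eq)
  qed
  have k2: "A * (c * B - A^2) - B * (- A * b - B^2) = (- A * B - b * c) * a"
  proof -
    have "A * (c * B - A^2) - B * (- A * b - B^2) - (- A * B - b * c) * a = (a * b * c + A * B * (a + b + c)) - (A^3 - B^3)" by algebra
    then show ?thesis unfolding K by (simp only: diff_self right_minus_eq)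
  qed
  have k3: "A * (A^2 - B * b) - B * (B^2 + A * a) = (a * b + A * B) * c"
  proof -
    have "A * (A^2 - B * b) - B * (B^2 + A * a) - (a * b + A * B) * c = (A^3 - B^3) - (a * b * c + A * B * (a + b + c))" by algebra
    then show ?thesis unfolding K by (simp only: diff_self right_minus_eq)
  qed
  have "ker A B V (vector [B^2 + A * c, a * c + A * B, A^2 - B * a])"
    unfolding ker_def vector_3 V3 by (intro conjI; (rule k1 | rule k2 | rule k3 | algebra))
  from no[OF this] have 1: "B^2 + A * c = 0" "A^2 - B * a = 0" by (simp_all add: vec3_eq_iff)
  have "ker A B V (vector [- A * B - b * c, c * B - A^2, - A * b - B^2])"
    unfolding ker_def vector_3 V3 by (intro conjI; (rule k1 | rule k2 | rule k3 | algebra))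
  from no[OF this] have 2: "c * B - A^2 = 0" "- A * b - B^2 = 0" by (simp_all add: vec3_eq_iff)
  have "ker A B V (vector [A^2 - B * b, B^2 + A * a, a * b + A * B])"
    unfolding ker_def vector_3 V3 by (intro conjI; (rule k1 | rule k2 | rule k3 | algebra))
  from no[OF this] have 3: "A^2 - B * b = 0" "B^2 + A * a = 0" by (simp_all add: vec3_eq_iff)
  show False
  proof (rule ker_minors[OF V AB])
    show "B^2 + A * V $ 1 = 0" unfolding V3 by (rule 3(2))
    have "B^2 + A * b = - (- A * b - B^2)" by simp
    then show "B^2 + A * V $ 2 = 0" unfolding V3 2(2) by simp
    show "B^2 + A * V $ 3 = 0" unfolding V3 by (rule 1(1))
    show "A^2 = B * V $ 1" unfolding V3 using 1(2) by (simp only: right_minus_eq)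
    show "A^2 = B * V $ 2" unfolding V3 using 3(1) by (simp only: right_minus_eq)
    have "c * B = A^2" using 2(1) by (simp only: right_minus_eq)
    then show "A^2 = B * V $ 3" unfolding V3 by (simp only: mult.commute[of B c])
  qed
qed

text \<open>Two rows orthogonal to the same two independent vectors are both proportional to the
  cross product n of those vectors.\<close>

lemma rank_one:
  fixes r1 :: complex
  assumes "r1 * x + r2 * y + r3 * z = 0" "r1 * x' + r2 * y' + r3 * z' = 0" "s1 * x + s2 * y + s3 * z = 0" "s1 * x' + s2 * y' + s3 * z' = 0"
    and n: "y * z' - z * y' \<noteq> 0 \<or> z * x' - x * z' \<noteq> 0 \<or> x * y' - y * x' \<noteq> 0"
  shows "r1 * s2 = r2 * s1" "r1 * s3 = r3 * s1" "r2 * s3 = r3 * s2"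
proof -
  define n1 n2 n3 where "n1 = y * z' - z * y'" and "n2 = z * x' - x * z'" and "n3 = x * y' - y * x'"
  note d = n1_def n2_def n3_def
  have r: "r1 * n2 = r2 * n1" "r1 * n3 = r3 * n1" "r2 * n3 = r3 * n2" unfolding d using assms(1,2) by algebra+
  have s: "s1 * n2 = s2 * n1" "s1 * n3 = s3 * n1" "s2 * n3 = s3 * n2" unfolding d using assms(3,4) by algebra+
  have m: "(r1 * s2 - r2 * s1) * n1 = 0" "(r1 * s2 - r2 * s1) * n2 = 0" "(r1 * s2 - r2 * s1) * n3 = 0"
    "(r1 * s3 - r3 * s1) * n1 = 0" "(r1 * s3 - r3 * s1) * n2 = 0" "(r1 * s3 - r3 * s1) * n3 = 0"
    "(r2 * s3 - r3 * s2) * n1 = 0" "(r2 * s3 - r3 * s2) * n2 = 0" "(r2 * s3 - r3 * s2) * n3 = 0"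
    using r s by algebra+
  have "n1 \<noteq> 0 \<or> n2 \<noteq> 0 \<or> n3 \<noteq> 0" using n by (simp add: d)
  then show "r1 * s2 = r2 * s1" "r1 * s3 = r3 * s1" "r2 * s3 = r3 * s2" using m by auto
qed

text \<open>Two independent kernel vectors would make all rows proportional, and then all the minors
  would vanish.\<close>

lemma ker_unique:
  assumes V: "nrm V" and AB: "A^3 - B^3 = 1" and k: "ker A B V v" "ker A B V w" and v: "v \<noteq> 0"
  shows "\<exists>c. w = c *s v"
proof -
  obtain a b c where V3: "V $ 1 = a" "V $ 2 = b" "V $ 3 = c" by blast
  obtain x y z where v3: "v $ 1 = x" "v $ 2 = y" "v $ 3 = z" by blast
  obtain x' y' z' where w3: "w $ 1 = x'" "w $ 2 = y'" "w $ 3 = z'" by blast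
  have kv: "A * x - B * y = z * c" "A * y - B * z = x * a" "A * z - B * x = y * b" using k(1) by (simp_all add: ker_def V3 v3)
  have kw: "A * x' - B * y' = z' * c" "A * y' - B * z' = x' * a" "A * z' - B * x' = y' * b" using k(2) by (simp_all add: ker_def V3 w3)
  have rows: "A * x + (- B) * y + (- c) * z = 0" "(- a) * x + A * y + (- B) * z = 0" "(- B) * x + (- b) * y + A * z = 0"
    "A * x' + (- B) * y' + (- c) * z' = 0" "(- a) * x' + A * y' + (- B) * z' = 0" "(- B) * x' + (- b) * y' + A * z' = 0"
    using kv kw by algebra+
  have n: "y * z' - z * y' = 0 \<and> z * x' - x * z' = 0 \<and> x * y' - y * x' = 0"
  proof (rule ccontr)
    assume "\<not> ?thesis"
    then have n: "y * z' - z * y' \<noteq> 0 \<or> z * x' - x * z' \<noteq> 0 \<or> x * y' - y * x' \<noteq> 0" by blast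
    note m = rank_one[OF rows(1,4) rows(2,5) n] rank_one[OF rows(1,4) rows(3,6) n] rank_one[OF rows(2,5) rows(3,6) n]
    show False
    proof (rule ker_minors[OF V AB])
      show "B^2 + A * V $ 1 = 0" unfolding V3 using m(8) by algebra
      show "B^2 + A * V $ 2 = 0" unfolding V3 using m(4) by algebra
      show "B^2 + A * V $ 3 = 0" unfolding V3 using m(3) by algebra
      show "A^2 = B * V $ 1" unfolding V3 using m(1) by algebra
      show "A^2 = B * V $ 2" unfolding V3 using m(9) by algebra
      show "A^2 = B * V $ 3" unfolding V3 using m(5) by algebra
    qed
  qed
  have "x \<noteq> 0 \<or> y \<noteq> 0 \<or> z \<noteq> 0" using v v3 by (auto simp: vec3_eq_iff)
  then consider "x \<noteq> 0" | "y \<noteq> 0" | "z \<noteq> 0" by blast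
  then show ?thesis
  proof cases
    case 1
    then have "w = (x' / x) *s v" using n by (simp add: vec3_eq_iff v3 w3 field_simps)
    then show ?thesis by blast
  next
    case 2
    then have "w = (y' / y) *s v" using n by (simp add: vec3_eq_iff v3 w3 field_simps)
    then show ?thesis by blast
  next
    case 3
    then have "w = (z' / z) *s v" using n by (simp add: vec3_eq_iff v3 w3 field_simps)
    then show ?thesis by blast
  qed
qed

text \<open>Fourier inversion: sum 0 means that the coefficient at the trivial character is
  absent.\<close>

lemma hv_surj: "w $ 1 + w $ 2 + w $ 3 = 0 \<Longrightarrow> \<exists>A B. w = hv A B"
proof -
  assume s: "w $ 1 + w $ 2 + w $ 3 = 0"
  define A B where "A = (w $ 1 + \<epsilon> * w $ 2 + \<epsilon>^2 * w $ 3) / 3" and "B = - (w $ 1 + \<epsilon>^2 * w $ 2 + \<epsilon> * w $ 3) / 3"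
  have 3: "3 * A = w $ 1 + \<epsilon> * w $ 2 + \<epsilon>^2 * w $ 3" "3 * B = - (w $ 1 + \<epsilon>^2 * w $ 2 + \<epsilon> * w $ 3)" by (simp_all add: A_def B_def)
  have e: "3 * (A - B) = 3 * w $ 1" "3 * (\<epsilon>^2 * A - \<epsilon> * B) = 3 * w $ 2" "3 * (\<epsilon> * A - \<epsilon>^2 * B) = 3 * w $ 3"
    using 3 s eps2 by algebra+
  have three: "x = y" if "3 * x = 3 * y" for x y :: complex using that by simp
  have "w = hv A B" by (simp only: vec3_eq_iff hv_nth three[OF e(1)] three[OF e(2)] three[OF e(3)] simp_thms)
  then show ?thesis by blast
qed

lemma hv_inj: "hv A B = hv A' B' \<Longrightarrow> A = A' \<and> B = B'"
proof -
  assume "hv A B = hv A' B'"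
  then have e: "A - B = A' - B'" "\<epsilon>^2 * A - \<epsilon> * B = \<epsilon>^2 * A' - \<epsilon> * B'" by (simp_all only: vec3_eq_iff hv_nth)
  have "(1 - \<epsilon>) * (B - B') = 0" using e eps2 by algebra
  then have "B = B'" using one_minus_eps by simp
  then show ?thesis using e(1) by simp
qed

text \<open>The kernel contains a given vertex of type \<delta> or \<gamma> for exactly one V, an
  image of the type h datum under a symmetry of the curve: odd permutations with \<epsilon>^2 for
  \<delta>, even ones with \<epsilon> for \<gamma>.\<close>

lemma ker_D_Idx_0: "ker A B V (vertex_coords \<epsilon> D_type Idx_0) \<longleftrightarrow> V = prm 1 3 2 (\<epsilon>^2) (hv A B)"
proof
  assume "ker A B V (vertex_coords \<epsilon> D_type Idx_0)"
  then have e: "A * \<epsilon> - B * 1 = 1 * V $ 3" "A * 1 - B * 1 = \<epsilon> * V $ 1" "A * 1 - B * \<epsilon> = 1 * V $ 2"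
    by (simp_all add: ker_def)
  have "V $ 1 = \<epsilon>^2 * (A - B)" "V $ 2 = \<epsilon>^2 * (\<epsilon> * A - \<epsilon>^2 * B)" "V $ 3 = \<epsilon>^2 * (\<epsilon>^2 * A - \<epsilon> * B)"
    using e eps2 by algebra+
  then show "V = prm 1 3 2 (\<epsilon>^2) (hv A B)" by (simp only: vec3_eq_iff prm_nth hv_nth)
next
  assume "V = prm 1 3 2 (\<epsilon>^2) (hv A B)"
  then have v: "V $ 1 = \<epsilon>^2 * (A - B)" "V $ 2 = \<epsilon>^2 * (\<epsilon> * A - \<epsilon>^2 * B)" "V $ 3 = \<epsilon>^2 * (\<epsilon>^2 * A - \<epsilon> * B)" by (simp_all only: prm_nth hv_nth)
  have "A * \<epsilon> - B * 1 = 1 * V $ 3" "A * 1 - B * 1 = \<epsilon> * V $ 1" "A * 1 - B * \<epsilon> = 1 * V $ 2"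
    unfolding v using eps2 by algebra+
  then show "ker A B V (vertex_coords \<epsilon> D_type Idx_0)" by (simp add: ker_def)
qed

lemma ker_D_Idx_1: "ker A B V (vertex_coords \<epsilon> D_type Idx_1) \<longleftrightarrow> V = prm 2 1 3 (\<epsilon>^2) (hv A B)"
proof
  assume "ker A B V (vertex_coords \<epsilon> D_type Idx_1)"
  then have e: "A * 1 - B * \<epsilon> = 1 * V $ 3" "A * \<epsilon> - B * 1 = 1 * V $ 1" "A * 1 - B * 1 = \<epsilon> * V $ 2"
    by (simp_all add: ker_def)
  have "V $ 1 = \<epsilon>^2 * (\<epsilon>^2 * A - \<epsilon> * B)" "V $ 2 = \<epsilon>^2 * (A - B)" "V $ 3 = \<epsilon>^2 * (\<epsilon> * A - \<epsilon>^2 * B)"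
    using e eps2 by algebra+
  then show "V = prm 2 1 3 (\<epsilon>^2) (hv A B)" by (simp only: vec3_eq_iff prm_nth hv_nth)
next
  assume "V = prm 2 1 3 (\<epsilon>^2) (hv A B)"
  then have v: "V $ 1 = \<epsilon>^2 * (\<epsilon>^2 * A - \<epsilon> * B)" "V $ 2 = \<epsilon>^2 * (A - B)" "V $ 3 = \<epsilon>^2 * (\<epsilon> * A - \<epsilon>^2 * B)" by (simp_all only: prm_nth hv_nth)
  have "A * 1 - B * \<epsilon> = 1 * V $ 3" "A * \<epsilon> - B * 1 = 1 * V $ 1" "A * 1 - B * 1 = \<epsilon> * V $ 2"
    unfolding v using eps2 by algebra+
  then show "ker A B V (vertex_coords \<epsilon> D_type Idx_1)" by (simp add: ker_def)
qed

lemma ker_D_Idx_inf: "ker A B V (vertex_coords \<epsilon> D_type Idx_inf) \<longleftrightarrow> V = prm 3 2 1 (\<epsilon>^2) (hv A B)"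
proof
  assume "ker A B V (vertex_coords \<epsilon> D_type Idx_inf)"
  then have e: "A * 1 - B * 1 = \<epsilon> * V $ 3" "A * 1 - B * \<epsilon> = 1 * V $ 1" "A * \<epsilon> - B * 1 = 1 * V $ 2"
    by (simp_all add: ker_def)
  have "V $ 1 = \<epsilon>^2 * (\<epsilon> * A - \<epsilon>^2 * B)" "V $ 2 = \<epsilon>^2 * (\<epsilon>^2 * A - \<epsilon> * B)" "V $ 3 = \<epsilon>^2 * (A - B)"
    using e eps2 by algebra+
  then show "V = prm 3 2 1 (\<epsilon>^2) (hv A B)" by (simp only: vec3_eq_iff prm_nth hv_nth)
next
  assume "V = prm 3 2 1 (\<epsilon>^2) (hv A B)"
  then have v: "V $ 1 = \<epsilon>^2 * (\<epsilon> * A - \<epsilon>^2 * B)" "V $ 2 = \<epsilon>^2 * (\<epsilon>^2 * A - \<epsilon> * B)" "V $ 3 = \<epsilon>^2 * (A - B)" by (simp_all only: prm_nth hv_nth)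
  have "A * 1 - B * 1 = \<epsilon> * V $ 3" "A * 1 - B * \<epsilon> = 1 * V $ 1" "A * \<epsilon> - B * 1 = 1 * V $ 2"
    unfolding v using eps2 by algebra+
  then show "ker A B V (vertex_coords \<epsilon> D_type Idx_inf)" by (simp add: ker_def)
qed

lemma ker_G_Idx_0: "ker A B V (vertex_coords \<epsilon> G_type Idx_0) \<longleftrightarrow> V = prm 1 2 3 (\<epsilon>) (hv A B)"
proof
  assume "ker A B V (vertex_coords \<epsilon> G_type Idx_0)"
  then have e: "A * \<epsilon>^2 - B * 1 = 1 * V $ 3" "A * 1 - B * 1 = \<epsilon>^2 * V $ 1" "A * 1 - B * \<epsilon>^2 = 1 * V $ 2"
    by (simp_all add: ker_def)
  have "V $ 1 = \<epsilon> * (A - B)" "V $ 2 = \<epsilon> * (\<epsilon>^2 * A - \<epsilon> * B)" "V $ 3 = \<epsilon> * (\<epsilon> * A - \<epsilon>^2 * B)"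
    using e eps2 by algebra+
  then show "V = prm 1 2 3 (\<epsilon>) (hv A B)" by (simp only: vec3_eq_iff prm_nth hv_nth)
next
  assume "V = prm 1 2 3 (\<epsilon>) (hv A B)"
  then have v: "V $ 1 = \<epsilon> * (A - B)" "V $ 2 = \<epsilon> * (\<epsilon>^2 * A - \<epsilon> * B)" "V $ 3 = \<epsilon> * (\<epsilon> * A - \<epsilon>^2 * B)" by (simp_all only: prm_nth hv_nth)
  have "A * \<epsilon>^2 - B * 1 = 1 * V $ 3" "A * 1 - B * 1 = \<epsilon>^2 * V $ 1" "A * 1 - B * \<epsilon>^2 = 1 * V $ 2"
    unfolding v using eps2 by algebra+
  then show "ker A B V (vertex_coords \<epsilon> G_type Idx_0)" by (simp add: ker_def)
qed

lemma ker_G_Idx_1: "ker A B V (vertex_coords \<epsilon> G_type Idx_1) \<longleftrightarrow> V = prm 3 1 2 (\<epsilon>) (hv A B)"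
proof
  assume "ker A B V (vertex_coords \<epsilon> G_type Idx_1)"
  then have e: "A * 1 - B * \<epsilon>^2 = 1 * V $ 3" "A * \<epsilon>^2 - B * 1 = 1 * V $ 1" "A * 1 - B * 1 = \<epsilon>^2 * V $ 2"
    by (simp_all add: ker_def)
  have "V $ 1 = \<epsilon> * (\<epsilon> * A - \<epsilon>^2 * B)" "V $ 2 = \<epsilon> * (A - B)" "V $ 3 = \<epsilon> * (\<epsilon>^2 * A - \<epsilon> * B)"
    using e eps2 by algebra+
  then show "V = prm 3 1 2 (\<epsilon>) (hv A B)" by (simp only: vec3_eq_iff prm_nth hv_nth)
next
  assume "V = prm 3 1 2 (\<epsilon>) (hv A B)"
  then have v: "V $ 1 = \<epsilon> * (\<epsilon> * A - \<epsilon>^2 * B)" "V $ 2 = \<epsilon> * (A - B)" "V $ 3 = \<epsilon> * (\<epsilon>^2 * A - \<epsilon> * B)" by (simp_all only: prm_nth hv_nth)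
  have "A * 1 - B * \<epsilon>^2 = 1 * V $ 3" "A * \<epsilon>^2 - B * 1 = 1 * V $ 1" "A * 1 - B * 1 = \<epsilon>^2 * V $ 2"
    unfolding v using eps2 by algebra+
  then show "ker A B V (vertex_coords \<epsilon> G_type Idx_1)" by (simp add: ker_def)
qed

lemma ker_G_Idx_inf: "ker A B V (vertex_coords \<epsilon> G_type Idx_inf) \<longleftrightarrow> V = prm 2 3 1 (\<epsilon>) (hv A B)"
proof
  assume "ker A B V (vertex_coords \<epsilon> G_type Idx_inf)"
  then have e: "A * 1 - B * 1 = \<epsilon>^2 * V $ 3" "A * 1 - B * \<epsilon>^2 = 1 * V $ 1" "A * \<epsilon>^2 - B * 1 = 1 * V $ 2"
    by (simp_all add: ker_def)
  have "V $ 1 = \<epsilon> * (\<epsilon>^2 * A - \<epsilon> * B)" "V $ 2 = \<epsilon> * (\<epsilon> * A - \<epsilon>^2 * B)" "V $ 3 = \<epsilon> * (A - B)"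
    using e eps2 by algebra+
  then show "V = prm 2 3 1 (\<epsilon>) (hv A B)" by (simp only: vec3_eq_iff prm_nth hv_nth)
next
  assume "V = prm 2 3 1 (\<epsilon>) (hv A B)"
  then have v: "V $ 1 = \<epsilon> * (\<epsilon>^2 * A - \<epsilon> * B)" "V $ 2 = \<epsilon> * (\<epsilon> * A - \<epsilon>^2 * B)" "V $ 3 = \<epsilon> * (A - B)" by (simp_all only: prm_nth hv_nth)
  have "A * 1 - B * 1 = \<epsilon>^2 * V $ 3" "A * 1 - B * \<epsilon>^2 = 1 * V $ 1" "A * \<epsilon>^2 - B * 1 = 1 * V $ 2"
    unfolding v using eps2 by algebra+
  then show "ker A B V (vertex_coords \<epsilon> G_type Idx_inf)" by (simp add: ker_def)
qed

definition bad :: "complex^3 \<Rightarrow> (complex^3) set" where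
  "bad w = {prm 1 3 2 (\<epsilon>^2) w, prm 2 1 3 (\<epsilon>^2) w, prm 3 2 1 (\<epsilon>^2) w, prm 1 2 3 \<epsilon> w, prm 3 1 2 \<epsilon> w, prm 2 3 1 \<epsilon> w}"

lemma ker_bad: "V \<in> bad (hv A B) \<longleftrightarrow> (\<exists>t\<in>{D_type, G_type}. \<exists>u. ker A B V (vertex_coords \<epsilon> t u))"
proof -
  have u: "(\<exists>u. P u) \<longleftrightarrow> P Idx_0 \<or> P Idx_1 \<or> P Idx_inf" for P by (metis vertex_index.exhaust)
  show ?thesis unfolding u bad_def by (simp only: ker_D_Idx_0 ker_D_Idx_1 ker_D_Idx_inf ker_G_Idx_0 ker_G_Idx_1 ker_G_Idx_inf bex_simps insert_iff empty_iff simp_thms disj_assoc)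
qed

lemma prm_eqD: "prm i j k c w = prm i' j' k' c' w \<Longrightarrow> c * w $ i = c' * w $ i' \<and> c * w $ j = c' * w $ j' \<and> c * w $ k = c' * w $ k'"
  by (simp only: vec3_eq_iff prm_nth)

text \<open>Symmetries preserve torsion. Two permutations of equal parity coincide on w only if its
  coordinates are all equal. An odd and an even one share exactly one index, where the scalars
  \<epsilon>^2 and \<epsilon> differ.\<close>

lemma bad_X: assumes w: "w \<in> X m" shows "bad w \<subseteq> X m" "card (bad w) = 6"
proof -
  note n = X_nrm[OF w]
  have e: "(\<epsilon>^2)^3 = 1" using eps3 by algebra
  have t: "tv m w" using w by (simp add: X_def)
  show "bad w \<subseteq> X m"
    unfolding bad_def using t
    by (simp add: X_iff[OF prm_closed(7)[OF eps3 n]] X_iff[OF prm_closed(8)[OF eps3 n]] X_iff[OF prm_closed(9)[OF eps3 n]]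
        X_iff[OF prm_closed(10)[OF e n]] X_iff[OF prm_closed(11)[OF e n]] X_iff[OF prm_closed(12)[OF e n]]
        prm_closed(1-6)[OF eps3] prm_closed(1-6)[OF e])
  have e2: "\<epsilon>^2 \<noteq> \<epsilon>" "\<epsilon>^2 \<noteq> 0" using eps_nz eps1 by (auto simp: power2_eq_square)
  have d: "\<epsilon>^2 * w $ 1 \<noteq> \<epsilon> * w $ 1" "\<epsilon>^2 * w $ 2 \<noteq> \<epsilon> * w $ 2" "\<epsilon>^2 * w $ 3 \<noteq> \<epsilon> * w $ 3" using e2(1) nrm_nz[OF n] by simp_all
  have c: "x = y" if "\<epsilon>^2 * x = \<epsilon>^2 * y \<or> \<epsilon> * x = \<epsilon> * y" for x y using that e2(2) eps_nz by simp
  have nc: "\<not> (w $ 1 = w $ 2 \<and> w $ 2 = w $ 3)" using nrm_not_const[OF n] by blast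
  have "distinct [prm 1 3 2 (\<epsilon>^2) w, prm 2 1 3 (\<epsilon>^2) w, prm 3 2 1 (\<epsilon>^2) w, prm 1 2 3 \<epsilon> w, prm 3 1 2 \<epsilon> w, prm 2 3 1 \<epsilon> w]"
    unfolding distinct.simps list.set insert_iff empty_iff de_Morgan_disj
    by (intro conjI notI TrueI; (erule FalseE)?; (drule prm_eqD; metis c d nc)?)
  from distinct_card[OF this] show "card (bad w) = 6" by (simp add: bad_def)
qed

text \<open>A kernel vector v has the prescribed data up to one common factor l, provided the type h
  data of v do not vanish; a cube root of l then rescales v.\<close>

lemma lift_exists:
  assumes V: "V \<in> X m" and H: "hv A B \<in> X m" and nb: "V \<notin> bad (hv A B)"
  shows "\<exists>w. R V_type w = V \<and> R H_type w = hv A B"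
proof -
  note nV = X_nrm[OF V]
  have AB: "A^3 - B^3 = 1" using X_nrm[OF H] unfolding nrm_def hv_prod by simp
  obtain v where v: "v \<noteq> 0" "ker A B V v" using ker_exists[OF nV AB] by blast
  obtain x y z where v3: "v $ 1 = x" "v $ 2 = y" "v $ 3 = z" by blast
  obtain p q r where V3: "V $ 1 = p" "V $ 2 = q" "V $ 3 = r" by blast
  have sum: "p + q + r = 0" using nV by (simp add: nrm_def V3)
  have k: "A * x - B * y = z * r" "A * y - B * z = x * p" "A * z - B * x = y * q" using v(2) by (simp_all add: ker_def V3 v3)
  define a b where "a = ha x y z" and "b = hb x y z"
  \<comment> \<open>Multiplying the kernel equations by xy, yz, zx and adding gives xyz (p + q + r)
    = 0 on the right and A b - B a on the left.\<close>
  have ab: "A * b = B * a" unfolding a_def b_def ha_def hb_def using k sum by algebra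
  have nz: "a \<noteq> 0 \<or> b \<noteq> 0"
  proof (rule ccontr)
    assume "\<not> ?thesis"
    then have "R H_type v = hv 0 0" by (simp add: a_def b_def v3)
    then have z: "T0 H_type v = 0" "T1 H_type v = 0" by (simp_all add: T_R hv_nth del: R.simps)
    obtain t u where t: "t \<noteq> H_type" "v \<in> vx t u" by (rule base_point_vertex[OF z v(1)])
    obtain c where c: "c \<noteq> 0" "v = c *s vertex_coords \<epsilon> t u" using t(2) unfolding proj_def by blast
    \<comment> \<open>Vanishing type h data would make v a vertex of another type. Type v would
      force A = B = 0, and types \<delta> and \<gamma> are what \<open>bad\<close> excludes.\<close>
    have kc: "ker A B V (vertex_coords \<epsilon> t u)" using v(2) unfolding c(2) ker_scale[OF c(1)] .
    show False
    proof (cases "t = V_type")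
      case True
      then have "A = 0 \<and> B = 0" using kc by (cases u) (auto simp: ker_def)
      then show False using AB by simp
    next
      case False
      then have "t \<in> {D_type, G_type}" using t(1) by (cases t) auto
      then show False using nb kc ker_bad[of V A B] by blast
    qed
  qed
  obtain l where l: "A = l * a" "B = l * b"
  proof (cases "a = 0")
    case True
    then have "b \<noteq> 0" using nz by simp
    then have "A = (B / b) * a" "B = (B / b) * b" using ab by (simp_all add: field_simps)
    then show thesis by (rule that)
  next
    case False
    then have "A = (A / a) * a" "B = (A / a) * b" using ab by (simp_all add: field_simps)
    then show thesis by (rule that)
  qed
  \<comment> \<open>The kernel equations for V, compared with l times those that v satisfies for its
    own data.\<close>
  have d: "x * (p - l * (y^3 - z^3)) = 0" "y * (q - l * (z^3 - x^3)) = 0" "z * (r - l * (x^3 - y^3)) = 0"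
    using k unfolding l a_def b_def ha_def hb_def by algebra+
  \<comment> \<open>At most one coordinate of v is 0, so at least two of the three equations can be
    divided; the last entry then follows from sum 0.\<close>
  have two: "\<not> (x = 0 \<and> y = 0)" "\<not> (y = 0 \<and> z = 0)" "\<not> (z = 0 \<and> x = 0)" using nz by (auto simp: a_def b_def ha_def hb_def)
  have "p = l * (y^3 - z^3) \<and> q = l * (z^3 - x^3) \<and> r = l * (x^3 - y^3)"
  proof -
    have s: "(p - l * (y^3 - z^3)) + (q - l * (z^3 - x^3)) + (r - l * (x^3 - y^3)) = 0" using sum by algebra
    have d': "x = 0 \<or> p - l * (y^3 - z^3) = 0" "y = 0 \<or> q - l * (z^3 - x^3) = 0" "z = 0 \<or> r - l * (x^3 - y^3) = 0"
      using d by (simp_all only: mult_eq_0_iff)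
    have "p - l * (y^3 - z^3) = 0 \<and> q - l * (z^3 - x^3) = 0 \<and> r - l * (x^3 - y^3) = 0"
      using s d' two by (metis add_0 add.right_neutral)
    then show ?thesis by (simp only: right_minus_eq)
  qed
  then have Vl: "V = l *s R V_type v" by (simp add: vec3_eq_iff V3 v3 rv_nth)
  have Hl: "hv A B = l *s R H_type v" by (simp add: vec3_eq_iff hv_nth v3 l a_def b_def algebra_simps)
  obtain c where c: "l = c^3" by (rule exists_complex_root[of 3 l]) auto
  have "R V_type (c *s v) = V \<and> R H_type (c *s v) = hv A B" unfolding R_scale Vl Hl c by (intro conjI refl)
  then show ?thesis by (rule exI)
qed

text \<open>Normalised vectors of the quadruple points. Types v and h are enough, since the other
  two types follow by collinearity.\<close>

definition SS :: "nat \<Rightarrow> (complex^3) set" where "SS m = {v. R V_type v \<in> X m \<and> R H_type v \<in> X m}"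

lemma SS_kernel:
  assumes "v \<in> SS m"
  shows "nrm (R V_type v)" "ha (v $ 1) (v $ 2) (v $ 3)^3 - hb (v $ 1) (v $ 2) (v $ 3)^3 = 1" "v \<noteq> 0"
proof -
  show n: "nrm (R V_type v)" using assms unfolding SS_def by (intro X_nrm[of "R V_type v" m]) blast
  have "nrm (R H_type v)" using assms unfolding SS_def by (intro X_nrm[of "R H_type v" m]) blast
  then show "ha (v $ 1) (v $ 2) (v $ 3)^3 - hb (v $ 1) (v $ 2) (v $ 3)^3 = 1" by (simp only: nrm_def R.simps hv_prod)
  show "v \<noteq> 0" using nrm_nz[OF n] by (auto simp: rv_nth)
qed

text \<open>Otherwise the one-dimensional kernel would be spanned by a vertex of type \<delta> or
  \<gamma>, and v would be a base point of the pencil of type v, against product 1.\<close>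

lemma SS_not_bad: assumes v: "v \<in> SS m" shows "R V_type v \<notin> bad (R H_type v)"
proof
  note n = SS_kernel[OF v]
  assume "R V_type v \<in> bad (R H_type v)"
  then have "R V_type v \<in> bad (hv (ha (v $ 1) (v $ 2) (v $ 3)) (hb (v $ 1) (v $ 2) (v $ 3)))" by (simp only: R.simps)
  then obtain t u where t: "t \<in> {D_type, G_type}"
    and k: "ker (ha (v $ 1) (v $ 2) (v $ 3)) (hb (v $ 1) (v $ 2) (v $ 3)) (R V_type v) (vertex_coords \<epsilon> t u)"
    unfolding ker_bad by blast
  obtain c where c: "v = c *s vertex_coords \<epsilon> t u"
    using ker_unique[OF n(1,2) k ker_R vertex_coords_nz] by blast
  have "T0 V_type (vertex_coords \<epsilon> t u) = 0" using T_vertex_off[OF _ self_in_proj, of t V_type u] t by auto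
  then have "R V_type (vertex_coords \<epsilon> t u) $ 1 = 0" using one_minus_eps unfolding T_R by simp
  then have "R V_type v $ 1 = 0" unfolding c R_scale by simp
  then show False using nrm_nz[OF n(1)] by simp
qed

lemma SS_image: "(\<lambda>v. (R H_type v, R V_type v)) ` SS m = Sigma (X m) (\<lambda>w. X m - bad w)"
proof (intro equalityI subsetI)
  fix g assume "g \<in> (\<lambda>v. (R H_type v, R V_type v)) ` SS m"
  then obtain v where v: "v \<in> SS m" "g = (R H_type v, R V_type v)" by blast
  have "R H_type v \<in> X m" "R V_type v \<in> X m" using v(1) by (simp_all only: SS_def mem_Collect_eq)
  then show "g \<in> Sigma (X m) (\<lambda>w. X m - bad w)" unfolding v(2) using SS_not_bad[OF v(1)] by blast
next
  fix g assume "g \<in> Sigma (X m) (\<lambda>w. X m - bad w)"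
  then obtain w V where g: "g = (w, V)" "w \<in> X m" "V \<in> X m" "V \<notin> bad w" by blast
  have "w $ 1 + w $ 2 + w $ 3 = 0" using X_nrm[OF g(2)] by (simp add: nrm_def)
  then obtain A B where w: "w = hv A B" using hv_surj by blast
  obtain v where v: "R V_type v = V" "R H_type v = hv A B"
    using lift_exists[OF g(3) g(2)[unfolded w] g(4)[unfolded w]] by blast
  then have "v \<in> SS m" using g by (simp only: SS_def mem_Collect_eq w)
  then show "g \<in> (\<lambda>v. (R H_type v, R V_type v)) ` SS m" unfolding g(1) w v[symmetric] by (rule imageI)
qed

lemma card_fibres:
  assumes fin: "finite (f ` A)" and k: "\<And>y. y \<in> A \<Longrightarrow> card {x \<in> A. f x = f y} = k" "k > 0"
  shows "finite A" "card A = k * card (f ` A)"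
proof -
  have k': "card {x \<in> A. f x = y} = k" if "y \<in> f ` A" for y using that k(1) by auto
  have fib: "finite {x \<in> A. f x = y}" if "y \<in> f ` A" for y by (rule card_ge_0_finite) (use k'[OF that] k(2) in simp)
  have A: "A = (\<Union>y\<in>f ` A. {x \<in> A. f x = y})" by auto
  have "finite (\<Union>y\<in>f ` A. {x \<in> A. f x = y})" by (rule finite_UN_I[OF fin fib])
  then show "finite A" by (simp only: A[symmetric])
  have "card A = card (\<Union>y\<in>f ` A. {x \<in> A. f x = y})" by (rule arg_cong[OF A])
  also have "\<dots> = (\<Sum>y\<in>f ` A. card {x \<in> A. f x = y})" by (rule card_UN_disjoint) (use fin fib in auto)
  also have "\<dots> = (\<Sum>y\<in>f ` A. k)" by (rule sum.cong[OF refl k'])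
  also have "\<dots> = k * card (f ` A)" by simp
  finally show "card A = k * card (f ` A)" .
qed

lemma card_scalings: "v \<noteq> 0 \<Longrightarrow> card ((\<lambda>c. c *s v) ` B) = card B" for v :: "complex^3"
  by (rule card_image) (auto simp: inj_on_def vec3_eq_iff)

text \<open>The entries have degree 3 in the vector, so their product is multiplied by c^9, while
  the torsion condition is not affected by scaling.\<close>

lemma SS_scale_iff: assumes "v \<in> SS m" shows "c *s v \<in> SS m \<longleftrightarrow> c^9 = 1"
proof -
  have X: "c *s v \<in> SS m \<longleftrightarrow> c^9 = 1 \<and> c \<noteq> 0"
  proof -
    have e: "c^3 * x * (c^3 * y) * (c^3 * z) = c^9 * (x * y * z)" for x y z by algebra
    have "R t v \<in> X m \<Longrightarrow> c \<noteq> 0 \<Longrightarrow> R t (c *s v) \<in> X m \<longleftrightarrow> c^9 = 1" for t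
      using tv_scale[of c m t v] by (simp add: X_def R_scale e del: R.simps)
    moreover have "c *s v \<in> SS m \<Longrightarrow> c \<noteq> 0" using SS_kernel(3)[of "c *s v" m] by auto
    ultimately show ?thesis using assms unfolding SS_def by blast
  qed
  then show ?thesis by auto
qed

text \<open>Double counting of \<open>SS m\<close>: three vectors for each pair of data, nine for
  each projective point.\<close>

lemma card_SS:
  assumes m: "m \<ge> 1"
  shows "finite (proj ` SS m)" "3 * card (proj ` SS m) = (9 * m^2 - 3) * (9 * m^2 - 9)"
proof -
  let ?g = "\<lambda>v. (R H_type v, R V_type v)"
  have b: "card (X m - bad w) = 9 * m^2 - 9" if "w \<in> X m" for w
  proof -
    have "finite (bad w)" by (simp add: bad_def)
    from card_Diff_subset[OF this bad_X(1)[OF that]] show ?thesis using bad_X(2)[OF that] card_X(2)[OF m] by simp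
  qed
  have "card (Sigma (X m) (\<lambda>w. X m - bad w)) = (\<Sum>w\<in>X m. card (X m - bad w))"
    by (rule card_SigmaI) (use card_X(1)[OF m] in auto)
  also have "\<dots> = (\<Sum>w\<in>X m. 9 * m^2 - 9)" by (rule sum.cong[OF refl b])
  also have "\<dots> = (9 * m^2 - 3) * (9 * m^2 - 9)" using card_X(2)[OF m] by simp
  finally have G: "card (?g ` SS m) = (9 * m^2 - 3) * (9 * m^2 - 9)" unfolding SS_image .
  have Gf: "finite (?g ` SS m)" unfolding SS_image using card_X(1)[OF m] by (intro finite_SigmaI) auto
  \<comment> \<open>Equal data give proportional vectors by uniqueness of the kernel, and the data
    are of degree 3, so the factor is a cube root of unity.\<close>
  have f3: "card {w \<in> SS m. ?g w = ?g v} = 3" if v: "v \<in> SS m" for v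
  proof -
    have "{w \<in> SS m. ?g w = ?g v} = (\<lambda>c. c *s v) ` {c. c^3 = 1}"
    proof (intro equalityI subsetI)
      fix w assume "w \<in> {w \<in> SS m. ?g w = ?g v}"
      then have w: "w \<in> SS m" "R H_type w = R H_type v" "R V_type w = R V_type v"
        by (simp_all only: mem_Collect_eq prod.inject)
      have h: "ha (w $ 1) (w $ 2) (w $ 3) = ha (v $ 1) (v $ 2) (v $ 3) \<and> hb (w $ 1) (w $ 2) (w $ 3) = hb (v $ 1) (v $ 2) (v $ 3)"
        by (rule hv_inj) (use w(2) in \<open>simp only: R.simps\<close>)
      have "ker (ha (v $ 1) (v $ 2) (v $ 3)) (hb (v $ 1) (v $ 2) (v $ 3)) (R V_type v) w" using ker_R[of w] unfolding w(3) by (simp only: h)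
      then obtain c where c: "w = c *s v" using ker_unique[OF SS_kernel(1,2)[OF v] ker_R _ SS_kernel(3)[OF v]] by blast
      have "c^3 * R V_type v $ 1 = R V_type v $ 1" using arg_cong[OF w(3), of "\<lambda>x. x $ 1"] by (simp only: c R_scale vector_smult_component)
      then have "c^3 = 1" using nrm_nz[OF SS_kernel(1)[OF v]] by simp
      then show "w \<in> (\<lambda>c. c *s v) ` {c. c^3 = 1}" using c by blast
    next
      fix w assume "w \<in> (\<lambda>c. c *s v) ` {c. c^3 = 1}"
      then obtain c where c: "c^3 = 1" "w = c *s v" by blast
      have "c^9 = 1" using c(1) by algebra
      then show "w \<in> {w \<in> SS m. ?g w = ?g v}" using SS_scale_iff[OF v, of c] c by (simp add: R_scale vector_smult_lid del: R.simps)
    qed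
    then show ?thesis using card_scalings[OF SS_kernel(3)[OF v]] card_roots_unity_eq[of 3] by simp
  qed
  have f9: "card {w \<in> SS m. proj w = proj v} = 9" if v: "v \<in> SS m" for v
  proof -
    have "{w \<in> SS m. proj w = proj v} = (\<lambda>c. c *s v) ` {c. c^9 = 1}"
    proof (intro equalityI subsetI)
      fix w assume w: "w \<in> {w \<in> SS m. proj w = proj v}"
      then have "proj v = proj w" by simp
      then obtain c where c: "w = c *s v" unfolding proj_eq_iff by blast
      then show "w \<in> (\<lambda>c. c *s v) ` {c. c^9 = 1}" using w SS_scale_iff[OF v, of c] by blast
    next
      fix w assume "w \<in> (\<lambda>c. c *s v) ` {c. c^9 = 1}"
      then obtain c where c: "c^9 = 1" "w = c *s v" by blast
      have "c \<noteq> 0" using c(1) by auto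
      then have "proj v = proj w" unfolding proj_eq_iff c(2) by blast
      then show "w \<in> {w \<in> SS m. proj w = proj v}" using SS_scale_iff[OF v, of c] c by simp
    qed
    then show ?thesis using card_scalings[OF SS_kernel(3)[OF v]] card_roots_unity_eq[of 9] by simp
  qed
  have S: "finite (SS m)" "card (SS m) = 3 * ((9 * m^2 - 3) * (9 * m^2 - 9))"
    using card_fibres[OF Gf f3] G by simp_all
  show fin: "finite (proj ` SS m)" using S(1) by simp
  have "card (SS m) = 9 * card (proj ` SS m)" by (rule card_fibres(2)[OF fin f9]) simp_all
  then show "3 * card (proj ` SS m) = (9 * m^2 - 3) * (9 * m^2 - 9)" using S(2) by simp
qed

text \<open>Two Halphen cubics through a point that is not a vertex belong to different types, and
  two types force all four; multiplicities 2 and 3 therefore do not occur.\<close>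

lemma multiple_points:
  assumes m: "m \<ge> 1" and p: "p \<in> proj_space" "p \<notin> vertices \<epsilon>"
  shows "multiplicity_at (halphen_union \<epsilon> m) p \<ge> 2 \<Longrightarrow> multiplicity_at (halphen_union \<epsilon> m) p = 4 \<and> p \<in> proj ` SS m"
proof -
  obtain v where v: "p = proj v" "v \<noteq> 0" using p(1) by (auto simp: proj_space_def)
  have M: "multiplicity_at (halphen_union \<epsilon> m) p = card {t. tv m (R t v)}"
  proof -
    have vp: "v \<in> p" unfolding v(1) by (rule self_in_proj)
    show ?thesis using nonvertex_multiplicity[OF m p vp] unfolding tv_T .
  qed
  assume "multiplicity_at (halphen_union \<epsilon> m) p \<ge> 2"
  then have "card {t. tv m (R t v)} \<ge> 2" using M by simp
  then have "\<not> card {t. tv m (R t v)} \<le> 1" by linarith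
  then obtain t1 t2 where t: "t1 \<noteq> t2" "tv m (R t1 v)" "tv m (R t2 v)"
    unfolding card_le_Suc0_iff_eq[OF finite_types(1), folded One_nat_def] by blast
  have all: "tv m (R t v)" for t by (rule two_imply_all[OF t])
  have "{t. tv m (R t v)} = UNIV" using all by blast
  then have 4: "multiplicity_at (halphen_union \<epsilon> m) p = 4" unfolding M by (simp add: UNIV_vertex_type)
  obtain c where c: "c \<noteq> 0" "\<forall>t. nrm (R t (c *s v))" by (rule normalise[OF t(2)])
  have "R t (c *s v) \<in> X m" for t using X_iff[OF c(2)[rule_format, of t]] tv_scale[OF c(1)] all by blast
  then have "c *s v \<in> SS m" unfolding SS_def by blast
  moreover have "p = proj (c *s v)" unfolding v(1) proj_eq_iff using c(1) by blast
  ultimately show "multiplicity_at (halphen_union \<epsilon> m) p = 4 \<and> p \<in> proj ` SS m" using 4 by blast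
qed

lemma SS_multiplicity:
  assumes m: "m \<ge> 1" and v: "v \<in> SS m"
  shows "proj v \<in> proj_space - vertices \<epsilon>" "multiplicity_at (halphen_union \<epsilon> m) (proj v) = 4"
proof -
  have ps: "proj v \<in> proj_space" unfolding proj_space_def using SS_kernel(3)[OF v] by blast
  have X: "R V_type v \<in> X m" "R H_type v \<in> X m" using v unfolding SS_def by blast+
  have nz: "T0 V_type v \<noteq> 0" "T0 H_type v \<noteq> 0"
    unfolding T_R using one_minus_eps nrm_nz[OF X_nrm[OF X(1)]] nrm_nz[OF X_nrm[OF X(2)]] by simp_all
  have nv: "proj v \<notin> vertices \<epsilon>"
  proof
    assume "proj v \<in> vertices \<epsilon>"
    then obtain s u where "proj v = vx s u" unfolding vertices_def by blast
    then have "v \<in> vx s u" using self_in_proj[of v] by simp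
    then have "T0 t v = 0" if "s \<noteq> t" for t using T_vertex_off[OF that] by blast
    then show False using nz by (cases "s = V_type") auto
  qed
  show "proj v \<in> proj_space - vertices \<epsilon>" using ps nv by blast
  have t: "tv m (R V_type v)" "tv m (R H_type v)" using X by (simp_all only: X_def mem_Collect_eq)
  have "multiplicity_at (halphen_union \<epsilon> m) (proj v) = card {t. tv m (R t v)}"
    using nonvertex_multiplicity[OF m ps nv self_in_proj] unfolding tv_T .
  moreover have "{t. tv m (R t v)} = UNIV" using two_imply_all[OF _ t] by blast
  ultimately show "multiplicity_at (halphen_union \<epsilon> m) (proj v) = 4" by (simp add: UNIV_vertex_type)
qed

lemma quadruple_set:
  assumes m: "m \<ge> 1"
  shows "{p \<in> proj_space - vertices \<epsilon>. multiplicity_at (halphen_union \<epsilon> m) p = 4} = proj ` SS m"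
proof (intro equalityI subsetI)
  fix p assume "p \<in> {p \<in> proj_space - vertices \<epsilon>. multiplicity_at (halphen_union \<epsilon> m) p = 4}"
  then have p: "p \<in> proj_space" "p \<notin> vertices \<epsilon>" "multiplicity_at (halphen_union \<epsilon> m) p = 4" by auto
  then show "p \<in> proj ` SS m" using multiple_points[OF m p(1,2)] by simp
next
  fix p assume "p \<in> proj ` SS m"
  then obtain v where "v \<in> SS m" "p = proj v" by blast
  then show "p \<in> {p \<in> proj_space - vertices \<epsilon>. multiplicity_at (halphen_union \<epsilon> m) p = 4}"
    using SS_multiplicity[OF m, of v] by simp
qed

lemma halphen_singularities:
  fixes n :: nat
  assumes m: "m \<ge> 1" and n: "n = 3 * m"
  shows "card (vertices \<epsilon>) = 12 \<and>
    (\<forall>p \<in> vertices \<epsilon>.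
       real (multiplicity_at (halphen_union \<epsilon> m) p) = real n ^ 2 - 3 \<and>
       finite {l \<in> exceptional_curve p. inf_near_multiplicity (halphen_union \<epsilon> m) p l = 3} \<and>
       real (card {l \<in> exceptional_curve p. inf_near_multiplicity (halphen_union \<epsilon> m) p l = 3})
         = real n ^ 2 / 3 - 1 \<and>
       (\<forall>l \<in> exceptional_curve p. inf_near_multiplicity (halphen_union \<epsilon> m) p l \<ge> 2 \<longrightarrow>
          inf_near_multiplicity (halphen_union \<epsilon> m) p l = 3)) \<and>
    (\<forall>p \<in> proj_space - vertices \<epsilon>. multiplicity_at (halphen_union \<epsilon> m) p \<ge> 2 \<longrightarrow>
       multiplicity_at (halphen_union \<epsilon> m) p = 4) \<and>
    finite {p \<in> proj_space - vertices \<epsilon>. multiplicity_at (halphen_union \<epsilon> m) p = 4} \<and>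
    real (card {p \<in> proj_space - vertices \<epsilon>. multiplicity_at (halphen_union \<epsilon> m) p = 4})
      = (real n ^ 2 - 3) * (real n ^ 2 / 3 - 3)"
proof (intro conjI ballI impI)
  have m2: "1 \<le> 3 * m^2" "3 \<le> 9 * m^2" "9 \<le> 9 * m^2" using m power_mono[of 1 m 2] by simp_all
  have r: "real (3 * m^2 - 1) = 3 * real m^2 - 1" "real (9 * m^2 - 3) = 9 * real m^2 - 3" "real (9 * m^2 - 9) = 9 * real m^2 - 9"
    unfolding of_nat_diff[OF m2(1)] of_nat_diff[OF m2(2)] of_nat_diff[OF m2(3)] by simp_all
  have n2: "real n ^ 2 = 9 * real m^2" unfolding n by (simp add: power_mult_distrib)
  show "card (vertices \<epsilon>) = 12" by (rule card_vertices)
  show "finite {p \<in> proj_space - vertices \<epsilon>. multiplicity_at (halphen_union \<epsilon> m) p = 4}"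
    unfolding quadruple_set[OF m] by (rule card_SS(1)[OF m])
  have "real (3 * card (proj ` SS m)) = real (9 * m^2 - 3) * real (9 * m^2 - 9)" unfolding card_SS(2)[OF m] by simp
  also have "\<dots> = (9 * real m^2 - 3) * (9 * real m^2 - 9)" by (simp only: r)
  finally have q: "3 * real (card (proj ` SS m)) = (9 * real m^2 - 3) * (9 * real m^2 - 9)" by simp
  have "(real n ^ 2 - 3) * (real n ^ 2 / 3 - 3) = (9 * real m^2 - 3) * (9 * real m^2 - 9) / 3"
    unfolding n by (simp add: power_mult_distrib field_simps)
  then show "real (card {p \<in> proj_space - vertices \<epsilon>. multiplicity_at (halphen_union \<epsilon> m) p = 4})
      = (real n ^ 2 - 3) * (real n ^ 2 / 3 - 3)"
    unfolding quadruple_set[OF m] using q by linarith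
  show "multiplicity_at (halphen_union \<epsilon> m) p = 4"
    if "p \<in> proj_space - vertices \<epsilon>" "multiplicity_at (halphen_union \<epsilon> m) p \<ge> 2" for p
    using multiple_points[OF m, of p] that by blast
  fix p assume "p \<in> vertices \<epsilon>"
  then obtain s u where p: "p = vx s u" unfolding vertices_def by blast
  show "real (multiplicity_at (halphen_union \<epsilon> m) p) = real n ^ 2 - 3"
    unfolding p vertex_multiplicity[OF m] of_nat_mult r n2 by simp
  show "finite {l \<in> exceptional_curve p. inf_near_multiplicity (halphen_union \<epsilon> m) p l = 3}"
    unfolding p by (rule triple_directions(1)[OF m refl])
  show "real (card {l \<in> exceptional_curve p. inf_near_multiplicity (halphen_union \<epsilon> m) p l = 3}) = real n ^ 2 / 3 - 1"
    unfolding p triple_directions(2)[OF m refl] r n2 by simp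
  fix l assume l: "l \<in> exceptional_curve p" "inf_near_multiplicity (halphen_union \<epsilon> m) p l \<ge> 2"
  obtain d where d: "l = vec.span {vertex_coords \<epsilon> s u, d}" "d \<notin> vec.span {vertex_coords \<epsilon> s u}"
    by (rule exceptional_curve_vertex[OF l(1)[unfolded p]])
  obtain t where t: "t \<noteq> s" by (metis vertex_type.distinct(1))
  show "inf_near_multiplicity (halphen_union \<epsilon> m) p l = 3"
    using l(2) inf_near_vertex[OF m d(2) t] unfolding p d(1) by (simp split: if_splits)
qed

end

theorem theorem1:
  fixes \<epsilon> :: complex and m n :: nat
  assumes "\<epsilon> ^ 3 = 1" and "\<epsilon> \<noteq> 1"
    and "m \<ge> 1" and "n = 3 * m"
  shows "card (vertices \<epsilon>) = 12 \<and>
    (\<forall>p \<in> vertices \<epsilon>.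
       real (multiplicity_at (halphen_union \<epsilon> m) p) = real n ^ 2 - 3 \<and>
       finite {l \<in> exceptional_curve p. inf_near_multiplicity (halphen_union \<epsilon> m) p l = 3} \<and>
       real (card {l \<in> exceptional_curve p. inf_near_multiplicity (halphen_union \<epsilon> m) p l = 3})
         = real n ^ 2 / 3 - 1 \<and>
       (\<forall>l \<in> exceptional_curve p. inf_near_multiplicity (halphen_union \<epsilon> m) p l \<ge> 2 \<longrightarrow>
          inf_near_multiplicity (halphen_union \<epsilon> m) p l = 3)) \<and>
    (\<forall>p \<in> proj_space - vertices \<epsilon>. multiplicity_at (halphen_union \<epsilon> m) p \<ge> 2 \<longrightarrow>
       multiplicity_at (halphen_union \<epsilon> m) p = 4) \<and>
    finite {p \<in> proj_space - vertices \<epsilon>. multiplicity_at (halphen_union \<epsilon> m) p = 4} \<and>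
    real (card {p \<in> proj_space - vertices \<epsilon>. multiplicity_at (halphen_union \<epsilon> m) p = 4})
      = (real n ^ 2 - 3) * (real n ^ 2 / 3 - 3)"
proof -
  interpret cube_root \<epsilon> using assms(1,2) by unfold_locales
  show ?thesis by (rule halphen_singularities[OF assms(3,4)])
qed

end
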